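(* Let $p,s\in\mathbb{N}$ with $ps>1$, let $Q(\partial_z)$ ($z\in\mathbb{C}^n$) be a homogeneous operator of order $p$ with constant complex coefficients, and let $\varphi\in\mathcal{O}(D^n)$. Let $\mu_B$ be a finite complex Borel measure on $\mathbb{C}^n$ supported in a bounded set $B\subset\mathbb{C}^n$, of total mass $1$, such that for some function $m$ of order $p$ $$M_{\mu_B}(\varphi;z,t)=\int_{B}\varphi(z+ty)\,d\mu_B(y)=\sum_{j=0}^{\infty}\frac{Q^j(\partial_z)\varphi(z)}{m(j)}t^{pj}.$$ Define the measure $\mu_B^s$ by $\mu_B^s(y)=\frac1s\sum_{k=0}^{s-1}\mu_B(e^{-\frac{2k\pi i}{ps}}y)$, i.e. $\int g\,d\mu_B^s=\frac1s\sum_{k=0}^{s-1}\int g(e^{\frac{2k\pi i}{ps}}y)\,d\mu_B(y)$. Then $$M_{\mu_B^s}(\varphi;z,t)=\frac1s\sum_{k=0}^{s-1}\int_B\varphi(z+e^{\frac{2\pi ki}{ps}}ty)\,d\mu_B(y)=\sum_{j=0}^{\infty}\frac{Q^{sj}(\partial_z)\varphi(z)}{m(sj)}t^{psj}.$$ Moreover, if $\widehat u$ is the formal power series solution of $(\partial_t-Q^s(\partial_z))u=0$, $u(0,z)=\varphi(z)$, then $\widehat u$ converges to some $u\in\mathcal{O}(D^{n+1})$ if and only if $M_{\mu_B^s}(\varphi;z,t)\in\mathcal{O}^{\frac{ps}{ps-1}}(D^n\times\mathbb{C})$. If additionally $d\in\mathbb{R}$ and $m$ is a generalised moment function of order $p$,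 then $\widehat u$ is $(ps-1)^{-1}$-summable in the direction $d$ if and only if there exist disc-sectors such that $M_{\mu_B^s}(\varphi;z,t)\in\mathcal{O}^{\frac{ps}{ps-1}}(D^n\times\widehat S_{\frac{d+2k\pi}{ps}})$ for $k=0,\dots,ps-1$.
   Context: Notation: $D^n_r=\{z\in\mathbb{C}^n:|z|<r\}$, $D_r=D^1_r$; $D^n$ denotes such a disc with unspecified radius. The complex generalised integral mean of $\varphi$ w.r.t. a finite complex Borel measure $\mu$ on $\mathbb{C}^n$ with bounded support and total mass $1$ is $M_\mu(\varphi;z,t)=\int_{\mathbb{C}^n}\varphi(z+ty)\,d\mu(y)$. The formal solution is $\widehat u(t,z)=\sum_{j\ge0}\frac{Q^{sj}(\partial_z)\varphi(z)}{j!}t^j$. Sectors: $S_d(\varepsilon)$ is the set of $t=\rho e^{i\theta}$ in the universal covering of $\mathbb{C}\setminus\{0\}$ with $\rho>0$, $|\theta-d|<\varepsilon/2$; disc-sector $\widehat S_d(\varepsilon;r_1)=S_d(\varepsilon)\cup D_{r_1}$; $\widehat S_d$ is a disc-sector in direction $d$ with unspecified $\varepsilon,r_1>0$. For $k>0$, $f(z,t)$ holomorphic on $D^n_r\times\widehat S_d(\varepsilon;r_1)$ belongs to $\mathcal{O}^k(D^n\times\widehat S_d)$ if for all $\tilde r<r$, $\tilde r_1<r_1$, $\tilde\varepsilon<\varepsilon$ there are $A,B$ with $\max_{|z|\le\tilde r}|f(z,t)|\le Ae^{B|t|^k}$ on $\widehat S_d(\tilde\varepsilon;\tilde r_1)$;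 $\mathcal{O}^k(D^n\times\mathbb{C})$ analogously for all $t\in\mathbb{C}$; same with variable order $(t,z)$; a function defined initially for small $|t|$ belongs to such a space if it extends holomorphically with this growth. $\widehat u=\sum_ju_j(z)t^j$ is $k$-summable in direction $d$ if for some disc-sector $\widehat S_d$, $\sum_j\frac{u_j(z)}{\Gamma(1+j/k)}t^j\in\mathcal{O}^k(\widehat S_d\times D^n)$. Function of order $s>0$: $m$ on $\mathbb{N}_0$ with $c^j\Gamma(1+sj)\le m(j)\le C^j\Gamma(1+sj)$ for some $c,C>0$. Moment function of order $s=1/k$ (Balser): $m(u)=\int_0^\infty x^{u-1}e(x)\,dx$, where $e$ is a kernel function of order $k$: for $k>1/2$, $e\in\mathcal{O}(S_0(\pi/k))$, $e(z)/z$ integrable at $0$, $e(x)>0$ for $x>0$, $e$ exponentially flat of order $k$ in $S_0(\pi/k)$ (for each $\varepsilon>0$, $|e(z)|\le Ae^{-(|z|/B)^k}$ on $S_0(\pi/k-\varepsilon)$), and $E(z)=\sum_j z^j/m(j)$ is entire of exponential growth of order at most $k$ with $E(1/z)/z$ integrable at $0$ in $S_\pi(2\pi-\pi/k)$; for general $k>0$, $e(z)=\tilde e(z^{1/q})/q$ with $\tilde e$ a kernel function of order $qk>1/2$ as before. A generalised moment function of order $s$ is a function $m_1$ of order $s$ such that for some moment function $m_2$ of order $s$, polynomials $p_1,p_2$ and $c>0$: $p_1(j)m_1(j)=p_2(j)m_2(j)c^j$ for all $j\in\mathbb{N}$. *)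

theory Defs
  imports "HOL-Analysis.Analysis" "HOL-Computational_Algebra.Polynomial"
begin

definition holo_n :: "(complex^'n) set \<Rightarrow> (complex^'n \<Rightarrow> complex) \<Rightarrow> bool" where
  "holo_n S f \<longleftrightarrow> (\<forall>x\<in>S. \<exists>L. linear L \<and> (\<forall>c v. L (c *s v) = c * L v)
                        \<and> (f has_derivative L) (at x))"

definition holo_tz :: "(complex \<times> (complex^'n)) set \<Rightarrow> (complex \<times> (complex^'n) \<Rightarrow> complex) \<Rightarrow> bool" where
  "holo_tz S f \<longleftrightarrow> (\<forall>x\<in>S. \<exists>L. linear L \<and> (\<forall>c a b. L (c * a, c *s b) = c * L (a, b))
                        \<and> (f has_derivative L) (at x))"

definition vupd :: "complex^'n \<Rightarrow> 'n \<Rightarrow> complex \<Rightarrow> complex^'n" where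
  "vupd z i w = (\<chi> j. if j = i then w else z $ j)"

definition pdz :: "'n \<Rightarrow> (complex^'n \<Rightarrow> complex) \<Rightarrow> (complex^'n \<Rightarrow> complex)" where
  "pdz i f = (\<lambda>z. deriv (\<lambda>w. f (vupd z i w)) (z $ i))"

definition dmulti :: "('n::finite \<Rightarrow> nat) \<Rightarrow> (complex^'n \<Rightarrow> complex) \<Rightarrow> (complex^'n \<Rightarrow> complex)" where
  "dmulti \<alpha> f = foldr (\<lambda>i g. (pdz i ^^ \<alpha> i) g) (SOME xs. distinct xs \<and> set xs = (UNIV::'n set)) f"

definition Qop :: "(('n::finite \<Rightarrow> nat) \<Rightarrow> complex) \<Rightarrow> nat \<Rightarrow> (complex^'n \<Rightarrow> complex) \<Rightarrow> (complex^'n \<Rightarrow> complex)" where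
  "Qop q p f = (\<lambda>z. \<Sum>\<alpha>\<in>{\<alpha>::'n \<Rightarrow> nat. sum \<alpha> UNIV = p}. q \<alpha> * dmulti \<alpha> f z)"

definition homog_op_order :: "(('n::finite \<Rightarrow> nat) \<Rightarrow> complex) \<Rightarrow> nat \<Rightarrow> bool" where
  "homog_op_order q p \<longleftrightarrow> (\<exists>\<alpha>. sum \<alpha> UNIV = p \<and> q \<alpha> \<noteq> 0)"

text \<open>A finite complex Borel measure mu is represented as h d nu with nu a finite
  positive Borel measure and h in L^1(nu); integral of g w.r.t. mu:\<close>
definition cint :: "'a measure \<Rightarrow> ('a \<Rightarrow> complex) \<Rightarrow> ('a \<Rightarrow> complex) \<Rightarrow> complex" where
  "cint \<nu> h g = (LINT y|\<nu>. g y * h y)"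

definition cmean :: "(complex^'n) measure \<Rightarrow> (complex^'n \<Rightarrow> complex) \<Rightarrow> (complex^'n \<Rightarrow> complex)
                      \<Rightarrow> complex^'n \<Rightarrow> complex \<Rightarrow> complex" where
  "cmean \<nu> h \<phi> z t = cint \<nu> h (\<lambda>y. \<phi> (z + t *s y))"

definition cint_s :: "nat \<Rightarrow> nat \<Rightarrow> (complex^'n) measure \<Rightarrow> (complex^'n \<Rightarrow> complex)
                      \<Rightarrow> (complex^'n \<Rightarrow> complex) \<Rightarrow> complex" where
  "cint_s p s \<nu> h g = (1 / of_nat s) *
      (\<Sum>k<s. cint \<nu> h (\<lambda>y. g (cis (2 * real k * pi / real (p * s)) *s y)))"

definition cmean_s :: "nat \<Rightarrow> nat \<Rightarrow> (complex^'n) measure \<Rightarrow> (complex^'n \<Rightarrow> complex)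
                      \<Rightarrow> (complex^'n \<Rightarrow> complex) \<Rightarrow> complex^'n \<Rightarrow> complex \<Rightarrow> complex" where
  "cmean_s p s \<nu> h \<phi> z t = cint_s p s \<nu> h (\<lambda>y. \<phi> (z + t *s y))"

text \<open>Sector S_d(eps) as subset of C; used only with eps < 2 pi, where the sector in the
  universal covering projects injectively onto this set.\<close>
definition sector :: "real \<Rightarrow> real \<Rightarrow> complex set" where
  "sector d \<epsilon> = {z. z \<noteq> 0 \<and> (\<exists>\<theta>. \<bar>\<theta> - d\<bar> < \<epsilon> / 2 \<and> z = of_real (norm z) * cis \<theta>)}"

definition disc_sector :: "real \<Rightarrow> real \<Rightarrow> real \<Rightarrow> complex set" where
  "disc_sector d \<epsilon> r1 = sector d \<epsilon> \<union> ball 0 r1"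

definition Ok_sector :: "real \<Rightarrow> real \<Rightarrow> real \<Rightarrow> real \<Rightarrow> real
                         \<Rightarrow> (complex \<Rightarrow> complex^'n \<Rightarrow> complex) \<Rightarrow> bool" where
  "Ok_sector k d \<epsilon> r1 r F \<longleftrightarrow>
     holo_tz {(t, z). t \<in> disc_sector d \<epsilon> r1 \<and> z \<in> ball 0 r} (\<lambda>(t, z). F t z) \<and>
     (\<forall>r' r1' \<epsilon>'. r' < r \<longrightarrow> r1' < r1 \<longrightarrow> \<epsilon>' < \<epsilon> \<longrightarrow>
        (\<exists>A B. \<forall>t \<in> disc_sector d \<epsilon>' r1'. \<forall>z. norm z \<le> r' \<longrightarrow>
                 norm (F t z) \<le> A * exp (B * norm t powr k)))"

definition Ok_entire :: "real \<Rightarrow> real \<Rightarrow> (complex \<Rightarrow> complex^'n \<Rightarrow> complex) \<Rightarrow> bool" where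
  "Ok_entire k r F \<longleftrightarrow>
     holo_tz {(t, z). z \<in> ball 0 r} (\<lambda>(t, z). F t z) \<and>
     (\<forall>r'. r' < r \<longrightarrow>
        (\<exists>A B. \<forall>t. \<forall>z. norm z \<le> r' \<longrightarrow> norm (F t z) \<le> A * exp (B * norm t powr k)))"

definition in_Ok_sector :: "real \<Rightarrow> real \<Rightarrow> (complex \<Rightarrow> complex^'n \<Rightarrow> complex) \<Rightarrow> bool" where
  "in_Ok_sector k d G \<longleftrightarrow>
     (\<exists>\<epsilon> r1 r F. 0 < \<epsilon> \<and> \<epsilon> < 2 * pi \<and> 0 < r1 \<and> 0 < r \<and> Ok_sector k d \<epsilon> r1 r F \<and>
        (\<exists>\<rho>>0. \<forall>t z. norm t < \<rho> \<longrightarrow> norm z < \<rho> \<longrightarrow> F t z = G t z))"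

definition in_Ok_entire :: "real \<Rightarrow> (complex \<Rightarrow> complex^'n \<Rightarrow> complex) \<Rightarrow> bool" where
  "in_Ok_entire k G \<longleftrightarrow>
     (\<exists>r F. 0 < r \<and> Ok_entire k r F \<and>
        (\<exists>\<rho>>0. \<forall>t z. norm t < \<rho> \<longrightarrow> norm z < \<rho> \<longrightarrow> F t z = G t z))"

definition k_summable :: "real \<Rightarrow> real \<Rightarrow> (nat \<Rightarrow> complex^'n \<Rightarrow> complex) \<Rightarrow> bool" where
  "k_summable k d u \<longleftrightarrow>
     (\<exists>\<epsilon> r1 r F. 0 < \<epsilon> \<and> \<epsilon> < 2 * pi \<and> 0 < r1 \<and> 0 < r \<and> Ok_sector k d \<epsilon> r1 r F \<and>
        (\<exists>\<rho>>0. \<forall>t z. norm t < \<rho> \<longrightarrow> norm z < \<rho> \<longrightarrow>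
            (\<lambda>j. u j z / of_real (Gamma (1 + real j / k)) * t ^ j) sums F t z))"

definition converges_holo :: "(nat \<Rightarrow> complex^'n \<Rightarrow> complex) \<Rightarrow> bool" where
  "converges_holo u \<longleftrightarrow>
     (\<exists>r U. 0 < r \<and> holo_tz (ball 0 r) U \<and>
        (\<forall>t z. norm (t, z) < r \<longrightarrow> (\<lambda>j. u j z * t ^ j) sums U (t, z)))"

definition order_fun :: "real \<Rightarrow> (nat \<Rightarrow> real) \<Rightarrow> bool" where
  "order_fun s m \<longleftrightarrow> (\<exists>c C. 0 < c \<and> 0 < C \<and>
     (\<forall>j. c ^ j * Gamma (1 + s * real j) \<le> m j \<and> m j \<le> C ^ j * Gamma (1 + s * real j)))"

definition kmoment :: "(complex \<Rightarrow> complex) \<Rightarrow> nat \<Rightarrow> real" where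
  "kmoment e u = integral {0<..} (\<lambda>x::real. x powr (real u - 1) * Re (e (of_real x)))"

text \<open>Kernel function of order k > 1/2 (Balser).\<close>
definition basic_kernel :: "real \<Rightarrow> (complex \<Rightarrow> complex) \<Rightarrow> bool" where
  "basic_kernel k e \<longleftrightarrow> k > 1/2 \<and>
     e holomorphic_on sector 0 (pi / k) \<and>
     (\<lambda>x::real. e (of_real x) / of_real x) absolutely_integrable_on {0<..1} \<and>
     (\<forall>x::real. x > 0 \<longrightarrow> e (of_real x) \<in> \<real> \<and> Re (e (of_real x)) > 0) \<and>
     (\<forall>\<delta>>0. \<exists>A B. 0 < A \<and> 0 < B \<and>
        (\<forall>z \<in> sector 0 (pi / k - \<delta>). norm (e z) \<le> A * exp (- ((norm z / B) powr k)))) \<and>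
     (\<forall>z::complex. summable (\<lambda>j. z ^ j / of_real (kmoment e j))) \<and>
     (\<exists>A B. \<forall>z::complex. norm (\<Sum>j. z ^ j / of_real (kmoment e j)) \<le> A * exp (B * norm z powr k)) \<and>
     (\<forall>\<theta>. \<bar>\<theta> - pi\<bar> < (2 * pi - pi / k) / 2 \<longrightarrow>
        (\<lambda>x::real. (\<Sum>j. (1 / (of_real x * cis \<theta>)) ^ j / of_real (kmoment e j)) / (of_real x * cis \<theta>))
          absolutely_integrable_on {0<..1})"

text \<open>Kernel function of general order k > 0: e(z) = e~(z^(1/q))/q with e~ of order qk > 1/2
  (only its values on the positive real axis enter the moments).\<close>
definition kernel_fun :: "real \<Rightarrow> (complex \<Rightarrow> complex) \<Rightarrow> bool" where
  "kernel_fun k e \<longleftrightarrow> k > 0 \<and> (\<exists>q::nat. q \<ge> 1 \<and> real q * k > 1/2 \<and>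
     (\<exists>e'. basic_kernel (real q * k) e' \<and>
        (\<forall>x::real. x > 0 \<longrightarrow> e (of_real x) = e' (of_real (x powr (1 / real q))) / of_nat q)))"

definition moment_fun :: "real \<Rightarrow> (nat \<Rightarrow> real) \<Rightarrow> bool" where
  "moment_fun s m \<longleftrightarrow> s > 0 \<and> (\<exists>e. kernel_fun (1 / s) e \<and> (\<forall>u. m u = kmoment e u))"

definition gen_moment_fun :: "real \<Rightarrow> (nat \<Rightarrow> real) \<Rightarrow> bool" where
  "gen_moment_fun s m1 \<longleftrightarrow> order_fun s m1 \<and>
     (\<exists>m2 p1 p2 c. moment_fun s m2 \<and> p1 \<noteq> 0 \<and> p2 \<noteq> 0 \<and> (c::real) > 0 \<and>
        (\<forall>j::nat. j \<ge> 1 \<longrightarrow> poly p1 (real j) * m1 j = poly p2 (real j) * m2 j * c ^ j))"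

end

theory Submission
  imports Defs "HOL-Complex_Analysis.Complex_Analysis" "HOL-Computational_Algebra.Fundamental_Theorem_Algebra" "HOL-Real_Asymp.Real_Asymp"
begin

text \<open>
  Put \<open>N = ps\<close>, \<open>k = 1/(N - 1)\<close> and \<open>a\<^sub>j = Q^(sj) \<phi>\<close>. Averaging the expansion of the mean over the rotations by
  \<open>exp (2 l \<pi> i / N)\<close> removes the terms whose index is not divisible by \<open>s\<close>. What remains is a comparison of two power
  series, with coefficients \<open>a\<^sub>j/j!\<close> for the formal solution and \<open>a\<^sub>j/m(sj)\<close> for the mean, the latter in powers of
  \<open>t\<^sup>N\<close>. Convergence is compared by Cauchy estimates, using \<open>j! ((N - 1)j)! \<le> (Nj)!\<close> in one direction and
  \<open>(Nj)!/j! \<le> (Nj)^((N - 1)j)\<close> in the other.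

  For summability one has to pass between the coefficients \<open>a\<^sub>j/(j! ((N - 1)j)!)\<close> and \<open>a\<^sub>j/m(sj)\<close>. A multiplier
  \<open>\<lambda>\<^sub>j = \<integral> \<kappa>\<^sup>j w dM\<close>, with \<open>\<kappa>\<close> bounded and of arbitrarily small argument, preserves continuation with growth of
  order \<open>k\<close> in a direction, because \<open>\<Sum> \<lambda>\<^sub>j u\<^sub>j t\<^sup>j = \<integral> F(\<kappa> t) w dM\<close> when \<open>F(t) = \<Sum> u\<^sub>j t\<^sup>j\<close>. Polynomials in \<open>j\<close> and their
  reciprocals are products of such multipliers, and so, by the Beta integral, are quotients of factorials. For a
  moment function one shows that \<open>\<Sum> c\<^sub>n x\<^sup>n\<close>, with \<open>c\<^sub>n\<close> the quotient of the moment by the factorial or its inverse,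
  continues to the plane slit along the positive axis: it is a Laplace transform of the kernel \<open>e\<close>, respectively of
  the function \<open>E\<close>. Deforming the contour of Cauchy's formula onto the two rays just off the positive axis then
  writes \<open>c\<^sub>n\<close> in the required form.
\<close>

section \<open>Holomorphic functions of several variables\<close>

text \<open>A quotient such as \<open>m j / fact (p * j)\<close> has to be spread over dilations
  that almost preserve a disc-sector. The integral defining a moment does not do this: its dilations
  run to infinity, which destroys convergence at the origin. Only after division by a factorial of
  the same order is the growth geometric. Cauchy's formula then offers \<open>\<kappa>\<close> = 1/x
  on a circle, bounded but of every argument; continuation off the positive axis is what permits
  opening the circle until the arguments are small. Since the claim is an equivalence, the quotient
  and its inverse both need this: the first exploits that the path may be rotated inside the sector
  where \<open>e\<close> is flat, the second that \<open>E\<close> is integrable along the rays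
  outside it. Logarithmic variables turn sectors into strips, rays into horizontal lines and
  rotations of a path into vertical shifts. Indices at which a representation fails (roots of a
  polynomial, the index 0, a divergent integral) are finite in number and cost only a polynomial in
  t with holomorphic coefficients.\<close>

lemma holomorphic_remainder_bound:
  fixes f :: "complex \<Rightarrow> complex"
  assumes hol: "f holomorphic_on ball 0 R" and R: "R > 0"
    and bnd: "\<And>c. c \<in> ball 0 R \<Longrightarrow> norm (f c) \<le> M"
    and w: "norm w \<le> R / 4"
  shows "norm (f w - f 0 - deriv f 0 * w) \<le> 32 * M / R\<^sup>2 * (norm w)\<^sup>2"
    and "norm (deriv f 0) \<le> 2 * M / R"
proof -
  \<comment> \<open>Circles of radius R/4 about points of the half ball stay in the domain; n = 2
    gives 2 M / (R/4)^2, the constant 32 M / R^2. That the bounds are linear in M matters: later M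
    is an integrable function of a parameter.\<close>
  have C: "norm ((deriv ^^ n) f x) \<le> fact n * M / (R/4) ^ n" if x: "x \<in> ball 0 (R/2)" for x n
  proof (rule Cauchy_inequality)
    have *: "cball x (R/4) \<subseteq> ball 0 R"
    proof
      fix y assume "y \<in> cball x (R/4)"
      then have "norm (y - x) \<le> R/4" by (simp add: dist_norm norm_minus_commute)
      then show "y \<in> ball 0 R" using x R norm_triangle_sub[of y x] by simp
    qed
    show "f holomorphic_on ball x (R/4)"
      using * ball_subset_cball by (blast intro: holomorphic_on_subset[OF hol])
    show "continuous_on (cball x (R/4)) f"
      using * hol continuous_on_subset holomorphic_on_imp_continuous_on by blast
    show "0 < R/4" using R by simp
    show "norm (f y) \<le> M" if "norm (x - y) = R/4" for y
    proof (rule bnd)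
      have "y \<in> cball x (R/4)" using that by (simp add: dist_norm)
      then show "y \<in> ball 0 R" using * by blast
    qed
  qed
  have der: "((deriv ^^ n) f has_field_derivative (deriv ^^ Suc n) f x) (at x within ball 0 (R/2))"
    if "x \<in> ball 0 (R/2)" for x n
  proof -
    have "(deriv ^^ n) f holomorphic_on ball 0 R"
      using hol holomorphic_higher_deriv by blast
    moreover have "x \<in> ball 0 R" using that R by auto
    ultimately show ?thesis
      by (simp add: DERIV_deriv_iff_field_differentiable has_field_derivative_at_within holomorphic_on_imp_differentiable_at)
  qed
  have "norm (((deriv ^^ 0) f) w - (\<Sum>i\<le>1. (deriv ^^ i) f 0 * (w - 0) ^ i / fact i))
     \<le> (32 * M / R\<^sup>2) * norm (w - 0) ^ Suc 1 / fact 1"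
  proof (rule field_Taylor[where S = "ball 0 (R/2)"])
    show "norm ((deriv ^^ Suc 1) f x) \<le> 32 * M / R\<^sup>2" if "x \<in> ball 0 (R/2)" for x
      using C[OF that, of 2] by (simp add: power_divide numeral_2_eq_2)
    show "((deriv ^^ i) f has_field_derivative (deriv ^^ Suc i) f x) (at x within ball 0 (R/2))"
      if "x \<in> ball 0 (R/2)" for i x using that by (rule der)
    show "convex (ball (0::complex) (R/2))" by (rule convex_ball)
  qed (use R w in simp_all)
  then show "norm (f w - f 0 - deriv f 0 * w) \<le> 32 * M / R\<^sup>2 * (norm w)\<^sup>2"
    by (simp add: algebra_simps power2_eq_square)
  have "norm ((deriv ^^ 1) f 0) \<le> fact 1 * M / (R/2) ^ 1"
  proof (rule Cauchy_inequality)
    show "f holomorphic_on ball 0 (R/2)" using R by (auto intro!: holomorphic_on_subset[OF hol])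
    show "continuous_on (cball 0 (R/2)) f" using R
      by (intro holomorphic_on_imp_continuous_on holomorphic_on_subset[OF hol]) auto
    show "norm (f y) \<le> M" if "norm (0 - y) = R/2" for y
      using that R by (intro bnd) auto
  qed (use R in auto)
  then show "norm (deriv f 0) \<le> 2 * M / R" by (simp add: mult.commute)
qed

lemma norm_cvec_scale: "norm (c *s b) = norm c * norm (b :: complex^'n)"
  by (simp add: norm_vec_def L2_set_right_distrib norm_mult)

lemma norm_cpair_scale: "norm (c * a, c *s b) = norm c * norm (a :: complex, b :: complex^'n)"
proof -
  have "norm (c * a, c *s b) = sqrt ((norm c)\<^sup>2 * ((norm a)\<^sup>2 + (norm b)\<^sup>2))"
    by (simp add: norm_prod_def norm_cvec_scale norm_mult power_mult_distrib algebra_simps)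
  then show ?thesis by (simp add: real_sqrt_mult norm_prod_def)
qed

lemma cvec_scale_linear: "bounded_linear (\<lambda>c. c *s (b :: complex^'n))"
  by (rule bounded_linear_intro[where K = "norm b"])
    (auto simp: vec_eq_iff algebra_simps norm_cvec_scale)

lemma has_field_derivative_line:
  fixes f :: "complex \<times> (complex^'n) \<Rightarrow> complex"
  assumes "(f has_derivative L) (at (y + (c * a, c *s b)))"
    and "\<forall>c a b. L (c * a, c *s b) = c * L (a, b)"
  shows "((\<lambda>c. f (y + (c * a, c *s b))) has_field_derivative L (a, b)) (at c)"
proof -
  have "((\<lambda>c. y + (c * a, c *s b)) has_derivative (\<lambda>c. (c * a, c *s b))) (at c)"
    by (auto intro!: derivative_eq_intros bounded_linear_imp_has_derivative[OF cvec_scale_linear])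
  from has_derivative_compose[OF this assms(1)]
  have "((\<lambda>c. f (y + (c * a, c *s b))) has_derivative (\<lambda>c. L (c * a, c *s b))) (at c)" .
  moreover have "(\<lambda>c. L (c * a, c *s b)) = (*) (L (a, b))"
    using assms(2) by (simp add: fun_eq_iff mult.commute)
  ultimately show ?thesis unfolding has_field_derivative_def by (simp only:)
qed

lemma holo_tzD:
  assumes "holo_tz S f" "x \<in> S"
  obtains L where "linear L" "\<forall>c a b. L (c * a, c *s b) = c * L (a, b)" "(f has_derivative L) (at x)"
  using assms unfolding holo_tz_def by blast

lemma holo_tz_subset: "holo_tz S f \<Longrightarrow> T \<subseteq> S \<Longrightarrow> holo_tz T f"
  unfolding holo_tz_def by blast

lemma holo_tz_continuous_on: "holo_tz S f \<Longrightarrow> continuous_on S f"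
  unfolding holo_tz_def
  by (metis continuous_at_imp_continuous_on has_derivative_continuous)

text \<open>For functions glued from several formulas: near each point any local representative may
  be used.\<close>

lemma holo_tz_local:
  assumes "\<And>x. x \<in> S \<Longrightarrow> \<exists>U g. open U \<and> x \<in> U \<and> holo_tz U g \<and> (\<forall>y\<in>U. g y = f y)"
  shows "holo_tz S f"
  unfolding holo_tz_def
proof
  fix x assume "x \<in> S"
  then obtain U g where U: "open U" "x \<in> U" "holo_tz U g" "\<forall>y\<in>U. g y = f y" using assms by blast
  from holo_tzD[OF U(3,2)] obtain L where L: "linear L" "\<forall>c a b. L (c * a, c *s b) = c * L (a, b)"
     "(g has_derivative L) (at x)" .
  have "(f has_derivative L) (at x)"
    using has_derivative_transform_within_open[OF L(3) U(1,2)] U(4) by blast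
  with L show "\<exists>L. linear L \<and> (\<forall>c a b. L (c * a, c *s b) = c * L (a, b)) \<and> (f has_derivative L) (at x)"
    by blast
qed

lemma holo_tz_cong:
  assumes "holo_tz S f" "open S" "\<And>x. x \<in> S \<Longrightarrow> f x = g x"
  shows "holo_tz S g"
  by (rule holo_tz_local) (use assms in blast)

lemma holo_tz_add: "holo_tz S f \<Longrightarrow> holo_tz S g \<Longrightarrow> holo_tz S (\<lambda>x. f x + g x)"
  unfolding holo_tz_def
proof
  fix x
  assume "\<forall>x\<in>S. \<exists>L. linear L \<and> (\<forall>c a b. L (c * a, c *s b) = c * L (a, b)) \<and> (f has_derivative L) (at x)"
    "\<forall>x\<in>S. \<exists>L. linear L \<and> (\<forall>c a b. L (c * a, c *s b) = c * L (a, b)) \<and> (g has_derivative L) (at x)" "x \<in> S"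
  then obtain L L' where "linear L" "\<forall>c a b. L (c * a, c *s b) = c * L (a, b)" "(f has_derivative L) (at x)"
    "linear L'" "\<forall>c a b. L' (c * a, c *s b) = c * L' (a, b)" "(g has_derivative L') (at x)" by blast
  then have "((\<lambda>x. f x + g x) has_derivative (\<lambda>x. L x + L' x)) (at x)" "linear L" "linear L'"
    "\<forall>c a b. L (c * a, c *s b) = c * L (a, b)" "\<forall>c a b. L' (c * a, c *s b) = c * L' (a, b)"
    by (auto intro: has_derivative_add)
  then show "\<exists>L. linear L \<and> (\<forall>c a b. L (c * a, c *s b) = c * L (a, b)) \<and> ((\<lambda>x. f x + g x) has_derivative L) (at x)"
    by (intro exI[of _ "\<lambda>x. L x + L' x"]) (auto intro!: linear_compose_add simp: algebra_simps)
qed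

lemma holo_tz_mult: "holo_tz S f \<Longrightarrow> holo_tz S g \<Longrightarrow> holo_tz S (\<lambda>x. f x * g x)"
  unfolding holo_tz_def
proof
  fix x
  assume "\<forall>x\<in>S. \<exists>L. linear L \<and> (\<forall>c a b. L (c * a, c *s b) = c * L (a, b)) \<and> (f has_derivative L) (at x)"
    "\<forall>x\<in>S. \<exists>L. linear L \<and> (\<forall>c a b. L (c * a, c *s b) = c * L (a, b)) \<and> (g has_derivative L) (at x)" "x \<in> S"
  then obtain L L' where L: "linear L" "\<forall>c a b. L (c * a, c *s b) = c * L (a, b)" "(f has_derivative L) (at x)"
    "linear L'" "\<forall>c a b. L' (c * a, c *s b) = c * L' (a, b)" "(g has_derivative L') (at x)" by blast
  from has_derivative_mult[OF L(3,6)]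
  have D: "((\<lambda>x. f x * g x) has_derivative (\<lambda>h. f x * L' h + L h * g x)) (at x)" .
  show "\<exists>L. linear L \<and> (\<forall>c a b. L (c * a, c *s b) = c * L (a, b)) \<and> ((\<lambda>x. f x * g x) has_derivative L) (at x)"
    using D has_derivative_linear[OF D] L by (intro exI[of _ "\<lambda>h. f x * L' h + L h * g x"]) (auto simp: algebra_simps)
qed

lemma holo_tz_fst:
  assumes "f holomorphic_on T" "open T" "\<And>x. x \<in> S \<Longrightarrow> fst x \<in> T"
  shows "holo_tz S (\<lambda>x :: complex \<times> (complex^'n). f (fst x))"
  unfolding holo_tz_def
proof
  fix x :: "complex \<times> (complex^'n)" assume "x \<in> S"
  then have "(f has_field_derivative deriv f (fst x)) (at (fst x))"
    using assms holomorphic_derivI by blast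
  from has_derivative_compose[OF has_derivative_fst[OF has_derivative_ident] this[unfolded has_field_derivative_def]]
  have D: "((\<lambda>x. f (fst x)) has_derivative (\<lambda>h. deriv f (fst x) * fst h)) (at x)" by simp
  show "\<exists>L. linear L \<and> (\<forall>c a b. L (c * a, c *s b) = c * L (a, b)) \<and> ((\<lambda>x. f (fst x)) has_derivative L) (at x)"
    using D has_derivative_linear[OF D] by (intro exI[of _ "\<lambda>h. deriv f (fst x) * fst h"]) (auto simp: algebra_simps)
qed

lemma holo_tz_const: "holo_tz S (\<lambda>x. c)"
  using holo_tz_fst[of "\<lambda>_. c" UNIV S] by simp

lemma holo_tz_compose_fst:
  assumes f: "holo_tz T f" and g: "g holomorphic_on U" "open U"
    and sub: "\<And>t z. (t, z) \<in> S \<Longrightarrow> t \<in> U \<and> (g t, z) \<in> T"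
  shows "holo_tz S (\<lambda>(t, z). f (g t, z))"
  unfolding holo_tz_def
proof
  fix x assume x: "x \<in> S"
  obtain t z where [simp]: "x = (t, z)" by (cases x)
  have t: "t \<in> U" "(g t, z) \<in> T" using sub x by auto
  from holo_tzD[OF f t(2)] obtain L where L: "linear L" "\<forall>c a b. L (c * a, c *s b) = c * L (a, b)"
     "(f has_derivative L) (at (g t, z))" .
  have gd: "(g has_field_derivative deriv g t) (at t)" using g t holomorphic_derivI by blast
  have "((\<lambda>x. g (fst x)) has_derivative (\<lambda>h. deriv g t * fst h)) (at x)"
    using has_derivative_compose[OF has_derivative_fst[OF has_derivative_ident], of g "\<lambda>h. deriv g t * h" x]
      gd[unfolded has_field_derivative_def] by simp
  then have "((\<lambda>x. (g (fst x), snd x)) has_derivative (\<lambda>h. (deriv g t * fst h, snd h))) (at x)"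
    by (intro has_derivative_Pair has_derivative_snd has_derivative_ident)
  from has_derivative_compose[OF this, of f L] L(3)
  have D: "((\<lambda>(t, z). f (g t, z)) has_derivative (\<lambda>h. L (deriv g t * fst h, snd h))) (at x)"
    by (simp add: case_prod_unfold)
  have "L (deriv g t * (c * a), c *s b) = c * L (deriv g t * a, b)" for c a b
    using L(2)[rule_format, of c "deriv g t * a" b] by (simp add: algebra_simps)
  then show "\<exists>L. linear L \<and> (\<forall>c a b. L (c * a, c *s b) = c * L (a, b)) \<and> ((\<lambda>(t, z). f (g t, z)) has_derivative L) (at x)"
    using D has_derivative_linear[OF D] by (intro exI[of _ "\<lambda>h. L (deriv g t * fst h, snd h)"]) auto
qed

lemma holo_tz_fix_fst:
  assumes f: "holo_tz T f" and sub: "\<And>t z. (t, z) \<in> S \<Longrightarrow> (c, z) \<in> T"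
  shows "holo_tz S (\<lambda>(t, z). f (c, z))"
  by (rule holo_tz_compose_fst[OF f, of "\<lambda>_. c" UNIV S]) (use sub in auto)

lemma holo_tz_section:
  assumes f: "holo_tz T f" and sub: "\<And>t. t \<in> U \<Longrightarrow> (t, z) \<in> T"
  shows "(\<lambda>t. f (t, z)) holomorphic_on U"
  unfolding holomorphic_on_def
proof
  fix t assume "t \<in> U"
  then have "(t, z) \<in> T" by (rule sub)
  from holo_tzD[OF f this] obtain L where L: "linear L" "\<forall>c a b. L (c * a, c *s b) = c * L (a, b)"
    "(f has_derivative L) (at (t, z))" .
  have "((\<lambda>c. f ((0, z) + (c * 1, c *s 0))) has_field_derivative L (1, 0)) (at t)"
    by (rule has_field_derivative_line) (use L in auto)
  then have "((\<lambda>c. f (c, z)) has_field_derivative L (1, 0)) (at t)" by simp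
  from has_field_derivative_at_within[OF this]
  show "(\<lambda>t. f (t, z)) field_differentiable at t within U"
    unfolding field_differentiable_def by (rule exI)
qed

section \<open>Differentiation under the integral sign\<close>

lemma has_field_derivative_along:
  fixes f :: "'v::real_normed_vector \<Rightarrow> complex" and sc :: "complex \<Rightarrow> 'v \<Rightarrow> 'v"
  assumes "(f has_derivative L) (at (y + sc c h))"
    and "bounded_linear (\<lambda>c. sc c h)"
    and "\<forall>c v. L (sc c v) = c * L v"
  shows "((\<lambda>c. f (y + sc c h)) has_field_derivative L h) (at c)"
proof -
  have "((\<lambda>c. y + sc c h) has_derivative (\<lambda>c. sc c h)) (at c)"
    by (auto intro!: derivative_eq_intros bounded_linear_imp_has_derivative[OF assms(2)])
  from has_derivative_compose[OF this assms(1)]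
  have "((\<lambda>c. f (y + sc c h)) has_derivative (\<lambda>c. L (sc c h))) (at c)" .
  moreover have "(\<lambda>c. L (sc c h)) = (*) (L h)"
    using assms(3) by (simp add: fun_eq_iff mult.commute)
  ultimately show ?thesis unfolding has_field_derivative_def by (simp only:)
qed

text \<open>On every complex line through y the integrand is a bounded holomorphic function of one
  variable, so Cauchy's estimates control its derivative and its second-order remainder by constants
  times \<open>g x\<close>, uniformly in the direction. Integrating these bounds yields a Frechet
  derivative from domination of the integrand alone. The scalar action is the parameter
  \<open>sc\<close>, so that one proof serves both C and the product of C with C^n.\<close>

lemma complex_linear_derivative_integral:
  fixes K :: "'x \<Rightarrow> 'v::euclidean_space \<Rightarrow> complex" and sc :: "complex \<Rightarrow> 'v \<Rightarrow> 'v"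
  assumes sc_norm: "\<And>c v. norm (sc c v) = norm c * norm v"
    and sc_lin: "\<And>v. bounded_linear (\<lambda>c. sc c v)"
    and sc_1: "\<And>v. sc 1 v = v"
    and S: "open S"
    and hol: "\<And>x y. x \<in> space M \<Longrightarrow> y \<in> S \<Longrightarrow>
       \<exists>L. linear L \<and> (\<forall>c v. L (sc c v) = c * L v) \<and> (K x has_derivative L) (at y)"
    and meas: "\<And>y. y \<in> S \<Longrightarrow> (\<lambda>x. K x y) \<in> borel_measurable M"
    and dom: "\<And>y. y \<in> S \<Longrightarrow> \<exists>U g. open U \<and> y \<in> U \<and> integrable M g \<and>
                 (\<forall>x\<in>space M. \<forall>y\<in>U \<inter> S. norm (K x y) \<le> g x)"
    and y: "y \<in> S"
  shows "\<exists>L. linear L \<and> (\<forall>c v. L (sc c v) = c * L v) \<and>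
      ((\<lambda>y. LINT x|M. K x y) has_derivative L) (at y)"
proof -
  have sc_0: "sc 0 v = 0" for v using sc_norm[of 0 v] by simp
  obtain U g where U: "open U" "y \<in> U" "integrable M g"
    and g: "\<forall>x\<in>space M. \<forall>y\<in>U \<inter> S. norm (K x y) \<le> g x" using dom[OF y] by metis
  note U = U g[rule_format]
  have "open (U \<inter> S)" "y \<in> U \<inter> S" using S U y by auto
  then obtain e where e: "e > 0" "ball y e \<subseteq> U \<inter> S" by (rule openE)
  have int: "integrable M (\<lambda>x. K x v)" if "v \<in> ball y e" for v
  proof (rule Bochner_Integration.integrable_bound[OF U(3)])
    have v: "v \<in> U \<inter> S" using that e(2) by (rule subsetD[rotated])
    then show "(\<lambda>x. K x v) \<in> borel_measurable M" by (intro meas) simp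
    show "AE x in M. norm (K x v) \<le> norm (g x)"
      using U(4)[OF _ v] by (intro AE_I2) (auto intro: order_trans[OF _ abs_ge_self])
  qed
  have "\<forall>x\<in>space M. \<exists>L. linear L \<and> (\<forall>c v. L (sc c v) = c * L v) \<and> (K x has_derivative L) (at y)"
    using hol y by simp
  then obtain L where L: "\<And>x. x \<in> space M \<Longrightarrow> linear (L x)"
    "\<And>x. x \<in> space M \<Longrightarrow> \<forall>c v. L x (sc c v) = c * L x v"
    "\<And>x. x \<in> space M \<Longrightarrow> (K x has_derivative L x) (at y)" by metis
  \<comment> \<open>Restriction to the complex line of direction h. Its disc has radius
    \<open>e / norm h\<close>, so Cauchy's estimates produce the factors \<open>norm h\<close> and
    \<open>(norm h)\<^sup>2\<close>.\<close>
  define \<phi> where "\<phi> x h c = K x (y + sc c h)" for x h c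
  have dist_v: "dist y (y + v) = norm v" for v 
    by (simp add: dist_norm)
  have in_ball: "y + sc c h \<in> ball y e" if "norm c * norm h < e" for c h
    using that sc_norm by (simp add: mem_ball dist_v)
  have der: "(\<phi> x h has_field_derivative L x h) (at 0)" if x: "x \<in> space M" for x h
    using has_field_derivative_along[of "K x" "L x" y sc 0 h] L[OF x] sc_lin
    unfolding \<phi>_def by (simp add: sc_0)
  have holl: "\<phi> x h holomorphic_on ball 0 (e / norm h)" if x: "x \<in> space M" and h: "h \<noteq> 0" for x h
    unfolding holomorphic_on_def
  proof
    fix c :: complex assume "c \<in> ball 0 (e / norm h)"
    then have "norm c * norm h < e" using h by (simp add: field_simps)
    then have "y + sc c h \<in> S" using subsetD[OF e(2) in_ball] by simp
    from hol[OF x this] obtain L' where L': "linear L'" "\<forall>c v. L' (sc c v) = c * L' v"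
      "(K x has_derivative L') (at (y + sc c h))" by blast
    from has_field_derivative_along[OF L'(3) sc_lin L'(2)]
    show "\<phi> x h field_differentiable at c within ball 0 (e / norm h)"
      unfolding \<phi>_def field_differentiable_def by (meson has_field_derivative_at_within)
  qed
  have bnd: "norm (\<phi> x h c) \<le> g x" if "x \<in> space M" "h \<noteq> 0" "c \<in> ball 0 (e / norm h)" for x h c
  proof -
    have "norm c * norm h < e" using that by (simp add: field_simps)
    then show ?thesis unfolding \<phi>_def by (intro U(4)[OF that(1)] subsetD[OF e(2) in_ball])
  qed
  have L_bnd: "norm (L x h) \<le> 2 * g x / e * norm h" if x: "x \<in> space M" for x h
  proof (cases "h = 0")
    case True
    then show ?thesis using linear_0[OF L(1)[OF x]] by simp
  next
    case False
    have "norm (deriv (\<phi> x h) 0) \<le> 2 * g x / (e / norm h)"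
      using holomorphic_remainder_bound(2)[OF holl[OF x False] _ bnd[OF x False], of 0] e False by simp
    then show ?thesis using DERIV_imp_deriv[OF der[OF x]] by simp
  qed
  have rem: "norm (K x (y + h) - K x y - L x h) \<le> 32 * g x / e\<^sup>2 * (norm h)\<^sup>2"
    if x: "x \<in> space M" and h: "norm h \<le> e / 4" for x h
  proof (cases "h = 0")
    case True
    then show ?thesis using linear_0[OF L(1)[OF x]] by simp
  next
    case False
    have "norm (\<phi> x h 1 - \<phi> x h 0 - deriv (\<phi> x h) 0 * 1) \<le> 32 * g x / (e / norm h)\<^sup>2 * (norm (1::complex))\<^sup>2"
      by (rule holomorphic_remainder_bound(1)[OF holl[OF x False] _ bnd[OF x False]])
        (use e False h in \<open>simp_all add: field_simps\<close>)
    then show ?thesis using DERIV_imp_deriv[OF der[OF x, of h]]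
      by (simp add: \<phi>_def power_divide sc_0 sc_1)
  qed
  have L_meas: "(\<lambda>x. L x h) \<in> borel_measurable M" for h
  proof -
    \<comment> \<open>The derivative is measurable in x as a limit of difference quotients along
      \<open>c n\<close>; the shift by \<open>n0\<close> keeps every point
      \<open>y + sc (c n) h\<close> inside the ball.\<close>
    obtain n0 :: nat where n0: "norm h / e < real n0" using reals_Archimedean2 by blast
    define c where "c n = (1 / of_nat (Suc (n + n0)) :: complex)" for n
    have c0: "c \<longlonglongrightarrow> 0"
      unfolding c_def by (rule LIMSEQ_ignore_initial_segment[OF lim_1_over_n[THEN LIMSEQ_Suc]])
    have cn: "c n \<noteq> 0" for n unfolding c_def by (simp del: of_nat_Suc)
    have cs: "norm (c n) * norm h < e" for n
    proof -
      have "norm h < e * real n0" using n0 e by (simp add: field_simps)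
      also have "\<dots> \<le> e * real (Suc (n + n0))" using e by (intro mult_left_mono) auto
      finally have "norm h < e * real (Suc (n + n0))" .
      then show ?thesis by (simp add: c_def norm_divide field_simps del: of_nat_Suc)
    qed
    show ?thesis
    proof (rule borel_measurable_LIMSEQ_metric)
      show "(\<lambda>x. (\<phi> x h (c n) - K x y) / c n) \<in> borel_measurable M" for n
        unfolding \<phi>_def using meas[of "y + sc (c n) h"] subsetD[OF e(2) in_ball[OF cs[of n]]] meas[OF y]
        by (intro borel_measurable_divide borel_measurable_diff) simp_all
      show "(\<lambda>n. (\<phi> x h (c n) - K x y) / c n) \<longlonglongrightarrow> L x h" if x: "x \<in> space M" for x
      proof -
        have "((\<lambda>c. (\<phi> x h c - \<phi> x h 0) / c) \<longlongrightarrow> L x h) (at 0)"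
          using der[OF x, of h] by (simp add: has_field_derivative_iff)
        moreover have "filterlim c (at 0) sequentially"
          using c0 cn by (simp add: filterlim_at)
        ultimately have "(\<lambda>n. (\<phi> x h (c n) - \<phi> x h 0) / c n) \<longlonglongrightarrow> L x h"
          by (rule filterlim_compose)
        then show ?thesis by (simp add: \<phi>_def sc_0 sc_1)
      qed
    qed
  qed
  have L_int: "integrable M (\<lambda>x. L x h)" for h
  proof (rule Bochner_Integration.integrable_bound[of M "\<lambda>x. 2 * g x / e * norm h"])
    show "integrable M (\<lambda>x. 2 * g x / e * norm h)" using U(3) by simp
    show "AE x in M. norm (L x h) \<le> norm (2 * g x / e * norm h)"
      using L_bnd by (intro AE_I2) (metis abs_ge_self order_trans real_norm_def)
  qed (rule L_meas)
  define L0 where "L0 h = (LINT x|M. L x h)" for h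
  have lin: "linear L0"
  proof (rule linearI)
    fix a b
    have "L0 (a + b) = (LINT x|M. L x a + L x b)"
      unfolding L0_def by (rule Bochner_Integration.integral_cong) (simp_all add: linear_add[OF L(1)])
    then show "L0 (a + b) = L0 a + L0 b"
      using Bochner_Integration.integral_add[OF L_int L_int] by (simp add: L0_def)
  next
    fix r :: real and a
    have "L0 (r *\<^sub>R a) = (LINT x|M. r *\<^sub>R L x a)"
      unfolding L0_def by (rule Bochner_Integration.integral_cong) (simp_all add: linear_scale[OF L(1)])
    then show "L0 (r *\<^sub>R a) = r *\<^sub>R L0 a" by (simp add: L0_def)
  qed
  have hom: "L0 (sc c v) = c * L0 v" for c v
  proof -
    have "L0 (sc c v) = (LINT x|M. c * L x v)"
      unfolding L0_def by (rule Bochner_Integration.integral_cong) (simp_all add: L(2))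
    then show ?thesis by (simp add: L0_def)
  qed
  define C where "C = (LINT x|M. 32 * g x / e\<^sup>2)"
  have diff: "norm ((LINT x|M. K x (y + h)) - (LINT x|M. K x y) - L0 h) \<le> C * (norm h)\<^sup>2"
    if h: "norm h \<le> e / 4" for h
  proof -
    have yb: "y + h \<in> ball y e" "y \<in> ball y e" using h e by (auto simp: dist_norm)
    have "(LINT x|M. K x (y + h)) - (LINT x|M. K x y) - L0 h = (LINT x|M. K x (y + h) - K x y - L x h)"
      unfolding L0_def using int[OF yb(1)] int[OF yb(2)] L_int by simp
    also have "norm \<dots> \<le> (LINT x|M. norm (K x (y + h) - K x y - L x h))"
      by (rule integral_norm_bound)
    also have "\<dots> \<le> (LINT x|M. 32 * g x / e\<^sup>2 * (norm h)\<^sup>2)"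
      by (rule integral_mono) (use int[OF yb(1)] int[OF yb(2)] L_int U(3) rem h in simp_all)
    finally show ?thesis unfolding C_def by simp
  qed
  have "((\<lambda>y. LINT x|M. K x y) has_derivative L0) (at y)"
    unfolding has_derivative_at2
  proof (intro conjI)
    show "bounded_linear L0" using lin linear_conv_bounded_linear by blast
    show "((\<lambda>w. (1 / norm (w - y)) *\<^sub>R ((LINT x|M. K x w) - ((LINT x|M. K x y) + L0 (w - y)))) \<longlongrightarrow> 0) (at y)"
    proof (rule Lim_null_comparison)
      show "\<forall>\<^sub>F w in at y. norm ((1 / norm (w - y)) *\<^sub>R ((LINT x|M. K x w) - ((LINT x|M. K x y) + L0 (w - y)))) \<le> C * norm (w - y)"
        unfolding eventually_at
      proof (intro exI[of _ "e/4"] conjI ballI impI)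
        show "0 < e / 4" using e by simp
        fix w assume w: "w \<noteq> y \<and> dist w y < e / 4"
        then have "norm ((LINT x|M. K x w) - ((LINT x|M. K x y) + L0 (w - y))) \<le> C * (norm (w - y))\<^sup>2"
          using diff[of "w - y"] by (simp add: dist_norm diff_diff_eq)
        then have "norm ((LINT x|M. K x w) - ((LINT x|M. K x y) + L0 (w - y))) / norm (w - y) \<le> C * norm (w - y)"
          using w by (simp add: divide_le_eq power2_eq_square)
        then show "norm ((1 / norm (w - y)) *\<^sub>R ((LINT x|M. K x w) - ((LINT x|M. K x y) + L0 (w - y)))) \<le> C * norm (w - y)"
          by simp
      qed
      have "((\<lambda>w. C * norm (w - y)) \<longlongrightarrow> C * norm (y - y)) (at y)"
        by (intro tendsto_intros)
      then show "((\<lambda>w. C * norm (w - y)) \<longlongrightarrow> 0) (at y)" by simp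
    qed
  qed
  with lin hom show "\<exists>L. linear L \<and> (\<forall>c v. L (sc c v) = c * L v) \<and>
      ((\<lambda>y. LINT x|M. K x y) has_derivative L) (at y)" by blast
qed

lemma holo_tz_integral:
  fixes K :: "'x \<Rightarrow> complex \<times> (complex^'n) \<Rightarrow> complex"
  assumes S: "open S"
    and hol: "\<And>x. x \<in> space M \<Longrightarrow> holo_tz S (K x)"
    and meas: "\<And>y. y \<in> S \<Longrightarrow> (\<lambda>x. K x y) \<in> borel_measurable M"
    and dom: "\<And>y. y \<in> S \<Longrightarrow> \<exists>U g. open U \<and> y \<in> U \<and> integrable M g \<and>
                 (\<forall>x\<in>space M. \<forall>y\<in>U \<inter> S. norm (K x y) \<le> g x)"
  shows "holo_tz S (\<lambda>y. LINT x|M. K x y)"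
proof -
  define sc :: "complex \<Rightarrow> complex \<times> (complex^'n) \<Rightarrow> complex \<times> (complex^'n)"
    where "sc c v = (c * fst v, c *s snd v)" for c v
  show ?thesis
    unfolding holo_tz_def
  proof
    fix y assume y: "y \<in> S"
    have "\<exists>L. linear L \<and> (\<forall>c v. L (sc c v) = c * L v) \<and>
      ((\<lambda>y. LINT x|M. K x y) has_derivative L) (at y)"
    proof (rule complex_linear_derivative_integral[where sc = sc and S = S and M = M and K = K and y = y])
      show "norm (sc c v) = norm c * norm v" for c v
        by (simp only: sc_def norm_cpair_scale prod.collapse)
      show "bounded_linear (\<lambda>c. sc c v)" for v
        unfolding sc_def by (intro bounded_linear_Pair cvec_scale_linear bounded_linear_mult_left)
      show "sc 1 v = v" for v by (simp add: sc_def)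
      fix x y assume x: "x \<in> space M" and "y \<in> S"
      from holo_tzD[OF hol[OF x] this(2)] obtain L where
        L: "linear L" "\<forall>c a b. L (c * a, c *s b) = c * L (a, b)" "(K x has_derivative L) (at y)" .
      have "\<forall>c v. L (sc c v) = c * L v"
        unfolding sc_def L(2)[rule_format] by simp
      with L show "\<exists>L. linear L \<and> (\<forall>c v. L (sc c v) = c * L v) \<and> (K x has_derivative L) (at y)"
        by (intro exI[of _ L] conjI)
    qed (rule S, erule meas, erule dom, rule y)
    then obtain L where L: "linear L" "\<forall>c v. L (sc c v) = c * L v"
      "((\<lambda>y. LINT x|M. K x y) has_derivative L) (at y)" by (elim exE conjE)
    have "L (c * a, c *s b) = c * L (a, b)" for c a b
      using spec[OF spec[OF L(2), of c], of "(a, b)"] unfolding sc_def by simp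
    with L show "\<exists>L. linear L \<and> (\<forall>c a b. L (c * a, c *s b) = c * L (a, b)) \<and>
      ((\<lambda>y. LINT x|M. K x y) has_derivative L) (at y)"
      by (intro exI[of _ L] conjI allI)
  qed
qed

lemma holomorphic_on_integral:
  fixes K :: "'x \<Rightarrow> complex \<Rightarrow> complex"
  assumes S: "open S"
    and hol: "\<And>x. x \<in> space M \<Longrightarrow> K x holomorphic_on S"
    and meas: "\<And>y. y \<in> S \<Longrightarrow> (\<lambda>x. K x y) \<in> borel_measurable M"
    and dom: "\<And>y. y \<in> S \<Longrightarrow> \<exists>U g. open U \<and> y \<in> U \<and> integrable M g \<and>
                 (\<forall>x\<in>space M. \<forall>y\<in>U \<inter> S. norm (K x y) \<le> g x)"
  shows "(\<lambda>y. LINT x|M. K x y) holomorphic_on S"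
  unfolding holomorphic_on_open[OF S]
proof
  fix y assume y: "y \<in> S"
  have "\<exists>L. linear L \<and> (\<forall>c v. L (c * v) = c * L v) \<and>
      ((\<lambda>y. LINT x|M. K x y) has_derivative L) (at y)"
  proof (rule complex_linear_derivative_integral[where sc = "(*)" and S = S and M = M and K = K and y = y])
    show "norm (c * v) = norm c * norm v" for c v :: complex by (rule norm_mult)
    show "bounded_linear (\<lambda>c. c * v)" for v :: complex by (rule bounded_linear_mult_left)
    show "1 * v = v" for v :: complex by simp
    show "\<exists>L. linear L \<and> (\<forall>c v. L (c * v) = c * L v) \<and> (K x has_derivative L) (at y)"
      if x: "x \<in> space M" and y: "y \<in> S" for x y
    proof -
      obtain D where "(K x has_field_derivative D) (at y)"
        using hol[OF x] y unfolding holomorphic_on_open[OF S] by blast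
      then show ?thesis unfolding has_field_derivative_def
        by (intro exI[of _ "(*) D"]) (auto intro: linear_times)
    qed
  qed (rule S, erule meas, erule dom, rule y)
  then obtain L where L: "\<forall>c v. L (c * v) = c * L v" "((\<lambda>y. LINT x|M. K x y) has_derivative L) (at y)" by (elim exE conjE)
  have "L c = L 1 * c" for c
    using spec[OF spec[OF L(1), of c], of 1] by (simp add: mult.commute)
  then have "L = (*) (L 1)" by (rule ext)
  with L(2) show "\<exists>D. ((\<lambda>y. LINT x|M. K x y) has_field_derivative D) (at y)"
    unfolding has_field_derivative_def by (intro exI[of _ "L 1"]) simp
qed

section \<open>Sectors and power series with parameters\<close>

lemma sector_mult:
  assumes t: "t \<in> sector d \<epsilon>'" and c: "c = of_real (norm c) * cis a" "\<bar>a\<bar> \<le> \<eta>" "c \<noteq> 0"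
    and e: "\<epsilon>' + 2 * \<eta> \<le> \<epsilon>"
  shows "c * t \<in> sector d \<epsilon>"
proof -
  obtain \<theta> where th: "\<bar>\<theta> - d\<bar> < \<epsilon>' / 2" "t = of_real (norm t) * cis \<theta>" "t \<noteq> 0"
    using t unfolding sector_def by auto
  have "c * t = (of_real (norm c) * cis a) * (of_real (norm t) * cis \<theta>)"
    using c(1) th(2) by argo
  also have "\<dots> = of_real (norm (c * t)) * cis (a + \<theta>)"
    by (simp add: norm_mult cis_mult[symmetric])
  finally have "c * t = of_real (norm (c * t)) * cis (a + \<theta>)" .
  moreover have "\<bar>a + \<theta> - d\<bar> < \<epsilon> / 2" using th(1) c(2) e by linarith
  ultimately show ?thesis using c(3) th(3) unfolding sector_def by auto
qed

text \<open>A point of the sector stays in a sector at the cost of \<eta> on each side, and a point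
  of the disc moves by at most the factor C. This is the geometric input for averages over
  dilations.\<close>

lemma disc_sector_mult:
  assumes t: "t \<in> disc_sector d \<epsilon>' r'" and c: "c = of_real (norm c) * cis a" "\<bar>a\<bar> \<le> \<eta>"
    and e: "\<epsilon>' + 2 * \<eta> \<le> \<epsilon>" and C: "norm c \<le> C" "0 < C" "C * r' \<le> r" "0 < r"
  shows "c * t \<in> disc_sector d \<epsilon> r"
proof (cases "c * t = 0")
  case True
  show ?thesis unfolding True using C by (simp add: disc_sector_def)
next
  case False
  show ?thesis
  proof (cases "t \<in> sector d \<epsilon>'")
    case True
    then show ?thesis using sector_mult[OF _ c _ e] False by (auto simp: disc_sector_def)
  next
    case no: False
    then have "norm t < r'" using t by (simp add: disc_sector_def)
    then have "norm (c * t) < C * r'" using False C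
      by (simp add: norm_mult mult_le_less_imp_less)
    then show ?thesis using C by (simp add: disc_sector_def)
  qed
qed

lemma open_sector: "open (sector d \<epsilon>)"
  unfolding open_contains_ball
proof
  fix z assume "z \<in> sector d \<epsilon>"
  then obtain \<theta> where th: "\<bar>\<theta> - d\<bar> < \<epsilon> / 2" "z = of_real (norm z) * cis \<theta>" and z: "z \<noteq> 0"
    unfolding sector_def by auto
  \<comment> \<open>The opening left over is 4 \<eta>. A nearby w is z multiplied by w / z, a number
    close to 1 whose argument stays below \<eta>, so \<open>sector_mult\<close> applies.\<close>
  define \<eta> where "\<eta> = (\<epsilon> / 2 - \<bar>\<theta> - d\<bar>) / 2"
  have \<eta>: "\<eta> > 0" using th(1) by (simp add: \<eta>_def)
  have "isCont Arg 1" by (rule continuous_at_Arg) simp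
  then have "\<exists>\<delta>>0. \<forall>w. dist w 1 < \<delta> \<longrightarrow> dist (Arg w) (Arg 1) < \<eta>"
    using \<eta> unfolding continuous_at_eps_delta by blast
  then obtain \<delta> where \<delta>: "\<delta> > 0" "\<And>w. dist w 1 < \<delta> \<Longrightarrow> \<bar>Arg w\<bar> < \<eta>"
    by (auto simp: dist_norm)
  show "\<exists>e>0. ball z e \<subseteq> sector d \<epsilon>"
  proof (intro exI conjI subsetI)
    show "min (\<delta> * norm z) (norm z) > 0" using \<delta>(1) z by simp
    fix w assume "w \<in> ball z (min (\<delta> * norm z) (norm z))"
    then have w: "norm (w - z) < \<delta> * norm z" "norm (w - z) < norm z" by (simp_all add: dist_norm norm_minus_commute)
    then have "w \<noteq> 0" by auto
    have "dist (w / z) 1 = norm (w - z) / norm z" using z by (simp add: dist_norm field_simps flip: norm_divide)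
    also have "\<dots> < \<delta>" using w z by (simp add: divide_less_eq)
    finally have "\<bar>Arg (w / z)\<bar> < \<eta>" by (rule \<delta>(2))
    moreover have "w / z = of_real (norm (w / z)) * cis (Arg (w / z))"
      using rcis_cmod_Arg[of "w / z"] by (simp add: rcis_def)
    moreover have "z \<in> sector d (2 * \<bar>\<theta> - d\<bar> + \<eta>)" using th(2) z \<eta> unfolding sector_def
      by (auto intro!: exI[of _ \<theta>])
    ultimately have "w / z * z \<in> sector d \<epsilon>"
      using \<open>w \<noteq> 0\<close> z by (intro sector_mult[where a = "Arg (w / z)" and \<eta> = \<eta>]) (auto simp: \<eta>_def field_simps)
    then show "w \<in> sector d \<epsilon>" using z by simp
  qed
qed

lemma open_disc_sector: "open (disc_sector d \<epsilon> r)"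
  unfolding disc_sector_def by (intro open_Un open_sector open_ball)

lemma sector_mono: "\<epsilon>' \<le> \<epsilon> \<Longrightarrow> sector d \<epsilon>' \<subseteq> sector d \<epsilon>"
  unfolding sector_def by force

lemma disc_sector_mono: "\<epsilon>' \<le> \<epsilon> \<Longrightarrow> r' \<le> r \<Longrightarrow> disc_sector d \<epsilon>' r' \<subseteq> disc_sector d \<epsilon> r"
  unfolding disc_sector_def using sector_mono[of \<epsilon>' \<epsilon> d] by auto

lemma open_cylinder: "open S \<Longrightarrow> open T \<Longrightarrow> open {(t, z). t \<in> S \<and> z \<in> T}"
  using open_Times[of S T] by simp

text \<open>The Weierstrass theorem, obtained as differentiation under the integral sign for the
  counting measure.\<close>

lemma holo_tz_suminf:
  fixes K :: "nat \<Rightarrow> complex \<times> (complex^'n) \<Rightarrow> complex"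
  assumes S: "open S"
    and hol: "\<And>j. holo_tz S (K j)"
    and dom: "\<And>y. y \<in> S \<Longrightarrow> \<exists>U g. open U \<and> y \<in> U \<and> summable g \<and>
                 (\<forall>j. \<forall>y\<in>U \<inter> S. norm (K j y) \<le> g j)"
  shows "holo_tz S (\<lambda>y. \<Sum>j. K j y)"
proof -
  have "holo_tz S (\<lambda>y. LINT j|count_space UNIV. K j y)"
  proof (rule holo_tz_integral[OF S])
    fix y assume y: "y \<in> S"
    obtain U g where U: "open U" "y \<in> U" "summable g" "\<forall>j. \<forall>y\<in>U \<inter> S. norm (K j y) \<le> g j"
      using dom[OF y] by (elim exE conjE)
    have "0 \<le> g j" for j using U(2,4) y by (meson IntI norm_ge_zero order_trans)
    then have "integrable (count_space UNIV) g"
      using U(3) by (simp add: integrable_count_space_nat_iff)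
    with U show "\<exists>U g. open U \<and> y \<in> U \<and> integrable (count_space UNIV) g \<and>
                 (\<forall>x\<in>space (count_space UNIV). \<forall>y\<in>U \<inter> S. norm (K x y) \<le> g x)"
      by (intro exI[of _ U] exI[of _ g] conjI) simp_all
  qed (use hol in simp_all)
  then show ?thesis
  proof (rule holo_tz_cong[OF _ S])
    fix y assume y: "y \<in> S"
    obtain U g where U: "y \<in> U" "summable g" "\<forall>j. \<forall>y\<in>U \<inter> S. norm (K j y) \<le> g j"
      using dom[OF y] by (elim exE conjE)
    have "summable (\<lambda>j. norm (K j y))"
      by (rule summable_comparison_test'[OF U(2), of 0]) (use U y in simp)
    then show "(LINT j|count_space UNIV. K j y) = (\<Sum>j. K j y)"
      by (intro integral_count_space_nat) (simp add: integrable_count_space_nat_iff)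
  qed
qed

lemma integral_cis_period:
  assumes "m \<noteq> 0"
  shows "(LINT \<theta>:{a..a + 2 * pi}|lborel. cis (of_int m * \<theta>)) = 0"
proof -
  have "((\<lambda>\<theta>. cis (of_int m * \<theta>)) has_integral
     cis (of_int m * (a + 2 * pi)) / (\<i> * of_int m) - cis (of_int m * a) / (\<i> * of_int m)) {a..a + 2 * pi}"
  proof (rule fundamental_theorem_of_calculus)
    fix x :: real
    have "((\<lambda>\<theta>. exp (\<i> * (of_int m * \<theta>)) / (\<i> * of_int m)) has_field_derivative
       exp (\<i> * (of_int m * of_real x))) (at (of_real x))"
    proof -
      have "((\<lambda>\<theta>. exp (\<i> * (of_int m * \<theta>)) / (\<i> * of_int m)) has_field_derivative
       exp (\<i> * (of_int m * of_real x)) * (\<i> * of_int m) / (\<i> * of_int m)) (at (of_real x))"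
        by (rule DERIV_cdivide) (auto intro!: derivative_eq_intros)
      then show ?thesis using assms by simp
    qed
    from has_vector_derivative_real_field[OF this]
    have "((\<lambda>\<theta>. exp (\<i> * (of_int m * of_real \<theta>)) / (\<i> * of_int m)) has_vector_derivative
       exp (\<i> * (of_int m * of_real x))) (at x within {a..a + 2 * pi})" .
    then show "((\<lambda>\<theta>. cis (of_int m * \<theta>) / (\<i> * of_int m)) has_vector_derivative cis (of_int m * x)) (at x within {a..a + 2 * pi})"
      by (simp add: cis_conv_exp)
  qed simp
  moreover have "cis (of_int m * (a + 2 * pi)) = cis (of_int m * a)"
  proof -
    have "cis (of_int m * (a + 2 * pi)) = cis (of_int m * a) * cis (2 * pi * of_int m)"
      by (simp add: cis_mult algebra_simps)
    then show ?thesis by (simp add: cis_multiple_2pi)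
  qed
  ultimately have "((\<lambda>\<theta>. cis (of_int m * \<theta>)) has_integral 0) {a..a + 2 * pi}" by simp
  then have "integral {a..a + 2 * pi} (\<lambda>\<theta>. cis (of_int m * \<theta>)) = 0" by (rule integral_unique)
  moreover have "set_integrable lborel {a..a + 2 * pi} (\<lambda>\<theta>. cis (of_int m * \<theta>))"
    by (rule borel_integrable_atLeastAtMost') (intro continuous_intros)
  ultimately show ?thesis by (simp add: set_borel_integral_eq_integral(2))
qed

text \<open>The sign \<sigma> covers both uses: power series on circles (\<sigma> = 1) and series in
  exp (- \<zeta>) on vertical segments (\<sigma> = -1). Absolute summability allows termwise
  integration, and every term but the n-th integrates to zero over a period.\<close>

lemma fourier_coefficient:
  fixes c :: "nat \<Rightarrow> complex" and \<sigma> :: int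
  assumes \<sigma>: "\<sigma> \<noteq> 0" and c: "summable (\<lambda>j. norm (c j))"
    and F: "\<And>\<theta>. (\<lambda>j. c j * cis (of_int \<sigma> * real j * \<theta>)) sums F \<theta>"
  shows "(LINT \<theta>:{a..a + 2 * pi}|lborel. F \<theta> * cis (- (of_int \<sigma> * real n * \<theta>))) = 2 * pi * c n"
proof -
  define f where "f j \<theta> = indicator {a..a + 2 * pi} \<theta> *\<^sub>R (c j * cis (of_int (\<sigma> * (int j - int n)) * \<theta>))" for j \<theta>
  have cis_eq: "cis (of_int \<sigma> * real j * \<theta>) * cis (- (of_int \<sigma> * real n * \<theta>)) = cis (of_int (\<sigma> * (int j - int n)) * \<theta>)" for j \<theta>
    by (simp add: cis_mult algebra_simps)
  have int: "set_integrable lborel {a..a + 2 * pi} (\<lambda>\<theta>. c j * cis (of_int (\<sigma> * (int j - int n)) * \<theta>))" for j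
    by (rule borel_integrable_atLeastAtMost') (intro continuous_intros)
  have int': "integrable lborel (f j)" for j
    using int[of j] unfolding set_integrable_def f_def .
  have "(\<lambda>j. integral\<^sup>L lborel (f j)) sums (LINT \<theta>|lborel. (\<Sum>j. f j \<theta>))"
  proof (rule sums_integral)
    show "AE \<theta> in lborel. summable (\<lambda>j. norm (f j \<theta>))"
      by (rule AE_I2, rule summable_comparison_test'[OF c, of 0]) (simp add: f_def norm_mult indicator_def)
    have "norm (LINT \<theta>|lborel. norm (f j \<theta>)) \<le> 2 * pi * norm (c j)" for j
    proof -
      have "(LINT \<theta>|lborel. norm (f j \<theta>)) = (LINT \<theta>|lborel. norm (c j) * indicator {a..a + 2 * pi} \<theta>)"
        by (rule Bochner_Integration.integral_cong) (simp_all add: f_def norm_mult)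
      then show ?thesis by simp
    qed
    then show "summable (\<lambda>j. LINT \<theta>|lborel. norm (f j \<theta>))"
      by (intro summable_comparison_test'[OF summable_mult[OF c, of "2 * pi"], of 0]) simp
  qed (rule int')
  moreover have "(\<Sum>j. f j \<theta>) = indicator {a..a + 2 * pi} \<theta> *\<^sub>R (F \<theta> * cis (- (of_int \<sigma> * real n * \<theta>)))" for \<theta>
  proof (rule sums_unique[symmetric])
    have "(\<lambda>j. indicator {a..a + 2 * pi} \<theta> *\<^sub>R (c j * cis (of_int \<sigma> * real j * \<theta>) * cis (- (of_int \<sigma> * real n * \<theta>))))
      sums (indicator {a..a + 2 * pi} \<theta> *\<^sub>R (F \<theta> * cis (- (of_int \<sigma> * real n * \<theta>))))"
      by (intro sums_scaleR_right sums_mult2 F)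
    then show "(\<lambda>j. f j \<theta>) sums (indicator {a..a + 2 * pi} \<theta> *\<^sub>R (F \<theta> * cis (- (of_int \<sigma> * real n * \<theta>))))"
      unfolding f_def cis_eq[symmetric] by (simp only: mult.assoc)
  qed
  moreover have "integral\<^sup>L lborel (f j) = (if j = n then 2 * pi * c n else 0)" for j
  proof (cases "j = n")
    case True
    then have "f j = (\<lambda>\<theta>. indicator {a..a + 2 * pi} \<theta> *\<^sub>R c n)" by (simp add: f_def fun_eq_iff)
    then show ?thesis using True by (simp add: scaleR_conv_of_real)
  next
    case False
    have "integral\<^sup>L lborel (f j) = (LINT \<theta>|lborel. c j * (indicator {a..a + 2 * pi} \<theta> *\<^sub>R cis (of_int (\<sigma> * (int j - int n)) * \<theta>)))"
      unfolding f_def by (simp only: mult_scaleR_right)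
    also have "\<dots> = c j * (LINT \<theta>:{a..a + 2 * pi}|lborel. cis (of_int (\<sigma> * (int j - int n)) * \<theta>))"
      unfolding set_lebesgue_integral_def by (rule integral_mult_right_zero)
    also have "\<dots> = 0" using \<sigma> False by (subst integral_cis_period) auto
    finally show ?thesis using False by simp
  qed
  ultimately have "(\<lambda>j. if j = n then 2 * pi * c n else 0) sums
      (LINT \<theta>:{a..a + 2 * pi}|lborel. F \<theta> * cis (- (of_int \<sigma> * real n * \<theta>)))"
    unfolding set_lebesgue_integral_def by simp
  moreover have "(\<lambda>j. if j = n then 2 * pi * c n else 0) sums (2 * pi * c n)"
    using sums_single[of n "\<lambda>_. 2 * pi * c n"] by simp
  ultimately show ?thesis by (rule sums_unique2)
qed


lemma power_series_coefficient_integral: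
  assumes F: "\<And>t. norm t < r \<Longrightarrow> (\<lambda>j. b j * t ^ j) sums F t" and \<rho>: "0 < \<rho>" "\<rho> < r"
  shows "b n = (LINT \<theta>|lborel. indicator {0..2 * pi} \<theta> *\<^sub>R (F (of_real \<rho> * cis \<theta>) * cis (- (real n * \<theta>)))) / (2 * pi * \<rho> ^ n)"
    and "summable (\<lambda>j. norm (b j) * \<rho> ^ j)"
proof -
  have "summable (\<lambda>j. norm (b j * of_real \<rho> ^ j))"
  proof (rule powser_insidea)
    show "summable (\<lambda>j. b j * of_real ((\<rho> + r) / 2) ^ j)"
      using F[of "of_real ((\<rho> + r) / 2)"] \<rho> by (simp add: sums_iff norm_divide flip: of_real_add)
  qed (use \<rho> in \<open>simp add: norm_divide flip: of_real_add\<close>)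
  then show s: "summable (\<lambda>j. norm (b j) * \<rho> ^ j)"
    using \<rho> by (simp add: norm_mult norm_power)
  have eq: "b j * of_real \<rho> ^ j * cis (of_int 1 * real j * \<theta>) = b j * (of_real \<rho> * cis \<theta>) ^ j" for j \<theta>
    by (simp add: power_mult_distrib Complex.DeMoivre)
  have "(\<lambda>j. b j * of_real \<rho> ^ j * cis (of_int 1 * real j * \<theta>)) sums F (of_real \<rho> * cis \<theta>)" for \<theta>
    unfolding eq by (rule F) (use \<rho> in \<open>simp add: norm_mult\<close>)
  from fourier_coefficient[OF _ _ this, of 0 n]
  have "(LINT \<theta>:{0..0 + 2 * pi}|lborel. F (of_real \<rho> * cis \<theta>) * cis (- (of_int 1 * real n * \<theta>))) = 2 * pi * (b n * of_real \<rho> ^ n)"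
    using s \<rho> by (simp add: norm_mult norm_power)
  then show "b n = (LINT \<theta>|lborel. indicator {0..2 * pi} \<theta> *\<^sub>R (F (of_real \<rho> * cis \<theta>) * cis (- (real n * \<theta>)))) / (2 * pi * \<rho> ^ n)"
    using \<rho> unfolding set_lebesgue_integral_def by (simp add: field_simps)
qed

text \<open>A coefficient is an average of F over a circle in t, hence inherits holomorphy in z by
  differentiation under the integral. The variable t in the conclusion is a dummy, which keeps
  functions of z alone inside the calculus of \<open>holo_tz\<close>.\<close>

lemma holo_tz_coefficient:
  fixes F :: "complex \<Rightarrow> complex^'n \<Rightarrow> complex"
  assumes hol: "holo_tz {(t, z). t \<in> ball 0 r \<and> z \<in> ball 0 r} (\<lambda>(t, z). F t z)"
    and F: "\<And>t z. norm t < r \<Longrightarrow> norm z < r \<Longrightarrow> (\<lambda>j. u j z * t ^ j) sums F t z"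
    and \<rho>: "0 < \<rho>" "\<rho> < r"
    and M: "\<And>t z. norm t < r \<Longrightarrow> norm z < r \<Longrightarrow> norm (F t z) \<le> M"
  shows "holo_tz {(t, z). z \<in> ball 0 r} (\<lambda>(t, z). u n z)"
    and "norm z < r \<Longrightarrow> norm (u n z) \<le> M / \<rho> ^ n"
proof -
  define K :: "real \<Rightarrow> complex \<times> (complex^'n) \<Rightarrow> complex" where
    "K \<theta> = (\<lambda>(t, z). (indicator {0..2 * pi} \<theta> * cis (- (real n * \<theta>)) / (2 * pi * \<rho> ^ n)) * F (of_real \<rho> * cis \<theta>) z)" for \<theta>
  have circ: "norm (of_real \<rho> * cis \<theta>) < r" for \<theta> using \<rho> by (simp add: norm_mult)
  have u_eq: "u n z = (LINT \<theta>|lborel. K \<theta> (t, z))" if z: "norm z < r" for t z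
  proof -
    have "u n z = (LINT \<theta>|lborel. indicator {0..2 * pi} \<theta> *\<^sub>R (F (of_real \<rho> * cis \<theta>) z * cis (- (real n * \<theta>)))) / (2 * pi * \<rho> ^ n)"
      by (rule power_series_coefficient_integral(1)[where F = "\<lambda>t. F t z" and b = "\<lambda>j. u j z", OF F[OF _ z] \<rho>])
    also have "\<dots> = (LINT \<theta>|lborel. indicator {0..2 * pi} \<theta> *\<^sub>R (F (of_real \<rho> * cis \<theta>) z * cis (- (real n * \<theta>))) / (2 * pi * \<rho> ^ n))"
      by (rule integral_divide_zero[symmetric])
    also have "\<dots> = (LINT \<theta>|lborel. K \<theta> (t, z))"
      by (rule Bochner_Integration.integral_cong) (simp_all add: K_def indicator_def)
    finally show ?thesis .
  qed
  have K_bnd: "norm (K \<theta> (t, z)) \<le> indicator {0..2 * pi} \<theta> * (M / (2 * pi * \<rho> ^ n))" if "norm z < r" for \<theta> t z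
    using M[OF circ that, of \<theta>] \<rho> by (simp add: K_def norm_mult norm_divide norm_power indicator_def divide_right_mono)
  have int: "integrable lborel (\<lambda>\<theta>. indicator {0..2 * pi} \<theta> * (M / (2 * pi * \<rho> ^ n)) :: real)"
    by (rule integrable_mult_left) simp
  have S: "open {(t :: complex, z :: complex^'n). z \<in> ball 0 r}"
    using open_cylinder[OF open_UNIV open_ball, of 0 r] by (simp only: UNIV_I simp_thms)
  have hz: "holo_tz {(t, z). z \<in> ball 0 r} (\<lambda>(t :: complex, z). F (of_real \<rho> * cis \<theta>) z)" for \<theta>
    using holo_tz_fix_fst[OF hol, of "{(t, z). z \<in> ball 0 r}" "of_real \<rho> * cis \<theta>"] circ[of \<theta>] by simp
  have cont: "continuous_on UNIV (\<lambda>\<theta>. F (of_real \<rho> * cis \<theta>) z)" if z: "norm z < r" for z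
  proof -
    have "(\<lambda>t. F t z) holomorphic_on ball 0 r"
      using holo_tz_section[OF hol, of "ball 0 r" z] z by simp
    then have "continuous_on (ball 0 r) (\<lambda>t. F t z)" by (rule holomorphic_on_imp_continuous_on)
    then show ?thesis
      by (rule continuous_on_compose2) (use circ in \<open>auto intro!: continuous_intros\<close>)
  qed
  have "holo_tz {(t, z). z \<in> ball 0 r} (\<lambda>y :: complex \<times> (complex^'n). LINT \<theta>|lborel. K \<theta> y)"
  proof (rule holo_tz_integral[OF S])
    fix \<theta> :: real
    have "K \<theta> = (\<lambda>y. (indicator {0..2 * pi} \<theta> * cis (- (real n * \<theta>)) / (2 * pi * \<rho> ^ n)) * (case y of (t, z) \<Rightarrow> F (of_real \<rho> * cis \<theta>) z))"
      unfolding K_def by (simp add: case_prod_unfold)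
    then show "holo_tz {(t, z). z \<in> ball 0 r} (K \<theta>)"
      by (simp only: holo_tz_mult[OF holo_tz_const hz])
  next
    fix y :: "complex \<times> (complex^'n)" assume "y \<in> {(t, z). z \<in> ball 0 r}"
    then obtain t z where y: "y = (t, z)" "norm z < r" by auto
    have [measurable]: "(\<lambda>\<theta>. F (of_real \<rho> * cis \<theta>) z) \<in> borel_measurable borel"
      by (rule borel_measurable_continuous_onI[OF cont[OF y(2)]])
    have [measurable]: "(\<lambda>\<theta>. cis (- (real n * \<theta>))) \<in> borel_measurable borel"
      by (intro borel_measurable_continuous_onI continuous_intros)
    show "(\<lambda>\<theta>. K \<theta> y) \<in> borel_measurable lborel"
      unfolding y K_def by simp
    show "\<exists>U g. open U \<and> y \<in> U \<and> integrable lborel g \<and>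
        (\<forall>\<theta>\<in>space lborel. \<forall>y\<in>U \<inter> {(t, z). z \<in> ball 0 r}. norm (K \<theta> y) \<le> g \<theta>)"
      using int K_bnd by (intro exI[of _ UNIV] exI[of _ "\<lambda>\<theta>. indicator {0..2 * pi} \<theta> * (M / (2 * pi * \<rho> ^ n))"] conjI) auto
  qed
  then show "holo_tz {(t, z). z \<in> ball 0 r} (\<lambda>(t, z). u n z)"
    by (rule holo_tz_cong[OF _ S]) (use u_eq in auto)
  show "norm (u n z) \<le> M / \<rho> ^ n" if z: "norm z < r"
  proof -
    have "norm (LINT \<theta>|lborel. K \<theta> (0, z)) \<le> (LINT \<theta>|lborel. indicator {0..2 * pi} \<theta> * (M / (2 * pi * \<rho> ^ n)))"
      using Bochner_Integration.integral_norm_bound_integral[OF _ int K_bnd[OF z]] order_trans[OF norm_ge_zero M[of 0 z]] z \<rho>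
      by (cases "integrable lborel (\<lambda>\<theta>. K \<theta> (0, z))") (auto simp: not_integrable_integral_eq)
    also have "\<dots> = M / \<rho> ^ n" by simp
    finally show ?thesis using u_eq[OF z] by simp
  qed
qed

section \<open>Multipliers preserving summability\<close>

text \<open>One radius serves the disc, the ball in z and the convergence of the series, and one
  pair A, B serves the whole domain; combining two such functions then only shrinks r. The opening
  is an explicit parameter because averaging over dilations consumes part of it.\<close>

definition sector_summable :: "real \<Rightarrow> real \<Rightarrow> real \<Rightarrow> (nat \<Rightarrow> complex^'n \<Rightarrow> complex) \<Rightarrow> bool" where
  "sector_summable k d \<epsilon> u \<longleftrightarrow> (\<exists>r F A B. 0 < r \<and> 0 \<le> A \<and> 0 \<le> B \<and>
     holo_tz {(t, z). t \<in> disc_sector d \<epsilon> r \<and> z \<in> ball 0 r} (\<lambda>(t, z). F t z) \<and>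
     (\<forall>t z. t \<in> disc_sector d \<epsilon> r \<longrightarrow> norm z < r \<longrightarrow> norm (F t z) \<le> A * exp (B * norm t powr k)) \<and>
     (\<forall>t z. norm t < r \<longrightarrow> norm z < r \<longrightarrow> (\<lambda>j. u j z * t ^ j) sums F t z))"

lemma sector_summableI:
  fixes u :: "nat \<Rightarrow> complex^'n \<Rightarrow> complex"
  assumes "0 < r" "0 \<le> A" "0 \<le> B"
     "holo_tz {(t, z). t \<in> disc_sector d \<epsilon> r \<and> z \<in> ball 0 r} (\<lambda>(t, z). F t z)"
     "\<And>t z. t \<in> disc_sector d \<epsilon> r \<Longrightarrow> norm z < r \<Longrightarrow> norm (F t z) \<le> A * exp (B * norm t powr k)"
     "\<And>t z. norm t < r \<Longrightarrow> norm z < r \<Longrightarrow> (\<lambda>j. u j z * t ^ j) sums F t z"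
  shows "sector_summable k d \<epsilon> u"
  unfolding sector_summable_def
  by (rule exI[of _ r], rule exI[of _ F], rule exI[of _ A], rule exI[of _ B]) (use assms in auto)

lemma powr_exp_mono:
  assumes "0 \<le> B" "B \<le> B'" "0 \<le> x" "x \<le> y" "0 \<le> k" "0 \<le> A" "A \<le> (A' :: real)"
  shows "A * exp (B * x powr k) \<le> A' * exp (B' * y powr k)"
  using assms by (intro mult_mono) (auto intro!: mult_mono powr_mono2)

lemma sector_summable_add:
  fixes u v :: "nat \<Rightarrow> complex^'n \<Rightarrow> complex"
  assumes k: "0 \<le> k" and u: "sector_summable k d \<epsilon> u" and v: "sector_summable k d \<epsilon> v"
  shows "sector_summable k d \<epsilon> (\<lambda>j z. u j z + v j z)"
proof -
  obtain r F A B where 1: "0 < r" "0 \<le> A" "0 \<le> B"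
     "holo_tz {(t, z). t \<in> disc_sector d \<epsilon> r \<and> z \<in> ball 0 r} (\<lambda>(t, z). F t z)"
     "\<forall>t z. t \<in> disc_sector d \<epsilon> r \<longrightarrow> norm z < r \<longrightarrow> norm (F t z) \<le> A * exp (B * norm t powr k)"
     "\<forall>t z. norm t < r \<longrightarrow> norm z < r \<longrightarrow> (\<lambda>j. u j z * t ^ j) sums F t z"
    using u unfolding sector_summable_def by (elim exE conjE)
  note 1 = 1(1-4) 1(5,6)[rule_format]
  obtain r' F' A' B' where 2: "0 < r'" "0 \<le> A'" "0 \<le> B'"
     "holo_tz {(t, z). t \<in> disc_sector d \<epsilon> r' \<and> z \<in> ball 0 r'} (\<lambda>(t, z). F' t z)"
     "\<forall>t z. t \<in> disc_sector d \<epsilon> r' \<longrightarrow> norm z < r' \<longrightarrow> norm (F' t z) \<le> A' * exp (B' * norm t powr k)"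
     "\<forall>t z. norm t < r' \<longrightarrow> norm z < r' \<longrightarrow> (\<lambda>j. v j z * t ^ j) sums F' t z"
    using v unfolding sector_summable_def by (elim exE conjE)
  note 2 = 2(1-4) 2(5,6)[rule_format]
  define R where "R = min r r'"
  have sub: "disc_sector d \<epsilon> R \<subseteq> disc_sector d \<epsilon> r" "disc_sector d \<epsilon> R \<subseteq> disc_sector d \<epsilon> r'"
    using disc_sector_mono[of \<epsilon> \<epsilon> R r d] disc_sector_mono[of \<epsilon> \<epsilon> R r' d] by (simp_all add: R_def)
  show ?thesis
  proof (rule sector_summableI[where r = R and A = "A + A'" and B = "max B B'" and F = "\<lambda>t z. F t z + F' t z"])
    have "holo_tz {(t, z). t \<in> disc_sector d \<epsilon> R \<and> z \<in> ball 0 R} (\<lambda>(t, z). F t z)"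
      by (rule holo_tz_subset[OF 1(4)]) (use sub in \<open>auto simp: R_def\<close>)
    moreover have "holo_tz {(t, z). t \<in> disc_sector d \<epsilon> R \<and> z \<in> ball 0 R} (\<lambda>(t, z). F' t z)"
      by (rule holo_tz_subset[OF 2(4)]) (use sub in \<open>auto simp: R_def\<close>)
    ultimately show "holo_tz {(t, z). t \<in> disc_sector d \<epsilon> R \<and> z \<in> ball 0 R} (\<lambda>(t, z). F t z + F' t z)"
      using holo_tz_add by (fastforce simp: case_prod_unfold)
    show "norm (F t z + F' t z) \<le> (A + A') * exp (max B B' * norm t powr k)"
      if "t \<in> disc_sector d \<epsilon> R" "norm z < R" for t z
    proof -
      have "norm (F t z) \<le> A * exp (max B B' * norm t powr k)"
        using 1(5)[of t z] that sub powr_exp_mono[of B "max B B'" "norm t" "norm t" k A A] k 1(2,3)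
        by (auto simp: R_def)
      moreover have "norm (F' t z) \<le> A' * exp (max B B' * norm t powr k)"
        using 2(5)[of t z] that sub powr_exp_mono[of B' "max B B'" "norm t" "norm t" k A' A'] k 2(2,3)
        by (auto simp: R_def)
      ultimately show ?thesis by (intro norm_triangle_le) (simp add: distrib_right)
    qed
    show "(\<lambda>j. (u j z + v j z) * t ^ j) sums (F t z + F' t z)" if "norm t < R" "norm z < R" for t z
      using sums_add[OF 1(6)[of t z] 2(6)[of t z]] that by (simp add: distrib_right R_def)
  qed (use 1 2 in \<open>auto simp: R_def\<close>)
qed

lemma sector_summable_mono:
  fixes u :: "nat \<Rightarrow> complex^'n \<Rightarrow> complex"
  assumes u: "sector_summable k d \<epsilon> u" and "\<epsilon>' \<le> \<epsilon>"
  shows "sector_summable k d \<epsilon>' u"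
proof -
  obtain r F A B where 1: "0 < r" "0 \<le> A" "0 \<le> B"
     "holo_tz {(t, z). t \<in> disc_sector d \<epsilon> r \<and> z \<in> ball 0 r} (\<lambda>(t, z). F t z)"
     "\<forall>t z. t \<in> disc_sector d \<epsilon> r \<longrightarrow> norm z < r \<longrightarrow> norm (F t z) \<le> A * exp (B * norm t powr k)"
     "\<forall>t z. norm t < r \<longrightarrow> norm z < r \<longrightarrow> (\<lambda>j. u j z * t ^ j) sums F t z"
    using u unfolding sector_summable_def by (elim exE conjE)
  note 1 = 1(1-4) 1(5,6)[rule_format]
  have sub: "disc_sector d \<epsilon>' r \<subseteq> disc_sector d \<epsilon> r" using assms(2) by (simp add: disc_sector_mono)
  show ?thesis
    by (rule sector_summableI[OF 1(1-3)])
      (use holo_tz_subset[OF 1(4), of "{(t, z). t \<in> disc_sector d \<epsilon>' r \<and> z \<in> ball 0 r}"] sub 1(5,6) in auto)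
qed

text \<open>Removing the terms of index below \<open>J\<close> makes the sum vanish to order \<open>J\<close> at the origin,
  so that it can be integrated against weights singular there.\<close>

lemma sector_summable_drop:
  fixes u :: "nat \<Rightarrow> complex^'n \<Rightarrow> complex"
  assumes k: "0 \<le> k" and u: "sector_summable k d \<epsilon> u"
  obtains r A B F where "0 < r" "0 \<le> A" "0 \<le> B"
     "holo_tz {(t, z). t \<in> disc_sector d \<epsilon> r \<and> z \<in> ball 0 r} (\<lambda>(t, z). F t z)"
     "\<And>t z. t \<in> disc_sector d \<epsilon> r \<Longrightarrow> norm z < r \<Longrightarrow> norm (F t z) \<le> A * norm t ^ J * exp (B * norm t powr k)"
     "\<And>t z. norm t < r \<Longrightarrow> norm z < r \<Longrightarrow> (\<lambda>j. (if j < J then 0 else u j z) * t ^ j) sums F t z"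
     "\<And>j. holo_tz {(t, z). z \<in> ball 0 r} (\<lambda>(t, z). u j z)"
     "\<And>j z. norm z < r \<Longrightarrow> norm (u j z) \<le> A / r ^ j"
proof -
  obtain r F A B where 1: "0 < r" "0 \<le> A" "0 \<le> B"
     "holo_tz {(t, z). t \<in> disc_sector d \<epsilon> r \<and> z \<in> ball 0 r} (\<lambda>(t, z). F t z)"
     "\<forall>t z. t \<in> disc_sector d \<epsilon> r \<longrightarrow> norm z < r \<longrightarrow> norm (F t z) \<le> A * exp (B * norm t powr k)"
     "\<forall>t z. norm t < r \<longrightarrow> norm z < r \<longrightarrow> (\<lambda>j. u j z * t ^ j) sums F t z"
    using u unfolding sector_summable_def by (elim exE conjE)
  note 1 = 1(1-4) 1(5,6)[rule_format]
  define \<rho> where "\<rho> = r / 2"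
  have \<rho>: "0 < \<rho>" "\<rho> < r" using 1(1) by (auto simp: \<rho>_def)
  define M where "M = A * exp (B * r powr k)"
  have M0: "0 \<le> M" using 1(2) by (simp add: M_def)
  have disc: "t \<in> disc_sector d \<epsilon> r" if "norm t < r" for t using that by (simp add: disc_sector_def)
  have FM: "norm (F t z) \<le> M" if "norm t < r" "norm z < r" for t z
  proof -
    have "norm (F t z) \<le> A * exp (B * norm t powr k)" by (rule 1(5)[OF disc[OF that(1)] that(2)])
    also have "\<dots> \<le> M" unfolding M_def using that k 1 by (intro powr_exp_mono) auto
    finally show ?thesis .
  qed
  have hol_disc: "holo_tz {(t, z). t \<in> ball 0 r \<and> z \<in> ball 0 r} (\<lambda>(t, z). F t z)"
    by (rule holo_tz_subset[OF 1(4)]) (use disc in auto)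
  have u_hol: "holo_tz {(t, z). z \<in> ball 0 r} (\<lambda>(t, z). u j z)" for j
    by (rule holo_tz_coefficient(1)[OF hol_disc 1(6) \<rho> FM])
  have u_bnd: "norm (u j z) \<le> M / \<rho> ^ j" if "norm z < r" for j z
    by (rule holo_tz_coefficient(2)[OF hol_disc 1(6) \<rho> FM that])
  define F' where "F' t z = F t z - (\<Sum>j<J. u j z * t ^ j)" for t z
  have F'_sums: "(\<lambda>j. (if j < J then 0 else u j z) * t ^ j) sums F' t z" if "norm t < r" "norm z < r" for t z
  proof -
    have "(\<lambda>j. if j < J then u j z * t ^ j else 0) sums (\<Sum>j<J. u j z * t ^ j)"
      using sums_If_finite_set[of "{..<J}" "\<lambda>j. u j z * t ^ j"] by simp
    from sums_diff[OF 1(6)[OF that] this] show ?thesis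
      unfolding F'_def by (rule sums_cong[THEN iffD1, rotated]) simp
  qed
  \<comment> \<open>Near the origin the tail starting at index J is compared with a geometric series
    of ratio at most 1/2, which leaves the factor q^J.\<close>
  have near: "norm (F' t z) \<le> 2 * M / \<rho> ^ J * norm t ^ J" if t: "norm t \<le> \<rho> / 2" and z: "norm z < r" for t z
  proof -
    define q where "q = norm t / \<rho>"
    have q: "0 \<le> q" "q \<le> 1/2" using t \<rho> by (auto simp: q_def field_simps)
    have sh: "(\<lambda>j. u (j + J) z * t ^ (j + J)) sums F' t z"
      using sums_split_initial_segment[OF F'_sums[of t z], of J] t z \<rho> by simp
    have b: "norm (u (j + J) z * t ^ (j + J)) \<le> M * q ^ J * q ^ j" for j
      using mult_right_mono[OF u_bnd[OF z, of "j + J"], of "norm t ^ (j + J)"]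
      by (simp add: norm_mult norm_power q_def power_add power_divide ac_simps)
    have geo: "(\<lambda>j. M * q ^ J * q ^ j) sums (M * q ^ J * (1 / (1 - q)))"
      using q by (intro sums_mult geometric_sums) auto
    have "norm (F' t z) \<le> M * q ^ J * (1 / (1 - q))"
      using suminf_le[of "\<lambda>j. norm (u (j + J) z * t ^ (j + J))" "\<lambda>j. M * q ^ J * q ^ j"]
        summable_norm[of "\<lambda>j. u (j + J) z * t ^ (j + J)"]
        summable_comparison_test'[of "\<lambda>j. M * q ^ J * q ^ j" 0 "\<lambda>j. norm (u (j + J) z * t ^ (j + J))"] b geo sh
      by (simp add: sums_iff)
    also have "\<dots> \<le> M * q ^ J * 2"
      using q M0 by (intro mult_left_mono) (auto simp: field_simps)
    finally show ?thesis by (simp add: q_def power_divide ac_simps)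
  qed
  \<comment> \<open>Away from the origin, 2 |t| / \<rho> is at least 1, so every lower power |t|^j
    is at most (2 / \<rho>)^(J - j) |t|^J. D collects these factors for F and for the removed
    polynomial.\<close>
  define D where "D = (2 / \<rho>) ^ J * A + (\<Sum>j<J. M / \<rho> ^ j * (2 / \<rho>) ^ (J - j))"
  have D0: "0 \<le> D" unfolding D_def using 1 M0 \<rho> by (intro add_nonneg_nonneg sum_nonneg) auto
  have far: "norm (F' t z) \<le> D * norm t ^ J * exp (B * norm t powr k)"
    if t: "t \<in> disc_sector d \<epsilon> r" "norm t \<ge> \<rho> / 2" and z: "norm z < r" for t z
  proof -
    have pw: "norm t ^ j \<le> (2 / \<rho>) ^ (J - j) * norm t ^ J" if "j \<le> J" for j
    proof -
      have "1 \<le> (2 / \<rho> * norm t) ^ (J - j)"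
        using t(2) \<rho> by (intro one_le_power) (simp add: field_simps)
      then have "norm t ^ j * 1 \<le> norm t ^ j * (2 / \<rho> * norm t) ^ (J - j)"
        by (rule mult_left_mono) simp
      also have "\<dots> = (2 / \<rho>) ^ (J - j) * (norm t ^ j * norm t ^ (J - j))"
        by (simp only: power_mult_distrib ac_simps)
      also have "norm t ^ j * norm t ^ (J - j) = norm t ^ J" using that by (simp flip: power_add)
      finally show ?thesis by simp
    qed
    have e1: "1 \<le> exp (B * norm t powr k)" using 1(3) by simp
    have "norm (F t z) \<le> 1 * (A * exp (B * norm t powr k))" using 1(5)[OF t(1) z] by simp
    also have "\<dots> \<le> ((2 / \<rho>) ^ J * norm t ^ J) * (A * exp (B * norm t powr k))"
      using pw[of 0] 1(2) by (intro mult_right_mono) auto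
    finally have a: "norm (F t z) \<le> (2 / \<rho>) ^ J * A * norm t ^ J * exp (B * norm t powr k)"
      by (simp only: ac_simps)
    have "norm (\<Sum>j<J. u j z * t ^ j) \<le> (\<Sum>j<J. M / \<rho> ^ j * (2 / \<rho>) ^ (J - j) * norm t ^ J)"
    proof (rule sum_norm_le)
      fix j assume "j \<in> {..<J}"
      have "norm (u j z * t ^ j) \<le> M / \<rho> ^ j * ((2 / \<rho>) ^ (J - j) * norm t ^ J)"
        unfolding norm_mult norm_power using u_bnd[OF z, of j] pw[of j] \<open>j \<in> {..<J}\<close> M0 \<rho>
        by (intro mult_mono) auto
      then show "norm (u j z * t ^ j) \<le> M / \<rho> ^ j * (2 / \<rho>) ^ (J - j) * norm t ^ J" by (simp only: mult.assoc)
    qed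
    also have "\<dots> = (\<Sum>j<J. M / \<rho> ^ j * (2 / \<rho>) ^ (J - j)) * norm t ^ J * 1"
      by (simp add: sum_distrib_right)
    also have "\<dots> \<le> (\<Sum>j<J. M / \<rho> ^ j * (2 / \<rho>) ^ (J - j)) * norm t ^ J * exp (B * norm t powr k)"
      using e1 M0 \<rho> by (intro mult_left_mono mult_nonneg_nonneg sum_nonneg) auto
    finally have b: "norm (\<Sum>j<J. u j z * t ^ j) \<le> (\<Sum>j<J. M / \<rho> ^ j * (2 / \<rho>) ^ (J - j)) * norm t ^ J * exp (B * norm t powr k)" .
    show ?thesis unfolding F'_def D_def using norm_triangle_ineq4[of "F t z" "\<Sum>j<J. u j z * t ^ j"] a b
      by (simp add: distrib_right)
  qed
  define A' where "A' = D + 2 * M / \<rho> ^ J + M"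
  have bnd: "norm (F' t z) \<le> A' * norm t ^ J * exp (B * norm t powr k)"
    if t: "t \<in> disc_sector d \<epsilon> r" and z: "norm z < r" for t z
  proof (cases "norm t \<le> \<rho> / 2")
    case True
    have "norm (F' t z) \<le> 2 * M / \<rho> ^ J * norm t ^ J * 1" using near[OF True z] by simp
    also have "\<dots> \<le> A' * norm t ^ J * exp (B * norm t powr k)"
      using 1(3) D0 M0 \<rho> by (intro mult_mono) (auto simp: A'_def)
    finally show ?thesis .
  next
    case False
    then have "norm (F' t z) \<le> D * norm t ^ J * exp (B * norm t powr k)" using far t z by simp
    also have "\<dots> \<le> A' * norm t ^ J * exp (B * norm t powr k)"
      using M0 \<rho> by (intro mult_right_mono) (auto simp: A'_def)
    finally show ?thesis .
  qed
  have F'_hol: "holo_tz {(t, z). t \<in> disc_sector d \<epsilon> r \<and> z \<in> ball 0 r} (\<lambda>(t, z). F' t z)"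
  proof -
    let ?S = "{(t, z). t \<in> disc_sector d \<epsilon> r \<and> z \<in> ball (0 :: complex^'n) r}"
    have "holo_tz ?S (\<lambda>y. \<Sum>j<n. (case y of (t, z) \<Rightarrow> u j z) * fst y ^ j)" for n
    proof (induction n)
      case 0
      then show ?case using holo_tz_const[of ?S 0] by simp
    next
      case (Suc n)
      have "holo_tz ?S (\<lambda>y. case y of (t, z) \<Rightarrow> u n z)" by (rule holo_tz_subset[OF u_hol]) auto
      moreover have "holo_tz ?S (\<lambda>y. fst y ^ n)"
        by (rule holo_tz_fst[where T = UNIV]) (auto intro!: holomorphic_intros)
      ultimately have "holo_tz ?S (\<lambda>y. (case y of (t, z) \<Rightarrow> u n z) * fst y ^ n)" by (rule holo_tz_mult)
      from holo_tz_add[OF Suc this] show ?case by simp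
    qed
    then have "holo_tz ?S (\<lambda>y. (-1) * (\<Sum>j<J. (case y of (t, z) \<Rightarrow> u j z) * fst y ^ j))"
      by (rule holo_tz_mult[OF holo_tz_const])
    from holo_tz_add[OF 1(4) this] show ?thesis unfolding F'_def by (simp add: case_prod_unfold)
  qed
  show thesis
  proof (rule that[of \<rho> A' B F'])
    show "holo_tz {(t, z). t \<in> disc_sector d \<epsilon> \<rho> \<and> z \<in> ball 0 \<rho>} (\<lambda>(t, z). F' t z)"
      by (rule holo_tz_subset[OF F'_hol]) (use \<rho> disc_sector_mono[of \<epsilon> \<epsilon> \<rho> r d] in auto)
    show "norm (F' t z) \<le> A' * norm t ^ J * exp (B * norm t powr k)" if "t \<in> disc_sector d \<epsilon> \<rho>" "norm z < \<rho>" for t z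
      using bnd that \<rho> disc_sector_mono[of \<epsilon> \<epsilon> \<rho> r d] by auto
    show "holo_tz {(t, z). z \<in> ball 0 \<rho>} (\<lambda>(t, z). u j z)" for j
      by (rule holo_tz_subset[OF u_hol]) (use \<rho> in auto)
    show "norm (u j z) \<le> A' / \<rho> ^ j" if "norm z < \<rho>" for j z
    proof -
      have "M / \<rho> ^ j \<le> A' / \<rho> ^ j" using D0 M0 \<rho> by (intro divide_right_mono) (auto simp: A'_def)
      then show ?thesis using u_bnd[of z j] that \<rho> by simp
    qed
  qed (use \<rho> F'_sums 1(3) D0 M0 in \<open>auto simp: A'_def\<close>)
qed

text \<open>For x at most 1 the constant 1 is enough; beyond, a single term of the exponential
  series, of index n at least J / k, dominates.\<close>

lemma power_le_exp_powr:
  fixes k :: real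
  assumes k: "0 < k"
  obtains C where "0 < C" "\<And>x. 0 \<le> x \<Longrightarrow> x ^ J \<le> C * exp (x powr k)"
proof -
  obtain n :: nat where n: "real J / k \<le> real n" using real_arch_simple by blast
  show thesis
  proof (rule that[of "1 + fact n"])
    fix x :: real assume x: "0 \<le> x"
    have e: "1 \<le> exp (x powr k)" by simp
    show "x ^ J \<le> (1 + fact n) * exp (x powr k)"
    proof (cases "x \<le> 1")
      case True
      then have "x ^ J \<le> 1 * 1" using x by (simp add: power_le_one)
      also have "\<dots> \<le> (1 + fact n) * exp (x powr k)" by (intro mult_mono e) auto
      finally show ?thesis .
    next
      case False
      then have "x ^ J = x powr real J" by (simp add: powr_realpow)
      also have "\<dots> \<le> x powr (k * real n)" using False n k by (intro powr_mono) (auto simp: field_simps)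
      also have "\<dots> = (x powr k) ^ n" using False by (simp add: powr_powr[symmetric] powr_realpow)
      also have "\<dots> \<le> fact n * exp (x powr k)"
      proof -
        have "(\<lambda>i. (x powr k) ^ i /\<^sub>R fact i) sums exp (x powr k)" by (rule exp_converges)
        from sum_le_suminf[OF sums_summable[OF this], of "{n}"] sums_unique[OF this]
        have "(x powr k) ^ n /\<^sub>R fact n \<le> exp (x powr k)" by simp
        then show ?thesis by (simp add: field_simps)
      qed
      also have "\<dots> \<le> (1 + fact n) * exp (x powr k)" by (intro mult_right_mono) auto
      finally show ?thesis .
    qed
  qed (simp add: add_pos_pos)
qed

lemma sector_summable_single:
  fixes b :: "complex^'n \<Rightarrow> complex"
  assumes k: "0 < k" and r: "0 < r"
    and hol: "holo_tz {(t, z). z \<in> ball 0 r} (\<lambda>(t, z). b z)"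
    and bnd: "\<And>z. norm z < r \<Longrightarrow> norm (b z) \<le> D"
  shows "sector_summable k d \<epsilon> (\<lambda>j z. if j = n then b z else 0)"
proof -
  obtain C where C: "0 < C" "\<And>x. 0 \<le> x \<Longrightarrow> x ^ n \<le> C * exp (x powr k)"
    using power_le_exp_powr[OF k, of n] by blast
  have D: "0 \<le> D" using bnd[of 0] r norm_ge_zero[of "b 0"] by (simp del: norm_ge_zero)
  show ?thesis
  proof (rule sector_summableI[where r = r and A = "D * C" and B = 1 and F = "\<lambda>t z. b z * t ^ n"])
    have "holo_tz {(t, z). t \<in> disc_sector d \<epsilon> r \<and> z \<in> ball 0 r} (\<lambda>y. (case y of (t, z) \<Rightarrow> b z) * fst y ^ n)"
      by (rule holo_tz_mult[OF holo_tz_subset[OF hol] holo_tz_fst[where T = UNIV]])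
        (auto intro!: holomorphic_intros)
    then show "holo_tz {(t, z). t \<in> disc_sector d \<epsilon> r \<and> z \<in> ball 0 r} (\<lambda>(t, z). b z * t ^ n)"
      by (simp add: case_prod_unfold)
    show "norm (b z * t ^ n) \<le> D * C * exp (1 * norm t powr k)" if "norm z < r" for t z
    proof -
      have "norm (b z * t ^ n) \<le> D * (C * exp (norm t powr k))"
        unfolding norm_mult norm_power using bnd[OF that] C(2)[of "norm t"] D by (intro mult_mono) auto
      then show ?thesis by (simp add: mult.assoc)
    qed
    show "(\<lambda>j. (if j = n then b z else 0) * t ^ j) sums (b z * t ^ n)" for t z
    proof -
      have "(\<lambda>j. (if j = n then b z else 0) * t ^ j) = (\<lambda>j. if j = n then b z * t ^ j else 0)" by auto
      then show ?thesis using sums_single[of n "\<lambda>j. b z * t ^ j"] by simp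
    qed
  qed (use C D r in auto)
qed

text \<open>A polynomial in t has growth of every positive order in every sector, so the factors on
  finitely many coefficients are arbitrary.\<close>

lemma sector_summable_finite:
  fixes u :: "nat \<Rightarrow> complex^'n \<Rightarrow> complex"
  assumes k: "0 < k" and r: "0 < r"
    and hol: "\<And>j. holo_tz {(t, z). z \<in> ball 0 r} (\<lambda>(t, z). u j z)"
    and bnd: "\<And>j z. norm z < r \<Longrightarrow> norm (u j z) \<le> D j"
  shows "sector_summable k d \<epsilon> (\<lambda>j z. if j < J then c j * u j z else 0)"
proof (induction J)
  case 0
  have "sector_summable k d \<epsilon> (\<lambda>j z. if j = 0 then (0 :: complex) else 0)"
    by (rule sector_summable_single[OF k r, where D = 0]) (simp_all add: case_prod_unfold holo_tz_const)
  then show ?case by simp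
next
  case (Suc J)
  have "sector_summable k d \<epsilon> (\<lambda>j z. if j = J then c J * u J z else 0)"
  proof (rule sector_summable_single[OF k r])
    show "holo_tz {(t, z). z \<in> ball 0 r} (\<lambda>(t, z). c J * u J z)"
    proof -
      have "holo_tz {(t, z). z \<in> ball 0 r} (\<lambda>y :: complex \<times> (complex^'n). c J * (case y of (t, z) \<Rightarrow> u J z))"
        by (rule holo_tz_mult[OF holo_tz_const hol])
      then show ?thesis by (simp add: case_prod_unfold)
    qed
    show "norm (c J * u J z) \<le> norm (c J) * D J" if "norm z < r" for z
      unfolding norm_mult using bnd[OF that] by (intro mult_left_mono) auto
  qed
  from sector_summable_add[OF _ Suc this] k
  have "sector_summable k d \<epsilon> (\<lambda>j z. (if j < J then c j * u j z else 0) + (if j = J then c J * u J z else 0))" by simp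
  moreover have "(\<lambda>j z. (if j < J then c j * u j z else 0) + (if j = J then c J * u J z else 0)) =
      (\<lambda>j z. if j < Suc J then c j * u j z else 0)" by (auto simp: fun_eq_iff less_Suc_eq)
  ultimately show ?case by simp
qed

text \<open>The continuation of the new series is the average of F(\<kappa> t) with weight w. Since
  F vanishes to order J after the lower terms are removed, integrability of |\<kappa>|^J |w| is
  enough, and the multiplier may be arbitrary below J: those terms form a polynomial and are added
  back at the end. Small arguments of \<kappa> cost opening, the bound C costs radius and type, and
  the order k is kept.\<close>

lemma sector_summable_average:
  fixes M :: "'x measure" and u :: "nat \<Rightarrow> complex^'n \<Rightarrow> complex"
  assumes k: "0 < k" and u: "sector_summable k d \<epsilon> u"
    and [measurable]: "\<kappa> \<in> borel_measurable M" "w \<in> borel_measurable M"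
    and int: "integrable M (\<lambda>x. norm (\<kappa> x) ^ J * norm (w x))"
    and C: "\<And>x. x \<in> space M \<Longrightarrow> norm (\<kappa> x) \<le> C"
    and ang: "\<And>x. x \<in> space M \<Longrightarrow> \<exists>a. \<bar>a\<bar> \<le> \<eta> \<and> \<kappa> x = of_real (norm (\<kappa> x)) * cis a"
    and e: "\<epsilon>' + 2 * \<eta> \<le> \<epsilon>"
    and lam: "\<And>j. J \<le> j \<Longrightarrow> l j = (LINT x|M. \<kappa> x ^ j * w x)"
  shows "sector_summable k d \<epsilon>' (\<lambda>j z. l j * u j z)"
proof -
  have k0: "0 \<le> k" using k by simp
  obtain r A B F where 1: "0 < r" "0 \<le> A" "0 \<le> B"
     "holo_tz {(t, z). t \<in> disc_sector d \<epsilon> r \<and> z \<in> ball 0 r} (\<lambda>(t, z). F t z)"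
    and Fb: "\<And>t z. t \<in> disc_sector d \<epsilon> r \<Longrightarrow> norm z < r \<Longrightarrow> norm (F t z) \<le> A * norm t ^ J * exp (B * norm t powr k)"
    and Fs: "\<And>t z. norm t < r \<Longrightarrow> norm z < r \<Longrightarrow> (\<lambda>j. (if j < J then 0 else u j z) * t ^ j) sums F t z"
    and uh: "\<And>j. holo_tz {(t, z). z \<in> ball 0 r} (\<lambda>(t, z). u j z)"
    and ub: "\<And>j z. norm z < r \<Longrightarrow> norm (u j z) \<le> A / r ^ j"
    using sector_summable_drop[OF k0 u, of J thesis] by blast
  \<comment> \<open>At least 1, so that powers of \<open>C'\<close> increase with the exponent and
    division by it cannot enlarge the radius.\<close>
  define C' where "C' = max C 1"
  have C': "norm (\<kappa> x) \<le> C'" if "x \<in> space M" for x using C[OF that] by (simp add: C'_def)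
  have C1: "1 \<le> C'" by (simp add: C'_def)
  define r' where "r' = r / (2 * C')"
  have r': "0 < r'" "C' * r' = r / 2" "r' \<le> r" using 1(1) C1 by (auto simp: r'_def field_simps)
  have in_dom: "\<kappa> x * t \<in> disc_sector d \<epsilon> r" if x: "x \<in> space M" and t: "t \<in> disc_sector d \<epsilon>' r'" for x t
  proof -
    obtain a where a: "\<bar>a\<bar> \<le> \<eta>" "\<kappa> x = of_real (norm (\<kappa> x)) * cis a" using ang[OF x] by blast
    show ?thesis by (rule disc_sector_mult[OF t a(2,1) e C'[OF x]]) (use C1 r' 1(1) in auto)
  qed
  define I where "I = (LINT x|M. norm (\<kappa> x) ^ J * norm (w x))"
  have I0: "0 \<le> I" unfolding I_def by (rule Bochner_Integration.integral_nonneg) simp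
  define K where "K x = (\<lambda>(t, z). w x * F (\<kappa> x * t) z)" for x
  let ?S = "{(t, z). t \<in> disc_sector d \<epsilon>' r' \<and> z \<in> ball (0 :: complex^'n) r'}"
  have S: "open ?S" by (intro open_cylinder open_disc_sector open_ball)
  have Kb: "norm (K x (t, z)) \<le> A * T ^ J * exp (B * (C' * T) powr k) * (norm (\<kappa> x) ^ J * norm (w x))"
    if x: "x \<in> space M" and t: "t \<in> disc_sector d \<epsilon>' r'" "norm t \<le> T" and z: "norm z < r'" for x t z T
  proof -
    have n: "norm (\<kappa> x * t) \<le> C' * T" unfolding norm_mult using C'[OF x] t C1 by (intro mult_mono) auto
    have "norm (F (\<kappa> x * t) z) \<le> A * norm (\<kappa> x * t) ^ J * exp (B * norm (\<kappa> x * t) powr k)"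
      by (rule Fb[OF in_dom[OF x t(1)]]) (use z r' in auto)
    also have "\<dots> \<le> A * (norm (\<kappa> x) ^ J * T ^ J) * exp (B * (C' * T) powr k)"
    proof (intro powr_exp_mono)
      show "A * norm (\<kappa> x * t) ^ J \<le> A * (norm (\<kappa> x) ^ J * T ^ J)"
        using t(2) 1(2) by (simp add: norm_mult power_mult_distrib mult_left_mono power_mono)
    qed (use n k0 1 in auto)
    finally have "norm (w x) * norm (F (\<kappa> x * t) z) \<le> norm (w x) * (A * (norm (\<kappa> x) ^ J * T ^ J) * exp (B * (C' * T) powr k))"
      by (rule mult_left_mono) simp
    then show ?thesis by (simp add: K_def norm_mult ac_simps)
  qed
  have Kint: "integrable M (\<lambda>x. c * (norm (\<kappa> x) ^ J * norm (w x)))" for c :: real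
    using int by simp
  have Kmeas: "(\<lambda>x. K x (t, z)) \<in> borel_measurable M" if t: "t \<in> disc_sector d \<epsilon>' r'" and z: "norm z < r'" for t z
  proof -
    have "(\<lambda>s. F s z) holomorphic_on disc_sector d \<epsilon> r"
      using holo_tz_section[OF 1(4), of "disc_sector d \<epsilon> r" z] z r' by simp
    then have "continuous_on (disc_sector d \<epsilon> r) (\<lambda>s. F s z)" by (rule holomorphic_on_imp_continuous_on)
    then have *: "(\<lambda>s. if s \<in> disc_sector d \<epsilon> r then F s z else 0) \<in> borel_measurable borel"
      by (intro borel_measurable_continuous_on_if continuous_on_const) (simp add: open_disc_sector)
    have "(\<lambda>x. \<kappa> x * t) \<in> borel_measurable M" by measurable
    from measurable_compose[OF this *]
    have "(\<lambda>x. w x * (if \<kappa> x * t \<in> disc_sector d \<epsilon> r then F (\<kappa> x * t) z else 0)) \<in> borel_measurable M"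
      by (intro borel_measurable_times) simp_all
    then show ?thesis by (rule measurable_cong[THEN iffD1, rotated]) (simp add: K_def in_dom t)
  qed
  define G where "G t z = (LINT x|M. K x (t, z))" for t z
  have Ghol: "holo_tz ?S (\<lambda>y. LINT x|M. K x y)"
  proof (rule holo_tz_integral[OF S])
    fix x assume x: "x \<in> space M"
    have "holo_tz ?S (\<lambda>(t, z). F (\<kappa> x * t) z)"
      using holo_tz_compose_fst[OF 1(4), of "\<lambda>t. \<kappa> x * t" UNIV ?S] in_dom[OF x] r'(3)
      by (fastforce intro!: holomorphic_intros)
    from holo_tz_mult[OF holo_tz_const this] show "holo_tz ?S (K x)"
      unfolding K_def by (simp add: case_prod_unfold)
  next
    fix y assume "y \<in> ?S"
    then obtain t z where y: "y = (t, z)" "t \<in> disc_sector d \<epsilon>' r'" "norm z < r'" by auto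
    show "(\<lambda>x. K x y) \<in> borel_measurable M" unfolding y by (rule Kmeas[OF y(2,3)])
    \<comment> \<open>The growth bound on F is uniform for bounded t only, so the domination is
      local: near y all first components have modulus below T.\<close>
    define T where "T = norm t + 1"
    define U :: "(complex \<times> (complex^'n)) set" where "U = {(s, z). s \<in> ball 0 T \<and> z \<in> UNIV}"
    have "open U" unfolding U_def by (intro open_cylinder open_ball open_UNIV)
    moreover have "y \<in> U" by (simp add: U_def y(1) T_def)
    moreover have "\<forall>x\<in>space M. \<forall>y\<in>U \<inter> ?S. norm (K x y) \<le> A * T ^ J * exp (B * (C' * T) powr k) * (norm (\<kappa> x) ^ J * norm (w x))"
      using Kb[of _ _ T] by (auto simp: U_def)
    ultimately show "\<exists>U g. open U \<and> y \<in> U \<and> integrable M g \<and> (\<forall>x\<in>space M. \<forall>y\<in>U \<inter> ?S. norm (K x y) \<le> g x)"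
      using Kint by blast
  qed
  \<comment> \<open>The factor |t|^J gained from the vanishing at the origin is absorbed into the
    exponential, which is why the type grows by 1.\<close>
  obtain D where D: "0 < D" "\<And>x. 0 \<le> x \<Longrightarrow> x ^ J \<le> D * exp (x powr k)"
    using power_le_exp_powr[OF k, of J] by blast
  have Gb: "norm (G t z) \<le> A * D * I * exp ((B * C' powr k + 1) * norm t powr k)"
    if t: "t \<in> disc_sector d \<epsilon>' r'" and z: "norm z < r'" for t z
  proof -
    let ?c = "A * norm t ^ J * exp (B * (C' * norm t) powr k)"
    have "norm (G t z) \<le> (LINT x|M. norm (K x (t, z)))"
      unfolding G_def by (rule integral_norm_bound)
    also have "\<dots> \<le> (LINT x|M. ?c * (norm (\<kappa> x) ^ J * norm (w x)))"
      by (rule Bochner_Integration.integral_mono'[OF Kint Kb[OF _ t _ z]]) (use 1(2) in auto)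
    also have "\<dots> = ?c * I" unfolding I_def by (rule integral_mult_right_zero)
    also have "\<dots> \<le> A * (D * exp (norm t powr k)) * exp (B * (C' * norm t) powr k) * I"
      using D(2)[of "norm t"] 1(2) I0 by (intro mult_right_mono mult_left_mono) auto
    also have "\<dots> = A * D * I * exp ((B * C' powr k + 1) * norm t powr k)"
      using C1 by (simp add: powr_mult algebra_simps exp_add[symmetric])
    finally show ?thesis .
  qed
  have Gs: "(\<lambda>j. (if j < J then 0 else l j * u j z) * t ^ j) sums G t z" if t: "norm t < r'" and z: "norm z < r'" for t z
  proof -
    define f where "f j x = w x * ((if j < J then 0 else u j z) * (\<kappa> x * t) ^ j)" for j x
    \<comment> \<open>Ratio of the geometric majorant that justifies integrating the series term by
      term; by the choice of \<open>r'\<close> it is below 1.\<close>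
    define q where "q = C' * norm t / r"
    have q: "0 \<le> q" "q < 1"
    proof -
      have "C' * norm t < C' * r'" using t C1 by simp
      then show "0 \<le> q" "q < 1" using r' 1(1) C1 by (simp_all add: q_def field_simps)
    qed
    have fb: "norm (f j x) \<le> (A * q ^ j) * (norm (\<kappa> x) ^ J * norm (w x))" if x: "x \<in> space M" for j x
    proof (cases "j < J")
      case True
      then show ?thesis using 1(2) q by (simp add: f_def)
    next
      case False
      have "norm (\<kappa> x) ^ j = norm (\<kappa> x) ^ J * norm (\<kappa> x) ^ (j - J)" using False by (simp flip: power_add)
      also have "\<dots> \<le> norm (\<kappa> x) ^ J * C' ^ j"
      proof (rule mult_left_mono)
        have "norm (\<kappa> x) ^ (j - J) \<le> C' ^ (j - J)" using C'[OF x] by (intro power_mono) auto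
        also have "\<dots> \<le> C' ^ j" using C1 by (intro power_increasing) auto
        finally show "norm (\<kappa> x) ^ (j - J) \<le> C' ^ j" .
      qed simp
      finally have kp: "norm (\<kappa> x) ^ j \<le> norm (\<kappa> x) ^ J * C' ^ j" .
      have "norm (u j z) \<le> A / r ^ j" using ub[of z j] z r' by simp
      then have "norm (u j z) * (norm (\<kappa> x) ^ j * norm t ^ j) \<le> A / r ^ j * ((norm (\<kappa> x) ^ J * C' ^ j) * norm t ^ j)"
        using kp 1 C1 by (intro mult_mono mult_nonneg_nonneg) auto
      then have "norm (w x) * (norm (u j z) * (norm (\<kappa> x) ^ j * norm t ^ j))
          \<le> norm (w x) * (A / r ^ j * ((norm (\<kappa> x) ^ J * C' ^ j) * norm t ^ j))"
        by (rule mult_left_mono) simp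
      then show ?thesis using False
        by (simp add: f_def norm_mult norm_power power_mult_distrib q_def power_divide ac_simps)
    qed
    have fm: "f j \<in> borel_measurable M" for j unfolding f_def by measurable
    have fi: "integrable M (f j)" for j
    proof (rule Bochner_Integration.integrable_bound[OF Kint[of "A * q ^ j"] fm], rule AE_I2)
      fix x assume "x \<in> space M"
      from fb[OF this] show "norm (f j x) \<le> norm (A * q ^ j * (norm (\<kappa> x) ^ J * norm (w x)))"
        unfolding real_norm_def by (rule order_trans[OF _ abs_ge_self])
    qed
    have geo: "summable (\<lambda>j. q ^ j)" using q by (intro summable_geometric) simp
    have "(\<lambda>j. integral\<^sup>L M (f j)) sums (LINT x|M. (\<Sum>j. f j x))"
    proof (rule sums_integral[OF fi])
      show "AE x in M. summable (\<lambda>j. norm (f j x))"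
      proof (rule AE_I2)
        fix x assume x: "x \<in> space M"
        have "summable (\<lambda>j. A * q ^ j * (norm (\<kappa> x) ^ J * norm (w x)))"
          by (intro summable_mult2 summable_mult geo)
        then show "summable (\<lambda>j. norm (f j x))"
          by (rule summable_comparison_test'[where N = 0]) (simp add: fb[OF x] del: norm_mult norm_power)
      qed
      have nb: "norm (LINT x|M. norm (f j x)) \<le> A * q ^ j * I" for j
      proof -
        have "(LINT x|M. norm (f j x)) \<le> (LINT x|M. (A * q ^ j) * (norm (\<kappa> x) ^ J * norm (w x)))"
          by (rule Bochner_Integration.integral_mono'[OF Kint fb]) (use 1(2) q in auto)
        also have "\<dots> = A * q ^ j * I" unfolding I_def by (rule integral_mult_right_zero)
        finally show ?thesis by simp
      qed
      have "summable (\<lambda>j. A * q ^ j * I)" by (intro summable_mult2 summable_mult geo)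
      then show "summable (\<lambda>j. LINT x|M. norm (f j x))"
        by (rule summable_comparison_test'[where N = 0]) (rule nb)
    qed
    moreover have "(LINT x|M. (\<Sum>j. f j x)) = G t z"
      unfolding G_def
    proof (rule Bochner_Integration.integral_cong[OF refl])
      fix x assume x: "x \<in> space M"
      have "norm (\<kappa> x * t) < r"
      proof -
        have "norm (\<kappa> x * t) \<le> C' * norm t" unfolding norm_mult using C'[OF x] by (intro mult_right_mono) auto
        also have "\<dots> < r" using q 1(1) by (simp add: q_def)
        finally show ?thesis .
      qed
      then have "(\<lambda>j. (if j < J then 0 else u j z) * (\<kappa> x * t) ^ j) sums F (\<kappa> x * t) z"
        by (rule Fs) (use z r' in simp)
      then have "(\<lambda>j. f j x) sums (w x * F (\<kappa> x * t) z)" unfolding f_def by (rule sums_mult)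
      then show "(\<Sum>j. f j x) = K x (t, z)" by (simp add: K_def sums_iff)
    qed
    moreover have "integral\<^sup>L M (f j) = (if j < J then 0 else l j * u j z) * t ^ j" for j
    proof (cases "j < J")
      case False
      then have "integral\<^sup>L M (f j) = (LINT x|M. (u j z * t ^ j) * (\<kappa> x ^ j * w x))"
        unfolding f_def by (intro Bochner_Integration.integral_cong) (simp_all add: power_mult_distrib ac_simps)
      also have "\<dots> = (u j z * t ^ j) * l j" using lam[of j] False by simp
      finally show ?thesis using False by (simp add: ac_simps)
    qed (simp add: f_def[abs_def])
    ultimately show ?thesis by simp
  qed
  \<comment> \<open>The average settles the indices from J on; the finitely many lower ones are
    supplied separately, with whatever values \<open>l\<close> takes there.\<close>
  have "sector_summable k d \<epsilon>' (\<lambda>j z. if j < J then 0 else l j * u j z)"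
  proof (rule sector_summableI[where r = r' and F = G and A = "A * D * I" and B = "B * C' powr k + 1"])
    show "holo_tz ?S (\<lambda>(t, z). G t z)" 
    proof -
      have "(\<lambda>(t, z). G t z) = (\<lambda>y. LINT x|M. K x y)" by (auto simp: fun_eq_iff G_def)
      with Ghol show ?thesis by (simp only:)
    qed
  qed (use r' Gb Gs 1 D I0 in auto)
  moreover have "sector_summable k d \<epsilon>' (\<lambda>j z. if j < J then l j * u j z else 0)"
    by (rule sector_summable_finite[OF k 1(1) uh ub])
  ultimately have "sector_summable k d \<epsilon>' (\<lambda>j z. (if j < J then 0 else l j * u j z) + (if j < J then l j * u j z else 0))"
    by (rule sector_summable_add[OF k0])
  moreover have "(\<lambda>j z. (if j < J then 0 else l j * u j z) + (if j < J then l j * u j z else 0)) = (\<lambda>j z. l j * u j z)"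
    by (auto simp: fun_eq_iff)
  ultimately show ?thesis by simp
qed

text \<open>Hiding the opening makes multipliers composable: each one shrinks it by an amount that
  no longer has to be recorded.\<close>

definition dir_summable :: "real \<Rightarrow> real \<Rightarrow> (nat \<Rightarrow> complex^'n \<Rightarrow> complex) \<Rightarrow> bool" where
  "dir_summable k d u \<longleftrightarrow> (\<exists>\<epsilon>>0. \<epsilon> < 2 * pi \<and> sector_summable k d \<epsilon> u)"

text \<open>The opening is unknown, so a representation is required for every \<eta>. The pair
  \<kappa>, w may change with \<eta>, while the multiplier \<open>l\<close> it represents is always
  the same.\<close>

lemma dir_summable_average:
  fixes M :: "'x measure" and u :: "nat \<Rightarrow> complex^'n \<Rightarrow> complex"
  assumes k: "0 < k" and u: "dir_summable k d u"
    and avg: "\<And>\<eta>. 0 < \<eta> \<Longrightarrow> \<exists>\<kappa> w C. \<kappa> \<in> borel_measurable M \<and> w \<in> borel_measurable M \<and>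
      integrable M (\<lambda>x. norm (\<kappa> x) ^ J * norm (w x)) \<and> (\<forall>x\<in>space M. norm (\<kappa> x) \<le> C) \<and>
      (\<forall>x\<in>space M. \<exists>a. \<bar>a\<bar> \<le> \<eta> \<and> \<kappa> x = of_real (norm (\<kappa> x)) * cis a) \<and>
      (\<forall>j\<ge>J. l j = (LINT x|M. \<kappa> x ^ j * w x))"
  shows "dir_summable k d (\<lambda>j z. l j * u j z)"
proof -
  obtain \<epsilon> where e: "0 < \<epsilon>" "\<epsilon> < 2 * pi" "sector_summable k d \<epsilon> u" using u unfolding dir_summable_def by blast
  have "0 < \<epsilon> / 4" using e by simp
  from avg[OF this] obtain \<kappa> w C where *: "\<kappa> \<in> borel_measurable M" "w \<in> borel_measurable M"
    "integrable M (\<lambda>x. norm (\<kappa> x) ^ J * norm (w x))" "\<forall>x\<in>space M. norm (\<kappa> x) \<le> C"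
    "\<forall>x\<in>space M. \<exists>a. \<bar>a\<bar> \<le> \<epsilon> / 4 \<and> \<kappa> x = of_real (norm (\<kappa> x)) * cis a"
    "\<forall>j\<ge>J. l j = (LINT x|M. \<kappa> x ^ j * w x)" by (elim exE conjE)
  have "sector_summable k d (\<epsilon> / 2) (\<lambda>j z. l j * u j z)"
    by (rule sector_summable_average[OF k e(3) *(1-3) *(4)[rule_format] *(5)[rule_format] _ *(6)[rule_format]]) auto
  then show ?thesis unfolding dir_summable_def using e by (intro exI[of _ "\<epsilon> / 2"]) auto
qed

text \<open>An average over a single dilation by a positive number: \<open>\<kappa>\<close> = c and
  w = a on a one-point measure.\<close>

lemma dir_summable_scale:
  fixes u :: "nat \<Rightarrow> complex^'n \<Rightarrow> complex" and c :: real
  assumes k: "0 < k" and c: "0 < c" and u: "dir_summable k d u"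
  shows "dir_summable k d (\<lambda>j z. a * of_real c ^ j * u j z)"
proof (rule dir_summable_average[OF k u, where M = "count_space {0 :: nat}" and J = 0])
  fix \<eta> :: real assume "0 < \<eta>"
  show "\<exists>\<kappa> w C. \<kappa> \<in> borel_measurable (count_space {0 :: nat}) \<and> w \<in> borel_measurable (count_space {0 :: nat}) \<and>
      integrable (count_space {0 :: nat}) (\<lambda>x. norm (\<kappa> x) ^ 0 * norm (w x)) \<and> (\<forall>x\<in>space (count_space {0 :: nat}). norm (\<kappa> x) \<le> C) \<and>
      (\<forall>x\<in>space (count_space {0 :: nat}). \<exists>a. \<bar>a\<bar> \<le> \<eta> \<and> \<kappa> x = of_real (norm (\<kappa> x)) * cis a) \<and>
      (\<forall>j\<ge>0. a * of_real c ^ j = (LINT x|count_space {0 :: nat}. \<kappa> x ^ j * w x))"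
    by (rule exI[of _ "\<lambda>_. of_real c"], rule exI[of _ "\<lambda>_. a"], rule exI[of _ c])
      (use c \<open>0 < \<eta>\<close> in \<open>auto simp: lebesgue_integral_count_space_finite integrable_count_space intro!: exI[of _ 0]\<close>)
qed

lemma dir_summable_add:
  fixes u v :: "nat \<Rightarrow> complex^'n \<Rightarrow> complex"
  assumes k: "0 < k" and u: "dir_summable k d u" and v: "dir_summable k d v"
  shows "dir_summable k d (\<lambda>j z. u j z + v j z)"
proof -
  obtain \<epsilon> where 1: "0 < \<epsilon>" "\<epsilon> < 2 * pi" "sector_summable k d \<epsilon> u"
    using u unfolding dir_summable_def by blast
  obtain \<epsilon>' where 2: "0 < \<epsilon>'" "\<epsilon>' < 2 * pi" "sector_summable k d \<epsilon>' v"
    using v unfolding dir_summable_def by blast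
  have "sector_summable k d (min \<epsilon> \<epsilon>') (\<lambda>j z. u j z + v j z)"
    by (rule sector_summable_add[OF _ sector_summable_mono[OF 1(3)] sector_summable_mono[OF 2(3)]]) (use k in auto)
  then show ?thesis unfolding dir_summable_def using 1 2 by (intro exI[of _ "min \<epsilon> \<epsilon>'"]) auto
qed

text \<open>\<open>t \<partial>\<^sub>t\<close> is an average over dilations \<open>t \<mapsto> (1 + \<rho> e\<^sup>i\<^sup>\<theta>) t\<close>, by Cauchy's formula.\<close>

lemma dir_summable_index:
  fixes u :: "nat \<Rightarrow> complex^'n \<Rightarrow> complex"
  assumes k: "0 < k" and u: "dir_summable k d u"
  shows "dir_summable k d (\<lambda>j z. of_nat j * u j z)"
proof (rule dir_summable_average[OF k u, where M = "lborel :: real measure" and J = 0])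
  fix \<eta> :: real assume \<eta>: "0 < \<eta>"
  have "isCont Arg 1" by (rule continuous_at_Arg) simp
  then have "\<exists>\<delta>>0. \<forall>w. dist w 1 < \<delta> \<longrightarrow> dist (Arg w) (Arg 1) < \<eta>"
    using \<eta> unfolding continuous_at_eps_delta by blast
  then obtain \<delta> where \<delta>: "\<delta> > 0" "\<And>w. dist w 1 < \<delta> \<Longrightarrow> \<bar>Arg w\<bar> < \<eta>"
    by (auto simp: dist_norm)
  \<comment> \<open>Below \<delta>, so that 1 + \<rho> e^(i \<theta>) has argument at most \<eta>,
    and at most 1, so that its modulus is at most 2.\<close>
  define \<rho> where "\<rho> = min (\<delta> / 2) 1"
  have \<rho>: "0 < \<rho>" "\<rho> < \<delta>" "\<rho> \<le> 1" using \<delta>(1) by (auto simp: \<rho>_def)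
  define \<kappa> where "\<kappa> \<theta> = 1 + of_real \<rho> * cis \<theta>" for \<theta>
  define w where "w \<theta> = of_real (indicator {0..2 * pi} \<theta>) * cis (- \<theta>) / (2 * pi * \<rho>)" for \<theta> :: real
  have [measurable]: "(\<lambda>\<theta>. cis (- \<theta>)) \<in> borel_measurable borel" "cis \<in> borel_measurable borel"
    by (intro borel_measurable_continuous_onI continuous_intros)+
  have [measurable]: "\<kappa> \<in> borel_measurable borel" "w \<in> borel_measurable borel"
    unfolding \<kappa>_def[abs_def] w_def[abs_def] by measurable
  show "\<exists>\<kappa> w C. \<kappa> \<in> borel_measurable (lborel :: real measure) \<and> w \<in> borel_measurable lborel \<and>
      integrable lborel (\<lambda>x. norm (\<kappa> x) ^ 0 * norm (w x)) \<and> (\<forall>x\<in>space lborel. norm (\<kappa> x) \<le> C) \<and>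
      (\<forall>x\<in>space lborel. \<exists>a. \<bar>a\<bar> \<le> \<eta> \<and> \<kappa> x = of_real (norm (\<kappa> x)) * cis a) \<and>
      (\<forall>j\<ge>0. of_nat j = (LINT x|lborel. \<kappa> x ^ j * w x))"
  proof (rule exI[of _ \<kappa>], rule exI[of _ w], rule exI[of _ 2], intro conjI ballI allI impI)
    have "norm (w \<theta>) = indicator {0..2 * pi} \<theta> * (1 / (2 * pi * \<rho>))" for \<theta>
      using \<rho> by (simp add: w_def norm_mult norm_divide)
    then show "integrable lborel (\<lambda>x. norm (\<kappa> x) ^ 0 * norm (w x))" by simp
    show "norm (\<kappa> \<theta>) \<le> 2" for \<theta>
      using norm_triangle_ineq[of 1 "of_real \<rho> * cis \<theta>"] \<rho> by (simp add: \<kappa>_def norm_mult)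
    show "\<exists>a. \<bar>a\<bar> \<le> \<eta> \<and> \<kappa> \<theta> = of_real (norm (\<kappa> \<theta>)) * cis a" for \<theta>
    proof (intro exI conjI)
      show "\<kappa> \<theta> = of_real (norm (\<kappa> \<theta>)) * cis (Arg (\<kappa> \<theta>))"
        using rcis_cmod_Arg[of "\<kappa> \<theta>"] by (simp add: rcis_def)
      show "\<bar>Arg (\<kappa> \<theta>)\<bar> \<le> \<eta>"
        using \<delta>(2)[of "\<kappa> \<theta>"] \<rho> by (simp add: \<kappa>_def dist_norm norm_mult)
    qed
    fix j :: nat
    \<comment> \<open>The weight extracts the coefficient of index 1 from the binomial expansion of
      (1 + t)^j, and this coefficient is j.\<close>
    have "(\<lambda>i. of_nat (j choose i) * t ^ i) sums (1 + t) ^ j" for t :: complex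
    proof -
      have "(\<lambda>i. of_nat (j choose i) * t ^ i) sums (\<Sum>i\<le>j. of_nat (j choose i) * t ^ i)"
        by (rule sums_finite) (auto simp: binomial_eq_0)
      also have "(\<Sum>i\<le>j. of_nat (j choose i) * t ^ i) = (1 + t) ^ j"
        using binomial_ring[of t 1 j] by (simp add: add.commute)
      finally show ?thesis .
    qed
    from power_series_coefficient_integral(1)[of "\<rho> + 1" "\<lambda>i. of_nat (j choose i)" "\<lambda>t. (1 + t) ^ j" \<rho> 1, OF this \<rho>(1)]
    have "of_nat j = (LINT \<theta>|lborel. indicator {0..2 * pi} \<theta> *\<^sub>R (\<kappa> \<theta> ^ j * cis (- \<theta>))) / (2 * pi * \<rho>)"
      by (simp add: \<kappa>_def)
    also have "\<dots> = (LINT \<theta>|lborel. indicator {0..2 * pi} \<theta> *\<^sub>R (\<kappa> \<theta> ^ j * cis (- \<theta>)) / (2 * pi * \<rho>))"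
      by (rule integral_divide_zero[symmetric])
    also have "\<dots> = (LINT x|lborel. \<kappa> x ^ j * w x)"
      by (rule Bochner_Integration.integral_cong) (simp_all add: w_def indicator_def)
    finally show "of_nat j = (LINT x|lborel. \<kappa> x ^ j * w x)" .
  qed simp_all
qed

lemma dir_summable_poly:
  fixes u :: "nat \<Rightarrow> complex^'n \<Rightarrow> complex" and P :: "complex poly"
  assumes k: "0 < k" and u: "dir_summable k d u"
  shows "dir_summable k d (\<lambda>j z. poly P (of_nat j) * u j z)"
proof (induction P)
  case 0
  show ?case using dir_summable_scale[OF k zero_less_one u, of 0] by simp
next
  case (pCons a P)
  from dir_summable_add[OF k dir_summable_scale[OF k zero_less_one u, of a] dir_summable_index[OF k pCons(2)]]
  show ?case by (simp add: algebra_simps)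
qed

section \<open>Exponential integrals over half-lines and division by polynomials\<close>

lemma integrable_exp_atMost:
  fixes a X :: real
  assumes a: "0 < a"
  shows "integrable lborel (\<lambda>x. indicator {..X} x * exp (a * x))"
    and "(LINT x|lborel. indicator {..X} x * exp (a * x)) = exp (a * X) / a"
proof -
  have "((\<lambda>x. exp (a * x) / a) \<longlongrightarrow> 0) at_bot"
    using a by real_asymp
  moreover have "((\<lambda>x. exp (a * x) / a) \<longlongrightarrow> exp (a * X) / a) (at_left X)"
    using a by (intro tendsto_intros) auto
  ultimately have *: "set_integrable lborel (einterval (-\<infinity>) (ereal X)) (\<lambda>x. exp (a * x))"
    "(LBINT x=-\<infinity>..ereal X. exp (a * x)) = exp (a * X) / a - 0"
    using a
    by (intro interval_integral_FTC_nonneg[where F = "\<lambda>x. exp (a * x) / a"];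
       auto intro!: derivative_eq_intros simp: ereal_tendsto_simps)+
  show "integrable lborel (\<lambda>x. indicator {..X} x * exp (a * x))"
  proof (rule Bochner_Integration.integrable_cong_AE_imp[OF *(1)[unfolded set_integrable_def]])
    show "AE x in lborel. indicator (einterval (-\<infinity>) (ereal X)) x *\<^sub>R exp (a * x) = indicator {..X} x * exp (a * x)"
      using AE_lborel_singleton[of X] by eventually_elim (auto simp: einterval_def indicator_def)
  qed simp
  have "(LINT x|lborel. indicator {..X} x * exp (a * x)) = (LBINT x=-\<infinity>..ereal X. exp (a * x))"
    unfolding interval_lebesgue_integral_def set_lebesgue_integral_def
    using AE_lborel_singleton[of X]
    by (auto intro!: integral_cong_AE elim!: eventually_mono simp: einterval_def indicator_def)
  then show "(LINT x|lborel. indicator {..X} x * exp (a * x)) = exp (a * X) / a" using *(2) by simp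
qed

lemma integrable_cexp_atMost:
  fixes a :: complex and X :: real
  assumes a: "0 < Re a"
  shows "integrable lborel (\<lambda>x. indicator {..X} x *\<^sub>R exp (a * of_real x))"
    and "(LINT x|lborel. indicator {..X} x *\<^sub>R exp (a * of_real x)) = exp (a * of_real X) / a"
proof -
  have a0: "a \<noteq> 0" using a by auto
  have nrm: "norm (exp (a * of_real x)) = exp (Re a * x)" for x by simp
  have meas: "(\<lambda>x::real. exp (a * of_real x)) \<in> borel_measurable borel"
    by (intro borel_measurable_continuous_onI continuous_intros)
  show int: "integrable lborel (\<lambda>x. indicator {..X} x *\<^sub>R exp (a * of_real x))"
  proof (rule Bochner_Integration.integrable_bound[OF integrable_exp_atMost(1)[OF a, of X]])
    show "(\<lambda>x. indicator {..X} x *\<^sub>R exp (a * of_real x)) \<in> borel_measurable lborel"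
      using meas by measurable
    show "AE x in lborel. norm (indicator {..X} x *\<^sub>R exp (a * of_real x)) \<le> norm (indicator {..X} x * exp (Re a * x))"
      by (rule AE_I2) (simp add: nrm abs_mult)
  qed
  have "((\<lambda>x. exp (a * of_real x) / a) \<longlongrightarrow> 0) at_bot"
  proof (rule tendsto_norm_zero_cancel)
    have "((\<lambda>x. exp (Re a * x) / norm a) \<longlongrightarrow> 0) at_bot" using a a0 by real_asymp
    then show "((\<lambda>x. norm (exp (a * of_real x) / a)) \<longlongrightarrow> 0) at_bot" by (simp add: norm_divide)
  qed
  moreover have "((\<lambda>x. exp (a * of_real x) / a) \<longlongrightarrow> exp (a * of_real X) / a) (at_left X)"
    using a0 by (intro tendsto_intros) auto
  moreover have "set_integrable lborel (einterval (-\<infinity>) (ereal X)) (\<lambda>x. exp (a * of_real x))"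
    unfolding set_integrable_def
  proof (rule Bochner_Integration.integrable_cong_AE_imp[OF int])
    show "AE x in lborel. indicator {..X} x *\<^sub>R exp (a * of_real x) = indicator (einterval (-\<infinity>) (ereal X)) x *\<^sub>R exp (a * of_real x)"
      using AE_lborel_singleton[of X] by eventually_elim (auto simp: einterval_def indicator_def)
    show "(\<lambda>x. indicator (einterval (-\<infinity>) (ereal X)) x *\<^sub>R exp (a * of_real x)) \<in> borel_measurable lborel"
      using meas by measurable
  qed
  moreover have "((\<lambda>x. exp (a * of_real x) / a) has_vector_derivative exp (a * of_real x)) (at x)" for x :: real
  proof -
    have "((\<lambda>x. exp (a * x) / a) has_field_derivative exp (a * of_real x) * a / a) (at (of_real x))"
      by (rule DERIV_cdivide) (auto intro!: derivative_eq_intros)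
    from has_vector_derivative_real_field[OF this] show ?thesis using a0 by simp
  qed
  ultimately have *: "(LBINT x=-\<infinity>..ereal X. exp (a * of_real x)) = exp (a * of_real X) / a - 0"
    by (intro interval_integral_FTC_integrable[where F = "\<lambda>x. exp (a * of_real x) / a"])
      (auto simp: ereal_tendsto_simps intro!: continuous_intros)
  have "(LINT x|lborel. indicator {..X} x *\<^sub>R exp (a * of_real x)) = (LBINT x=-\<infinity>..ereal X. exp (a * of_real x))"
    unfolding interval_lebesgue_integral_def set_lebesgue_integral_def
    using AE_lborel_singleton[of X] meas
    by (auto intro!: integral_cong_AE elim!: eventually_mono simp: einterval_def indicator_def)
  then show "(LINT x|lborel. indicator {..X} x *\<^sub>R exp (a * of_real x)) = exp (a * of_real X) / a" using * by simp
qed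

text \<open>For j > Re \<alpha>, 1 / (j - \<alpha>) is the integral of exp ((j - \<alpha>) x) over x
  \<le> 0, an average over the contractions \<kappa> = exp x with weight exp (- \<alpha> x). The
  remaining indices, among them j = \<alpha> if \<alpha> is a natural number, lie below J, where the
  multiplier is free.\<close>

lemma dir_summable_inverse_linear:
  fixes u :: "nat \<Rightarrow> complex^'n \<Rightarrow> complex"
  assumes k: "0 < k" and u: "dir_summable k d u"
  shows "dir_summable k d (\<lambda>j z. 1 / (of_nat j - \<alpha>) * u j z)"
proof -
  obtain J :: nat where J: "Re \<alpha> + 1 \<le> real J" using real_arch_simple by blast
  show ?thesis
  proof (rule dir_summable_average[OF k u, where M = "lborel :: real measure" and J = J])
    fix \<eta> :: real assume \<eta>: "0 < \<eta>"
    define \<kappa> :: "real \<Rightarrow> complex" where "\<kappa> x = of_real (indicator {..0} x * exp x)" for x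
    define w :: "real \<Rightarrow> complex" where "w x = indicator {..0} x *\<^sub>R exp (- \<alpha> * of_real x)" for x
    have [measurable]: "(\<lambda>x::real. exp (- \<alpha> * of_real x)) \<in> borel_measurable borel"
      by (intro borel_measurable_continuous_onI continuous_intros)
    have [measurable]: "\<kappa> \<in> borel_measurable borel" "w \<in> borel_measurable borel"
      unfolding \<kappa>_def[abs_def] w_def[abs_def] by measurable
    have pw: "\<kappa> x ^ j * w x = indicator {..0} x *\<^sub>R exp ((of_nat j - \<alpha>) * of_real x)" for x j
      by (simp add: \<kappa>_def w_def indicator_def exp_of_nat_mult[symmetric] exp_of_real[symmetric] exp_add[symmetric] algebra_simps)
    show "\<exists>\<kappa> w C. \<kappa> \<in> borel_measurable (lborel :: real measure) \<and> w \<in> borel_measurable lborel \<and>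
      integrable lborel (\<lambda>x. norm (\<kappa> x) ^ J * norm (w x)) \<and> (\<forall>x\<in>space lborel. norm (\<kappa> x) \<le> C) \<and>
      (\<forall>x\<in>space lborel. \<exists>a. \<bar>a\<bar> \<le> \<eta> \<and> \<kappa> x = of_real (norm (\<kappa> x)) * cis a) \<and>
      (\<forall>j\<ge>J. 1 / (of_nat j - \<alpha>) = (LINT x|lborel. \<kappa> x ^ j * w x))"
    proof (rule exI[of _ \<kappa>], rule exI[of _ w], rule exI[of _ 1], intro conjI ballI allI impI)
      have "integrable lborel (\<lambda>x. norm (\<kappa> x ^ J * w x))"
        unfolding pw by (rule integrable_norm[OF integrable_cexp_atMost(1)]) (use J in simp)
      then show "integrable lborel (\<lambda>x. norm (\<kappa> x) ^ J * norm (w x))" by (simp add: norm_mult norm_power)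
      show "norm (\<kappa> x) \<le> 1" for x by (simp add: \<kappa>_def indicator_def)
      show "\<exists>a. \<bar>a\<bar> \<le> \<eta> \<and> \<kappa> x = of_real (norm (\<kappa> x)) * cis a" for x
        using \<eta> by (intro exI[of _ 0]) (simp add: \<kappa>_def indicator_def)
      fix j assume "J \<le> j"
      then show "1 / (of_nat j - \<alpha>) = (LINT x|lborel. \<kappa> x ^ j * w x)"
        unfolding pw using J by (subst integrable_cexp_atMost(2)) simp_all
    qed simp_all
  qed
qed

text \<open>One complex root is split off at a time; this is why polynomials are complex here. With
  1 / 0 = 0 the factorisation of the reciprocal also holds at indices that are roots.\<close>

lemma dir_summable_divide_poly:
  fixes u :: "nat \<Rightarrow> complex^'n \<Rightarrow> complex" and P :: "complex poly"
  assumes k: "0 < k" and "P \<noteq> 0" and "dir_summable k d u"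
  shows "dir_summable k d (\<lambda>j z. 1 / poly P (of_nat j) * u j z)"
  using assms(2,3)
proof (induction "degree P" arbitrary: P u rule: less_induct)
  case less
  show ?case
  proof (cases "degree P = 0")
    case True
    then obtain c where "P = [:c:]" by (auto elim: degree_eq_zeroE)
    then show ?thesis using dir_summable_scale[OF k zero_less_one less(3), of "1 / c"] by simp
  next
    case False
    then have "\<not> constant (poly P)" by (simp add: constant_degree)
    then obtain \<alpha> where "poly P \<alpha> = 0" using fundamental_theorem_of_algebra by blast
    then obtain P' where P': "P = [:- \<alpha>, 1:] * P'" by (auto simp: poly_eq_0_iff_dvd)
    then have "P' \<noteq> 0" using less(2) by auto
    then have "degree P' < degree P" by (simp add: P' degree_mult_eq del: mult_pCons_left)
    from less(1)[OF this \<open>P' \<noteq> 0\<close> dir_summable_inverse_linear[OF k less(3), of \<alpha>]]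
    show ?thesis by (simp add: P' mult.commute[of "poly P' _"] del: mult_pCons_left)
  qed
qed

section \<open>Quotients of factorials\<close>

text \<open>These ratios are the moments of the Beta distribution with parameters a and b - a;
  \<open>D\<close> is its normalising constant 1 / Beta a (b - a). The contractions \<kappa> = x in
  [0, 1] are real, so they cost no opening.\<close>

lemma dir_summable_pochhammer_ratio:
  fixes u :: "nat \<Rightarrow> complex^'n \<Rightarrow> complex" and a b :: real
  assumes k: "0 < k" and u: "dir_summable k d u" and ab: "0 < a" "a < b"
  shows "dir_summable k d (\<lambda>j z. of_real (pochhammer a j / pochhammer b j) * u j z)"
proof (rule dir_summable_average[OF k u, where M = "lborel :: real measure" and J = 0])
  fix \<eta> :: real assume \<eta>: "0 < \<eta>"
  define D where "D = Gamma b / Gamma a / Gamma (b - a)"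
  define g where "g j x = indicator {0..1} x *\<^sub>R (x powr (a + real j - 1) * (1 - x) powr (b - a - 1))" for j and x :: real
  have gint: "integrable lborel (g j)" for j
    using integrable_Beta[of "a + real j" "b - a"] ab unfolding set_integrable_def g_def by simp
  have gval: "integral\<^sup>L lborel (g j) = Beta (a + real j) (b - a)" for j
    using set_borel_integral_eq_integral(2)[OF integrable_Beta[of "a + real j" "b - a"]]
      integral_unique[OF has_integral_Beta_real[of "a + real j" "b - a"]] ab
    unfolding set_lebesgue_integral_def g_def by simp
  define \<kappa> :: "real \<Rightarrow> complex" where "\<kappa> x = of_real (indicator {0..1} x * x)" for x
  define w :: "real \<Rightarrow> complex" where "w x = of_real (D * g 0 x)" for x
  have [measurable]: "g j \<in> borel_measurable borel" for j using gint by auto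
  have [measurable]: "\<kappa> \<in> borel_measurable borel" "w \<in> borel_measurable borel"
    unfolding \<kappa>_def[abs_def] w_def[abs_def] by measurable
  have pw: "\<kappa> x ^ j * w x = of_real (D * g j x)" for x j
  proof (cases "x \<in> {0<..1}")
    case True
    then have "x powr (a + real j - 1) = x ^ j * x powr (a - 1)"
      by (simp add: powr_add[symmetric] powr_realpow[symmetric] add.commute add_diff_eq)
    then show ?thesis using True by (simp add: \<kappa>_def w_def g_def)
  qed (auto simp: \<kappa>_def w_def g_def indicator_def)
  show "\<exists>\<kappa> w C. \<kappa> \<in> borel_measurable (lborel :: real measure) \<and> w \<in> borel_measurable lborel \<and>
      integrable lborel (\<lambda>x. norm (\<kappa> x) ^ 0 * norm (w x)) \<and> (\<forall>x\<in>space lborel. norm (\<kappa> x) \<le> C) \<and>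
      (\<forall>x\<in>space lborel. \<exists>a. \<bar>a\<bar> \<le> \<eta> \<and> \<kappa> x = of_real (norm (\<kappa> x)) * cis a) \<and>
      (\<forall>j\<ge>0. of_real (pochhammer a j / pochhammer b j) = (LINT x|lborel. \<kappa> x ^ j * w x))"
  proof (rule exI[of _ \<kappa>], rule exI[of _ w], rule exI[of _ 1], intro conjI ballI allI impI)
    show "integrable lborel (\<lambda>x. norm (\<kappa> x) ^ 0 * norm (w x))"
      unfolding w_def using gint[of 0] by simp
    show "norm (\<kappa> x) \<le> 1" for x by (simp add: \<kappa>_def indicator_def)
    show "\<exists>a. \<bar>a\<bar> \<le> \<eta> \<and> \<kappa> x = of_real (norm (\<kappa> x)) * cis a" for x
      using \<eta> by (intro exI[of _ 0]) (simp add: \<kappa>_def indicator_def)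
    fix j :: nat
    have "(LINT x|lborel. \<kappa> x ^ j * w x) = of_real (D * Beta (a + real j) (b - a))"
      unfolding pw integral_complex_of_real by (simp add: gval)
    also have "D * Beta (a + real j) (b - a) = pochhammer a j / pochhammer b j"
    proof -
      have nz: "Gamma a \<noteq> 0" "Gamma b \<noteq> 0" "Gamma (b - a) \<noteq> 0" "Gamma (b + real j) \<noteq> 0"
        using ab by (auto simp: Gamma_eq_zero_iff dest!: nonpos_Ints_nonpos)
      have "pochhammer a j = Gamma (a + real j) / Gamma a" "pochhammer b j = Gamma (b + real j) / Gamma b"
        using ab by (auto intro!: pochhammer_Gamma dest!: nonpos_Ints_nonpos)
      then show ?thesis using nz by (simp add: D_def Beta_def add.commute[of "real j"] algebra_simps)
    qed
    finally show "of_real (pochhammer a j / pochhammer b j) = (LINT x|lborel. \<kappa> x ^ j * w x)" ..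
  qed simp_all
qed

text \<open>The Beta integral requires the larger parameter in the denominator. Raising a to a + 1
  achieves this, and \<open>pochhammer (a + 1) j\<close> = (1 + j / a) \<open>pochhammer a j\<close>
  shows that the correction is a polynomial factor.\<close>

lemma dir_summable_pochhammer_ratio':
  fixes u :: "nat \<Rightarrow> complex^'n \<Rightarrow> complex" and a b :: real
  assumes k: "0 < k" and u: "dir_summable k d u" and ab: "0 < a" "0 < b" "b < a + 1"
  shows "dir_summable k d (\<lambda>j z. of_real (pochhammer b j / pochhammer a j) * u j z)"
proof -
  from dir_summable_poly[OF k dir_summable_pochhammer_ratio[OF k u ab(2,3)], of "[:1, of_real (1 / a):]"]
  have "dir_summable k d (\<lambda>j z. (1 + of_nat j * of_real (1 / a)) * (of_real (pochhammer b j / pochhammer (a + 1) j) * u j z))"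
    by simp
  moreover have "(1 + of_nat j * of_real (1 / a)) * (of_real (pochhammer b j / pochhammer (a + 1) j) * u j z) =
     of_real (pochhammer b j / pochhammer a j) * u j z" for j z
  proof -
    have "a * pochhammer (a + 1) j = (a + real j) * pochhammer a j"
      using pochhammer_rec[of a j] pochhammer_rec'[of a j] by (simp add: mult.commute)
    moreover have "pochhammer a j > 0" "pochhammer (a + 1) j > 0" using ab by (auto intro!: pochhammer_pos)
    ultimately have p: "pochhammer (a + 1) j = (a + real j) * pochhammer a j / a" "pochhammer a j \<noteq> 0"
      using ab by (auto simp: field_simps)
    have "(1 + real j / a) * (pochhammer b j / pochhammer (a + 1) j) = pochhammer b j / pochhammer a j"
      unfolding p(1) using ab p(2) by (simp add: divide_simps)
    then have "of_real ((1 + real j / a) * (pochhammer b j / pochhammer (a + 1) j)) = (of_real (pochhammer b j / pochhammer a j) :: complex)"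
      by (simp only:)
    then have "(1 + of_nat j * of_real (1 / a)) * of_real (pochhammer b j / pochhammer (a + 1) j) * u j z =
      of_real (pochhammer b j / pochhammer a j) * u j z" by simp
    then show ?thesis by (simp only: mult.assoc)
  qed
  ultimately show ?thesis by (simp only:)
qed

text \<open>Gauss' multiplication formula at integers: passing from j to j + 1 adds N consecutive
  factors, one for each residue class i.\<close>

lemma fact_mult_eq_prod_pochhammer:
  assumes "0 < N"
  shows "fact (N * j) = real N ^ (N * j) * (\<Prod>i=1..N. pochhammer (real i / real N) j)"
proof (induction j)
  case (Suc j)
  have "fact (N * j + n) = fact (N * j) * (\<Prod>i=1..n. real (N * j + i))" for n
    by (induction n) (simp_all add: algebra_simps)
  from this[of N] have "fact (N * Suc j) = fact (N * j) * (\<Prod>i=1..N. real (N * j + i))"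
    by (simp add: add.commute)
  also have "(\<Prod>i=1..N. real (N * j + i)) = (\<Prod>i=1..N. real N * (real i / real N + real j))"
    using assms by (intro prod.cong) (auto simp: field_simps)
  also have "\<dots> = real N ^ N * (\<Prod>i=1..N. real i / real N + real j)"
    by (simp add: prod.distrib)
  finally show ?case unfolding Suc
    by (simp add: pochhammer_rec' prod.distrib power_add mult_ac del: of_nat_Suc)
qed simp


text \<open>Identities between multipliers often hold only from some index on. The replaced terms
  must be multiples of \<open>u j\<close> because they have to remain holomorphic in z.\<close>

lemma dir_summable_modify:
  fixes u v :: "nat \<Rightarrow> complex^'n \<Rightarrow> complex"
  assumes k: "0 < k" and u: "dir_summable k d u" and v: "dir_summable k d v"
    and le: "\<And>j. j < J \<Longrightarrow> v' j = (\<lambda>z. c j * u j z)" and ge: "\<And>j. J \<le> j \<Longrightarrow> v' j = v j"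
  shows "dir_summable k d v'"
proof -
  have k0: "0 \<le> k" using k by simp
  obtain \<epsilon> where e: "0 < \<epsilon>" "\<epsilon> < 2 * pi" "sector_summable k d \<epsilon> u"
    using u unfolding dir_summable_def by blast
  have "sector_summable k d \<epsilon> (\<lambda>j z. if j < J then c j * u j z else 0)"
    by (rule sector_summable_drop[OF k0 e(3), of J]) (rule sector_summable_finite[OF k])
  then have 1: "dir_summable k d (\<lambda>j z. if j < J then c j * u j z else 0)"
    using e unfolding dir_summable_def by blast
  obtain \<epsilon> where e: "0 < \<epsilon>" "\<epsilon> < 2 * pi" "sector_summable k d \<epsilon> v"
    using v unfolding dir_summable_def by blast
  have "sector_summable k d \<epsilon> (\<lambda>j z. if j < J then (- 1) * v j z else 0)"
    by (rule sector_summable_drop[OF k0 e(3), of J]) (rule sector_summable_finite[OF k])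
  then have 2: "dir_summable k d (\<lambda>j z. if j < J then (- 1) * v j z else 0)"
    using e unfolding dir_summable_def by blast
  from dir_summable_add[OF k dir_summable_add[OF k v 2] 1]
  have "dir_summable k d (\<lambda>j z. (v j z + (if j < J then (- 1) * v j z else 0)) + (if j < J then c j * u j z else 0))" .
  moreover have "(\<lambda>j z. (v j z + (if j < J then (- 1) * v j z else 0)) + (if j < J then c j * u j z else 0)) = v'"
    using le ge by (auto simp: fun_eq_iff not_less)
  ultimately show ?thesis by simp
qed

lemma dir_summable_prod:
  fixes u :: "nat \<Rightarrow> complex^'n \<Rightarrow> complex"
  assumes "finite I" and "\<And>i u. i \<in> I \<Longrightarrow> dir_summable k d (u :: nat \<Rightarrow> complex^'n \<Rightarrow> complex) \<Longrightarrow> dir_summable k d (\<lambda>j z. l i j * u j z)"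
    and "dir_summable k d u"
  shows "dir_summable k d (\<lambda>j z. (\<Prod>i\<in>I. l i j) * u j z)"
  using assms
proof (induction I rule: finite_induct)
  case (insert i I)
  have "dir_summable k d (\<lambda>j z. (\<Prod>i\<in>I. l i j) * u j z)" by (rule insert.IH) (use insert.prems in auto)
  then have "dir_summable k d (\<lambda>j z. l i j * ((\<Prod>i\<in>I. l i j) * u j z))" by (rule insert.prems(1)[rotated]) simp
  then show ?case using insert.hyps by (simp add: mult.assoc)
qed simp

text \<open>Gauss' formula is applied to N and to N - 1. The factor with i = N is
  \<open>pochhammer 1 j\<close> = j! and cancels, which leaves N - 1 factors above and N - 1 below,
  paired by i.\<close>

lemma fact_mult_quotient:
  fixes N :: nat
  assumes N: "2 \<le> N"
  defines "C \<equiv> real N ^ N / real (N - 1) ^ (N - 1)"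
  shows "fact (N * j) / (fact j * fact ((N - 1) * j)) =
      C ^ j * (\<Prod>i=1..N - 1. pochhammer (real i / real N) j / pochhammer (real i / real (N - 1)) j)"
proof -
  have split: "(\<Prod>i=1..N. pochhammer (real i / real N) j) = (\<Prod>i=1..N - 1. pochhammer (real i / real N) j) * fact j"
  proof -
    have "{1..N} = insert N {1..N - 1}" using N by auto
    then show ?thesis using N by (simp add: pochhammer_fact[symmetric])
  qed
  have "fact (N * j) = real N ^ (N * j) * ((\<Prod>i=1..N - 1. pochhammer (real i / real N) j) * fact j)"
    unfolding split[symmetric] using N by (intro fact_mult_eq_prod_pochhammer) simp
  moreover have "fact ((N - 1) * j) = real (N - 1) ^ ((N - 1) * j) * (\<Prod>i=1..N - 1. pochhammer (real i / real (N - 1)) j)"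
    using N by (intro fact_mult_eq_prod_pochhammer) simp
  ultimately show ?thesis
    by (simp add: C_def prod_dividef power_divide power_mult)
qed

lemma dir_summable_fact_quotient:
  fixes u :: "nat \<Rightarrow> complex^'n \<Rightarrow> complex" and N :: nat
  assumes k: "0 < k" and N: "2 \<le> N" and u: "dir_summable k d u"
  shows "dir_summable k d (\<lambda>j z. of_real (fact (N * j) / (fact j * fact ((N - 1) * j))) * u j z)"
    and "dir_summable k d (\<lambda>j z. of_real (fact j * fact ((N - 1) * j) / fact (N * j)) * u j z)"
proof -
  define C where "C = real N ^ N / real (N - 1) ^ (N - 1)"
  have C: "0 < C" using N by (simp add: C_def)
  have q: "fact (N * j) / (fact j * fact ((N - 1) * j)) =
      C ^ j * (\<Prod>i=1..N - 1. pochhammer (real i / real N) j / pochhammer (real i / real (N - 1)) j)" for j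
    unfolding C_def by (rule fact_mult_quotient[OF N])
  have q': "fact j * fact ((N - 1) * j) / fact (N * j) =
     (1 / C) ^ j * (\<Prod>i=1..N - 1. pochhammer (real i / real (N - 1)) j / pochhammer (real i / real N) j)" for j
  proof -
    have "fact j * fact ((N - 1) * j) / fact (N * j) = inverse (fact (N * j) / (fact j * fact ((N - 1) * j)) :: real)"
      by simp
    also have "\<dots> = (1 / C) ^ j * (\<Prod>i=1..N - 1. pochhammer (real i / real (N - 1)) j / pochhammer (real i / real N) j)"
      unfolding q by (simp add: prod_dividef power_divide)
    finally show ?thesis .
  qed
  \<comment> \<open>Within a pair the parameters satisfy i/N < i/(N-1) \<le> 1 < i/N + 1, which is
    what the Beta integral needs in one direction and the shifted one in the other.\<close>
  have ab: "0 < real i / real N" "real i / real N < real i / real (N - 1)" "real i / real (N - 1) < real i / real N + 1"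
    if "i \<in> {1..N - 1}" for i
  proof -
    have "real i \<le> real (N - 1)" "0 < real i" using that by auto
    then show "0 < real i / real N" "real i / real N < real i / real (N - 1)" using N by (auto intro!: divide_strict_left_mono)
    have "real i / real (N - 1) \<le> 1" using \<open>real i \<le> real (N - 1)\<close> N by (simp add: divide_le_eq)
    also have "1 < real i / real N + 1" using \<open>0 < real i / real N\<close> by simp
    finally show "real i / real (N - 1) < real i / real N + 1" .
  qed
  have "dir_summable k d (\<lambda>j z. (\<Prod>i=1..N - 1. of_real (pochhammer (real i / real N) j / pochhammer (real i / real (N - 1)) j)) * u j z)"
    by (rule dir_summable_prod[OF _ _ u]) (use ab in \<open>auto intro!: dir_summable_pochhammer_ratio[OF k] simp del: of_real_divide\<close>)
  from dir_summable_scale[OF k C this, of 1]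
  show "dir_summable k d (\<lambda>j z. of_real (fact (N * j) / (fact j * fact ((N - 1) * j))) * u j z)"
    unfolding q by (simp add: mult.assoc)
  have "dir_summable k d (\<lambda>j z. (\<Prod>i=1..N - 1. of_real (pochhammer (real i / real (N - 1)) j / pochhammer (real i / real N) j)) * u j z)"
  proof (rule dir_summable_prod[OF _ _ u])
    fix i and v :: "nat \<Rightarrow> complex^'n \<Rightarrow> complex" assume i: "i \<in> {1..N - 1}" and v: "dir_summable k d v"
    show "dir_summable k d (\<lambda>j z. of_real (pochhammer (real i / real (N - 1)) j / pochhammer (real i / real N) j) * v j z)"
      by (rule dir_summable_pochhammer_ratio'[OF k v]) (use ab[OF i] in auto)
  qed simp
  from dir_summable_scale[OF k _ this, of "1 / C" 1] C
  show "dir_summable k d (\<lambda>j z. of_real (fact j * fact ((N - 1) * j) / fact (N * j)) * u j z)"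
    unfolding q' by (simp add: mult.assoc)
qed

section \<open>Contour shifts in strips\<close>

lemma open_strip: "open {\<zeta>. a < Im \<zeta> \<and> Im \<zeta> < b}"
  using open_Int[OF open_halfspace_Im_gt open_halfspace_Im_lt, of a b] by (simp add: Int_def conj_commute)

lemma convex_strip: "convex {\<zeta>. a < Im \<zeta> \<and> Im \<zeta> < b}"
  using convex_Int[OF convex_halfspace_Im_gt convex_halfspace_Im_lt, of a b] by (simp add: Int_def conj_commute)

text \<open>A holomorphic function on a convex strip has a primitive, and each of the four sides is
  a difference of its values at corners.\<close>

lemma rectangle_integral:
  assumes h: "h holomorphic_on {\<zeta>. a < Im \<zeta> \<and> Im \<zeta> < b}" and ab: "a < \<alpha>" "\<alpha> \<le> \<beta>" "\<beta> < b" and lr: "l \<le> r"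
  shows "integral {l..r} (\<lambda>x. h (Complex x \<beta>)) - integral {l..r} (\<lambda>x. h (Complex x \<alpha>)) =
     \<i> * integral {\<alpha>..\<beta>} (\<lambda>y. h (Complex r y)) - \<i> * integral {\<alpha>..\<beta>} (\<lambda>y. h (Complex l y))"
proof -
  let ?S = "{\<zeta>. a < Im \<zeta> \<and> Im \<zeta> < b}"
  obtain g where g': "\<And>z. z \<in> ?S \<Longrightarrow> (g has_field_derivative h z) (at z within ?S)"
    using holomorphic_convex_primitive'[OF convex_strip open_strip h] by blast
  have g: "(g has_field_derivative h z) (at z)" if "z \<in> ?S" for z
    using g'[OF that] unfolding at_within_open[OF that open_strip] .
  have H: "integral {l..r} (\<lambda>x. h (Complex x y)) = g (Complex r y) - g (Complex l y)" if y: "\<alpha> \<le> y" "y \<le> \<beta>" for y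
  proof (rule integral_unique, rule fundamental_theorem_of_calculus[OF lr])
    fix x assume "x \<in> {l..r}"
    have "((\<lambda>x. Complex x y) has_vector_derivative 1) (at x within {l..r})"
      unfolding Complex_eq by (auto intro!: derivative_eq_intros)
    moreover have "(g has_field_derivative h (Complex x y)) (at (Complex x y))" by (rule g) (use y ab in auto)
    ultimately show "((\<lambda>x. g (Complex x y)) has_vector_derivative h (Complex x y)) (at x within {l..r})"
      using field_vector_diff_chain_within[of "\<lambda>x. Complex x y" 1 x "{l..r}" g "h (Complex x y)"]
      by (simp add: o_def has_field_derivative_at_within)
  qed
  have V: "\<i> * integral {\<alpha>..\<beta>} (\<lambda>y. h (Complex x y)) = g (Complex x \<beta>) - g (Complex x \<alpha>)" for x
  proof -
    have "((\<lambda>y. \<i> * h (Complex x y)) has_integral g (Complex x \<beta>) - g (Complex x \<alpha>)) {\<alpha>..\<beta>}"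
    proof (rule fundamental_theorem_of_calculus[OF ab(2)])
      fix y assume y: "y \<in> {\<alpha>..\<beta>}"
      have "((\<lambda>y. Complex x y) has_vector_derivative \<i>) (at y within {\<alpha>..\<beta>})"
        unfolding Complex_eq by (auto intro!: derivative_eq_intros)
      moreover have "(g has_field_derivative h (Complex x y)) (at (Complex x y))" by (rule g) (use y ab in auto)
      ultimately show "((\<lambda>y. g (Complex x y)) has_vector_derivative \<i> * h (Complex x y)) (at y within {\<alpha>..\<beta>})"
        using field_vector_diff_chain_within[of "\<lambda>y. Complex x y" \<i> y "{\<alpha>..\<beta>}" g "h (Complex x y)"]
        by (simp add: o_def has_field_derivative_at_within)
    qed
    then have "integral {\<alpha>..\<beta>} (\<lambda>y. \<i> * h (Complex x y)) = g (Complex x \<beta>) - g (Complex x \<alpha>)" by (rule integral_unique)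
    then show ?thesis by simp
  qed
  show ?thesis unfolding V using H[of \<alpha>] H[of \<beta>] ab by simp
qed

lemma continuous_on_horizontal:
  assumes h: "h holomorphic_on {\<zeta>. a < Im \<zeta> \<and> Im \<zeta> < b}" and y: "a < y" "y < b"
  shows "continuous_on UNIV (\<lambda>x. h (Complex x y))"
  by (rule continuous_on_compose2[OF holomorphic_on_imp_continuous_on[OF h]])
    (use y in \<open>auto intro!: continuous_intros simp: Complex_eq\<close>)

lemma continuous_on_vertical:
  assumes h: "h holomorphic_on {\<zeta>. a < Im \<zeta> \<and> Im \<zeta> < b}" and y: "a < \<alpha>" "\<beta> < b"
  shows "continuous_on {\<alpha>..\<beta>} (\<lambda>y. h (Complex x y))"
  by (rule continuous_on_compose2[OF holomorphic_on_imp_continuous_on[OF h]])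
    (use y in \<open>auto intro!: continuous_intros simp: Complex_eq\<close>)

lemma LINT_Icc_eq_integral:
  fixes f :: "real \<Rightarrow> complex"
  assumes "continuous_on {a..b} f"
  shows "(LINT x|lborel. indicator {a..b} x *\<^sub>R f x) = integral {a..b} f"
  using set_borel_integral_eq_integral(2)[OF borel_integrable_atLeastAtMost'[OF assms]]
  unfolding set_lebesgue_integral_def .

lemma strip_vertical_limit:
  fixes h :: "complex \<Rightarrow> complex"
  assumes h: "h holomorphic_on {\<zeta>. a < Im \<zeta> \<and> Im \<zeta> < b}" and ab: "a < \<alpha>" "\<alpha> \<le> \<beta>" "\<beta> < b"
    and bnd: "\<forall>\<^sub>F n in sequentially. \<forall>y\<in>{\<alpha>..\<beta>}. norm (h (Complex (r n) y)) \<le> g n" and g: "g \<longlonglongrightarrow> 0"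
  shows "(\<lambda>n. \<i> * integral {\<alpha>..\<beta>} (\<lambda>y. h (Complex (r n) y))) \<longlonglongrightarrow> 0"
proof (rule Lim_null_comparison)
  show "\<forall>\<^sub>F n in sequentially. norm (\<i> * integral {\<alpha>..\<beta>} (\<lambda>y. h (Complex (r n) y))) \<le> g n * (\<beta> - \<alpha>)"
    using bnd
  proof eventually_elim
    case (elim n)
    have "norm (integral {\<alpha>..\<beta>} (\<lambda>y. h (Complex (r n) y))) \<le> g n * (\<beta> - \<alpha>)"
      using integral_bound[OF ab(2) continuous_on_vertical[OF h ab(1,3)], of "r n" "g n"] elim by blast
    then show ?case by (simp add: norm_mult)
  qed
  show "(\<lambda>n. g n * (\<beta> - \<alpha>)) \<longlonglongrightarrow> 0" using tendsto_mult_left_zero[OF g] by simp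
qed

text \<open>The left side of the rectangle recedes to minus infinity. The bound C exp x both removes
  it and dominates the horizontal integrals; the right side, at real part X, stays.\<close>

lemma half_strip_integral:
  assumes h: "h holomorphic_on {\<zeta>. a < Im \<zeta> \<and> Im \<zeta> < b}" and ab: "a < \<alpha>" "\<alpha> \<le> \<beta>" "\<beta> < b"
    and bnd: "\<And>x y. \<alpha> \<le> y \<Longrightarrow> y \<le> \<beta> \<Longrightarrow> x \<le> X \<Longrightarrow> norm (h (Complex x y)) \<le> C * exp x"
  shows "(LINT x|lborel. indicator {..X} x *\<^sub>R h (Complex x \<beta>)) - (LINT x|lborel. indicator {..X} x *\<^sub>R h (Complex x \<alpha>)) =
     \<i> * integral {\<alpha>..\<beta>} (\<lambda>y. h (Complex X y))"
proof -
  have lim: "(\<lambda>n. integral {X - real n..X} (\<lambda>x. h (Complex x y))) \<longlonglongrightarrow> (LINT x|lborel. indicator {..X} x *\<^sub>R h (Complex x y))"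
    if y: "\<alpha> \<le> y" "y \<le> \<beta>" for y
  proof -
    have c: "continuous_on UNIV (\<lambda>x. h (Complex x y))" by (rule continuous_on_horizontal[OF h]) (use y ab in auto)
    then have [measurable]: "(\<lambda>x. h (Complex x y)) \<in> borel_measurable borel" by (rule borel_measurable_continuous_onI)
    have "(\<lambda>n. LINT x|lborel. indicator {X - real n..X} x *\<^sub>R h (Complex x y)) \<longlonglongrightarrow> (LINT x|lborel. indicator {..X} x *\<^sub>R h (Complex x y))"
    proof (rule integral_dominated_convergence[where w = "\<lambda>x. C * (indicator {..X} x * exp (1 * x))"])
      show "integrable lborel (\<lambda>x. C * (indicator {..X} x * exp (1 * x)))"
        by (intro integrable_mult_right integrable_exp_atMost(1)) simp
      show "AE x in lborel. (\<lambda>n. indicator {X - real n..X} x *\<^sub>R h (Complex x y)) \<longlonglongrightarrow> indicator {..X} x *\<^sub>R h (Complex x y)"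
      proof (rule AE_I2)
        fix x
        obtain n0 :: nat where "X - x \<le> real n0" using real_arch_simple by blast
        then have "\<forall>\<^sub>F n in sequentially. indicator {..X} x *\<^sub>R h (Complex x y) = indicator {X - real n..X} x *\<^sub>R h (Complex x y)"
          by (intro eventually_sequentiallyI[of n0]) (auto simp: indicator_def)
        then show "(\<lambda>n. indicator {X - real n..X} x *\<^sub>R h (Complex x y)) \<longlonglongrightarrow> indicator {..X} x *\<^sub>R h (Complex x y)"
          by (rule Lim_transform_eventually[OF tendsto_const])
      qed
      show "AE x in lborel. norm (indicator {X - real n..X} x *\<^sub>R h (Complex x y)) \<le> C * (indicator {..X} x * exp (1 * x))" for n
        using bnd[OF y] by (intro AE_I2) (auto simp: indicator_def intro: order_trans[OF norm_ge_zero])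
    qed measurable
    moreover have "(LINT x|lborel. indicator {X - real n..X} x *\<^sub>R h (Complex x y)) = integral {X - real n..X} (\<lambda>x. h (Complex x y))" for n
      by (rule LINT_Icc_eq_integral) (use c continuous_on_subset in blast)
    ultimately show ?thesis by simp
  qed
  have v: "(\<lambda>n. \<i> * integral {\<alpha>..\<beta>} (\<lambda>y. h (Complex (X - real n) y))) \<longlonglongrightarrow> 0"
  proof (rule strip_vertical_limit[OF h ab])
    show "\<forall>\<^sub>F n in sequentially. \<forall>y\<in>{\<alpha>..\<beta>}. norm (h (Complex (X - real n) y)) \<le> C * exp (X - real n)"
      using bnd by (intro always_eventually) auto
    show "(\<lambda>n. C * exp (X - real n)) \<longlonglongrightarrow> 0" by real_asymp
  qed
  have "(\<lambda>n. integral {X - real n..X} (\<lambda>x. h (Complex x \<beta>)) - integral {X - real n..X} (\<lambda>x. h (Complex x \<alpha>)))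
     \<longlonglongrightarrow> \<i> * integral {\<alpha>..\<beta>} (\<lambda>y. h (Complex X y)) - 0"
    unfolding rectangle_integral[OF h ab, of "X - real n" X for n, simplified]
    by (intro tendsto_diff tendsto_const v)
  moreover have "(\<lambda>n. integral {X - real n..X} (\<lambda>x. h (Complex x \<beta>)) - integral {X - real n..X} (\<lambda>x. h (Complex x \<alpha>)))
     \<longlonglongrightarrow> (LINT x|lborel. indicator {..X} x *\<^sub>R h (Complex x \<beta>)) - (LINT x|lborel. indicator {..X} x *\<^sub>R h (Complex x \<alpha>))"
    by (intro tendsto_diff lim) (use ab in auto)
  ultimately show ?thesis using LIMSEQ_unique by fastforce
qed

text \<open>The majorant g serves twice: its integrability lets the horizontal sides grow to full
  lines, and its limits at both ends remove the vertical sides.\<close>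

lemma strip_integral_shift:
  assumes h: "h holomorphic_on {\<zeta>. a < Im \<zeta> \<and> Im \<zeta> < b}" and ab: "a < \<alpha>" "\<alpha> \<le> \<beta>" "\<beta> < b"
    and bnd: "\<And>x y. \<alpha> \<le> y \<Longrightarrow> y \<le> \<beta> \<Longrightarrow> norm (h (Complex x y)) \<le> g x"
    and g: "integrable lborel g" "(g \<longlongrightarrow> 0) at_top" "(g \<longlongrightarrow> 0) at_bot"
  shows "(LINT x|lborel. h (Complex x \<beta>)) = (LINT x|lborel. h (Complex x \<alpha>))"
proof -
  have lim: "(\<lambda>n. integral {- real n..real n} (\<lambda>x. h (Complex x y))) \<longlonglongrightarrow> (LINT x|lborel. h (Complex x y))"
    if y: "\<alpha> \<le> y" "y \<le> \<beta>" for y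
  proof -
    have c: "continuous_on UNIV (\<lambda>x. h (Complex x y))" by (rule continuous_on_horizontal[OF h]) (use y ab in auto)
    then have [measurable]: "(\<lambda>x. h (Complex x y)) \<in> borel_measurable borel" by (rule borel_measurable_continuous_onI)
    have "(\<lambda>n. LINT x|lborel. indicator {- real n..real n} x *\<^sub>R h (Complex x y)) \<longlonglongrightarrow> (LINT x|lborel. h (Complex x y))"
    proof (rule integral_dominated_convergence[where w = g])
      show "AE x in lborel. (\<lambda>n. indicator {- real n..real n} x *\<^sub>R h (Complex x y)) \<longlonglongrightarrow> h (Complex x y)"
      proof (rule AE_I2)
        fix x
        obtain n0 :: nat where "\<bar>x\<bar> \<le> real n0" using real_arch_simple by blast
        then have "\<forall>\<^sub>F n in sequentially. h (Complex x y) = indicator {- real n..real n} x *\<^sub>R h (Complex x y)"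
          by (intro eventually_sequentiallyI[of n0]) (auto simp: indicator_def)
        then show "(\<lambda>n. indicator {- real n..real n} x *\<^sub>R h (Complex x y)) \<longlonglongrightarrow> h (Complex x y)"
          by (rule Lim_transform_eventually[OF tendsto_const])
      qed
      show "AE x in lborel. norm (indicator {- real n..real n} x *\<^sub>R h (Complex x y)) \<le> g x" for n
        using bnd[OF y] by (intro AE_I2) (auto simp: indicator_def intro: order_trans[OF norm_ge_zero])
    qed (use g in measurable)
    moreover have "(LINT x|lborel. indicator {- real n..real n} x *\<^sub>R h (Complex x y)) = integral {- real n..real n} (\<lambda>x. h (Complex x y))" for n
      by (rule LINT_Icc_eq_integral) (use c continuous_on_subset in blast)
    ultimately show ?thesis by simp
  qed
  have v: "(\<lambda>n. \<i> * integral {\<alpha>..\<beta>} (\<lambda>y. h (Complex (s * real n) y))) \<longlonglongrightarrow> 0" if s: "s \<in> {1, -1}" for s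
  proof (rule strip_vertical_limit[OF h ab])
    show "\<forall>\<^sub>F n in sequentially. \<forall>y\<in>{\<alpha>..\<beta>}. norm (h (Complex (s * real n) y)) \<le> g (s * real n)"
      using bnd by (intro always_eventually) auto
    have "filterlim (\<lambda>n. real n) at_top sequentially" "filterlim (\<lambda>n. - real n) at_bot sequentially" by real_asymp+
    then show "(\<lambda>n. g (s * real n)) \<longlonglongrightarrow> 0"
      using s filterlim_compose[OF g(2)] filterlim_compose[OF g(3)] by auto
  qed
  have "(\<lambda>n. integral {- real n..real n} (\<lambda>x. h (Complex x \<beta>)) - integral {- real n..real n} (\<lambda>x. h (Complex x \<alpha>)))
     \<longlonglongrightarrow> 0 - 0"
    unfolding rectangle_integral[OF h ab, of "- real n" "real n" for n, simplified]
    by (intro tendsto_diff) (use v[of 1] v[of "-1"] in simp_all)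
  moreover have "(\<lambda>n. integral {- real n..real n} (\<lambda>x. h (Complex x \<beta>)) - integral {- real n..real n} (\<lambda>x. h (Complex x \<alpha>)))
     \<longlonglongrightarrow> (LINT x|lborel. h (Complex x \<beta>)) - (LINT x|lborel. h (Complex x \<alpha>))"
    by (intro tendsto_diff lim) (use ab in auto)
  ultimately show ?thesis using LIMSEQ_unique by fastforce
qed

text \<open>Euler's integral for \<open>Gamma (a / K)\<close> under t = c exp (K x). With x = ln |z|
  the integrand is |z|^a exp (- c |z|^K), the majorant that exponential flatness of order K
  supplies.\<close>

lemma double_exponential_integral:
  fixes a c K :: real
  assumes "0 < a" "0 < c" "0 < K"
  shows "integrable lborel (\<lambda>x. exp (a * x) * exp (- c * exp (K * x)))"
    and "(LINT x|lborel. exp (a * x) * exp (- c * exp (K * x))) = Gamma (a / K) / (K * c powr (a / K))"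
proof -
  define f where "f t = t powr (a / K - 1) * exp (- t)" for t :: real
  have aK: "0 < a / K" using assms by simp
  have img: "(\<lambda>x. c * exp (K * x)) ` UNIV = {0<..}"
  proof (intro set_eqI iffI)
    fix t :: real assume "t \<in> {0<..}"
    then show "t \<in> range (\<lambda>x. c * exp (K * x))"
      using assms by (intro image_eqI[where x = "ln (t / c) / K"]) (auto simp: exp_ln)
  qed (use assms in auto)
  have f0: "f absolutely_integrable_on {0<..}" "integral {0<..} f = Gamma (a / K)"
  proof -
    have hi: "(f has_integral Gamma (a / K)) {0..}"
      using Gamma_integral_real[OF aK] by (simp add: f_def[abs_def] exp_minus field_simps)
    have "{x \<in> {0<..} - {0..}. f x \<noteq> 0} = {}" "{x \<in> {0..} - {0<..}. f x \<noteq> 0} = {}"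
      by (auto simp: f_def)
    then have "negligible {x \<in> {0<..} - {0..}. f x \<noteq> 0}" "negligible {x \<in> {0..} - {0<..}. f x \<noteq> 0}"
      by (simp_all only: negligible_empty)
    from has_integral_spike_set_eq[OF this, of "Gamma (a / K)"]
    have hi': "(f has_integral Gamma (a / K)) {0<..}" using hi by (simp only:)
    then show "integral {0<..} f = Gamma (a / K)" by (rule integral_unique)
    show "f absolutely_integrable_on {0<..}"
      using hi' by (subst absolutely_integrable_on_iff_nonneg) (auto simp: f_def)
  qed
  have "(\<lambda>x. \<bar>c * (K * exp (K * x))\<bar> *\<^sub>R f (c * exp (K * x))) absolutely_integrable_on UNIV \<and>
      integral UNIV (\<lambda>x. \<bar>c * (K * exp (K * x))\<bar> *\<^sub>R f (c * exp (K * x))) = Gamma (a / K)"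
  proof -
    have "((\<lambda>x. c * exp (K * x)) has_field_derivative c * (K * exp (K * x))) (at x within UNIV)" for x
      by (auto intro!: derivative_eq_intros)
    moreover have "inj (\<lambda>x. c * exp (K * x))" using assms by (auto simp: inj_on_def)
    ultimately show ?thesis
      using has_absolute_integral_change_of_variables_1'[of UNIV "\<lambda>x. c * exp (K * x)" "\<lambda>x. c * (K * exp (K * x))" f "Gamma (a / K)"]
        f0 unfolding img by simp
  qed
  moreover have "\<bar>c * (K * exp (K * x))\<bar> *\<^sub>R f (c * exp (K * x)) = (K * c powr (a / K)) * (exp (a * x) * exp (- c * exp (K * x)))" for x
  proof -
    have "(c * exp (K * x)) powr (a / K - 1) = (c * exp (K * x)) powr (a / K) / (c * exp (K * x))"
      using assms by (simp add: powr_diff)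
    also have "(c * exp (K * x)) powr (a / K) = c powr (a / K) * exp (a * x)"
      using assms by (simp add: powr_mult exp_powr_real mult.commute)
    finally show ?thesis using assms by (simp add: f_def abs_mult)
  qed
  ultimately have *: "(\<lambda>x. (K * c powr (a / K)) * (exp (a * x) * exp (- c * exp (K * x)))) absolutely_integrable_on UNIV"
      "integral UNIV (\<lambda>x. (K * c powr (a / K)) * (exp (a * x) * exp (- c * exp (K * x)))) = Gamma (a / K)" by simp_all
  have D: "K * c powr (a / K) \<noteq> 0" using assms by simp
  have m: "(\<lambda>x. (K * c powr (a / K)) * (exp (a * x) * exp (- c * exp (K * x)))) \<in> borel_measurable lborel"
    by measurable
  have i: "integrable lborel (\<lambda>x. (K * c powr (a / K)) * (exp (a * x) * exp (- c * exp (K * x))))"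
    using *(1) integrable_completion[OF m] by (simp add: set_integrable_def)
  from integrable_mult_right[OF this, of "1 / (K * c powr (a / K))"] D
  show "integrable lborel (\<lambda>x. exp (a * x) * exp (- c * exp (K * x)))" by simp
  have "(LINT x|lborel. (K * c powr (a / K)) * (exp (a * x) * exp (- c * exp (K * x)))) = Gamma (a / K)"
    using integral_lborel[OF i] *(2) by (simp only:)
  then have "(K * c powr (a / K)) * (LINT x|lborel. exp (a * x) * exp (- c * exp (K * x))) = Gamma (a / K)"
    by (simp only: integral_mult_right_zero)
  then show "(LINT x|lborel. exp (a * x) * exp (- c * exp (K * x))) = Gamma (a / K) / (K * c powr (a / K))"
    using D by (metis nonzero_mult_div_cancel_left)
qed

lemma double_exponential_tendsto:
  fixes a c K :: real
  assumes "0 < a" "0 < c" "0 < K"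
  shows "((\<lambda>x. exp (a * x) * exp (- c * exp (K * x))) \<longlongrightarrow> 0) at_top"
    and "((\<lambda>x. exp (a * x) * exp (- c * exp (K * x))) \<longlongrightarrow> 0) at_bot"
  using assms by real_asymp+

section \<open>Multipliers from Hankel contours\<close>

text \<open>A power series \<open>\<Sum> c\<^sub>n x\<^sup>n\<close> continued to the complement of the positive axis, in the logarithmic
  variable \<open>x = exp (- \<zeta>)\<close>. The continuation is only given strip by strip.\<close>

locale log_continuation =
  fixes c :: "nat \<Rightarrow> complex" and D X0 :: real
  assumes c_bound: "norm (c n) \<le> D * exp (X0 * real n)"
    and continuation: "0 < y \<Longrightarrow> y < 2 * pi \<Longrightarrow> \<exists>A \<eta> C X. 0 < \<eta> \<and>
      A holomorphic_on {\<zeta>. y - \<eta> < Im \<zeta> \<and> Im \<zeta> < y + \<eta>} \<and>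
      (\<forall>\<zeta>. y - \<eta> < Im \<zeta> \<and> Im \<zeta> < y + \<eta> \<longrightarrow> norm (A \<zeta>) \<le> C * (1 + exp (- Re \<zeta>))) \<and>
      (\<forall>\<zeta>. y - \<eta> < Im \<zeta> \<and> Im \<zeta> < y + \<eta> \<and> X < Re \<zeta> \<longrightarrow> (\<lambda>k. c k * exp (- (of_nat k * \<zeta>))) sums A \<zeta>)"
begin

definition S :: "complex \<Rightarrow> complex" where
  "S \<zeta> = (\<Sum>k. c k * exp (- (of_nat k * \<zeta>)))"

lemma S_summable: "X0 < Re \<zeta> \<Longrightarrow> summable (\<lambda>k. norm (c k * exp (- (of_nat k * \<zeta>))))"
proof (rule summable_comparison_test'[of "\<lambda>k. D * exp (X0 - Re \<zeta>) ^ k" 0])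
  assume "X0 < Re \<zeta>"
  then show "summable (\<lambda>k. D * exp (X0 - Re \<zeta>) ^ k)" by (intro summable_mult summable_geometric) simp
  fix k :: nat
  have "norm (c k * exp (- (of_nat k * \<zeta>))) \<le> D * exp (X0 * real k) * exp (- (real k * Re \<zeta>))"
    unfolding norm_mult using c_bound[of k] by (intro mult_mono) (auto intro: order_trans[OF norm_ge_zero c_bound])
  also have "\<dots> = D * exp (X0 - Re \<zeta>) ^ k"
    by (simp add: exp_of_nat_mult[symmetric] exp_add[symmetric] algebra_simps)
  finally show "norm (norm (c k * exp (- (of_nat k * \<zeta>)))) \<le> D * exp (X0 - Re \<zeta>) ^ k" by simp
qed

lemma S_sums: "X0 < Re \<zeta> \<Longrightarrow> (\<lambda>k. c k * exp (- (of_nat k * \<zeta>))) sums S \<zeta>"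
  unfolding S_def by (rule summable_sums, rule summable_norm_cancel, rule S_summable)

lemma S_holomorphic: "S holomorphic_on {\<zeta>. X0 < Re \<zeta>}"
proof -
  define P where "P x = (\<Sum>k. c k * x ^ k)" for x
  have P: "(\<lambda>k. c k * (x - 0) ^ k) sums P x" if "x \<in> ball 0 (exp (- X0))" for x
  proof (cases "x = 0")
    case True
    then show ?thesis using powser_sums_zero[of c] unfolding P_def by (simp add: sums_iff)
  next
    case False
    define \<zeta> where "\<zeta> = - ln x"
    have "ln (norm x) < ln (exp (- X0))" using that False by (subst ln_less_cancel_iff) auto
    then have "ln (norm x) < - X0" by simp
    then have "X0 < Re \<zeta>" using False by (simp add: \<zeta>_def)
    from S_sums[OF this] have "(\<lambda>k. c k * x ^ k) sums S \<zeta>"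
      using False by (simp add: \<zeta>_def exp_of_nat_mult)
    then show ?thesis by (simp add: P_def sums_iff)
  qed
  have "P holomorphic_on ball 0 (exp (- X0))" by (rule power_series_holomorphic[OF P])
  then have "(\<lambda>\<zeta>. P (exp (- \<zeta>))) holomorphic_on {\<zeta>. X0 < Re \<zeta>}"
    by (rule holomorphic_on_compose_gen[of "\<lambda>\<zeta>. exp (- \<zeta>)", unfolded o_def, rotated])
      (auto intro!: holomorphic_intros)
  moreover have "P (exp (- \<zeta>)) = S \<zeta>" for \<zeta>
    unfolding P_def S_def by (simp add: exp_of_nat_mult[symmetric])
  ultimately show ?thesis by simp
qed

text \<open>The local continuations agree on overlaps by the identity theorem, so \<open>A\<close>
  can be read off at each \<zeta> from the strip centred at Im \<zeta>. Holomorphy is kept strip by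
  strip, in the form in which contours are moved later.\<close>

lemma global_continuation:
  obtains A where "\<And>y. 0 < y \<Longrightarrow> y < 2 * pi \<Longrightarrow> \<exists>A' \<eta> C. 0 < \<eta> \<and>
      A' holomorphic_on {\<zeta>. y - \<eta> < Im \<zeta> \<and> Im \<zeta> < y + \<eta>} \<and>
      (\<forall>\<zeta>. y - \<eta> < Im \<zeta> \<and> Im \<zeta> < y + \<eta> \<longrightarrow> norm (A' \<zeta>) \<le> C * (1 + exp (- Re \<zeta>))) \<and>
      (\<forall>\<zeta>. y - \<eta> < Im \<zeta> \<and> Im \<zeta> < y + \<eta> \<and> X0 < Re \<zeta> \<longrightarrow> A' \<zeta> = S \<zeta>) \<and>
      (\<forall>\<zeta>. y - \<eta> < Im \<zeta> \<and> Im \<zeta> < y + \<eta> \<and> 0 < Im \<zeta> \<and> Im \<zeta> < 2 * pi \<longrightarrow> A' \<zeta> = A \<zeta>)"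
proof -
  define Q where "Q y A \<eta> C X \<longleftrightarrow> 0 < \<eta> \<and>
      A holomorphic_on {\<zeta>. y - \<eta> < Im \<zeta> \<and> Im \<zeta> < y + \<eta>} \<and>
      (\<forall>\<zeta>. y - \<eta> < Im \<zeta> \<and> Im \<zeta> < y + \<eta> \<longrightarrow> norm (A \<zeta>) \<le> C * (1 + exp (- Re \<zeta>))) \<and>
      (\<forall>\<zeta>. y - \<eta> < Im \<zeta> \<and> Im \<zeta> < y + \<eta> \<and> X < Re \<zeta> \<longrightarrow> (\<lambda>k. c k * exp (- (of_nat k * \<zeta>))) sums A \<zeta>)"
    for y \<eta> C X and A :: "complex \<Rightarrow> complex"
  have "\<forall>y\<in>{0<..<2 * pi}. \<exists>A \<eta> C X. Q y A \<eta> C X"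
    using continuation unfolding Q_def by simp
  then obtain A0 \<eta> C X where p: "\<forall>y\<in>{0<..<2 * pi}. Q y (A0 y) (\<eta> y) (C y) (X y)" by metis
  let ?T = "\<lambda>y. {\<zeta>. y - \<eta> y < Im \<zeta> \<and> Im \<zeta> < y + \<eta> y}"
  have eta: "0 < \<eta> y" and A0h: "A0 y holomorphic_on ?T y"
    and A0b: "\<And>\<zeta>. y - \<eta> y < Im \<zeta> \<Longrightarrow> Im \<zeta> < y + \<eta> y \<Longrightarrow> norm (A0 y \<zeta>) \<le> C y * (1 + exp (- Re \<zeta>))"
    and A0s: "\<And>\<zeta>. y - \<eta> y < Im \<zeta> \<Longrightarrow> Im \<zeta> < y + \<eta> y \<Longrightarrow> X y < Re \<zeta> \<Longrightarrow> (\<lambda>k. c k * exp (- (of_nat k * \<zeta>))) sums A0 y \<zeta>"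
    if "0 < y" "y < 2 * pi" for y
    using bspec[OF p, of y] that unfolding Q_def by simp_all
  \<comment> \<open>The given agreement with the series starts at \<open>X y\<close>, which varies
    with y. The identity theorem extends it to the common half-plane Re \<zeta> > X0, on which two
    strips can then be compared.\<close>
  have A0S: "A0 y \<zeta> = S \<zeta>" if y: "0 < y" "y < 2 * pi" and z: "y - \<eta> y < Im \<zeta>" "Im \<zeta> < y + \<eta> y" "X0 < Re \<zeta>" for y \<zeta>
  proof (rule analytic_continuation_open[where s = "{\<zeta>. max X0 (X y) < Re \<zeta>} \<inter> ?T y" and s' = "{\<zeta>. X0 < Re \<zeta>} \<inter> ?T y"
        and f = "A0 y" and g = S and z = \<zeta>])
    show "open ({\<zeta>. max X0 (X y) < Re \<zeta>} \<inter> ?T y)" "open ({\<zeta>. X0 < Re \<zeta>} \<inter> ?T y)"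
      by (intro open_Int open_strip open_halfspace_Re_gt)+
    have "Complex (max X0 (X y) + 1) y \<in> {\<zeta>. max X0 (X y) < Re \<zeta>} \<inter> ?T y" using eta[OF y] by auto
    then show "{\<zeta>. max X0 (X y) < Re \<zeta>} \<inter> ?T y \<noteq> {}" by blast
    show "connected ({\<zeta>. X0 < Re \<zeta>} \<inter> ?T y)"
      by (intro convex_connected convex_Int convex_strip convex_halfspace_Re_gt)
    show "A0 y holomorphic_on {\<zeta>. X0 < Re \<zeta>} \<inter> ?T y" by (rule holomorphic_on_subset[OF A0h[OF y]]) auto
    show "S holomorphic_on {\<zeta>. X0 < Re \<zeta>} \<inter> ?T y" by (rule holomorphic_on_subset[OF S_holomorphic]) auto
    show "A0 y w = S w" if "w \<in> {\<zeta>. max X0 (X y) < Re \<zeta>} \<inter> ?T y" for w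
      using A0s[OF y, of w] that by (auto simp: S_def sums_iff)
  qed (use z in auto)
  have AA: "A0 y \<zeta> = A0 y' \<zeta>" if y: "0 < y" "y < 2 * pi" and y': "0 < y'" "y' < 2 * pi"
    and z: "y - \<eta> y < Im \<zeta>" "Im \<zeta> < y + \<eta> y" "y' - \<eta> y' < Im \<zeta>" "Im \<zeta> < y' + \<eta> y'" for y y' \<zeta>
  proof (rule analytic_continuation_open[where s = "{\<zeta>. X0 < Re \<zeta>} \<inter> (?T y \<inter> ?T y')" and s' = "?T y \<inter> ?T y'"
        and f = "A0 y" and g = "A0 y'" and z = \<zeta>])
    show "open ({\<zeta>. X0 < Re \<zeta>} \<inter> (?T y \<inter> ?T y'))" "open (?T y \<inter> ?T y')"
      by (intro open_Int open_strip open_halfspace_Re_gt)+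
    have "Complex (X0 + 1) (Im \<zeta>) \<in> {\<zeta>. X0 < Re \<zeta>} \<inter> (?T y \<inter> ?T y')" using z by auto
    then show "{\<zeta>. X0 < Re \<zeta>} \<inter> (?T y \<inter> ?T y') \<noteq> {}" by blast
    show "connected (?T y \<inter> ?T y')" by (intro convex_connected convex_Int convex_strip)
    show "A0 y holomorphic_on ?T y \<inter> ?T y'" by (rule holomorphic_on_subset[OF A0h[OF y]]) auto
    show "A0 y' holomorphic_on ?T y \<inter> ?T y'" by (rule holomorphic_on_subset[OF A0h[OF y']]) auto
    show "A0 y w = A0 y' w" if "w \<in> {\<zeta>. X0 < Re \<zeta>} \<inter> (?T y \<inter> ?T y')" for w
      using A0S[OF y, of w] A0S[OF y', of w] that by auto
  qed (use z in auto)
  show thesis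
  proof (rule that[of "\<lambda>\<zeta>. A0 (Im \<zeta>) \<zeta>"])
    fix y :: real assume y: "0 < y" "y < 2 * pi"
    show "\<exists>A' \<eta> C. 0 < \<eta> \<and>
      A' holomorphic_on {\<zeta>. y - \<eta> < Im \<zeta> \<and> Im \<zeta> < y + \<eta>} \<and>
      (\<forall>\<zeta>. y - \<eta> < Im \<zeta> \<and> Im \<zeta> < y + \<eta> \<longrightarrow> norm (A' \<zeta>) \<le> C * (1 + exp (- Re \<zeta>))) \<and>
      (\<forall>\<zeta>. y - \<eta> < Im \<zeta> \<and> Im \<zeta> < y + \<eta> \<and> X0 < Re \<zeta> \<longrightarrow> A' \<zeta> = S \<zeta>) \<and>
      (\<forall>\<zeta>. y - \<eta> < Im \<zeta> \<and> Im \<zeta> < y + \<eta> \<and> 0 < Im \<zeta> \<and> Im \<zeta> < 2 * pi \<longrightarrow> A' \<zeta> = A0 (Im \<zeta>) \<zeta>)"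
    proof (rule exI[of _ "A0 y"], rule exI[of _ "\<eta> y"], rule exI[of _ "C y"], intro conjI allI impI)
      show "0 < \<eta> y" by (rule eta[OF y])
      show "A0 y holomorphic_on ?T y" by (rule A0h[OF y])
      show "norm (A0 y \<zeta>) \<le> C y * (1 + exp (- Re \<zeta>))" if "y - \<eta> y < Im \<zeta> \<and> Im \<zeta> < y + \<eta> y" for \<zeta>
        using that by (intro A0b[OF y]) simp_all
      show "A0 y \<zeta> = S \<zeta>" if "y - \<eta> y < Im \<zeta> \<and> Im \<zeta> < y + \<eta> y \<and> X0 < Re \<zeta>" for \<zeta>
        using that by (intro A0S[OF y]) simp_all
      fix \<zeta> assume z: "y - \<eta> y < Im \<zeta> \<and> Im \<zeta> < y + \<eta> y \<and> 0 < Im \<zeta> \<and> Im \<zeta> < 2 * pi"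
      then have "0 < \<eta> (Im \<zeta>)" by (intro eta) auto
      then show "A0 y \<zeta> = A0 (Im \<zeta>) \<zeta>" using z by (intro AA[OF y]) auto
    qed
  qed
qed

text \<open>Cauchy's coefficient formula on the circle |x| = exp (- X), unrolled to a vertical
  segment of length 2 \<pi>. Its starting point is free, so that the segment can later be cut
  symmetrically about the positive axis.\<close>

lemma coefficient_vertical:
  assumes X: "X0 < X"
  shows "integral {a..a + 2 * pi} (\<lambda>y. S (Complex X y) * exp (of_nat n * Complex X y)) = 2 * pi * c n"
proof -
  have eq: "c k * exp (- (of_nat k * Complex X \<theta>)) = c k * of_real (exp (- (real k * X))) * cis (of_int (-1) * real k * \<theta>)" for k \<theta>
    by (simp add: cis_conv_exp exp_of_real[symmetric] exp_add[symmetric] Complex_eq algebra_simps)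
  have s: "summable (\<lambda>k. norm (c k * of_real (exp (- (real k * X)))))"
    using S_summable[of "Complex X 0"] X by (simp add: norm_mult)
  have sm: "(\<lambda>k. c k * of_real (exp (- (real k * X))) * cis (of_int (-1) * real k * \<theta>)) sums S (Complex X \<theta>)" for \<theta>
    unfolding eq[symmetric] by (rule S_sums) (use X in simp)
  have "continuous_on {a..a + 2 * pi} (\<lambda>\<theta>. S (Complex X \<theta>))"
    by (rule continuous_on_compose2[OF holomorphic_on_imp_continuous_on[OF S_holomorphic]])
      (use X in \<open>auto intro!: continuous_intros simp: Complex_eq\<close>)
  then have cont: "continuous_on {a..a + 2 * pi} (\<lambda>\<theta>. S (Complex X \<theta>) * cis (- (of_int (-1) * real n * \<theta>)))"
    by (intro continuous_intros)
  have "integral {a..a + 2 * pi} (\<lambda>\<theta>. S (Complex X \<theta>) * cis (- (of_int (-1) * real n * \<theta>))) =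
    2 * pi * (c n * of_real (exp (- (real n * X))))"
    using fourier_coefficient[OF _ s sm, of a n] LINT_Icc_eq_integral[OF cont]
    unfolding set_lebesgue_integral_def by simp
  moreover have "(\<lambda>\<theta>. S (Complex X \<theta>) * exp (of_nat n * Complex X \<theta>)) =
      (\<lambda>\<theta>. S (Complex X \<theta>) * cis (- (of_int (-1) * real n * \<theta>)) * of_real (exp (real n * X)))"
    by (rule ext) (simp add: cis_conv_exp exp_of_real[symmetric] exp_add[symmetric] Complex_eq algebra_simps)
  ultimately have "integral {a..a + 2 * pi} (\<lambda>y. S (Complex X y) * exp (of_nat n * Complex X y)) =
      2 * pi * (c n * of_real (exp (- (real n * X)))) * of_real (exp (real n * X))"
    by (simp only: integral_mult_left)
  also have "\<dots> = 2 * pi * c n * (of_real (exp (- (real n * X))) * of_real (exp (real n * X)))"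
    by (simp only: ac_simps)
  also have "of_real (exp (- (real n * X))) * of_real (exp (real n * X)) = (1 :: complex)"
    by (simp flip: of_real_mult exp_add)
  finally show ?thesis by simp
qed

text \<open>Of the vertical segment only the part with |Im \<zeta>| \<le> \<delta> is kept. The part
  from \<delta> to 2 \<pi> - \<delta> is pushed to the left onto two horizontal half-lines, along
  which x = exp (- \<zeta>) runs to infinity close to the positive axis. The weights
  \<open>w1\<close> and \<open>w2\<close> do not depend on n, as a multiplier requires.\<close>

lemma hankel_representation:
  assumes X: "X0 < X" and \<delta>: "0 < \<delta>" "\<delta> < pi"
  shows "\<exists>(w1 :: real \<Rightarrow> complex) w2 C. w1 \<in> borel_measurable borel \<and> w2 \<in> borel_measurable borel \<and>
    (\<forall>x. norm (w1 x) \<le> C * (1 + exp (- x))) \<and> (\<forall>x. norm (w2 x) \<le> C * (1 + exp (- x))) \<and>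
    (\<forall>n\<ge>2. 2 * pi * \<i> * c n =
       (LINT x|lborel. indicator {..X} x *\<^sub>R (w2 x * exp (of_nat n * Complex x (- \<delta>)))) -
       (LINT x|lborel. indicator {..X} x *\<^sub>R (w1 x * exp (of_nat n * Complex x \<delta>))) +
       \<i> * integral {- \<delta>..\<delta>} (\<lambda>y. S (Complex X y) * exp (of_nat n * Complex X y)))"
proof -
  obtain A where A: "\<And>y. 0 < y \<Longrightarrow> y < 2 * pi \<Longrightarrow> \<exists>A' \<eta> C. 0 < \<eta> \<and>
      A' holomorphic_on {\<zeta>. y - \<eta> < Im \<zeta> \<and> Im \<zeta> < y + \<eta>} \<and>
      (\<forall>\<zeta>. y - \<eta> < Im \<zeta> \<and> Im \<zeta> < y + \<eta> \<longrightarrow> norm (A' \<zeta>) \<le> C * (1 + exp (- Re \<zeta>))) \<and>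
      (\<forall>\<zeta>. y - \<eta> < Im \<zeta> \<and> Im \<zeta> < y + \<eta> \<and> X0 < Re \<zeta> \<longrightarrow> A' \<zeta> = S \<zeta>) \<and>
      (\<forall>\<zeta>. y - \<eta> < Im \<zeta> \<and> Im \<zeta> < y + \<eta> \<and> 0 < Im \<zeta> \<and> Im \<zeta> < 2 * pi \<longrightarrow> A' \<zeta> = A \<zeta>)"
    using global_continuation by blast
  have line: "(\<lambda>x. A (Complex x y)) \<in> borel_measurable borel \<and> (\<exists>C. \<forall>x. norm (A (Complex x y)) \<le> C * (1 + exp (- x)))"
    if y: "0 < y" "y < 2 * pi" for y
  proof -
    obtain A' \<eta> C where A': "0 < \<eta>" "A' holomorphic_on {\<zeta>. y - \<eta> < Im \<zeta> \<and> Im \<zeta> < y + \<eta>}"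
      "\<forall>\<zeta>. y - \<eta> < Im \<zeta> \<and> Im \<zeta> < y + \<eta> \<longrightarrow> norm (A' \<zeta>) \<le> C * (1 + exp (- Re \<zeta>))"
      "\<forall>\<zeta>. y - \<eta> < Im \<zeta> \<and> Im \<zeta> < y + \<eta> \<and> 0 < Im \<zeta> \<and> Im \<zeta> < 2 * pi \<longrightarrow> A' \<zeta> = A \<zeta>"
      using A[OF y] by (elim exE conjE)
    have eq: "A (Complex x y) = A' (Complex x y)" for x using A'(1,4) y by simp
    have "continuous_on UNIV (\<lambda>x. A' (Complex x y))" by (rule continuous_on_horizontal[OF A'(2)]) (use A'(1) in auto)
    then have "(\<lambda>x. A' (Complex x y)) \<in> borel_measurable borel" by (rule borel_measurable_continuous_onI)
    moreover have "norm (A' (Complex x y)) \<le> C * (1 + exp (- x))" for x using A'(1) A'(3)[rule_format, of "Complex x y"] by simp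
    ultimately show ?thesis unfolding eq by blast
  qed
  define I where "I n y = (LINT x|lborel. indicator {..X} x *\<^sub>R (A (Complex x y) * exp (of_nat n * Complex x y)))" for n y
  define s where "s n y = S (Complex X y) * exp (of_nat n * Complex X y)" for n y
  have s_cont: "continuous_on T (s n)" for n T
  proof -
    have "continuous_on T (\<lambda>y. S (Complex X y))"
      by (rule continuous_on_compose2[OF holomorphic_on_imp_continuous_on[OF S_holomorphic]])
        (use X in \<open>auto intro!: continuous_intros simp: Complex_eq\<close>)
    then show ?thesis unfolding s_def[abs_def] Complex_eq by (intro continuous_intros)
  qed
  have s_int: "s n integrable_on {a..b}" for n a b by (rule integrable_continuous_real[OF s_cont])
  have step: "I n hi - I n lo = \<i> * integral {lo..hi} (s n)"
    if y: "0 < y" "y < 2 * pi" and A': "0 < \<eta>" "A' holomorphic_on {\<zeta>. y - \<eta> < Im \<zeta> \<and> Im \<zeta> < y + \<eta>}"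
      "\<forall>\<zeta>. y - \<eta> < Im \<zeta> \<and> Im \<zeta> < y + \<eta> \<longrightarrow> norm (A' \<zeta>) \<le> C * (1 + exp (- Re \<zeta>))"
      "\<forall>\<zeta>. y - \<eta> < Im \<zeta> \<and> Im \<zeta> < y + \<eta> \<and> X0 < Re \<zeta> \<longrightarrow> A' \<zeta> = S \<zeta>"
      "\<forall>\<zeta>. y - \<eta> < Im \<zeta> \<and> Im \<zeta> < y + \<eta> \<and> 0 < Im \<zeta> \<and> Im \<zeta> < 2 * pi \<longrightarrow> A' \<zeta> = A \<zeta>"
    and lh: "y - \<eta> < lo" "lo \<le> hi" "hi < y + \<eta>" "0 < lo" "hi < 2 * pi" and n: "2 \<le> n" for y A' \<eta> C lo hi n
  proof -
    define h where "h \<zeta> = A' \<zeta> * exp (of_nat n * \<zeta>)" for \<zeta>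
    have "h holomorphic_on {\<zeta>. y - \<eta> < Im \<zeta> \<and> Im \<zeta> < y + \<eta>}"
      unfolding h_def by (intro holomorphic_intros A')
    \<comment> \<open>The continuation may grow like exp (- x) to the left; the factor exp (n x)
      turns this into decay like exp x once n \<ge> 2, which is the origin of that
      restriction.\<close>
    moreover have "norm (h (Complex x v)) \<le> \<bar>C\<bar> * (exp (real (n - 1) * X) + exp (real (n - 2) * X)) * exp x"
      if "lo \<le> v" "v \<le> hi" "x \<le> X" for x v
    proof -
      have "norm (A' (Complex x v)) \<le> C * (1 + exp (- x))" using A'(3)[rule_format, of "Complex x v"] that lh by simp
      also have "\<dots> \<le> \<bar>C\<bar> * (1 + exp (- x))" by (intro mult_right_mono) (auto intro: add_nonneg_nonneg)
      finally have "norm (h (Complex x v)) \<le> \<bar>C\<bar> * (1 + exp (- x)) * exp (real n * x)"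
        unfolding h_def norm_mult by (intro mult_mono) (auto simp: add_nonneg_nonneg)
      also have "\<dots> = \<bar>C\<bar> * (exp (real (n - 1) * x) + exp (real (n - 2) * x)) * exp x"
        using n by (simp add: of_nat_diff algebra_simps exp_add[symmetric])
      also have "\<dots> \<le> \<bar>C\<bar> * (exp (real (n - 1) * X) + exp (real (n - 2) * X)) * exp x"
        using that by (intro mult_right_mono mult_left_mono add_mono) (auto intro: mult_left_mono)
      finally show ?thesis .
    qed
    ultimately have "(LINT x|lborel. indicator {..X} x *\<^sub>R h (Complex x hi)) - (LINT x|lborel. indicator {..X} x *\<^sub>R h (Complex x lo)) =
       \<i> * integral {lo..hi} (\<lambda>v. h (Complex X v))"
      by (rule half_strip_integral[OF _ lh(1-3)])
    moreover have "h (Complex x v) = A (Complex x v) * exp (of_nat n * Complex x v)" if "lo \<le> v" "v \<le> hi" for x v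
      using A'(5)[rule_format, of "Complex x v"] that lh by (simp add: h_def)
    moreover have "integral {lo..hi} (\<lambda>v. h (Complex X v)) = integral {lo..hi} (s n)"
      using A'(4) lh X by (intro integral_cong) (simp add: h_def s_def)
    ultimately show ?thesis using lh unfolding I_def by simp
  qed
  have I_eq: "I n (2 * pi - \<delta>) - I n \<delta> = \<i> * integral {\<delta>..2 * pi - \<delta>} (s n)" if n: "2 \<le> n" for n
  proof -
    \<comment> \<open>The strips in which half-lines can be compared have no common width, so the
      equality is propagated from \<delta> to 2 \<pi> - \<delta> as local constancy on a connected
      interval.\<close>
    define E where "E y = I n y - \<i> * integral {\<delta>..y} (s n)" for y
    have "E \<delta> = E (2 * pi - \<delta>)"
    proof (rule connected_local_const[where A = "{\<delta>..2 * pi - \<delta>}"])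
      show "\<forall>y\<in>{\<delta>..2 * pi - \<delta>}. \<forall>\<^sub>F y' in at y within {\<delta>..2 * pi - \<delta>}. E y = E y'"
      proof
        fix y assume yd: "y \<in> {\<delta>..2 * pi - \<delta>}"
        then have y: "0 < y" "y < 2 * pi" using \<delta> by auto
        obtain A' \<eta> C where A': "0 < \<eta>" "A' holomorphic_on {\<zeta>. y - \<eta> < Im \<zeta> \<and> Im \<zeta> < y + \<eta>}"
          "\<forall>\<zeta>. y - \<eta> < Im \<zeta> \<and> Im \<zeta> < y + \<eta> \<longrightarrow> norm (A' \<zeta>) \<le> C * (1 + exp (- Re \<zeta>))"
          "\<forall>\<zeta>. y - \<eta> < Im \<zeta> \<and> Im \<zeta> < y + \<eta> \<and> X0 < Re \<zeta> \<longrightarrow> A' \<zeta> = S \<zeta>"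
          "\<forall>\<zeta>. y - \<eta> < Im \<zeta> \<and> Im \<zeta> < y + \<eta> \<and> 0 < Im \<zeta> \<and> Im \<zeta> < 2 * pi \<longrightarrow> A' \<zeta> = A \<zeta>"
          using A[OF y] by (elim exE conjE)
        have Eq: "E lo = E hi" if lh: "y - \<eta> < lo" "lo \<le> hi" "hi < y + \<eta>" "\<delta> \<le> lo" "hi \<le> 2 * pi - \<delta>" for lo hi
        proof -
          have "I n hi - I n lo = \<i> * integral {lo..hi} (s n)"
            by (rule step[OF y A' lh(1-3) _ _ n]) (use lh \<delta> in auto)
          moreover have "integral {\<delta>..lo} (s n) + integral {lo..hi} (s n) = integral {\<delta>..hi} (s n)"
            by (rule Henstock_Kurzweil_Integration.integral_combine[OF lh(4,2) s_int])
          ultimately show ?thesis unfolding E_def by (simp add: algebra_simps flip: distrib_left)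
        qed
        show "\<forall>\<^sub>F y' in at y within {\<delta>..2 * pi - \<delta>}. E y = E y'"
          unfolding eventually_at
        proof (rule exI[of _ \<eta>], intro conjI ballI impI A'(1))
          fix y' assume "y' \<in> {\<delta>..2 * pi - \<delta>}" "y' \<noteq> y \<and> dist y' y < \<eta>"
          then show "E y = E y'" using Eq[of y y'] Eq[of y' y] yd A'(1) by (cases "y \<le> y'") (auto simp: dist_real_def)
        qed
      qed
    qed (use \<delta> in auto)
    then show ?thesis unfolding E_def by (simp add: algebra_simps)
  qed
  define w1 where "w1 x = A (Complex x \<delta>)" for x
  define w2 where "w2 x = A (Complex x (2 * pi - \<delta>))" for x
  have "0 < \<delta>" "\<delta> < 2 * pi" "0 < 2 * pi - \<delta>" "2 * pi - \<delta> < 2 * pi" using \<delta> by auto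
  note L = line[OF this(1,2)] line[OF this(3,4)]
  obtain C1 C2 where C12: "\<And>x. norm (w1 x) \<le> C1 * (1 + exp (- x))" "\<And>x. norm (w2 x) \<le> C2 * (1 + exp (- x))"
    using L unfolding w1_def w2_def by blast
  have e0: "0 \<le> 1 + exp (- x)" for x :: real by (simp add: add_nonneg_nonneg)
  show ?thesis
  proof (rule exI[of _ w1], rule exI[of _ w2], rule exI[of _ "max C1 C2"], intro conjI allI impI)
    show "w1 \<in> borel_measurable borel" "w2 \<in> borel_measurable borel"
      using L unfolding w1_def[abs_def] w2_def[abs_def] by blast+
    show "norm (w1 x) \<le> max C1 C2 * (1 + exp (- x))" "norm (w2 x) \<le> max C1 C2 * (1 + exp (- x))" for x
      by (rule order_trans[OF C12(1)] order_trans[OF C12(2)], rule mult_right_mono[OF _ e0], simp)+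
    fix n :: nat assume n: "2 \<le> n"
    have "integral {- \<delta>..- \<delta> + 2 * pi} (s n) = 2 * pi * c n"
      unfolding s_def[abs_def] by (rule coefficient_vertical[OF X])
    moreover have "integral {- \<delta>..\<delta>} (s n) + integral {\<delta>..- \<delta> + 2 * pi} (s n) = integral {- \<delta>..- \<delta> + 2 * pi} (s n)"
      by (rule Henstock_Kurzweil_Integration.integral_combine[OF _ _ s_int]) (use \<delta> in auto)
    ultimately have "2 * pi * c n = integral {- \<delta>..\<delta>} (s n) + integral {\<delta>..2 * pi - \<delta>} (s n)" by simp
    then have "2 * pi * \<i> * c n = \<i> * integral {- \<delta>..\<delta>} (s n) + \<i> * integral {\<delta>..2 * pi - \<delta>} (s n)"
      by (metis (no_types, lifting) distrib_left mult.assoc mult.commute)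
    also have "\<dots> = I n (2 * pi - \<delta>) - I n \<delta> + \<i> * integral {- \<delta>..\<delta>} (s n)"
      unfolding I_eq[OF n] by (rule add.commute)
    also have "I n (2 * pi - \<delta>) = (LINT x|lborel. indicator {..X} x *\<^sub>R (w2 x * exp (of_nat n * Complex x (- \<delta>))))"
    proof -
      \<comment> \<open>For natural n the exponential has period 2 \<pi> i, so the upper half-line
        counts as one with the small argument - \<delta>.\<close>
      have "exp (of_nat n * Complex x (2 * pi - \<delta>)) = exp (of_nat n * Complex x (- \<delta>))" for x
      proof -
        have "of_nat n * Complex x (2 * pi - \<delta>) = of_nat n * Complex x (- \<delta>) + 2 * of_nat n * pi * \<i>"
          by (simp add: Complex_eq algebra_simps)
        then show ?thesis using exp_integer_2pi[of "of_nat n"] by (simp add: exp_add mult.commute mult.left_commute)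
      qed
      then show ?thesis unfolding I_def w2_def by simp
    qed
    also have "I n \<delta> = (LINT x|lborel. indicator {..X} x *\<^sub>R (w1 x * exp (of_nat n * Complex x \<delta>)))"
      unfolding I_def w1_def ..
    finally show "2 * pi * \<i> * c n =
       (LINT x|lborel. indicator {..X} x *\<^sub>R (w2 x * exp (of_nat n * Complex x (- \<delta>)))) -
       (LINT x|lborel. indicator {..X} x *\<^sub>R (w1 x * exp (of_nat n * Complex x \<delta>))) +
       \<i> * integral {- \<delta>..\<delta>} (\<lambda>y. S (Complex X y) * exp (of_nat n * Complex X y))"
      unfolding s_def[abs_def] .
  qed
qed

text \<open>Each of the three pieces of the contour is an average with \<kappa> = exp (L \<zeta>),
  so that the power \<kappa>^j is the exponential belonging to the index L j. The arguments are at
  most L \<delta>, and the moduli at most exp (L X) because the contour stays in Re \<zeta> \<le>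
  X.\<close>

lemma dir_summable_multiplier:
  fixes u :: "nat \<Rightarrow> complex^'n \<Rightarrow> complex"
  assumes k: "0 < k" and L: "1 \<le> L" and u: "dir_summable k d u"
  shows "dir_summable k d (\<lambda>j z. c (L * j) * u j z)"
proof -
  have k0: "0 \<le> k" using k by simp
  obtain \<epsilon> where e: "0 < \<epsilon>" "\<epsilon> < 2 * pi" "sector_summable k d \<epsilon> u" using u unfolding dir_summable_def by blast
  \<comment> \<open>The bound \<epsilon> / (8 L) keeps the arguments L \<delta> of \<kappa> small
    compared with the opening; the bound 1 ensures \<delta> < \<pi>.\<close>
  define \<delta> where "\<delta> = min 1 (\<epsilon> / (8 * real L))"
  have \<delta>: "0 < \<delta>" "\<delta> < pi" using e L pi_gt3 by (auto simp: \<delta>_def)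
  have L\<delta>: "real L * \<delta> \<le> \<epsilon> / 8"
  proof -
    have "real L * \<delta> \<le> real L * (\<epsilon> / (8 * real L))" unfolding \<delta>_def by (intro mult_left_mono) auto
    then show ?thesis using L by simp
  qed
  define X where "X = X0 + 1"
  have X: "X0 < X" by (simp add: X_def)
  obtain w1 w2 C where w: "w1 \<in> borel_measurable borel" "w2 \<in> borel_measurable borel"
    and wb: "\<forall>x. norm (w1 x) \<le> C * (1 + exp (- x))" "\<forall>x. norm (w2 x) \<le> C * (1 + exp (- x))"
    and c_eq: "\<forall>n\<ge>2. 2 * pi * \<i> * c n =
       (LINT x|lborel. indicator {..X} x *\<^sub>R (w2 x * exp (of_nat n * Complex x (- \<delta>)))) -
       (LINT x|lborel. indicator {..X} x *\<^sub>R (w1 x * exp (of_nat n * Complex x \<delta>))) +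
       \<i> * integral {- \<delta>..\<delta>} (\<lambda>y. S (Complex X y) * exp (of_nat n * Complex X y))"
    using hankel_representation[OF X \<delta>] by (elim exE conjE)
  note wb = wb[rule_format] and c_eq = c_eq[rule_format]
  have ray: "sector_summable k d (\<epsilon> / 2) (\<lambda>j z. (a * (LINT x|lborel. indicator {..X} x *\<^sub>R (v x * exp (of_nat (L * j) * Complex x s)))) * u j z)"
    if v [measurable]: "v \<in> borel_measurable borel" and vb: "\<And>x. norm (v x) \<le> C * (1 + exp (- x))" and s: "\<bar>s\<bar> = \<delta>"
    for v :: "real \<Rightarrow> complex" and s and a :: complex
  proof -
    define \<kappa> where "\<kappa> x = indicator {..X} x *\<^sub>R exp (of_nat L * Complex x s)" for x
    define w where "w x = a * (indicator {..X} x *\<^sub>R v x)" for x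
    have m: "(\<lambda>x. exp (of_nat L * Complex x s)) \<in> borel_measurable borel"
      unfolding Complex_eq by (intro borel_measurable_continuous_onI continuous_intros)
    have [measurable]: "\<kappa> \<in> borel_measurable borel" "w \<in> borel_measurable borel"
      unfolding \<kappa>_def[abs_def] w_def[abs_def]
      by (intro borel_measurable_scaleR borel_measurable_times borel_measurable_indicator borel_measurable_const m v; simp)+
    have \<kappa>n: "norm (\<kappa> x) = indicator {..X} x * exp (real L * x)" for x by (simp add: \<kappa>_def)
    show ?thesis
    proof (rule sector_summable_average[OF k e(3), where M = "lborel :: real measure" and J = 2 and \<kappa> = \<kappa> and w = w
          and C = "exp (real L * X)" and \<eta> = "real L * \<delta>"])
      let ?g = "\<lambda>x. norm a * \<bar>C\<bar> * (indicator {..X} x * exp (2 * real L * x) + indicator {..X} x * exp ((2 * real L - 1) * x))"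
      show "integrable lborel (\<lambda>x. norm (\<kappa> x) ^ 2 * norm (w x))"
      proof (rule Bochner_Integration.integrable_bound[of _ ?g])
        show "integrable lborel ?g"
          using L by (intro integrable_mult_right Bochner_Integration.integrable_add integrable_exp_atMost(1)) auto
        show "AE x in lborel. norm (norm (\<kappa> x) ^ 2 * norm (w x)) \<le> norm (?g x)"
        proof (rule AE_I2)
          fix x
          have "norm (v x) \<le> \<bar>C\<bar> * (1 + exp (- x))"
            using vb[of x] by (rule order_trans) (auto intro!: mult_right_mono simp: add_nonneg_nonneg)
          then have "exp (real L * x) ^ 2 * (norm a * norm (v x)) \<le> exp (real L * x) ^ 2 * (norm a * (\<bar>C\<bar> * (1 + exp (- x))))"
            by (intro mult_left_mono) auto
          also have "\<dots> = norm a * \<bar>C\<bar> * (exp (2 * real L * x) + exp ((2 * real L - 1) * x))"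
            by (simp add: power2_eq_square algebra_simps exp_add[symmetric])
          finally show "norm (norm (\<kappa> x) ^ 2 * norm (w x)) \<le> norm (?g x)"
            unfolding \<kappa>n w_def by (simp add: norm_mult indicator_def)
        qed
      qed measurable
      show "norm (\<kappa> x) \<le> exp (real L * X)" for x unfolding \<kappa>n by (simp add: indicator_def mult_left_mono)
      show "\<exists>b. \<bar>b\<bar> \<le> real L * \<delta> \<and> \<kappa> x = of_real (norm (\<kappa> x)) * cis b" for x
      proof (intro exI conjI)
        show "\<bar>real L * s\<bar> \<le> real L * \<delta>" using s by (simp add: abs_mult)
        show "\<kappa> x = of_real (norm (\<kappa> x)) * cis (real L * s)"
          unfolding \<kappa>n by (simp add: \<kappa>_def indicator_def cis_conv_exp exp_of_real[symmetric] exp_add[symmetric] Complex_eq algebra_simps)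
      qed
      show "\<epsilon> / 2 + 2 * (real L * \<delta>) \<le> \<epsilon>" using L\<delta> e by linarith
      fix j :: nat
      have "(\<lambda>x. \<kappa> x ^ j * w x) = (\<lambda>x. a * (indicator {..X} x *\<^sub>R (v x * exp (of_nat (L * j) * Complex x s))))"
        by (rule ext) (simp add: \<kappa>_def w_def indicator_def exp_of_nat_mult[symmetric] mult_ac)
      then show "a * (LINT x|lborel. indicator {..X} x *\<^sub>R (v x * exp (of_nat (L * j) * Complex x s))) = (LINT x|lborel. \<kappa> x ^ j * w x)"
        by (simp only: integral_mult_right_zero)
    qed simp_all
  qed
  define l1 where "l1 j = 1 / (2 * pi * \<i>) * (LINT x|lborel. indicator {..X} x *\<^sub>R (w2 x * exp (of_nat (L * j) * Complex x (- \<delta>))))" for j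
  define l2 where "l2 j = (- 1 / (2 * pi * \<i>)) * (LINT x|lborel. indicator {..X} x *\<^sub>R (w1 x * exp (of_nat (L * j) * Complex x \<delta>)))" for j
  have 1: "sector_summable k d (\<epsilon> / 2) (\<lambda>j z. l1 j * u j z)"
    unfolding l1_def by (rule ray[OF w(2) wb(2)]) (use \<delta> in simp)
  have 2: "sector_summable k d (\<epsilon> / 2) (\<lambda>j z. l2 j * u j z)"
    unfolding l2_def by (rule ray[OF w(1) wb(1)]) (use \<delta> in simp)
  \<comment> \<open>Taking the remainder as third multiplier makes the three add up to
    \<open>c (L * j)\<close> for every j. Its integral form is required from j = 2 on only, where
    the contour formula is available.\<close>
  have 3: "sector_summable k d (\<epsilon> / 2) (\<lambda>j z. (c (L * j) - l1 j - l2 j) * u j z)"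
  proof -
    have Sc: "continuous_on UNIV (\<lambda>y. S (Complex X y))"
      by (rule continuous_on_compose2[OF holomorphic_on_imp_continuous_on[OF S_holomorphic]])
        (use X in \<open>auto intro!: continuous_intros simp: Complex_eq\<close>)
    define \<kappa> where "\<kappa> y = indicator {- \<delta>..\<delta>} y *\<^sub>R exp (of_nat L * Complex X y)" for y
    define w where "w y = indicator {- \<delta>..\<delta>} y *\<^sub>R (S (Complex X y) / (2 * pi))" for y
    have m: "(\<lambda>y. exp (of_nat L * Complex X y)) \<in> borel_measurable borel" "(\<lambda>y. S (Complex X y)) \<in> borel_measurable borel"
      unfolding Complex_eq using Sc[unfolded Complex_eq] by (auto intro!: borel_measurable_continuous_onI continuous_intros)
    have [measurable]: "\<kappa> \<in> borel_measurable borel" "w \<in> borel_measurable borel"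
      unfolding \<kappa>_def[abs_def] w_def[abs_def]
      by (intro borel_measurable_scaleR borel_measurable_divide borel_measurable_indicator borel_measurable_const m; simp)+
    have \<kappa>n: "norm (\<kappa> y) = indicator {- \<delta>..\<delta>} y * exp (real L * X)" for y by (simp add: \<kappa>_def)
    show ?thesis
    proof (rule sector_summable_average[OF k e(3), where M = "lborel :: real measure" and J = 2 and \<kappa> = \<kappa> and w = w
          and C = "exp (real L * X)" and \<eta> = "real L * \<delta>"])
      have "integrable lborel (\<lambda>y. indicator {- \<delta>..\<delta>} y *\<^sub>R (exp (real L * X) ^ 2 * norm (S (Complex X y) / (2 * pi))))"
        unfolding set_integrable_def[symmetric]
        by (intro borel_integrable_atLeastAtMost' continuous_on_mult continuous_on_const continuous_on_norm
            continuous_on_divide continuous_on_subset[OF Sc]) auto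
      moreover have "(\<lambda>y. norm (\<kappa> y) ^ 2 * norm (w y)) = (\<lambda>y. indicator {- \<delta>..\<delta>} y *\<^sub>R (exp (real L * X) ^ 2 * norm (S (Complex X y) / (2 * pi))))"
        unfolding \<kappa>n w_def by (auto simp: fun_eq_iff indicator_def)
      ultimately show "integrable lborel (\<lambda>y. norm (\<kappa> y) ^ 2 * norm (w y))" by (simp only:)
      show "norm (\<kappa> y) \<le> exp (real L * X)" for y unfolding \<kappa>n by (simp add: indicator_def)
      show "\<exists>b. \<bar>b\<bar> \<le> real L * \<delta> \<and> \<kappa> y = of_real (norm (\<kappa> y)) * cis b" for y
      proof (cases "y \<in> {- \<delta>..\<delta>}")
        case True
        show ?thesis
        proof (intro exI conjI)
          show "\<bar>real L * y\<bar> \<le> real L * \<delta>" using True by (auto simp: abs_mult intro!: mult_left_mono)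
          show "\<kappa> y = of_real (norm (\<kappa> y)) * cis (real L * y)"
            unfolding \<kappa>n by (simp add: \<kappa>_def indicator_def cis_conv_exp exp_of_real[symmetric] exp_add[symmetric] Complex_eq algebra_simps)
        qed
      qed (use \<delta> in \<open>auto simp: \<kappa>_def intro!: exI[of _ 0]\<close>)
      show "\<epsilon> / 2 + 2 * (real L * \<delta>) \<le> \<epsilon>" using L\<delta> e by linarith
      fix j :: nat assume j: "2 \<le> j"
      have n: "2 \<le> L * j" using mult_le_mono[OF L j] by simp
      have cont: "continuous_on {- \<delta>..\<delta>} (\<lambda>y. S (Complex X y) * exp (of_nat (L * j) * Complex X y))"
        unfolding Complex_eq
        by (intro continuous_intros continuous_on_subset[OF Sc[unfolded Complex_eq]] subset_UNIV)
      have "(LINT y|lborel. \<kappa> y ^ j * w y) = (LINT y|lborel. (1 / (2 * pi)) * (indicator {- \<delta>..\<delta>} y *\<^sub>R (S (Complex X y) * exp (of_nat (L * j) * Complex X y))))"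
        by (rule Bochner_Integration.integral_cong)
          (simp_all add: \<kappa>_def w_def indicator_def exp_of_nat_mult[symmetric] mult_ac)
      also have "\<dots> = 1 / (2 * pi) * integral {- \<delta>..\<delta>} (\<lambda>y. S (Complex X y) * exp (of_nat (L * j) * Complex X y))"
        unfolding LINT_Icc_eq_integral[OF cont, symmetric] by (rule integral_mult_right_zero)
      finally have I3: "(LINT y|lborel. \<kappa> y ^ j * w y) = 1 / (2 * pi) * integral {- \<delta>..\<delta>} (\<lambda>y. S (Complex X y) * exp (of_nat (L * j) * Complex X y))" .
      have "c (L * j) = 1 / (2 * pi * \<i>) * (2 * pi * \<i> * c (L * j))" by simp
      also have "\<dots> = l1 j + l2 j + (LINT y|lborel. \<kappa> y ^ j * w y)"
        unfolding c_eq[OF n] l1_def l2_def I3 by (simp add: field_simps)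
      finally show "c (L * j) - l1 j - l2 j = (LINT y|lborel. \<kappa> y ^ j * w y)" by simp
    qed simp_all
  qed
  from sector_summable_add[OF k0 sector_summable_add[OF k0 1 2] 3]
  have "sector_summable k d (\<epsilon> / 2) (\<lambda>j z. c (L * j) * u j z)" by (simp add: algebra_simps)
  then show ?thesis unfolding dir_summable_def using e by (intro exI[of _ "\<epsilon> / 2"]) auto
qed

end

section \<open>Moments of kernel functions\<close>

lemma strip_integral_shift_zero:
  assumes h: "h holomorphic_on {\<zeta>. - a < Im \<zeta> \<and> Im \<zeta> < a}" and \<theta>: "\<bar>\<theta>\<bar> < a"
    and bnd: "\<And>x y. \<bar>y\<bar> \<le> \<bar>\<theta>\<bar> \<Longrightarrow> norm (h (Complex x y)) \<le> g x"
    and g: "integrable lborel g" "(g \<longlongrightarrow> 0) at_top" "(g \<longlongrightarrow> 0) at_bot"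
  shows "(LINT x|lborel. h (Complex x \<theta>)) = (LINT x|lborel. h (Complex x 0))"
proof (cases "0 \<le> \<theta>")
  case True
  show ?thesis by (rule strip_integral_shift[OF h _ _ _ _ g]) (use True \<theta> bnd in auto)
next
  case False
  have "(LINT x|lborel. h (Complex x 0)) = (LINT x|lborel. h (Complex x \<theta>))"
    by (rule strip_integral_shift[OF h _ _ _ _ g]) (use False \<theta> bnd in auto)
  then show ?thesis ..
qed

text \<open>The derivative of exp has modulus at most 1 on the closed left half-plane, which is
  convex.\<close>

lemma norm_exp_minus_1_le:
  assumes "Re w \<le> 0"
  shows "norm (exp w - 1) \<le> norm w"
proof -
  have "norm (exp w - exp 0) \<le> 1 * norm (w - 0)"
  proof (rule field_differentiable_bound[where S = "{z. Re z \<le> 0}" and f' = exp])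
    show "convex {z. Re z \<le> 0}" by (rule convex_halfspace_Re_le)
    show "(exp has_field_derivative exp z) (at z within {z. Re z \<le> 0})" for z
      by (rule has_field_derivative_at_within[OF DERIV_exp])
  qed (use assms in auto)
  then show ?thesis by simp
qed

text \<open>Basic kernels only, so K > 1/2; kernels of general order are reduced to these by
  \<open>kmoment_root_kernel\<close>.\<close>

locale kernel =
  fixes K :: real and e :: "complex \<Rightarrow> complex"
  assumes basic: "basic_kernel K e"
begin

lemma K_gt: "1 / 2 < K" and K_pos: "0 < K"
  using basic unfolding basic_kernel_def by auto

lemma exp_in_sector: "\<bar>Im \<xi>\<bar> < \<epsilon> / 2 \<Longrightarrow> exp \<xi> \<in> sector 0 \<epsilon>"
proof -
  assume "\<bar>Im \<xi>\<bar> < \<epsilon> / 2"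
  moreover have "exp \<xi> = of_real (norm (exp \<xi>)) * cis (Im \<xi>)"
    unfolding norm_exp_eq_Re by (rule exp_eq_polar)
  ultimately have "\<bar>Im \<xi> - 0\<bar> < \<epsilon> / 2 \<and> exp \<xi> = of_real (norm (exp \<xi>)) * cis (Im \<xi>)"
    by (simp only: diff_zero simp_thms)
  then have "\<exists>\<theta>. \<bar>\<theta> - 0\<bar> < \<epsilon> / 2 \<and> exp \<xi> = of_real (norm (exp \<xi>)) * cis \<theta>" by (rule exI[of _ "Im \<xi>"])
  then show ?thesis unfolding sector_def by (intro CollectI conjI exp_not_eq_zero)
qed

lemma holomorphic_log: "(\<lambda>\<xi>. e (exp \<xi>)) holomorphic_on {\<xi>. - (pi / (2 * K)) < Im \<xi> \<and> Im \<xi> < pi / (2 * K)}"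
proof -
  have "e holomorphic_on sector 0 (pi / K)" using basic unfolding basic_kernel_def by blast
  then show ?thesis
    by (rule holomorphic_on_compose_gen[of exp, unfolded o_def, rotated])
      (auto intro!: holomorphic_intros exp_in_sector simp: abs_less_iff)
qed

lemma flat:
  assumes "\<tau> < pi / (2 * K)"
  shows "\<exists>A c. 0 < A \<and> 0 < c \<and> (\<forall>\<xi>. \<bar>Im \<xi>\<bar> \<le> \<tau> \<longrightarrow> norm (e (exp \<xi>)) \<le> A * exp (- c * exp (K * Re \<xi>)))"
proof -
  \<comment> \<open>Half of the angle left between 2 \<tau> and the full opening \<pi> / K, so that
    the closed strip lies inside the narrower sector.\<close>
  define \<delta> where "\<delta> = (pi / K - 2 * \<tau>) / 2"
  have \<delta>: "0 < \<delta>" "\<tau> < (pi / K - \<delta>) / 2" using assms K_pos by (auto simp: \<delta>_def field_simps)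
  obtain A B where AB: "0 < A" "0 < B" "\<forall>z\<in>sector 0 (pi / K - \<delta>). norm (e z) \<le> A * exp (- ((norm z / B) powr K))"
    using basic \<delta>(1) unfolding basic_kernel_def by blast
  have b: "norm (e (exp \<xi>)) \<le> A * exp (- (B powr (- K)) * exp (K * Re \<xi>))" if "\<bar>Im \<xi>\<bar> \<le> \<tau>" for \<xi>
  proof -
    have "exp \<xi> \<in> sector 0 (pi / K - \<delta>)" using that \<delta>(2) by (intro exp_in_sector) auto
    then have "norm (e (exp \<xi>)) \<le> A * exp (- ((norm (exp \<xi>) / B) powr K))" using AB(3) by blast
    also have "(norm (exp \<xi>) / B) powr K = B powr (- K) * exp (K * Re \<xi>)"
      using AB(2) by (simp add: powr_divide powr_minus exp_powr_real mult.commute divide_simps)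
    finally show ?thesis by simp
  qed
  show ?thesis
    by (rule exI[of _ A], rule exI[of _ "B powr (- K)"], intro conjI allI impI) (use AB(1,2) b in auto)
qed

definition moment :: "real \<Rightarrow> complex" where
  "moment a = (LINT \<xi>|lborel. exp (of_real a * of_real \<xi>) * e (exp (of_real \<xi>)))"

text \<open>Rotating the ray of integration within the sector of flatness is a vertical shift in the
  logarithmic variable. Flatness controls the right end, the factor exp (a x) the left one, whence a
  > 0.\<close>

lemma ray_integral:
  assumes a: "0 < a" and \<theta>: "\<bar>\<theta>\<bar> < pi / (2 * K)"
  shows "(LINT x|lborel. exp (of_real a * Complex x \<theta>) * e (exp (Complex x \<theta>))) = moment a"
proof -
  obtain A c where Ac: "0 < A" "0 < c" "\<forall>\<xi>. \<bar>Im \<xi>\<bar> \<le> \<bar>\<theta>\<bar> \<longrightarrow> norm (e (exp \<xi>)) \<le> A * exp (- c * exp (K * Re \<xi>))"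
    using flat[OF \<theta>] by (elim exE conjE)
  have "(LINT x|lborel. exp (of_real a * Complex x \<theta>) * e (exp (Complex x \<theta>))) =
      (LINT x|lborel. exp (of_real a * Complex x 0) * e (exp (Complex x 0)))"
  proof (rule strip_integral_shift_zero[where h = "\<lambda>\<xi>. exp (of_real a * \<xi>) * e (exp \<xi>)" and a = "pi / (2 * K)"
        and g = "\<lambda>x. A * (exp (a * x) * exp (- c * exp (K * x)))"])
    show "(\<lambda>\<xi>. exp (of_real a * \<xi>) * e (exp \<xi>)) holomorphic_on {\<xi>. - (pi / (2 * K)) < Im \<xi> \<and> Im \<xi> < pi / (2 * K)}"
      by (intro holomorphic_intros holomorphic_log)
    show "norm (exp (of_real a * Complex x y) * e (exp (Complex x y))) \<le> A * (exp (a * x) * exp (- c * exp (K * x)))"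
      if "\<bar>y\<bar> \<le> \<bar>\<theta>\<bar>" for x y
      using mult_left_mono[OF Ac(3)[rule_format, of "Complex x y"], of "exp (a * x)"] that by (simp add: norm_mult mult_ac)
    show "integrable lborel (\<lambda>x. A * (exp (a * x) * exp (- c * exp (K * x))))"
      by (intro integrable_mult_right double_exponential_integral a Ac K_pos)
    show "((\<lambda>x. A * (exp (a * x) * exp (- c * exp (K * x)))) \<longlongrightarrow> 0) at_top"
      "((\<lambda>x. A * (exp (a * x) * exp (- c * exp (K * x)))) \<longlongrightarrow> 0) at_bot"
      using double_exponential_tendsto[OF a Ac(2) K_pos] by (auto intro: tendsto_mult_right_zero)
  qed (rule \<theta>)
  also have "\<dots> = moment a" unfolding moment_def by (simp only: complex_of_real_def)
  finally show ?thesis .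
qed

lemma kernel_real: "e (exp (of_real x)) = of_real (Re (e (exp (of_real x))))" and kernel_pos: "0 < Re (e (exp (of_real x)))"
proof -
  have *: "\<forall>x::real. x > 0 \<longrightarrow> e (of_real x) \<in> \<real> \<and> Re (e (of_real x)) > 0"
    using basic unfolding basic_kernel_def by blast
  then have "e (of_real (exp x)) \<in> \<real>" "Re (e (of_real (exp x))) > 0" by simp_all
  then show "e (exp (of_real x)) = of_real (Re (e (exp (of_real x))))" "0 < Re (e (exp (of_real x)))"
    by (simp_all add: exp_of_real)
qed

lemma moment_real:
  assumes a: "0 < a"
  shows "integrable lborel (\<lambda>x. exp (a * x) * Re (e (exp (of_real x))))"
    and "moment a = of_real (LINT x|lborel. exp (a * x) * Re (e (exp (of_real x))))"
    and "0 < (LINT x|lborel. exp (a * x) * Re (e (exp (of_real x))))"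
proof -
  obtain A c where Ac: "0 < A" "0 < c" "\<forall>\<xi>. \<bar>Im \<xi>\<bar> \<le> 0 \<longrightarrow> norm (e (exp \<xi>)) \<le> A * exp (- c * exp (K * Re \<xi>))"
    using flat[of 0] K_pos by (auto simp: divide_simps)
  have c: "continuous_on UNIV (\<lambda>x. e (exp (Complex x 0)))"
    by (rule continuous_on_horizontal[OF holomorphic_log]) (use K_pos in auto)
  have C0: "Complex x 0 = of_real x" for x by (simp add: complex_eq_iff)
  have [measurable]: "(\<lambda>x. e (exp (of_real x))) \<in> borel_measurable borel"
    using borel_measurable_continuous_onI[OF c] unfolding C0 .
  show int: "integrable lborel (\<lambda>x. exp (a * x) * Re (e (exp (of_real x))))"
  proof (rule Bochner_Integration.integrable_bound)
    show "integrable lborel (\<lambda>x. A * (exp (a * x) * exp (- c * exp (K * x))))"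
      by (intro integrable_mult_right double_exponential_integral a Ac K_pos)
    show "AE x in lborel. norm (exp (a * x) * Re (e (exp (of_real x)))) \<le> norm (A * (exp (a * x) * exp (- c * exp (K * x))))"
    proof (rule AE_I2)
      fix x :: real
      have "\<bar>Re (e (exp (of_real x)))\<bar> \<le> A * exp (- c * exp (K * x))"
        using Ac(3)[rule_format, of "of_real x"] abs_Re_le_cmod[of "e (exp (of_real x))"] by simp
      from mult_left_mono[OF this, of "exp (a * x)"]
      show "norm (exp (a * x) * Re (e (exp (of_real x)))) \<le> norm (A * (exp (a * x) * exp (- c * exp (K * x))))"
        using Ac(1) by (simp add: abs_mult mult_ac)
    qed
  qed measurable
  have "exp (of_real a * of_real x) * e (exp (of_real x)) = of_real (exp (a * x) * Re (e (exp (of_real x))))" for x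
  proof -
    have "exp (of_real a * of_real x) = (of_real (exp (a * x)) :: complex)"
      using exp_of_real[of "a * x", where 'a = complex] by simp
    then show ?thesis by (subst kernel_real) simp
  qed
  then show "moment a = of_real (LINT x|lborel. exp (a * x) * Re (e (exp (of_real x))))"
    unfolding moment_def by (simp only: integral_complex_of_real)
  have pos: "0 < exp (a * x) * Re (e (exp (of_real x)))" for x using kernel_pos[of x] by simp
  show "0 < (LINT x|lborel. exp (a * x) * Re (e (exp (of_real x))))"
  proof (rule ccontr)
    assume "\<not> ?thesis"
    moreover have "0 \<le> (LINT x|lborel. exp (a * x) * Re (e (exp (of_real x))))"
      using pos by (intro Bochner_Integration.integral_nonneg) (auto intro: less_imp_le)
    ultimately have "(LINT x|lborel. exp (a * x) * Re (e (exp (of_real x)))) = 0" by linarith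
    then have "AE x in lborel. exp (a * x) * Re (e (exp (of_real x))) = 0"
      using integral_nonneg_eq_0_iff_AE[OF int] pos by (auto intro: less_imp_le)
    then have "AE x in (lborel :: real measure). False"
      by eventually_elim (use pos in \<open>auto simp: less_le\<close>)
    then have "emeasure lborel (UNIV :: real set) = 0" by (simp add: AE_iff_measurable[OF _ refl])
    then show False by simp
  qed
qed

text \<open>The substitution x = exp \<xi> on the positive axis. Index 0 is left out, since there
  the factor that gives decay for \<xi> towards minus infinity is missing.\<close>

lemma kmoment_eq:
  assumes n: "0 < n"
  shows "moment (real n) = of_real (kmoment e n)" and "0 < kmoment e n"
proof -
  note m = moment_real[of "real n"]
  define I where "I = (LINT x|lborel. exp (real n * x) * Re (e (exp (of_real x))))"
  define f where "f x = x powr (real n - 1) * Re (e (of_real x))" for x :: real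
  have sub: "\<bar>exp x\<bar> * f (exp x) = exp (real n * x) * Re (e (exp (of_real x)))" for x
  proof -
    have "exp x * exp x powr (real n - 1) = exp (real n * x)"
      by (simp add: exp_powr_real exp_add[symmetric] algebra_simps)
    then show ?thesis by (simp add: f_def exp_of_real flip: mult.assoc)
  qed
  have int: "integrable lborel (\<lambda>x. \<bar>exp x\<bar> * f (exp x))" unfolding sub using m(1) n by simp
  then have "(\<lambda>x. \<bar>exp x\<bar> * f (exp x)) absolutely_integrable_on UNIV"
    using integrable_completion[of "\<lambda>x. \<bar>exp x\<bar> * f (exp x)" lborel] by (simp add: set_integrable_def)
  moreover have "integral UNIV (\<lambda>x. \<bar>exp x\<bar> * f (exp x)) = I"
    using integral_lborel[OF int] unfolding sub I_def by simp
  moreover have "range exp = {0 :: real<..}"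
    by (auto simp: image_iff) (metis exp_ln)
  ultimately have "integral {0<..} f = I"
    using has_absolute_integral_change_of_variables_1'[of UNIV exp exp f I]
    by (simp add: inj_on_def DERIV_exp)
  then have "kmoment e n = I" by (simp add: kmoment_def f_def[abs_def])
  then show "moment (real n) = of_real (kmoment e n)" "0 < kmoment e n" using m(2,3) n by (simp_all add: I_def)
qed

end

lemma cos_nonpos_between: "pi / 2 \<le> x \<Longrightarrow> x \<le> 3 * pi / 2 \<Longrightarrow> cos x \<le> 0"
proof -
  assume "pi / 2 \<le> x" "x \<le> 3 * pi / 2"
  then have "0 \<le> cos (x - pi)" by (intro cos_ge_zero) auto
  then show ?thesis by (simp add: cos_diff)
qed

section \<open>Continuation of the series of moments divided by factorials\<close>

context kernel
begin

lemma ray_measurable: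
  assumes "\<bar>\<theta>\<bar> < pi / (2 * K)"
  shows "(\<lambda>x. e (exp (Complex x \<theta>))) \<in> borel_measurable borel"
  by (rule borel_measurable_continuous_onI[OF continuous_on_horizontal[OF holomorphic_log]]) (use assms in auto)

lemma moment_bound:
  assumes a: "0 < a" and A: "\<And>x. norm (e (exp (of_real x))) \<le> A * exp (- c * exp (K * x))" and c: "0 < c"
  shows "norm (moment a) \<le> A * (Gamma (a / K) / (K * c powr (a / K)))"
proof -
  have "norm (moment a) \<le> (LINT x|lborel. norm (exp (of_real a * of_real x) * e (exp (of_real x))))"
    unfolding moment_def by (rule integral_norm_bound)
  also have "\<dots> \<le> (LINT x|lborel. A * (exp (a * x) * exp (- c * exp (K * x))))"
  proof (rule Bochner_Integration.integral_mono')
    show "integrable lborel (\<lambda>x. A * (exp (a * x) * exp (- c * exp (K * x))))"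
      by (intro integrable_mult_right double_exponential_integral a c K_pos)
    show *: "norm (exp (of_real a * of_real x) * e (exp (of_real x))) \<le> A * (exp (a * x) * exp (- c * exp (K * x)))" for x
      using mult_left_mono[OF A[of x], of "exp (a * x)"] by (simp add: norm_mult mult_ac)
    show "0 \<le> A * (exp (a * x) * exp (- c * exp (K * x)))" for x
      by (rule order_trans[OF norm_ge_zero *])
  qed
  also have "\<dots> = A * (Gamma (a / K) / (K * c powr (a / K)))"
    by (simp only: integral_mult_right_zero double_exponential_integral(2)[OF a c K_pos])
  finally show ?thesis .
qed

text \<open>With x = exp (- \<zeta>) and y = exp \<xi> the first factor is exp (x y^K) - 1, whose
  expansion gives the moments at n K divided by n!. Subtracting 1 removes the term n = 0 and makes
  the integrand decay where y tends to 0.\<close>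

definition borel_laplace :: "real \<Rightarrow> complex \<Rightarrow> complex" where
  "borel_laplace \<theta> \<zeta> = (LINT x|lborel. (exp (exp (of_real K * Complex x \<theta> - \<zeta>)) - 1) * e (exp (Complex x \<theta>)))"

text \<open>Termwise integration, with geometric majorant of ratio exp (- Re \<zeta>) / c; this is
  where the threshold - ln c comes from. The coefficients are the same for every \<theta> by
  \<open>ray_integral\<close>, so all these integrals continue one series.\<close>

lemma borel_laplace_sums:
  assumes \<theta>: "\<bar>\<theta>\<bar> < pi / (2 * K)" and c: "0 < c"
    and A: "\<And>x. norm (e (exp (Complex x \<theta>))) \<le> A * exp (- c * exp (K * x))"
    and z: "- ln c < Re \<zeta>"
  shows "(\<lambda>n. (if n = 0 then 0 else moment (real n * K) / fact n) * exp (- (of_nat n * \<zeta>))) sums borel_laplace \<theta> \<zeta>"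
proof -
  have A0: "0 \<le> A" using order_trans[OF norm_ge_zero A[of 0]] by (simp add: zero_le_mult_iff)
  define W where "W x = of_real K * Complex x \<theta> - \<zeta>" for x
  define f where "f n x = (if n = 0 then 0 else exp (W x) ^ n / fact n) * e (exp (Complex x \<theta>))" for n :: nat and x
  have nW: "norm (exp (W x)) = exp (K * x) * exp (- Re \<zeta>)" for x by (simp add: W_def exp_add[symmetric])
  have fW: "f n x = exp (- (of_nat n * \<zeta>)) / fact n * (exp (of_real (real n * K) * Complex x \<theta>) * e (exp (Complex x \<theta>)))" if "n \<noteq> 0" for n x
    using that by (simp add: f_def W_def exp_of_nat_mult[symmetric] exp_add[symmetric] algebra_simps)
  have Wm: "(\<lambda>x. exp (W x)) \<in> borel_measurable borel"
    unfolding W_def Complex_eq by (intro borel_measurable_continuous_onI continuous_intros)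
  have "f n \<in> borel_measurable borel" for n
    unfolding f_def[abs_def] using Wm ray_measurable[OF \<theta>]
    by (cases "n = 0") (auto intro!: borel_measurable_times borel_measurable_divide borel_measurable_power)
  then have fm: "f n \<in> borel_measurable lborel" for n by simp
  define g where "g n x = exp (- real n * Re \<zeta>) / fact n * A * (exp (real n * K * x) * exp (- c * exp (K * x)))" for n :: nat and x
  have fb: "norm (f n x) \<le> g n x" for n x
  proof (cases "n = 0")
    case True
    then show ?thesis using A0 by (simp add: f_def g_def)
  next
    case False
    then show ?thesis
      using mult_left_mono[OF A[of x], of "exp (- real n * Re \<zeta>) / fact n * exp (real n * K * x)"]
      by (simp add: fW g_def norm_mult norm_divide mult_ac)
  qed
  have gi: "integrable lborel (g n)" if "n \<noteq> 0" for n
    unfolding g_def[abs_def] using that K_pos c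
    by (intro integrable_mult_right double_exponential_integral) auto
  have fi: "integrable lborel (f n)" for n
  proof (cases "n = 0")
    case False
    show ?thesis
      by (rule Bochner_Integration.integrable_bound[OF gi[OF False] fm])
        (rule AE_I2, unfold real_norm_def, rule order_trans[OF fb abs_ge_self])
  qed (simp add: f_def[abs_def])
  define q where "q = exp (- Re \<zeta>) / c"
  have q: "0 < q" "q < 1"
  proof -
    have "exp (- Re \<zeta>) < exp (ln c)" using z by (subst exp_less_cancel_iff) simp
    then show "0 < q" "q < 1" using c by (auto simp: q_def)
  qed
  have gI: "(LINT x|lborel. norm (f n x)) \<le> A / K * q ^ n" for n
  proof (cases "n = 0")
    case True
    then show ?thesis using A0 K_pos by (simp add: f_def)
  next
    case False
    then have n: "0 < real n * K" using K_pos by simp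
    have "(LINT x|lborel. norm (f n x)) \<le> (LINT x|lborel. g n x)"
      by (rule Bochner_Integration.integral_mono'[OF gi[OF False] fb]) (rule order_trans[OF norm_ge_zero fb])
    also have "\<dots> = exp (- real n * Re \<zeta>) / fact n * A * (Gamma (real n * K / K) / (K * c powr (real n * K / K)))"
      unfolding g_def by (simp only: integral_mult_right_zero double_exponential_integral(2)[OF n c K_pos])
    also have "\<dots> = A / K * q ^ n * (fact (n - 1) / fact n)"
    proof -
      have "Gamma (real n) = fact (n - 1)" using False Gamma_fact[of "n - 1", where 'a = real] by (simp add: of_nat_diff)
      then show ?thesis using K_pos c
        by (simp add: q_def power_divide powr_realpow exp_of_nat_mult[symmetric] field_simps)
    qed
    also have "\<dots> \<le> A / K * q ^ n * 1"
      using A0 K_pos q by (intro mult_left_mono) (auto simp: fact_mono divide_le_eq)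
    finally show ?thesis by simp
  qed
  have geo: "summable (\<lambda>n. A / K * q ^ n)" using q by (intro summable_mult summable_geometric) auto
  have sm: "(\<lambda>n. f n x) sums ((exp (exp (W x)) - 1) * e (exp (Complex x \<theta>)))" for x
  proof -
    have "(\<lambda>n. exp (W x) ^ n / fact n) sums exp (exp (W x))"
      using exp_converges[of "exp (W x)"] by (simp add: scaleR_conv_of_real field_simps)
    moreover have "(\<lambda>n. if n = 0 then 1 else (0 :: complex)) sums 1" using sums_single[of 0 "\<lambda>_. 1 :: complex"] by simp
    ultimately have "(\<lambda>n. exp (W x) ^ n / fact n - (if n = 0 then 1 else 0)) sums (exp (exp (W x)) - 1)"
      by (rule sums_diff)
    moreover have "(\<lambda>n. exp (W x) ^ n / fact n - (if n = 0 then 1 else 0)) = (\<lambda>n. if n = 0 then 0 else exp (W x) ^ n / fact n)"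
      by auto
    ultimately show ?thesis unfolding f_def by (intro sums_mult2) simp
  qed
  have "(\<lambda>n. integral\<^sup>L lborel (f n)) sums (LINT x|lborel. (\<Sum>n. f n x))"
  proof (rule sums_integral[OF fi])
    show "AE x in lborel. summable (\<lambda>n. norm (f n x))"
    proof (rule AE_I2)
      fix x
      have "summable (\<lambda>n. inverse (fact n) * norm (exp (W x)) ^ n)" by (rule summable_exp)
      then have "summable (\<lambda>n. inverse (fact n) * norm (exp (W x)) ^ n * norm (e (exp (Complex x \<theta>))))" by (rule summable_mult2)
      then show "summable (\<lambda>n. norm (f n x))"
        by (rule summable_comparison_test'[where N = 0]) (simp add: f_def norm_mult norm_divide norm_power field_simps)
    qed
    show "summable (\<lambda>n. LINT x|lborel. norm (f n x))"
      using geo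
    proof (rule summable_comparison_test'[where N = 0])
      fix n :: nat
      have "0 \<le> (LINT x|lborel. norm (f n x))" by (rule Bochner_Integration.integral_nonneg) simp
      then show "norm (LINT x|lborel. norm (f n x)) \<le> A / K * q ^ n"
        using gI[of n] by (simp only: real_norm_def abs_of_nonneg)
    qed
  qed
  moreover have "(LINT x|lborel. (\<Sum>n. f n x)) = borel_laplace \<theta> \<zeta>"
    unfolding borel_laplace_def sums_unique[OF sm, symmetric] W_def ..
  moreover have "integral\<^sup>L lborel (f n) = (if n = 0 then 0 else moment (real n * K) / fact n) * exp (- (of_nat n * \<zeta>))" for n
  proof (cases "n = 0")
    case False
    then have n: "0 < real n * K" using K_pos by simp
    have "integral\<^sup>L lborel (f n) = (LINT x|lborel. exp (- (of_nat n * \<zeta>)) / fact n * (exp (of_real (real n * K) * Complex x \<theta>) * e (exp (Complex x \<theta>))))"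
      using False by (intro Bochner_Integration.integral_cong) (simp_all add: fW)
    also have "\<dots> = exp (- (of_nat n * \<zeta>)) / fact n * moment (real n * K)"
      by (simp only: integral_mult_right_zero ray_integral[OF n \<theta>])
    finally show ?thesis using False by simp
  qed (simp add: f_def[abs_def])
  ultimately show ?thesis by simp
qed

text \<open>The strip is chosen so that exp (K \<xi> - \<zeta>) has nonpositive real part on the
  whole line of integration. There |exp w - 1| \<le> |w|, so the double exponential is replaced by a
  single one and the integral converges for every Re \<zeta>.\<close>

lemma borel_laplace_holomorphic_bound:
  assumes \<theta>: "\<bar>\<theta>\<bar> < pi / (2 * K)" and c: "0 < c"
    and A: "\<And>x. norm (e (exp (Complex x \<theta>))) \<le> A * exp (- c * exp (K * x))"
    and ab: "pi / 2 + K * \<theta> \<le> a" "b \<le> 3 * pi / 2 + K * \<theta>"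
  shows "borel_laplace \<theta> holomorphic_on {\<zeta>. a < Im \<zeta> \<and> Im \<zeta> < b}"
    and "a < Im \<zeta> \<Longrightarrow> Im \<zeta> < b \<Longrightarrow> norm (borel_laplace \<theta> \<zeta>) \<le> A / (K * c) * exp (- Re \<zeta>)"
proof -
  let ?S = "{\<zeta>. a < Im \<zeta> \<and> Im \<zeta> < b}"
  define k where "k x \<zeta> = (exp (exp (of_real K * Complex x \<theta> - \<zeta>)) - 1) * e (exp (Complex x \<theta>))" for x \<zeta>
  define g where "g x = exp (K * x) * exp (- c * exp (K * x))" for x
  have gi: "integrable lborel (\<lambda>x. r * g x)" for r :: real
    unfolding g_def by (intro integrable_mult_right double_exponential_integral c K_pos)
  have gI: "(LINT x|lborel. g x) = 1 / (K * c)"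
    unfolding g_def double_exponential_integral(2)[OF K_pos c K_pos] using K_pos c by simp
  have kb: "norm (k x \<zeta>) \<le> exp (- Re \<zeta>) * A * g x" if z: "\<zeta> \<in> ?S" for x \<zeta>
  proof -
    let ?w = "exp (of_real K * Complex x \<theta> - \<zeta>)"
    have "Re ?w \<le> 0"
    proof -
      have "cos (K * \<theta> - Im \<zeta>) = cos (Im \<zeta> - K * \<theta>)" by (metis cos_minus minus_diff_eq)
      also have "\<dots> \<le> 0" using z ab by (intro cos_nonpos_between) auto
      finally show ?thesis by (simp add: Re_exp mult_nonneg_nonpos)
    qed
    then have "norm (exp ?w - 1) \<le> norm ?w" by (rule norm_exp_minus_1_le)
    also have "\<dots> = exp (- Re \<zeta>) * exp (K * x)" by (simp add: exp_add[symmetric])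
    finally have "norm (k x \<zeta>) \<le> (exp (- Re \<zeta>) * exp (K * x)) * (A * exp (- c * exp (K * x)))"
      unfolding k_def norm_mult using A[of x] by (intro mult_mono) auto
    then show ?thesis by (simp add: g_def mult_ac)
  qed
  have A0: "0 \<le> A" using order_trans[OF norm_ge_zero A[of 0]] by (simp add: zero_le_mult_iff)
  have g0: "0 \<le> g x" for x by (simp add: g_def)
  have "(\<lambda>\<zeta>. LINT x|lborel. k x \<zeta>) holomorphic_on ?S"
  proof (rule holomorphic_on_integral[OF open_strip])
    show "k x holomorphic_on ?S" for x unfolding k_def by (intro holomorphic_intros)
    show "(\<lambda>x. k x \<zeta>) \<in> borel_measurable lborel" for \<zeta>
    proof -
      have "(\<lambda>x. exp (exp (of_real K * Complex x \<theta> - \<zeta>)) - 1) \<in> borel_measurable borel"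
        unfolding Complex_eq by (intro borel_measurable_continuous_onI continuous_intros)
      from borel_measurable_times[OF this ray_measurable[OF \<theta>]]
      show ?thesis unfolding k_def by simp
    qed
    fix \<zeta>0 assume "\<zeta>0 \<in> ?S"
    have "\<forall>x\<in>space lborel. \<forall>\<zeta>\<in>{\<zeta>. Re \<zeta>0 - 1 < Re \<zeta>} \<inter> ?S. norm (k x \<zeta>) \<le> exp (1 - Re \<zeta>0) * A * g x"
    proof (intro ballI)
      fix x \<zeta> assume z: "\<zeta> \<in> {\<zeta>. Re \<zeta>0 - 1 < Re \<zeta>} \<inter> ?S"
      then have "norm (k x \<zeta>) \<le> exp (- Re \<zeta>) * A * g x" by (intro kb) auto
      also have "\<dots> \<le> exp (1 - Re \<zeta>0) * A * g x"
        using z A0 g0 by (intro mult_right_mono) auto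
      finally show "norm (k x \<zeta>) \<le> exp (1 - Re \<zeta>0) * A * g x" .
    qed
    then show "\<exists>U g. open U \<and> \<zeta>0 \<in> U \<and> integrable lborel g \<and> (\<forall>x\<in>space lborel. \<forall>y\<in>U \<inter> ?S. norm (k x y) \<le> g x)"
      by (intro exI[of _ "{\<zeta>. Re \<zeta>0 - 1 < Re \<zeta>}"], intro exI[of _ "\<lambda>x. exp (1 - Re \<zeta>0) * A * g x"] conjI gi open_halfspace_Re_gt) auto
  qed
  then show "borel_laplace \<theta> holomorphic_on ?S" unfolding borel_laplace_def k_def .
  assume z: "a < Im \<zeta>" "Im \<zeta> < b"
  have "norm (borel_laplace \<theta> \<zeta>) \<le> (LINT x|lborel. norm (k x \<zeta>))"
    unfolding borel_laplace_def k_def by (rule integral_norm_bound)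
  also have "\<dots> \<le> (LINT x|lborel. exp (- Re \<zeta>) * A * g x)"
    by (rule Bochner_Integration.integral_mono'[OF gi kb]) (use z A0 g0 in auto)
  also have "\<dots> = exp (- Re \<zeta>) * A * (1 / (K * c))" by (simp only: integral_mult_right_zero gI)
  finally show "norm (borel_laplace \<theta> \<zeta>) \<le> A / (K * c) * exp (- Re \<zeta>)" by (simp add: mult_ac)
qed

text \<open>One line of integration reaches only a strip of \<zeta> of width \<pi>; tilting it
  within the sector of flatness, by up to \<pi> / (2 K) either way, covers all 0 < Im \<zeta> < 2
  \<pi>.\<close>

lemma forward_continuation:
  "\<exists>D X0. log_continuation (\<lambda>n. if n = 0 then 0 else moment (real n * K) / fact n) D X0"
proof -
  obtain A c where Ac: "0 < A" "0 < c" "\<forall>\<xi>. \<bar>Im \<xi>\<bar> \<le> 0 \<longrightarrow> norm (e (exp \<xi>)) \<le> A * exp (- c * exp (K * Re \<xi>))"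
    using flat[of 0] K_pos by (auto simp: divide_simps)
  have A: "norm (e (exp (of_real x))) \<le> A * exp (- c * exp (K * x))" for x
    using Ac(3)[rule_format, of "of_real x"] by simp
  have "log_continuation (\<lambda>n. if n = 0 then 0 else moment (real n * K) / fact n) (A / K) (- ln c)"
  proof
    fix n :: nat
    show "norm (if n = 0 then 0 else moment (real n * K) / fact n) \<le> A / K * exp (- ln c * real n)"
    proof (cases "n = 0")
      case True
      then show ?thesis using Ac(1) K_pos by simp
    next
      case False
      then have "norm (moment (real n * K)) \<le> A * (Gamma (real n * K / K) / (K * c powr (real n * K / K)))"
        using K_pos by (intro moment_bound A Ac) auto
      also have "\<dots> = A / K * exp (- ln c * real n) * fact (n - 1)"
        using False Gamma_fact[of "n - 1", where 'a = real] K_pos Ac(2)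
        by (simp add: of_nat_diff powr_def exp_minus field_simps)
      also have "\<dots> \<le> A / K * exp (- ln c * real n) * fact n"
        using Ac(1) K_pos by (intro mult_left_mono fact_mono) auto
      finally show ?thesis using False by (simp add: norm_divide divide_le_eq)
    qed
  next
    fix y :: real assume y: "0 < y" "y < 2 * pi"
    \<comment> \<open>This linear choice sends (0, 2 \<pi>) onto the admissible angles, and y - K
      \<theta> = (y + \<pi>) / 2 lies between \<pi>/2 and 3 \<pi>/2, as the cosine condition
      demands. The margin is y/2 below and \<pi> - y/2 above; \<eta> is the smaller of the
      two.\<close>
    define \<theta> where "\<theta> = (y - pi) / (2 * K)"
    have \<theta>: "\<bar>\<theta>\<bar> < pi / (2 * K)" using y K_pos by (auto simp: \<theta>_def abs_if field_simps)
    have K\<theta>: "K * \<theta> = (y - pi) / 2" using K_pos by (simp add: \<theta>_def)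
    define \<eta> where "\<eta> = min y (2 * pi - y) / 2"
    have "\<eta> \<le> y / 2" "\<eta> \<le> (2 * pi - y) / 2" "0 < \<eta>" using y by (auto simp: \<eta>_def)
    then have \<eta>: "0 < \<eta>" "pi / 2 + K * \<theta> \<le> y - \<eta>" "y + \<eta> \<le> 3 * pi / 2 + K * \<theta>"
      unfolding K\<theta> by (simp_all add: field_simps)
    obtain A' c' where Ac': "0 < A'" "0 < c'" "\<forall>\<xi>. \<bar>Im \<xi>\<bar> \<le> \<bar>\<theta>\<bar> \<longrightarrow> norm (e (exp \<xi>)) \<le> A' * exp (- c' * exp (K * Re \<xi>))"
      using flat[OF \<theta>] by (elim exE conjE)
    have A': "norm (e (exp (Complex x \<theta>))) \<le> A' * exp (- c' * exp (K * x))" for x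
      using Ac'(3)[rule_format, of "Complex x \<theta>"] by simp
    note B = borel_laplace_holomorphic_bound[OF \<theta> Ac'(2) A' \<eta>(2,3)]
    show "\<exists>A \<eta> C X. 0 < \<eta> \<and> A holomorphic_on {\<zeta>. y - \<eta> < Im \<zeta> \<and> Im \<zeta> < y + \<eta>} \<and>
      (\<forall>\<zeta>. y - \<eta> < Im \<zeta> \<and> Im \<zeta> < y + \<eta> \<longrightarrow> norm (A \<zeta>) \<le> C * (1 + exp (- Re \<zeta>))) \<and>
      (\<forall>\<zeta>. y - \<eta> < Im \<zeta> \<and> Im \<zeta> < y + \<eta> \<and> X < Re \<zeta> \<longrightarrow>
        (\<lambda>k. (if k = 0 then 0 else moment (real k * K) / fact k) * exp (- (of_nat k * \<zeta>))) sums A \<zeta>)"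
    proof (rule exI[of _ "borel_laplace \<theta>"], rule exI[of _ \<eta>], rule exI[of _ "A' / (K * c')"], rule exI[of _ "- ln c'"],
        intro conjI allI impI)
      fix \<zeta> assume "y - \<eta> < Im \<zeta> \<and> Im \<zeta> < y + \<eta>"
      then have "norm (borel_laplace \<theta> \<zeta>) \<le> A' / (K * c') * exp (- Re \<zeta>)" by (intro B(2)) auto
      also have "\<dots> \<le> A' / (K * c') * (1 + exp (- Re \<zeta>))" using Ac' K_pos by (intro mult_left_mono) auto
      finally show "norm (borel_laplace \<theta> \<zeta>) \<le> A' / (K * c') * (1 + exp (- Re \<zeta>))" .
    next
      fix \<zeta> assume "y - \<eta> < Im \<zeta> \<and> Im \<zeta> < y + \<eta> \<and> - ln c' < Re \<zeta>"
      then show "(\<lambda>k. (if k = 0 then 0 else moment (real k * K) / fact k) * exp (- (of_nat k * \<zeta>))) sums borel_laplace \<theta> \<zeta>"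
        by (intro borel_laplace_sums[OF \<theta> Ac'(2) A']) auto
    qed (rule \<eta>(1), rule B(1))
  qed
  then show ?thesis by blast
qed

text \<open>The multiplier is used along n = N j, where n K = L j is an integer and the Mellin
  transform becomes a moment of \<open>e\<close>.\<close>

lemma dir_summable_kmoment:
  fixes u :: "nat \<Rightarrow> complex^'n \<Rightarrow> complex"
  assumes k: "0 < k" and N: "1 \<le> N" and L: "real L = real N * K" and u: "dir_summable k d u"
  shows "dir_summable k d (\<lambda>j z. of_real (kmoment e (L * j) / fact (N * j)) * u j z)"
proof -
  obtain D X0 where "log_continuation (\<lambda>n. if n = 0 then 0 else moment (real n * K) / fact n) D X0"
    using forward_continuation by blast
  from log_continuation.dir_summable_multiplier[OF this k N u]
  have 1: "dir_summable k d (\<lambda>j z. (if N * j = 0 then 0 else moment (real (N * j) * K) / fact (N * j)) * u j z)" .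
  show ?thesis
  \<comment> \<open>The continued series has coefficient 0 at index 0, so the true value at j = 0 is
    restored here.\<close>
  proof (rule dir_summable_modify[OF k u 1, where J = 1 and c = "\<lambda>j. of_real (kmoment e (L * j) / fact (N * j))"])
    fix j :: nat assume j: "1 \<le> j"
    have "0 < L" using L N K_pos by (intro gr0I) auto
    then have "0 < L * j" using j by simp
    from kmoment_eq(1)[OF this] have "of_real (kmoment e (L * j)) = moment (real (N * j) * K)"
      using L by (simp add: mult_ac)
    then show "(\<lambda>z. of_real (kmoment e (L * j) / fact (N * j)) * u j z) =
        (\<lambda>z. (if N * j = 0 then 0 else moment (real (N * j) * K) / fact (N * j)) * u j z)"
      using j N by simp
  qed simp
qed

end

section \<open>Continuation of the series of factorials divided by moments\<close>

context kernel
begin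

definition E :: "complex \<Rightarrow> complex" where
  "E z = (\<Sum>j. z ^ j / of_real (kmoment e j))"

lemma E_sums: "(\<lambda>j. z ^ j / of_real (kmoment e j)) sums E z"
proof -
  have "\<forall>z::complex. summable (\<lambda>j. z ^ j / of_real (kmoment e j))" using basic unfolding basic_kernel_def by blast
  then show ?thesis unfolding E_def by (intro summable_sums) blast
qed

lemma E_holomorphic: "E holomorphic_on UNIV"
proof -
  have "E holomorphic_on ball 0 r" for r
    by (rule power_series_holomorphic[where a = "\<lambda>j. 1 / of_real (kmoment e j)"]) (use E_sums in simp)
  then have "E field_differentiable at z" for z
    by (rule holomorphic_on_imp_differentiable_at[of _ "ball 0 (norm z + 1)"]) auto
  then show ?thesis by (simp add: holomorphic_on_def field_differentiable_at_within)
qed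

lemma E_growth: "\<exists>A B. 0 < A \<and> 0 < B \<and> (\<forall>z. norm (E z) \<le> A * exp (B * norm z powr K))"
proof -
  obtain A B where AB: "\<forall>z. norm (E z) \<le> A * exp (B * norm z powr K)"
    using basic unfolding basic_kernel_def E_def by blast
  have b: "norm (E z) \<le> max A 1 * exp (max B 1 * norm z powr K)" for z
  proof -
    have "norm (E z) \<le> A * exp (B * norm z powr K)" using AB by blast
    also have "\<dots> \<le> max A 1 * exp (max B 1 * norm z powr K)"
      by (intro mult_mono) (auto intro: mult_right_mono)
    finally show ?thesis .
  qed
  show ?thesis by (rule exI[of _ "max A 1"], rule exI[of _ "max B 1"]) (use b in auto)
qed

text \<open>Covers n = 0 as well: the integrand is nonnegative, and a divergent integral has the
  value 0.\<close>

lemma kmoment_nonneg: "0 \<le> kmoment e n"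
proof -
  have "\<forall>x::real. x > 0 \<longrightarrow> e (of_real x) \<in> \<real> \<and> Re (e (of_real x)) > 0"
    using basic unfolding basic_kernel_def by blast
  then have "0 \<le> x powr (real n - 1) * Re (e (of_real x))" if "x \<in> {0<..}" for x
    using that by (intro mult_nonneg_nonneg) (auto intro: less_imp_le)
  then show ?thesis unfolding kmoment_def
    by (cases "(\<lambda>x. x powr (real n - 1) * Re (e (of_real x))) integrable_on {0<..}")
      (auto intro: Henstock_Kurzweil_Integration.integral_nonneg simp: not_integrable_integral)
qed

lemma E_term_le: "0 \<le> x \<Longrightarrow> x ^ n / kmoment e n \<le> norm (E (of_real x))"
proof -
  assume x: "0 \<le> x"
  have "(\<lambda>j. of_real (x ^ j / kmoment e j)) sums E (of_real x)" using E_sums[of "of_real x"] by simp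
  then have s: "(\<lambda>j. x ^ j / kmoment e j) sums Re (E (of_real x))"
    using sums_Re by fastforce
  from sum_le_suminf[OF sums_summable[OF s], of "{n}"] sums_unique[OF s] x kmoment_nonneg
  have "x ^ n / kmoment e n \<le> Re (E (of_real x))" by simp
  also have "\<dots> \<le> norm (E (of_real x))" by (rule complex_Re_le_cmod)
  finally show ?thesis .
qed

text \<open>The kernel axiom speaks of E(1/z)/z near 0 along the ray of argument \<theta>. With z =
  exp (- x) cis \<theta> the factor 1/z cancels the Jacobian up to a unit, and the ray becomes one
  of argument - \<theta> running to infinity.\<close>

lemma E_ray_integrable:
  assumes "\<bar>\<theta> - pi\<bar> < pi - pi / (2 * K)"
  shows "integrable lborel (\<lambda>x. indicator {0..} x * norm (E (exp (Complex x (- \<theta>)))))"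
proof -
  define f where "f x = E (1 / (of_real x * cis \<theta>)) / (of_real x * cis \<theta>)" for x :: real
  have "\<bar>\<theta> - pi\<bar> < (2 * pi - pi / K) / 2" using assms by (simp add: field_simps)
  then have "f absolutely_integrable_on {0<..1}"
    using basic unfolding basic_kernel_def f_def E_def by blast
  moreover have "(\<lambda>x. exp (- x)) ` {0..} = {0<..1 :: real}"
  proof (intro set_eqI iffI)
    fix t :: real assume "t \<in> {0<..1}"
    then show "t \<in> (\<lambda>x. exp (- x)) ` {0..}" by (intro image_eqI[where x = "- ln t"]) auto
  qed auto
  moreover have "((\<lambda>x. exp (- x)) has_field_derivative - exp (- x)) (at x within {0..})" for x :: real
    by (auto intro!: derivative_eq_intros)
  ultimately have "(\<lambda>x. \<bar>- exp (- x)\<bar> *\<^sub>R f (exp (- x))) absolutely_integrable_on {0..}"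
    using absolutely_integrable_change_of_variables_real[of "{0..}" "\<lambda>x. exp (- x)" "\<lambda>x. - exp (- x)" f]
    by (simp add: inj_on_def)
  moreover have "\<bar>- exp (- x)\<bar> *\<^sub>R f (exp (- x)) = E (exp (Complex x (- \<theta>))) * cis (- \<theta>)" for x
  proof -
    have "1 / (of_real (exp (- x)) * cis \<theta>) = exp (Complex x (- \<theta>))"
      by (simp add: exp_eq_polar exp_minus field_simps flip: cis_inverse)
    then have "f (exp (- x)) = E (exp (Complex x (- \<theta>))) * exp (Complex x (- \<theta>))"
      unfolding f_def by (simp add: divide_inverse mult.commute)
    moreover have "exp (Complex x (- \<theta>)) = of_real (exp x) * cis (- \<theta>)" by (simp add: exp_eq_polar)
    ultimately show ?thesis by (simp add: scaleR_conv_of_real exp_minus field_simps)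
  qed
  ultimately have "(\<lambda>x. E (exp (Complex x (- \<theta>))) * cis (- \<theta>)) absolutely_integrable_on {0..}" by simp
  then have "integrable lebesgue (\<lambda>x. norm (indicator {0..} x *\<^sub>R (E (exp (Complex x (- \<theta>))) * cis (- \<theta>))))"
    unfolding set_integrable_def by (rule integrable_norm)
  then have i: "integrable lebesgue (\<lambda>x. indicator {0..} x * norm (E (exp (Complex x (- \<theta>)))))"
    by (simp add: norm_mult)
  have "continuous_on UNIV (\<lambda>x. E (exp (Complex x (- \<theta>))))"
    by (rule continuous_on_compose2[OF holomorphic_on_imp_continuous_on[OF E_holomorphic]])
      (auto intro!: continuous_intros simp: Complex_eq)
  then have [measurable]: "(\<lambda>x. E (exp (Complex x (- \<theta>)))) \<in> borel_measurable borel"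
    by (rule borel_measurable_continuous_onI)
  have "(\<lambda>x. indicator {0..} x * norm (E (exp (Complex x (- \<theta>))))) \<in> borel_measurable lborel" 
    by (intro borel_measurable_times borel_measurable_norm) simp_all
  from integrable_completion[OF this] i show ?thesis by simp
qed

text \<open>On the real line s = exp (K \<xi>) turns this into the integral of s^(n/K) exp (- s).
  Tilted lines give the same value as long as K \<gamma> stays within \<pi>/2, where exp (- s) still
  decays.\<close>

lemma gamma_ray_integral:
  assumes \<gamma>: "\<bar>\<gamma>\<bar> < pi / (2 * K)"
  shows "(LINT x|lborel. exp (of_nat n * Complex x \<gamma>) * (of_real K * exp (of_real K * Complex x \<gamma>) * exp (- exp (of_real K * Complex x \<gamma>)))) =
    of_real (Gamma (1 + real n / K))"
proof -
  define h where "h \<xi> = exp (of_nat n * \<xi>) * (of_real K * exp (of_real K * \<xi>) * exp (- exp (of_real K * \<xi>)))" for \<xi> :: complex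
  define \<sigma> where "\<sigma> = cos (K * \<bar>\<gamma>\<bar>)"
  have K\<gamma>: "K * \<bar>\<gamma>\<bar> < pi / 2" using \<gamma> K_pos by (simp add: field_simps)
  then have \<sigma>: "0 < \<sigma>" unfolding \<sigma>_def using K_pos by (intro cos_gt_zero_pi) (auto intro: less_le_trans[of _ 0])
  have n: "0 < real n + K" using K_pos by simp
  have "(LINT x|lborel. h (Complex x \<gamma>)) = (LINT x|lborel. h (Complex x 0))"
  proof (rule strip_integral_shift_zero[where g = "\<lambda>x. K * (exp ((real n + K) * x) * exp (- \<sigma> * exp (K * x)))"])
    show "h holomorphic_on {\<zeta>. - (pi / (2 * K)) < Im \<zeta> \<and> Im \<zeta> < pi / (2 * K)}"
      unfolding h_def by (intro holomorphic_intros)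
    show "norm (h (Complex x y)) \<le> K * (exp ((real n + K) * x) * exp (- \<sigma> * exp (K * x)))" if "\<bar>y\<bar> \<le> \<bar>\<gamma>\<bar>" for x y
    proof -
      have "\<sigma> \<le> cos (K * \<bar>y\<bar>)"
        unfolding \<sigma>_def
      proof (rule cos_monotone_0_pi_le)
        show "K * \<bar>\<gamma>\<bar> \<le> pi" using K\<gamma> pi_gt_zero by linarith
      qed (use that K_pos in \<open>auto intro: mult_left_mono\<close>)
      also have "cos (K * \<bar>y\<bar>) = cos (K * y)" by (cases "0 \<le> y") auto
      finally have "\<sigma> * exp (K * x) \<le> cos (K * y) * exp (K * x)" by simp
      then have "exp (- (exp (K * x) * cos (K * y))) \<le> exp (- \<sigma> * exp (K * x))" by (simp add: mult.commute)
      moreover have "norm (h (Complex x y)) = K * exp ((real n + K) * x) * exp (- (exp (K * x) * cos (K * y)))"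
      proof -
        have "exp (K * x) * exp (x * real n) = exp (x * (real n + K))"
          by (simp add: exp_add[symmetric] algebra_simps)
        then show ?thesis using K_pos by (simp add: h_def norm_mult Re_exp mult_ac)
      qed
      ultimately show ?thesis using K_pos by (simp add: mult_left_mono mult.assoc)
    qed
    show "integrable lborel (\<lambda>x. K * (exp ((real n + K) * x) * exp (- \<sigma> * exp (K * x))))"
      by (intro integrable_mult_right double_exponential_integral n \<sigma> K_pos)
    show "((\<lambda>x. K * (exp ((real n + K) * x) * exp (- \<sigma> * exp (K * x)))) \<longlongrightarrow> 0) at_top"
      "((\<lambda>x. K * (exp ((real n + K) * x) * exp (- \<sigma> * exp (K * x)))) \<longlongrightarrow> 0) at_bot"
      using double_exponential_tendsto[OF n \<sigma> K_pos] by (auto intro: tendsto_mult_right_zero)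
  qed (rule \<gamma>)
  also have "\<dots> = (LINT x|lborel. of_real (K * (exp ((real n + K) * x) * exp (- 1 * exp (K * x)))))"
  proof (rule Bochner_Integration.integral_cong[OF refl])
    fix x :: real
    have "Complex x 0 = of_real x" by (simp add: complex_eq_iff)
    moreover have "exp (of_nat n * of_real x) = (of_real (exp (real n * x)) :: complex)"
      "exp (of_real K * of_real x) = (of_real (exp (K * x)) :: complex)"
      using exp_of_real[of "real n * x", where 'a = complex] exp_of_real[of "K * x", where 'a = complex] by simp_all
    moreover have "exp (- of_real (exp (K * x))) = (of_real (exp (- exp (K * x))) :: complex)"
      using exp_of_real[of "- exp (K * x)", where 'a = complex] by simp
    moreover have "exp ((real n + K) * x) = exp (real n * x) * exp (K * x)"
      by (simp add: exp_add[symmetric] algebra_simps)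
    ultimately show "h (Complex x 0) = of_real (K * (exp ((real n + K) * x) * exp (- 1 * exp (K * x))))"
      unfolding h_def by simp
  qed
  also have "\<dots> = of_real (K * (Gamma ((real n + K) / K) / (K * 1 powr ((real n + K) / K))))"
    by (simp only: integral_complex_of_real integral_mult_right_zero double_exponential_integral(2)[OF n zero_less_one K_pos])
  also have "\<dots> = of_real (Gamma (1 + real n / K))" using K_pos by (simp add: add_divide_distrib add.commute)
  finally show ?thesis unfolding h_def .
qed

end

lemma powr_add_divide:
  fixes c K x :: real
  assumes "0 < c" "0 < K"
  shows "c powr ((x + K) / K) = c * exp (x / K * ln c)"
proof -
  have "(x + K) / K = 1 + x / K" using assms by (simp add: field_simps)
  moreover have "c powr (x / K) = exp (x / K * ln c)" using assms by (simp add: powr_def)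
  ultimately show ?thesis using assms by (simp add: powr_add)
qed

lemma quotient_cancel:
  fixes a b c g m p :: real
  assumes "b \<noteq> 0" "c \<noteq> 0"
  shows "b * c / m * (g / (b * (a * c * p))) = g / m * (1 / a * inverse p)"
  using assms by (cases "m = 0"; cases "p = 0"; cases "a = 0") (simp_all add: field_simps)

context kernel
begin

text \<open>A Laplace transform of order K of \<open>E\<close>: shifting \<xi> by \<zeta> would give
  E(x exp \<xi>) against a fixed weight, with x = exp (- \<zeta>). Keeping \<zeta> in the weight
  means that E is evaluated only on the fixed ray of argument \<beta>, where its integrability is
  known.\<close>

definition laplace_borel :: "real \<Rightarrow> complex \<Rightarrow> complex" where
  "laplace_borel \<beta> \<zeta> = (LINT x|lborel. E (exp (Complex x \<beta>)) *
     (of_real K * exp (of_real K * (Complex x \<beta> + \<zeta>)) * exp (- exp (of_real K * (Complex x \<beta> + \<zeta>)))))"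

lemma weight_bound:
  assumes y: "\<bar>K * (\<beta> + Im \<zeta>)\<bar> \<le> \<alpha>" and \<alpha>: "0 \<le> \<alpha>" "\<alpha> < pi / 2"
  defines "r \<equiv> \<lambda>x. exp (K * Re \<zeta>) * exp (K * x)"
  shows "norm (of_real K * exp (of_real K * (Complex x \<beta> + \<zeta>)) * exp (- exp (of_real K * (Complex x \<beta> + \<zeta>))))
     \<le> K * (r x * exp (- cos \<alpha> * r x))"
proof -
  let ?u = "exp (of_real K * (Complex x \<beta> + \<zeta>))"
  have nu: "norm ?u = r x" by (simp add: r_def exp_add[symmetric] distrib_left add.commute)
  have "cos \<alpha> \<le> cos \<bar>K * (\<beta> + Im \<zeta>)\<bar>"
    by (rule cos_monotone_0_pi_le) (use y \<alpha> in auto)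
  also have "cos \<bar>K * (\<beta> + Im \<zeta>)\<bar> = cos (K * (\<beta> + Im \<zeta>))" by (rule cos_abs_real)
  finally have "cos \<alpha> * r x \<le> cos (K * (\<beta> + Im \<zeta>)) * r x" by (intro mult_right_mono) (auto simp: r_def)
  also have "\<dots> = Re ?u" unfolding nu[symmetric] by (simp add: Re_exp)
  finally have "norm (exp (- ?u)) \<le> exp (- cos \<alpha> * r x)" by simp
  then have "K * norm ?u * norm (exp (- ?u)) \<le> K * r x * exp (- cos \<alpha> * r x)"
    unfolding nu using K_pos by (intro mult_left_mono) (auto simp: r_def)
  then show ?thesis using K_pos by (simp add: norm_mult mult_ac)
qed

lemma x_exp_bound: "0 < \<sigma> \<Longrightarrow> 0 \<le> x \<Longrightarrow> x * exp (- \<sigma> * x) \<le> 1 / (\<sigma> :: real)"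
proof -
  assume s: "0 < \<sigma>" "0 \<le> x"
  have "\<sigma> * x \<le> exp (\<sigma> * x)" using exp_ge_add_one_self[of "\<sigma> * x"] by linarith
  then have "\<sigma> * x * exp (- \<sigma> * x) \<le> exp (\<sigma> * x) * exp (- \<sigma> * x)" by (intro mult_right_mono) auto
  then show ?thesis using s by (simp add: exp_add[symmetric] field_simps)
qed

lemma E_log_continuous: "continuous_on UNIV (\<lambda>x. E (exp (Complex x \<beta>)))"
  by (rule continuous_on_compose2[OF holomorphic_on_imp_continuous_on[OF E_holomorphic]])
    (auto intro!: continuous_intros simp: Complex_eq)

lemma laplace_borel_integrand_measurable:
  "(\<lambda>x. E (exp (Complex x \<beta>)) * (of_real K * exp (of_real K * (Complex x \<beta> + \<zeta>)) * exp (- exp (of_real K * (Complex x \<beta> + \<zeta>)))))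
    \<in> borel_measurable borel"
  using E_log_continuous[of \<beta>] unfolding Complex_eq
  by (intro borel_measurable_continuous_onI continuous_intros)

text \<open>For x \<ge> 0 the weight is bounded and E is integrable along the ray; for x \<le> 0 E
  is bounded and the weight is integrable. Both contributions have bounds independent of Re
  \<zeta>.\<close>

lemma laplace_borel_holomorphic_bound:
  assumes \<alpha>: "0 \<le> \<alpha>" "\<alpha> < pi / 2" and ab: "- \<alpha> \<le> K * (\<beta> + a)" "K * (\<beta> + b) \<le> \<alpha>"
    and \<beta>: "\<bar>- \<beta> - pi\<bar> < pi - pi / (2 * K)"
  shows "laplace_borel \<beta> holomorphic_on {\<zeta>. a < Im \<zeta> \<and> Im \<zeta> < b}"
    and "\<exists>C. \<forall>\<zeta>. a < Im \<zeta> \<and> Im \<zeta> < b \<longrightarrow> norm (laplace_borel \<beta> \<zeta>) \<le> C * (1 + exp (- Re \<zeta>))"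
proof -
  let ?S = "{\<zeta>. a < Im \<zeta> \<and> Im \<zeta> < b}"
  define \<sigma> where "\<sigma> = cos \<alpha>"
  have \<sigma>: "0 < \<sigma>" unfolding \<sigma>_def using \<alpha> by (intro cos_gt_zero_pi) auto
  define k where "k x \<zeta> = E (exp (Complex x \<beta>)) * (of_real K * exp (of_real K * (Complex x \<beta> + \<zeta>)) * exp (- exp (of_real K * (Complex x \<beta> + \<zeta>))))" for x \<zeta>
  define r where "r \<zeta> x = exp (K * Re \<zeta>) * exp (K * x)" for \<zeta> x
  obtain A B where AB: "0 < A" "0 < B" "\<forall>z. norm (E z) \<le> A * exp (B * norm z powr K)"
    using E_growth by (elim exE conjE)
  define M where "M = A * exp B"
  have M0: "0 \<le> M" using AB by (simp add: M_def)
  have E_small: "norm (E (exp (Complex x \<beta>))) \<le> M" if "x \<le> 0" for x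
  proof -
    have "norm (E (exp (Complex x \<beta>))) \<le> A * exp (B * norm (exp (Complex x \<beta>)) powr K)" using AB(3) by blast
    also have "norm (exp (Complex x \<beta>)) powr K = exp (K * x)" by (simp add: exp_powr_real mult.commute)
    also have "A * exp (B * exp (K * x)) \<le> M"
      unfolding M_def using that AB K_pos by (intro mult_left_mono) (auto simp: mult_nonneg_nonpos)
    finally show ?thesis .
  qed
  have w: "norm (k x \<zeta>) \<le> norm (E (exp (Complex x \<beta>))) * (K * (r \<zeta> x * exp (- \<sigma> * r \<zeta> x)))" if z: "\<zeta> \<in> ?S" for x \<zeta>
  proof -
    have "K * (\<beta> + a) \<le> K * (\<beta> + Im \<zeta>)" "K * (\<beta> + Im \<zeta>) \<le> K * (\<beta> + b)"
      using z K_pos by (auto intro!: mult_left_mono)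
    then have "\<bar>K * (\<beta> + Im \<zeta>)\<bar> \<le> \<alpha>" using ab by linarith
    from mult_left_mono[OF weight_bound[OF this \<alpha>, of x], of "norm (E (exp (Complex x \<beta>)))"]
    show ?thesis by (simp add: k_def r_def \<sigma>_def norm_mult mult_ac)
  qed
  \<comment> \<open>Here r exp (- \<sigma> r) \<le> 1 / \<sigma> replaces the weight by a constant
    valid for all \<zeta> in the strip.\<close>
  define g1 where "g1 x = K / \<sigma> * (indicator {0..} x * norm (E (exp (Complex x \<beta>))))" for x
  have g1i: "integrable lborel g1"
    using E_ray_integrable[OF \<beta>] unfolding g1_def by (intro integrable_mult_right) simp
  have g10: "0 \<le> g1 x" for x using \<sigma> K_pos by (simp add: g1_def)
  have right: "norm (k x \<zeta>) \<le> g1 x" if z: "\<zeta> \<in> ?S" and x: "0 \<le> x" for x \<zeta>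
  proof -
    have "norm (k x \<zeta>) \<le> norm (E (exp (Complex x \<beta>))) * (K * (1 / \<sigma>))"
      using K_pos by (intro order_trans[OF w[OF z]] mult_left_mono x_exp_bound \<sigma>) (auto simp: r_def)
    then show ?thesis using x by (simp add: g1_def mult_ac)
  qed
  have left: "norm (k x \<zeta>) \<le> M * (K * (r \<zeta> x * exp (- \<sigma> * r \<zeta> x)))" if z: "\<zeta> \<in> ?S" and x: "x \<le> 0" for x \<zeta>
    using K_pos by (intro order_trans[OF w[OF z]] mult_right_mono E_small x) (auto simp: r_def)
  have "(\<lambda>\<zeta>. LINT x|lborel. k x \<zeta>) holomorphic_on ?S"
  proof (rule holomorphic_on_integral[OF open_strip])
    show "k x holomorphic_on ?S" for x unfolding k_def by (intro holomorphic_intros)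
    show "(\<lambda>x. k x \<zeta>) \<in> borel_measurable lborel" for \<zeta>
      using laplace_borel_integrand_measurable unfolding k_def by simp
    fix \<zeta>0 assume "\<zeta>0 \<in> ?S"
    define g where "g x = g1 x + M * K * exp (K * (Re \<zeta>0 + 1)) * (indicator {..0} x * exp (K * x))" for x
    have gi: "integrable lborel g"
      unfolding g_def by (intro Bochner_Integration.integrable_add g1i integrable_mult_right integrable_exp_atMost(1) K_pos)
    have "\<forall>x\<in>space lborel. \<forall>\<zeta>\<in>{\<zeta>. Re \<zeta> < Re \<zeta>0 + 1} \<inter> ?S. norm (k x \<zeta>) \<le> g x"
    proof (intro ballI)
      fix x \<zeta> assume z: "\<zeta> \<in> {\<zeta>. Re \<zeta> < Re \<zeta>0 + 1} \<inter> ?S"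
      show "norm (k x \<zeta>) \<le> g x"
      proof (cases "0 \<le> x")
        case True
        then have "norm (k x \<zeta>) \<le> g1 x" using right z by blast
        also have "\<dots> \<le> g x" using M0 K_pos by (simp add: g_def indicator_def)
        finally show ?thesis .
      next
        case False
        then have "norm (k x \<zeta>) \<le> M * (K * (r \<zeta> x * exp (- \<sigma> * r \<zeta> x)))" using left z by simp
        also have "\<dots> \<le> M * (K * (r \<zeta> x * 1))"
          using M0 K_pos \<sigma> by (intro mult_left_mono) (auto simp: r_def)
        also have "\<dots> \<le> M * (K * (exp (K * (Re \<zeta>0 + 1)) * exp (K * x)))"
          unfolding r_def using M0 K_pos z by (intro mult_left_mono mult_right_mono) auto
        also have "\<dots> \<le> g x" using False g10[of x] by (simp add: g_def mult_ac)
        finally show ?thesis .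
      qed
    qed
    then show "\<exists>U g. open U \<and> \<zeta>0 \<in> U \<and> integrable lborel g \<and> (\<forall>x\<in>space lborel. \<forall>y\<in>U \<inter> ?S. norm (k x y) \<le> g x)"
      by (intro exI[of _ "{\<zeta>. Re \<zeta> < Re \<zeta>0 + 1}"], intro exI[of _ g] conjI gi open_halfspace_Re_lt) auto
  qed
  then show "laplace_borel \<beta> holomorphic_on ?S" unfolding laplace_borel_def k_def .
  define C where "C = (LINT x|lborel. g1 x) + M / \<sigma>"
  have "norm (laplace_borel \<beta> \<zeta>) \<le> C * (1 + exp (- Re \<zeta>))" if z: "a < Im \<zeta> \<and> Im \<zeta> < b" for \<zeta>
  proof -
    define c where "c = \<sigma> * exp (K * Re \<zeta>)"
    have c: "0 < c" using \<sigma> by (simp add: c_def)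
    \<comment> \<open>The integral of the weight over the whole line is scale invariant: the factor
      exp (K Re \<zeta>) cancels against c, leaving M / \<sigma>.\<close>
    define g2 where "g2 x = M * K * exp (K * Re \<zeta>) * (exp (K * x) * exp (- c * exp (K * x)))" for x
    have g2i: "integrable lborel g2" unfolding g2_def
      by (intro integrable_mult_right double_exponential_integral K_pos c)
    have "(LINT x|lborel. g2 x) = M * K * exp (K * Re \<zeta>) * (Gamma (K / K) / (K * c powr (K / K)))"
      unfolding g2_def by (simp only: integral_mult_right_zero double_exponential_integral(2)[OF K_pos c K_pos])
    also have "\<dots> = M / \<sigma>" using K_pos \<sigma> by (simp add: c_def)
    finally have g2I: "(LINT x|lborel. g2 x) = M / \<sigma>" .
    have g20: "0 \<le> g2 x" for x using M0 K_pos by (simp add: g2_def)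
    have "norm (laplace_borel \<beta> \<zeta>) \<le> (LINT x|lborel. norm (k x \<zeta>))"
      unfolding laplace_borel_def k_def by (rule integral_norm_bound)
    also have "\<dots> \<le> (LINT x|lborel. g1 x + g2 x)"
    proof (rule Bochner_Integration.integral_mono'[OF Bochner_Integration.integrable_add[OF g1i g2i]])
      fix x
      show "norm (k x \<zeta>) \<le> g1 x + g2 x"
      proof (cases "0 \<le> x")
        case True
        then show ?thesis using right[of \<zeta> x] z g20[of x] by simp
      next
        case False
        then have "norm (k x \<zeta>) \<le> g2 x" using left[of \<zeta> x] z by (simp add: g2_def r_def c_def mult_ac)
        then show ?thesis using g10[of x] by simp
      qed
      show "0 \<le> g1 x + g2 x" using g10 g20 by (simp add: add_nonneg_nonneg)
    qed
    also have "\<dots> = C" unfolding C_def g2I[symmetric] using g1i g2i by (rule Bochner_Integration.integral_add)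
    finally have 1: "norm (laplace_borel \<beta> \<zeta>) \<le> C" .
    have "0 \<le> C" using 1 norm_ge_zero order_trans by blast
    then have "C * 1 \<le> C * (1 + exp (- Re \<zeta>))" by (intro mult_left_mono) auto
    with 1 show ?thesis by simp
  qed
  then show "\<exists>C. \<forall>\<zeta>. a < Im \<zeta> \<and> Im \<zeta> < b \<longrightarrow> norm (laplace_borel \<beta> \<zeta>) \<le> C * (1 + exp (- Re \<zeta>))" by blast
qed

text \<open>A single term of the series for E on the positive axis is bounded by E itself;
  integrating this inequality against the Laplace weight turns the power into a Gamma value.\<close>

lemma inverse_moment_bound:
  "\<exists>D X. 0 \<le> D \<and> (\<forall>n. Gamma (1 + real n / K) / kmoment e n \<le> D * exp (X * real n))"
proof -
  obtain A B where AB: "0 < A" "0 < B" "\<forall>z. norm (E z) \<le> A * exp (B * norm z powr K)"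
    using E_growth by (elim exE conjE)
  define X where "X = ln (B + 1) / K"
  have eX: "exp (K * X) = B + 1" using AB K_pos by (simp add: X_def)
  define g where "g x = A * K * (B + 1) * (exp (K * x) * exp (- 1 * exp (K * x)))" for x
  have gi: "integrable lborel g" unfolding g_def
    by (intro integrable_mult_right double_exponential_integral K_pos zero_less_one)
  define D where "D = (LINT x|lborel. g x)"
  have "Gamma (1 + real n / K) / kmoment e n \<le> D * exp (X * real n)" for n
  proof -
    \<comment> \<open>Decay of rate B + 1 beats the growth of E of type B and leaves exp (- exp (K
      x)), a majorant that no longer depends on n. Rescaling the weight costs c^(n/K) = exp (X
      n).\<close>
    define c where "c = B + 1"
    have c: "0 < c" using AB by (simp add: c_def)
    have n: "0 < real n + K" using K_pos by simp
    define f where "f x = c * K / kmoment e n * (exp ((real n + K) * x) * exp (- c * exp (K * x)))" for x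
    have "(LINT x|lborel. f x) = c * K / kmoment e n * (Gamma ((real n + K) / K) / (K * c powr ((real n + K) / K)))"
      unfolding f_def by (simp only: integral_mult_right_zero double_exponential_integral(2)[OF n c K_pos])
    also have "c powr ((real n + K) / K) = c * exp (X * real n)"
      unfolding powr_add_divide[OF c K_pos] by (simp add: X_def c_def mult.commute)
    also have "c * K / kmoment e n * (Gamma ((real n + K) / K) / (K * (c * exp (X * real n)))) =
        Gamma (1 + real n / K) / kmoment e n * exp (- (X * real n))"
    proof -
      have "(real n + K) / K = 1 + real n / K" using K_pos by (simp add: field_simps)
      then show ?thesis
        using quotient_cancel[of K c "kmoment e n" "Gamma (1 + real n / K)" 1 "exp (X * real n)"] c K_pos
        by (simp add: exp_minus mult.commute[of c K])
    qed
    finally have fI: "(LINT x|lborel. f x) = Gamma (1 + real n / K) / kmoment e n * exp (- (X * real n))" .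
    have "(LINT x|lborel. f x) \<le> D"
      unfolding D_def
    proof (rule Bochner_Integration.integral_mono'[OF gi])
      fix x
      have "exp x ^ n / kmoment e n \<le> norm (E (of_real (exp x)))" by (rule E_term_le) simp
      also have "\<dots> \<le> A * exp (B * exp (K * x))"
        using AB(3)[rule_format, of "of_real (exp x)"] by (simp add: exp_powr_real mult.commute)
      finally have "c * K * (exp (K * x) * exp (- c * exp (K * x))) * (exp x ^ n / kmoment e n) \<le>
          c * K * (exp (K * x) * exp (- c * exp (K * x))) * (A * exp (B * exp (K * x)))"
        using c K_pos by (intro mult_left_mono) auto
      also have "\<dots> = A * K * c * (exp (K * x) * exp (- c * exp (K * x) + B * exp (K * x)))"
        by (simp only: exp_add ac_simps)
      also have "- c * exp (K * x) + B * exp (K * x) = - 1 * exp (K * x)" by (simp add: c_def algebra_simps)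
      also have "c * K * (exp (K * x) * exp (- c * exp (K * x))) * (exp x ^ n / kmoment e n) = f x"
      proof -
        have "exp ((real n + K) * x) = exp (real n * x) * exp (K * x)"
          by (simp add: exp_add[symmetric] algebra_simps)
        then show ?thesis by (simp add: f_def exp_of_nat_mult[symmetric] mult_ac)
      qed
      finally show "f x \<le> g x" by (simp add: g_def c_def)
      show "0 \<le> g x" using AB K_pos by (simp add: g_def)
    qed
    then have "Gamma (1 + real n / K) / kmoment e n * exp (- (X * real n)) * exp (X * real n) \<le> D * exp (X * real n)"
      unfolding fI by (intro mult_right_mono) auto
    then show ?thesis by (simp add: mult.assoc exp_add[symmetric])
  qed
  moreover have "0 \<le> D" unfolding D_def g_def using AB K_pos by (intro Bochner_Integration.integral_nonneg) auto
  ultimately show ?thesis by blast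
qed

text \<open>Termwise integration for large Re \<zeta>. The threshold combines the coefficient growth
  exp (X n) with the loss (cos \<alpha>)^(- n / K) caused by the slower decay of the weight on a
  tilted line.\<close>

lemma laplace_borel_sums:
  assumes \<alpha>: "0 \<le> \<alpha>" "\<alpha> < pi / 2" and y: "\<bar>K * (\<beta> + Im \<zeta>)\<bar> \<le> \<alpha>"
    and D: "0 \<le> D" "\<And>n. Gamma (1 + real n / K) / kmoment e n \<le> D * exp (X * real n)"
    and z: "X - ln (cos \<alpha>) / K < Re \<zeta>"
  shows "(\<lambda>n. of_real (Gamma (1 + real n / K) / kmoment e n) * exp (- (of_nat n * \<zeta>))) sums laplace_borel \<beta> \<zeta>"
proof -
  define \<sigma> where "\<sigma> = cos \<alpha>"
  have \<sigma>: "0 < \<sigma>" unfolding \<sigma>_def using \<alpha> by (intro cos_gt_zero_pi) auto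
  define W where "W x = of_real K * exp (of_real K * (Complex x \<beta> + \<zeta>)) * exp (- exp (of_real K * (Complex x \<beta> + \<zeta>)))" for x
  define r where "r x = exp (K * Re \<zeta>) * exp (K * x)" for x
  have Wb: "norm (W x) \<le> K * (r x * exp (- \<sigma> * r x))" for x
    using weight_bound[OF y \<alpha>, of x] unfolding W_def r_def \<sigma>_def .
  define f where "f n x = exp (Complex x \<beta>) ^ n / of_real (kmoment e n) * W x" for n :: nat and x
  define c where "c = \<sigma> * exp (K * Re \<zeta>)"
  have c: "0 < c" using \<sigma> by (simp add: c_def)
  have n: "0 < real n + K" for n :: nat using K_pos by simp
  define g where "g n x = K * exp (K * Re \<zeta>) / kmoment e n * (exp ((real n + K) * x) * exp (- c * exp (K * x)))" for n and x
  have gi: "integrable lborel (g n)" for n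
    unfolding g_def[abs_def] by (intro integrable_mult_right double_exponential_integral n c K_pos)
  have fb: "norm (f n x) \<le> g n x" for n x
  proof -
    have "norm (f n x) = exp (real n * x) / kmoment e n * norm (W x)"
      using kmoment_nonneg[of n] by (simp add: f_def norm_mult norm_divide norm_power exp_of_nat_mult[symmetric])
    also have "\<dots> \<le> exp (real n * x) / kmoment e n * (K * (r x * exp (- \<sigma> * r x)))"
      using kmoment_nonneg[of n] by (intro mult_left_mono Wb) auto
    also have "\<dots> = g n x"
    proof -
      have "exp ((real n + K) * x) = exp (real n * x) * exp (K * x)"
        by (simp add: exp_add[symmetric] algebra_simps)
      then show ?thesis by (simp add: g_def r_def c_def mult_ac)
    qed
    finally show ?thesis .
  qed
  have fm: "f n \<in> borel_measurable lborel" for n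
  proof -
    have "continuous_on UNIV (f n)"
      unfolding f_def[abs_def] W_def Complex_eq divide_inverse by (intro continuous_intros)
    then show ?thesis by (simp add: borel_measurable_continuous_onI)
  qed
  have fi: "integrable lborel (f n)" for n
    by (rule Bochner_Integration.integrable_bound[OF gi fm])
      (rule AE_I2, unfold real_norm_def, rule order_trans[OF fb abs_ge_self])
  define q where "q = exp (X - ln \<sigma> / K - Re \<zeta>)"
  have q: "0 < q" "q < 1" using z by (auto simp: q_def \<sigma>_def)
  have gI: "(LINT x|lborel. norm (f n x)) \<le> D / \<sigma> * q ^ n" for n
  proof -
    have "(LINT x|lborel. norm (f n x)) \<le> (LINT x|lborel. g n x)"
      by (rule Bochner_Integration.integral_mono'[OF gi fb]) (rule order_trans[OF norm_ge_zero fb])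
    also have "\<dots> = K * exp (K * Re \<zeta>) / kmoment e n * (Gamma ((real n + K) / K) / (K * c powr ((real n + K) / K)))"
      unfolding g_def by (simp only: integral_mult_right_zero double_exponential_integral(2)[OF n c K_pos])
    also have "c powr ((real n + K) / K) = c * exp (real n * (ln \<sigma> / K + Re \<zeta>))"
    proof -
      have "ln c = ln \<sigma> + K * Re \<zeta>" using \<sigma> by (simp add: c_def ln_mult)
      then have "real n / K * ln c = real n * (ln \<sigma> / K + Re \<zeta>)" using K_pos by (simp add: field_simps)
      moreover have "c powr ((real n + K) / K) = c * exp (real n / K * ln c)"
        by (rule powr_add_divide[OF c K_pos])
      ultimately show ?thesis by (simp only:)
    qed
    also have "K * exp (K * Re \<zeta>) / kmoment e n * (Gamma ((real n + K) / K) / (K * (c * exp (real n * (ln \<sigma> / K + Re \<zeta>))))) =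
        Gamma (1 + real n / K) / kmoment e n * (1 / \<sigma> * exp (- (real n * (ln \<sigma> / K + Re \<zeta>))))"
    proof -
      have "(real n + K) / K = 1 + real n / K" using K_pos by (simp add: field_simps)
      then show ?thesis
        unfolding c_def exp_minus
        using quotient_cancel[of K "exp (K * Re \<zeta>)" "kmoment e n" "Gamma (1 + real n / K)" \<sigma> "exp (real n * (ln \<sigma> / K + Re \<zeta>))"] K_pos
        by simp
    qed
    also have "\<dots> \<le> D * exp (X * real n) * (1 / \<sigma> * exp (- (real n * (ln \<sigma> / K + Re \<zeta>))))"
      using \<sigma> by (intro mult_right_mono D) auto
    also have "\<dots> = D / \<sigma> * q ^ n"
      by (simp add: q_def exp_of_nat_mult[symmetric] exp_add[symmetric] algebra_simps flip: exp_diff)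
    finally show ?thesis .
  qed
  have geo: "summable (\<lambda>n. D / \<sigma> * q ^ n)" using q by (intro summable_mult summable_geometric) auto
  have sm: "(\<lambda>n. f n x) sums (E (exp (Complex x \<beta>)) * W x)" for x
    unfolding f_def by (intro sums_mult2 E_sums)
  have "(\<lambda>n. integral\<^sup>L lborel (f n)) sums (LINT x|lborel. (\<Sum>n. f n x))"
  proof (rule sums_integral[OF fi])
    show "AE x in lborel. summable (\<lambda>n. norm (f n x))"
    proof (rule AE_I2)
      fix x
      have eq: "norm (f n x) = Re (exp (of_real x) ^ n / of_real (kmoment e n)) * norm (W x)" for n
      proof -
        have "(exp (of_real x) ^ n / of_real (kmoment e n) :: complex) = of_real (exp x ^ n / kmoment e n)"
          by (simp add: exp_of_real)
        then have b: "Re (exp (of_real x) ^ n / of_real (kmoment e n)) = exp x ^ n / kmoment e n"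
          by (simp only: Re_complex_of_real)
        have a: "norm (f n x) = exp x ^ n / kmoment e n * norm (W x)"
          using kmoment_nonneg[of n] by (simp add: f_def norm_mult norm_divide norm_power)
        show ?thesis unfolding a b ..
      qed
      show "summable (\<lambda>n. norm (f n x))"
        unfolding eq by (rule summable_mult2) (rule sums_summable[OF sums_Re[OF E_sums]])
    qed
    show "summable (\<lambda>n. LINT x|lborel. norm (f n x))"
      using geo
    proof (rule summable_comparison_test'[where N = 0])
      fix n :: nat
      have "0 \<le> (LINT x|lborel. norm (f n x))" by (rule Bochner_Integration.integral_nonneg) simp
      then show "norm (LINT x|lborel. norm (f n x)) \<le> D / \<sigma> * q ^ n"
        using gI[of n] by (simp only: real_norm_def abs_of_nonneg)
    qed
  qed
  moreover have "(LINT x|lborel. (\<Sum>n. f n x)) = laplace_borel \<beta> \<zeta>"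
    unfolding laplace_borel_def sums_unique[OF sm, symmetric] W_def ..
  moreover have "integral\<^sup>L lborel (f n) = of_real (Gamma (1 + real n / K) / kmoment e n) * exp (- (of_nat n * \<zeta>))" for n
  proof -
    define \<gamma> where "\<gamma> = \<beta> + Im \<zeta>"
    define G where "G x = exp (of_nat n * Complex x \<gamma>) * (of_real K * exp (of_real K * Complex x \<gamma>) * exp (- exp (of_real K * Complex x \<gamma>)))" for x
    have "K * \<bar>\<gamma>\<bar> < pi / 2" using y \<alpha> K_pos by (simp add: \<gamma>_def abs_mult)
    then have "\<bar>\<gamma>\<bar> < pi / (2 * K)" using K_pos by (simp add: field_simps)
    from gamma_ray_integral[OF this, of n] have G: "(LINT x|lborel. G x) = of_real (Gamma (1 + real n / K))" unfolding G_def .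
    have "f n x = exp (- (of_nat n * \<zeta>)) / of_real (kmoment e n) * G (Re \<zeta> + 1 * x)" for x
    proof -
      have s: "Complex (Re \<zeta> + 1 * x) \<gamma> = Complex x \<beta> + \<zeta>" by (simp add: complex_eq_iff \<gamma>_def add.commute)
      have "exp (- (of_nat n * \<zeta>)) * exp (of_nat n * (Complex x \<beta> + \<zeta>)) = exp (Complex x \<beta>) ^ n"
        by (simp add: exp_of_nat_mult[symmetric] exp_add[symmetric] algebra_simps)
      then show ?thesis unfolding G_def s f_def W_def by (simp add: mult_ac)
    qed
    then have "integral\<^sup>L lborel (f n) = (LINT x|lborel. exp (- (of_nat n * \<zeta>)) / of_real (kmoment e n) * G (Re \<zeta> + 1 * x))"
      by (intro Bochner_Integration.integral_cong) auto
    also have "\<dots> = exp (- (of_nat n * \<zeta>)) / of_real (kmoment e n) * (LINT x|lborel. G (Re \<zeta> + 1 * x))"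
      by (rule integral_mult_right_zero)
    also have "(LINT x|lborel. G (Re \<zeta> + 1 * x)) = (LINT x|lborel. G x)"
      using lborel_integral_real_affine[of 1 G "Re \<zeta>"] by simp
    finally show ?thesis unfolding G by simp
  qed
  ultimately show ?thesis by simp
qed

lemma backward_continuation:
  "\<exists>D X0. log_continuation (\<lambda>n. of_real (Gamma (1 + real n / K) / kmoment e n)) D X0"
proof -
  obtain D X where D: "0 \<le> D" "\<forall>n. Gamma (1 + real n / K) / kmoment e n \<le> D * exp (X * real n)"
    using inverse_moment_bound by (elim exE conjE)
  note D = D(1) D(2)[rule_format]
  have "log_continuation (\<lambda>n. of_real (Gamma (1 + real n / K) / kmoment e n)) D X"
  proof
    fix n :: nat
    have "0 \<le> Gamma (1 + real n / K) / kmoment e n"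
      using kmoment_nonneg[of n] K_pos
      by (intro divide_nonneg_nonneg) (auto intro!: less_imp_le[OF Gamma_real_pos] add_pos_nonneg)
    then show "norm (of_real (Gamma (1 + real n / K) / kmoment e n) :: complex) \<le> D * exp (X * real n)"
      unfolding norm_of_real using D(2)[of n] by linarith
  next
    fix y :: real assume y: "0 < y" "y < 2 * pi"
    \<comment> \<open>Two demands meet: \<beta> must be the argument of a ray on which E is
      integrable, and K (\<beta> + y) must stay within \<pi>/2 for the weight to decay. With this
      \<beta> one has K (\<beta> + y) = (y - \<pi>) / 2; that the integrable rays form a nonempty
      range uses K > 1/2.\<close>
    define \<beta> where "\<beta> = - pi - (y - pi) * (1 - 1 / (2 * K))"
    have K2: "0 < 1 - 1 / (2 * K)" using K_gt by (simp add: field_simps)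
    have "\<bar>- \<beta> - pi\<bar> = \<bar>y - pi\<bar> * (1 - 1 / (2 * K))" using K2 by (simp add: \<beta>_def abs_mult)
    also have "\<dots> < pi * (1 - 1 / (2 * K))" using y K2 by (intro mult_strict_right_mono) auto
    also have "\<dots> = pi - pi / (2 * K)" using K_pos by (simp add: field_simps)
    finally have \<beta>: "\<bar>- \<beta> - pi\<bar> < pi - pi / (2 * K)" .
    have K\<beta>: "K * (\<beta> + v) = (y - pi) / 2 + K * (v - y)" for v using K_pos by (simp add: \<beta>_def field_simps)
    \<comment> \<open>Midway between the angle |y - \<pi>| / 2 at the centre of the strip and the
      limit \<pi>/2; the slack divided by K becomes the half-width \<eta>.\<close>
    define \<alpha> where "\<alpha> = (pi / 2 + \<bar>y - pi\<bar> / 2) / 2"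
    have \<alpha>: "0 \<le> \<alpha>" "\<alpha> < pi / 2" "\<bar>y - pi\<bar> / 2 < \<alpha>" using y by (auto simp: \<alpha>_def abs_if field_simps)
    define \<eta> where "\<eta> = (\<alpha> - \<bar>y - pi\<bar> / 2) / K"
    have \<eta>: "0 < \<eta>" "K * \<eta> = \<alpha> - \<bar>y - pi\<bar> / 2" using \<alpha> K_pos by (auto simp: \<eta>_def)
    have ab: "- \<alpha> \<le> K * (\<beta> + (y - \<eta>))" "K * (\<beta> + (y + \<eta>)) \<le> \<alpha>"
      unfolding K\<beta> using \<eta>(2) by (auto simp: abs_if field_simps split: if_splits)
    obtain C where C: "\<forall>\<zeta>. y - \<eta> < Im \<zeta> \<and> Im \<zeta> < y + \<eta> \<longrightarrow> norm (laplace_borel \<beta> \<zeta>) \<le> C * (1 + exp (- Re \<zeta>))"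
      using laplace_borel_holomorphic_bound(2)[OF \<alpha>(1,2) ab \<beta>] by (elim exE)
    show "\<exists>A \<eta> C X. 0 < \<eta> \<and> A holomorphic_on {\<zeta>. y - \<eta> < Im \<zeta> \<and> Im \<zeta> < y + \<eta>} \<and>
      (\<forall>\<zeta>. y - \<eta> < Im \<zeta> \<and> Im \<zeta> < y + \<eta> \<longrightarrow> norm (A \<zeta>) \<le> C * (1 + exp (- Re \<zeta>))) \<and>
      (\<forall>\<zeta>. y - \<eta> < Im \<zeta> \<and> Im \<zeta> < y + \<eta> \<and> X < Re \<zeta> \<longrightarrow>
        (\<lambda>k. of_real (Gamma (1 + real k / K) / kmoment e k) * exp (- (of_nat k * \<zeta>))) sums A \<zeta>)"
    proof (rule exI[of _ "laplace_borel \<beta>"], rule exI[of _ \<eta>], rule exI[of _ C], rule exI[of _ "X - ln (cos \<alpha>) / K"],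
        intro conjI)
      show "0 < \<eta>" by (rule \<eta>(1))
      show "laplace_borel \<beta> holomorphic_on {\<zeta>. y - \<eta> < Im \<zeta> \<and> Im \<zeta> < y + \<eta>}"
        by (rule laplace_borel_holomorphic_bound(1)[OF \<alpha>(1,2) ab \<beta>])
      show "\<forall>\<zeta>. y - \<eta> < Im \<zeta> \<and> Im \<zeta> < y + \<eta> \<longrightarrow> norm (laplace_borel \<beta> \<zeta>) \<le> C * (1 + exp (- Re \<zeta>))" by (rule C)
      show "\<forall>\<zeta>. y - \<eta> < Im \<zeta> \<and> Im \<zeta> < y + \<eta> \<and> X - ln (cos \<alpha>) / K < Re \<zeta> \<longrightarrow>
        (\<lambda>k. of_real (Gamma (1 + real k / K) / kmoment e k) * exp (- (of_nat k * \<zeta>))) sums laplace_borel \<beta> \<zeta>"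
      proof (intro allI impI, elim conjE)
        fix \<zeta> assume z: "y - \<eta> < Im \<zeta>" "Im \<zeta> < y + \<eta>" "X - ln (cos \<alpha>) / K < Re \<zeta>"
        have "K * (\<beta> + (y - \<eta>)) \<le> K * (\<beta> + Im \<zeta>)" "K * (\<beta> + Im \<zeta>) \<le> K * (\<beta> + (y + \<eta>))"
          using z K_pos by (auto intro!: mult_left_mono)
        then have "\<bar>K * (\<beta> + Im \<zeta>)\<bar> \<le> \<alpha>" using ab by linarith
        then show "(\<lambda>k. of_real (Gamma (1 + real k / K) / kmoment e k) * exp (- (of_nat k * \<zeta>))) sums laplace_borel \<beta> \<zeta>"
          by (rule laplace_borel_sums[OF \<alpha>(1,2) _ D z(3)])
      qed
    qed
  qed
  then show ?thesis by blast
qed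

text \<open>Now the multiplier is used along n = L j, where n / K = N j is an integer and the Gamma
  value is a factorial.\<close>

lemma dir_summable_inverse_kmoment:
  fixes u :: "nat \<Rightarrow> complex^'n \<Rightarrow> complex"
  assumes k: "0 < k" and N: "1 \<le> N" and L: "real L = real N * K" and u: "dir_summable k d u"
  shows "dir_summable k d (\<lambda>j z. of_real (fact (N * j) / kmoment e (L * j)) * u j z)"
proof -
  have "0 < L" using L N K_pos by (intro gr0I) auto
  then have L1: "1 \<le> L" by simp
  obtain D X0 where "log_continuation (\<lambda>n. of_real (Gamma (1 + real n / K) / kmoment e n)) D X0"
    using backward_continuation by blast
  from log_continuation.dir_summable_multiplier[OF this k L1 u]
  have "dir_summable k d (\<lambda>j z. of_real (Gamma (1 + real (L * j) / K) / kmoment e (L * j)) * u j z)" .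
  moreover have "Gamma (1 + real (L * j) / K) = fact (N * j)" for j
  proof -
    have "real (L * j) / K = real (N * j)" using L K_pos by (simp add: field_simps)
    then show ?thesis using Gamma_fact[of "N * j", where 'a = real] by (simp only:)
  qed
  ultimately show ?thesis by (simp only:)
qed

end

section \<open>Passage to powers of the variable\<close>

text \<open>\<open>Ok_sector\<close> bounds the function on strictly smaller domains only. Halving
  the opening and the radii once turns these bounds into a single pair of constants.\<close>

lemma Ok_sector_imp_sector_summable:
  fixes F :: "complex \<Rightarrow> complex^'n \<Rightarrow> complex"
  assumes F: "Ok_sector k d \<epsilon> r1 r F" and pos: "0 < \<epsilon>" "0 < r1" "0 < r" "0 < \<rho>"
    and sm: "\<And>t z. norm t < \<rho> \<Longrightarrow> norm z < \<rho> \<Longrightarrow> (\<lambda>j. u j z * t ^ j) sums F t z"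
  shows "sector_summable k d (\<epsilon> / 2) u"
proof -
  have hol: "holo_tz {(t, z). t \<in> disc_sector d \<epsilon> r1 \<and> z \<in> ball 0 r} (\<lambda>(t, z). F t z)"
    using F unfolding Ok_sector_def by blast
  have gr: "\<exists>A B. \<forall>t \<in> disc_sector d \<epsilon>' r1'. \<forall>z. norm z \<le> r' \<longrightarrow> norm (F t z) \<le> A * exp (B * norm t powr k)"
      if "r' < r" "r1' < r1" "\<epsilon>' < \<epsilon>" for r' r1' \<epsilon>'
    using F that unfolding Ok_sector_def by blast
  obtain A B where AB: "\<forall>t \<in> disc_sector d (\<epsilon> / 2) (r1 / 2). \<forall>z. norm z \<le> r / 2 \<longrightarrow> norm (F t z) \<le> A * exp (B * norm t powr k)"
    using gr[of "r / 2" "r1 / 2" "\<epsilon> / 2"] pos by auto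
  define R where "R = min (r1 / 2) (min (r / 2) \<rho>)"
  have R: "0 < R" "R \<le> r1 / 2" "R \<le> r / 2" "R \<le> \<rho>" using pos by (auto simp: R_def)
  have sub: "disc_sector d (\<epsilon> / 2) R \<subseteq> disc_sector d \<epsilon> r1" "disc_sector d (\<epsilon> / 2) R \<subseteq> disc_sector d (\<epsilon> / 2) (r1 / 2)"
    using R pos disc_sector_mono[of "\<epsilon> / 2" \<epsilon> R r1 d] disc_sector_mono[of "\<epsilon> / 2" "\<epsilon> / 2" R "r1 / 2" d] by simp_all
  show ?thesis
  proof (rule sector_summableI[where r = R and A = "\<bar>A\<bar>" and B = "\<bar>B\<bar>" and F = F])
    show "holo_tz {(t, z). t \<in> disc_sector d (\<epsilon> / 2) R \<and> z \<in> ball 0 R} (\<lambda>(t, z). F t z)"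
      by (rule holo_tz_subset[OF hol]) (use sub R pos in auto)
    show "norm (F t z) \<le> \<bar>A\<bar> * exp (\<bar>B\<bar> * norm t powr k)" if "t \<in> disc_sector d (\<epsilon> / 2) R" "norm z < R" for t z
    proof -
      have "norm (F t z) \<le> A * exp (B * norm t powr k)" using AB sub that R by auto
      also have "\<dots> \<le> \<bar>A\<bar> * exp (\<bar>B\<bar> * norm t powr k)"
        by (intro mult_mono) (auto intro: mult_right_mono)
      finally show ?thesis .
    qed
  qed (use R sm in auto)
qed

lemma k_summable_iff_dir_summable:
  fixes u :: "nat \<Rightarrow> complex^'n \<Rightarrow> complex"
  shows "k_summable k d u \<longleftrightarrow> dir_summable k d (\<lambda>j z. u j z / of_real (Gamma (1 + real j / k)))"
proof
  assume "k_summable k d u"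
  then obtain \<epsilon> r1 r \<rho> and F :: "complex \<Rightarrow> complex^'n \<Rightarrow> complex" where *: "0 < \<epsilon>" "\<epsilon> < 2 * pi" "0 < r1" "0 < r" "Ok_sector k d \<epsilon> r1 r F" "\<rho> > 0"
    "\<forall>t z. norm t < \<rho> \<longrightarrow> norm z < \<rho> \<longrightarrow> (\<lambda>j. u j z / of_real (Gamma (1 + real j / k)) * t ^ j) sums F t z"
    unfolding k_summable_def by blast
  from Ok_sector_imp_sector_summable[OF *(5,1,3,4,6) *(7)[rule_format]] *(1,2)
  show "dir_summable k d (\<lambda>j z. u j z / of_real (Gamma (1 + real j / k)))"
    unfolding dir_summable_def by (intro exI[of _ "\<epsilon> / 2"]) auto
next
  assume "dir_summable k d (\<lambda>j z. u j z / of_real (Gamma (1 + real j / k)))"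
  then obtain \<epsilon> r A B and F :: "complex \<Rightarrow> complex^'n \<Rightarrow> complex" where *: "0 < \<epsilon>" "\<epsilon> < 2 * pi" "0 < r"
     "holo_tz {(t, z). t \<in> disc_sector d \<epsilon> r \<and> z \<in> ball 0 r} (\<lambda>(t, z). F t z)"
     "\<forall>t z. t \<in> disc_sector d \<epsilon> r \<longrightarrow> norm z < r \<longrightarrow> norm (F t z) \<le> A * exp (B * norm t powr k)"
     "\<forall>t z. norm t < r \<longrightarrow> norm z < r \<longrightarrow> (\<lambda>j. u j z / of_real (Gamma (1 + real j / k)) * t ^ j) sums F t z"
    unfolding dir_summable_def sector_summable_def by (elim exE conjE)
  have "Ok_sector k d \<epsilon> r r F"
    unfolding Ok_sector_def
  proof (intro conjI allI impI *(4))
    fix r' r1' \<epsilon>' assume "r' < r" "r1' < r" "\<epsilon>' < \<epsilon>"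
    then have "disc_sector d \<epsilon>' r1' \<subseteq> disc_sector d \<epsilon> r" using disc_sector_mono[of \<epsilon>' \<epsilon> r1' r d] by simp
    with *(5) \<open>r' < r\<close> have "\<forall>t\<in>disc_sector d \<epsilon>' r1'. \<forall>z. norm z \<le> r' \<longrightarrow> norm (F t z) \<le> A * exp (B * norm t powr k)"
      by (meson le_less_trans subsetD)
    then show "\<exists>A B. \<forall>t\<in>disc_sector d \<epsilon>' r1'. \<forall>z. norm z \<le> r' \<longrightarrow> norm (F t z) \<le> A * exp (B * norm t powr k)"
      by blast
  qed
  with * show "k_summable k d u" unfolding k_summable_def by blast
qed

lemma sums_multiples:
  fixes v :: "nat \<Rightarrow> complex"
  assumes N: "1 \<le> N"
  shows "(\<lambda>i. (if N dvd i then v (i div N) else 0) * t ^ i) sums x \<longleftrightarrow> (\<lambda>j. v j * t ^ (N * j)) sums x"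
proof -
  have "strict_mono (\<lambda>j. N * j)" using N by (intro strict_monoI) simp
  moreover have "(if N dvd i then v (i div N) else 0) * t ^ i = 0" if "i \<notin> range (\<lambda>j. N * j)" for i
    using that by (auto simp: dvd_def)
  ultimately have "(\<lambda>j. (if N dvd N * j then v (N * j div N) else 0) * t ^ (N * j)) sums x
      \<longleftrightarrow> (\<lambda>i. (if N dvd i then v (i div N) else 0) * t ^ i) sums x"
    by (rule sums_mono_reindex)
  then show ?thesis using N by simp
qed

text \<open>Descent along \<open>\<tau> = t\<^sup>N\<close>: a single sector suffices, since near the origin the sum only involves \<open>t\<^sup>N\<close>.\<close>

lemma sector_summable_power_root:
  fixes v :: "nat \<Rightarrow> complex^'n \<Rightarrow> complex"
  assumes k: "0 < k" and N: "1 \<le> N" and e: "0 < \<epsilon>"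
    and w: "sector_summable (real N * k) (d / real N) \<epsilon> (\<lambda>i z. if N dvd i then v (i div N) z else 0)"
  shows "dir_summable k d v"
proof -
  have k0: "0 \<le> real N * k" using k N by simp
  \<comment> \<open>Used with J = 0, so nothing is dropped; what is wanted are the holomorphy of the
    coefficients and the estimates for them.\<close>
  obtain r A B F where r: "0 < r" "0 \<le> A" "0 \<le> B"
    and Fh: "holo_tz {(t, z). t \<in> disc_sector (d / real N) \<epsilon> r \<and> z \<in> ball 0 r} (\<lambda>(t, z). F t z)"
    and Fb0: "\<And>t z. t \<in> disc_sector (d / real N) \<epsilon> r \<Longrightarrow> norm z < r \<Longrightarrow> norm (F t z) \<le> A * norm t ^ 0 * exp (B * norm t powr (real N * k))"
    and Fs: "\<And>t z. norm t < r \<Longrightarrow> norm z < r \<Longrightarrow> (\<lambda>i. (if i < 0 then 0 else if N dvd i then v (i div N) z else 0) * t ^ i) sums F t z"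
    and wh: "\<And>i. holo_tz {(t, z). z \<in> ball 0 r} (\<lambda>(t, z). if N dvd i then v (i div N) z else 0)"
    and wb: "\<And>i z. norm z < r \<Longrightarrow> norm (if N dvd i then v (i div N) z else 0) \<le> A / r ^ i"
    using sector_summable_drop[OF k0 w, of 0 thesis] by blast
  have Fb: "norm (F t z) \<le> A * exp (B * norm t powr (real N * k))"
    if "t \<in> disc_sector (d / real N) \<epsilon> r" "norm z < r" for t z using Fb0[OF that] by simp
  have Fs: "(\<lambda>j. v j z * t ^ (N * j)) sums F t z" if "norm t < r" "norm z < r" for t z
    using Fs[OF that] unfolding sums_multiples[OF N, symmetric] by simp
  have vh: "holo_tz {(t, z). z \<in> ball 0 r} (\<lambda>(t, z). v j z)" for j using wh[of "N * j"] N by simp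
  have vb: "norm (v j z) \<le> A / r ^ (N * j)" if "norm z < r" for j z using wb[OF that, of "N * j"] N by simp
  define \<epsilon>' where "\<epsilon>' = min \<epsilon> pi"
  have e': "0 < \<epsilon>'" "\<epsilon>' \<le> \<epsilon>" "\<epsilon>' \<le> pi" using e by (auto simp: \<epsilon>'_def)
  \<comment> \<open>The sector is first turned to the positive axis, where its opening of at most
    \<pi> keeps it away from the cut of the logarithm. Adding i d before dividing by N puts the root
    in the direction d / N.\<close>
  define root where "root \<tau> = exp ((Ln (\<tau> * cis (- d)) + \<i> * d) / of_nat N)" for \<tau>
  have N0: "N \<noteq> 0" using N by simp
  have rt: "\<tau> * cis (- d) \<notin> \<real>\<^sub>\<le>\<^sub>0 \<and> root \<tau> ^ N = \<tau> \<and> norm (root \<tau>) = norm \<tau> powr (1 / real N) \<and> root \<tau> \<in> sector (d / real N) \<epsilon>"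
    if tau: "\<tau> \<in> sector d \<epsilon>'" for \<tau>
  proof -
    obtain \<theta> where th: "\<tau> \<noteq> 0" "\<bar>\<theta> - d\<bar> < \<epsilon>' / 2" "\<tau> = of_real (norm \<tau>) * cis \<theta>"
      using tau unfolding sector_def by blast
    have bnd: "\<bar>\<theta> - d\<bar> < pi / 2" using th(2) e' by linarith
    define L where "L = Complex (ln (norm \<tau>)) (\<theta> - d)"
    have eL: "exp L = \<tau> * cis (- d)"
    proof -
      have "\<tau> * cis (- d) = of_real (norm \<tau>) * (cis \<theta> * cis (- d))" using th(3) by (metis mult.assoc)
      also have "\<dots> = exp L" using th(1) by (simp add: L_def exp_eq_polar cis_mult)
      finally show ?thesis ..
    qed
    have LnL: "Ln (\<tau> * cis (- d)) = L"
      unfolding eL[symmetric]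
    proof (rule Ln_exp)
      have "- (pi / 2) < \<theta> - d" "\<theta> - d < pi / 2" using bnd by linarith+
      then show "- pi < Im L" "Im L \<le> pi" using pi_gt_zero by (simp_all add: L_def)
    qed
    have "- (pi / 2) < \<theta> - d" "\<theta> - d < pi / 2" using bnd by linarith+
    then have "0 < cos (\<theta> - d)" by (rule cos_gt_zero_pi)
    then have "0 < Re (exp L)" by (simp add: L_def Re_exp)
    then have n: "\<tau> * cis (- d) \<notin> \<real>\<^sub>\<le>\<^sub>0" unfolding eL[symmetric] by (auto simp: complex_nonpos_Reals_iff)
    have rL: "(L + \<i> * d) / of_nat N = Complex (ln (norm \<tau>) / real N) (\<theta> / real N)"
      using N0 by (simp add: L_def complex_eq_iff Re_divide_of_nat Im_divide_of_nat)
    have pw: "root \<tau> ^ N = \<tau>"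
    proof -
      have "root \<tau> ^ N = exp (L + \<i> * d)" using N0 by (simp add: root_def LnL flip: exp_of_nat_mult)
      also have "\<dots> = \<tau> * (cis (- d) * cis d)" by (simp add: exp_add eL cis_conv_exp mult.assoc)
      finally show ?thesis by (simp add: cis_mult)
    qed
    have nr: "norm (root \<tau>) = norm \<tau> powr (1 / real N)"
      using th(1) by (simp add: root_def LnL rL powr_def)
    have "root \<tau> = of_real (norm (root \<tau>)) * cis (\<theta> / real N)"
      unfolding root_def LnL rL by (subst exp_eq_polar) simp
    moreover have "\<bar>\<theta> / real N - d / real N\<bar> < \<epsilon> / 2"
    proof -
      have "\<bar>\<theta> / real N - d / real N\<bar> = \<bar>\<theta> - d\<bar> / real N" by (simp add: diff_divide_distrib[symmetric])
      also have "\<dots> \<le> \<bar>\<theta> - d\<bar> / 1" using N by (intro divide_left_mono) auto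
      also have "\<dots> < \<epsilon>' / 2" using th(2) by simp
      also have "\<dots> \<le> \<epsilon> / 2" using e' by simp
      finally show ?thesis .
    qed
    moreover have "root \<tau> \<noteq> 0" by (simp add: root_def)
    ultimately have "root \<tau> \<in> sector (d / real N) \<epsilon>" unfolding sector_def by blast
    with n pw nr show ?thesis by blast
  qed
  have root_hol: "root holomorphic_on sector d \<epsilon>'"
    unfolding root_def using rt N0 by (intro holomorphic_intros) auto
  \<comment> \<open>A point of modulus below (r/2)^N has its root in the disc where the series for F
    is valid, and the series in \<tau> has a geometric majorant of ratio 1/2.\<close>
  define R where "R = min ((r / 2) ^ N) r"
  have R: "0 < R" "R \<le> r" "R \<le> (r / 2) ^ N" using r by (auto simp: R_def)
  define P where "P \<tau> z = (\<Sum>j. v j z * \<tau> ^ j)" for \<tau> z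
  \<comment> \<open>The branch of the root exists on the sector only, so the disc is covered by the
    power series in \<tau>. On the overlap both agree because the expansion of F contains only
    powers of t^N.\<close>
  define W where "W \<tau> z = (if norm \<tau> < R then P \<tau> z else F (root \<tau>) z)" for \<tau> z
  have vb2: "norm (v j z * \<tau> ^ j) \<le> A * (1 / 2) ^ j" if "norm \<tau> < R" "norm z < R" for j \<tau> z
  proof -
    have "norm (v j z * \<tau> ^ j) \<le> A / r ^ (N * j) * ((r / 2) ^ N) ^ j"
      unfolding norm_mult norm_power using that R r vb[of z j]
      by (intro mult_mono power_mono) auto
    also have "\<dots> = A * (1 / 2) ^ (N * j)"
      using r by (simp add: power_mult[symmetric] power_divide)
    also have "\<dots> \<le> A * (1 / 2) ^ j"
      using N r by (intro mult_left_mono power_decreasing) auto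
    finally show ?thesis .
  qed
  have half: "(\<lambda>j. A * (1 / 2) ^ j) sums (A * 2)" using sums_mult[OF geometric_sums[of "1 / 2 :: real"], of A] by simp
  have vsum: "summable (\<lambda>j. norm (v j z * \<tau> ^ j))" if "norm \<tau> < R" "norm z < R" for \<tau> z
    using sums_summable[OF half] by (rule summable_comparison_test'[where N = 0]) (simp only: norm_ge_zero real_norm_def abs_of_nonneg vb2[OF that])
  have Psum: "(\<lambda>j. v j z * \<tau> ^ j) sums P \<tau> z" if "norm \<tau> < R" "norm z < R" for \<tau> z
    unfolding P_def by (rule summable_sums, rule summable_norm_cancel, rule vsum[OF that])
  have overlap: "F (root \<tau>) z = P \<tau> z" if tau: "\<tau> \<in> sector d \<epsilon>'" "norm \<tau> < R" and z: "norm z < R" for \<tau> z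
  proof -
    have "norm (root \<tau>) ^ N < r ^ N"
    proof -
      have "norm (root \<tau>) ^ N = norm \<tau>" using rt[OF tau(1)] by (metis norm_power)
      also have "\<dots> < (r / 2) ^ N" using tau R by simp
      also have "\<dots> \<le> r ^ N" using r by (intro power_mono) auto
      finally show ?thesis .
    qed
    then have "norm (root \<tau>) < r" using r by (auto intro: power_less_imp_less_base)
    from Fs[OF this, of z] z R have "(\<lambda>j. v j z * root \<tau> ^ (N * j)) sums F (root \<tau>) z" by simp
    then have "(\<lambda>j. v j z * \<tau> ^ j) sums F (root \<tau>) z" using rt[OF tau(1)] by (simp add: power_mult)
    with Psum[OF tau(2) z] show ?thesis by (rule sums_unique2[rotated])
  qed
  have Whol: "holo_tz {(t, z). t \<in> disc_sector d \<epsilon>' R \<and> z \<in> ball 0 R} (\<lambda>(t, z). W t z)"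
  proof (rule holo_tz_local)
    fix y :: "complex \<times> (complex^'n)" assume "y \<in> {(t, z). t \<in> disc_sector d \<epsilon>' R \<and> z \<in> ball 0 R}"
    then obtain t z where y: "y = (t, z)" "t \<in> disc_sector d \<epsilon>' R" "norm z < R" by auto
    show "\<exists>U g. open U \<and> y \<in> U \<and> holo_tz U g \<and> (\<forall>y\<in>U. g y = (case y of (t, z) \<Rightarrow> W t z))"
    proof (cases "norm t < R")
      case True
      let ?U = "{(t, z). t \<in> ball (0 :: complex) R \<and> z \<in> ball (0 :: complex^'n) R}"
      have op: "open ?U" by (intro open_cylinder open_ball)
      have "holo_tz ?U (\<lambda>y. \<Sum>j. (case y of (t, z) \<Rightarrow> v j z) * fst y ^ j)"
      proof (rule holo_tz_suminf[OF op])
        show "holo_tz ?U (\<lambda>y. (case y of (t, z) \<Rightarrow> v j z) * fst y ^ j)" for j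
          by (rule holo_tz_mult[OF holo_tz_subset[OF vh] holo_tz_fst[where T = UNIV]])
            (use R in \<open>auto intro!: holomorphic_intros\<close>)
        show "\<exists>U g. open U \<and> y \<in> U \<and> summable g \<and> (\<forall>j. \<forall>y\<in>U \<inter> ?U. norm ((case y of (t, z) \<Rightarrow> v j z) * fst y ^ j) \<le> g j)"
          if "y \<in> ?U" for y
          by (rule exI[of _ ?U], rule exI[of _ "\<lambda>j. A * (1 / 2) ^ j"])
            (use that op sums_summable[OF half] vb2 in auto)
      qed
      moreover have "\<forall>y\<in>?U. (\<Sum>j. (case y of (t, z) \<Rightarrow> v j z) * fst y ^ j) = (case y of (t, z) \<Rightarrow> W t z)"
        by (auto simp: W_def P_def)
      moreover have "y \<in> ?U" using y True by simp
      ultimately show ?thesis using op by blast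
    next
      case False
      then have tS: "t \<in> sector d \<epsilon>'" using y by (simp add: disc_sector_def)
      let ?U = "{(t, z). t \<in> sector d \<epsilon>' \<and> z \<in> ball (0 :: complex^'n) R}"
      have op: "open ?U" by (intro open_cylinder open_ball open_sector)
      have "holo_tz ?U (\<lambda>(t, z). F (root t) z)"
        using holo_tz_compose_fst[OF Fh root_hol open_sector, of ?U] rt R by (fastforce simp: disc_sector_def)
      moreover have "\<forall>y\<in>?U. (case y of (t, z) \<Rightarrow> F (root t) z) = (case y of (t, z) \<Rightarrow> W t z)"
        using overlap by (auto simp: W_def)
      moreover have "y \<in> ?U" using y tS by simp
      ultimately show ?thesis using op by blast
    qed
  qed
  have Wb: "norm (W t z) \<le> (2 * A) * exp (B * norm t powr k)" if t: "t \<in> disc_sector d \<epsilon>' R" and z: "norm z < R" for t z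
  proof (cases "norm t < R")
    case True
    have "norm (P t z) \<le> (\<Sum>j. norm (v j z * t ^ j))" unfolding P_def by (rule summable_norm[OF vsum[OF True z]])
    also have "\<dots> \<le> (\<Sum>j. A * (1 / 2) ^ j)"
      by (rule suminf_le[OF vb2[OF True z] vsum[OF True z] sums_summable[OF half]])
    also have "\<dots> = 2 * A * 1" using sums_unique[OF half] by simp
    also have "\<dots> \<le> 2 * A * exp (B * norm t powr k)" using r by (intro mult_left_mono) auto
    finally show ?thesis using True by (simp add: W_def)
  next
    case False
    then have tS: "t \<in> sector d \<epsilon>'" using t by (simp add: disc_sector_def)
    have "norm (F (root t) z) \<le> A * exp (B * norm (root t) powr (real N * k))"
      using rt[OF tS] z R by (intro Fb) (auto simp: disc_sector_def)
    also have "norm (root t) powr (real N * k) = norm t powr k"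
      using rt[OF tS] N0 by (simp add: powr_powr)
    also have "A * exp (B * norm t powr k) \<le> 2 * A * exp (B * norm t powr k)" using r by (intro mult_right_mono) auto
    finally show ?thesis using False by (simp add: W_def)
  qed
  have "sector_summable k d \<epsilon>' v"
    by (rule sector_summableI[where r = R and F = W and A = "2 * A" and B = B, OF _ _ _ Whol Wb])
      (use R r Psum in \<open>auto simp: W_def\<close>)
  then show ?thesis unfolding dir_summable_def using e' pi_gt_zero by (intro exI[of _ \<epsilon>']) auto
qed

lemma in_Ok_sector_imp_dir_summable:
  fixes v :: "nat \<Rightarrow> complex^'n \<Rightarrow> complex"
  assumes k: "0 < k" and N: "1 \<le> N" and G: "in_Ok_sector (real N * k) (d / real N) G"
    and \<rho>: "0 < \<rho>" and sm: "\<And>t z. norm t < \<rho> \<Longrightarrow> norm z < \<rho> \<Longrightarrow> (\<lambda>j. v j z * t ^ (N * j)) sums G t z"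
  shows "dir_summable k d v"
proof -
  obtain \<epsilon> r1 r F \<rho>' where *: "0 < \<epsilon>" "0 < r1" "0 < r" "Ok_sector (real N * k) (d / real N) \<epsilon> r1 r F" "\<rho>' > 0"
    "\<forall>t z. norm t < \<rho>' \<longrightarrow> norm z < \<rho>' \<longrightarrow> F t z = G t z"
    using G unfolding in_Ok_sector_def by blast
  have "sector_summable (real N * k) (d / real N) (\<epsilon> / 2) (\<lambda>i z. if N dvd i then v (i div N) z else 0)"
  proof (rule Ok_sector_imp_sector_summable[OF *(4,1,2,3), of "min \<rho> \<rho>'"])
    fix t :: complex and z :: "complex^'n" assume "norm t < min \<rho> \<rho>'" "norm z < min \<rho> \<rho>'"
    then have "(\<lambda>j. v j z * t ^ (N * j)) sums F t z" using sm[of t z] *(6) by simp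
    then show "(\<lambda>i. (if N dvd i then v (i div N) z else 0) * t ^ i) sums F t z"
      using sums_multiples[OF N, of "\<lambda>j. v j z" t "F t z"] by simp
  qed (use \<rho> *(5) in simp)
  from sector_summable_power_root[OF k N _ this] *(1) show ?thesis by simp
qed

text \<open>The map t to t^N multiplies arguments by N, so the sector of opening \<epsilon> / N
  about (d + 2 l \<pi>) / N goes into the sector about d + 2 l \<pi>, which is the one about d.
  Growth of order k in t^N is growth of order N k in t.\<close>

lemma dir_summable_imp_in_Ok_sector:
  fixes v :: "nat \<Rightarrow> complex^'n \<Rightarrow> complex"
  assumes k: "0 < k" and N: "1 \<le> N" and v: "dir_summable k d v"
    and \<rho>: "0 < \<rho>" and sm: "\<And>t z. norm t < \<rho> \<Longrightarrow> norm z < \<rho> \<Longrightarrow> (\<lambda>j. v j z * t ^ (N * j)) sums G t z"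
  shows "in_Ok_sector (real N * k) ((d + 2 * real l * pi) / real N) G"
proof -
  obtain \<epsilon> r A B F where *: "0 < \<epsilon>" "\<epsilon> < 2 * pi" "0 < r"
     "holo_tz {(t, z). t \<in> disc_sector d \<epsilon> r \<and> z \<in> ball 0 r} (\<lambda>(t, z). F t z)"
     "\<forall>t z. t \<in> disc_sector d \<epsilon> r \<longrightarrow> norm z < r \<longrightarrow> norm (F t z) \<le> A * exp (B * norm t powr k)"
     "\<forall>t z. norm t < r \<longrightarrow> norm z < r \<longrightarrow> (\<lambda>j. v j z * t ^ j) sums F t z"
    using v unfolding dir_summable_def sector_summable_def by (elim exE conjE)
  let ?d = "(d + 2 * real l * pi) / real N"
  \<comment> \<open>At most 1, so that |t^N| \<le> |t| and the small disc is mapped into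
    itself.\<close>
  define R where "R = min 1 r"
  have R: "0 < R" "R \<le> 1" "R \<le> r" using * by (auto simp: R_def)
  have small: "norm (t ^ N) < R'" if "norm t < R'" "R' \<le> 1" for t :: complex and R'
  proof -
    have "norm t ^ N \<le> norm t ^ 1" using that N by (intro power_decreasing) auto
    then show ?thesis using that by (simp add: norm_power)
  qed
  have dom: "t ^ N \<in> disc_sector d \<epsilon> r" if t: "t \<in> disc_sector ?d (\<epsilon> / real N) R" for t
  proof (cases "norm t < R")
    case True
    then show ?thesis using small[OF True R(2)] R by (simp add: disc_sector_def)
  next
    case False
    then obtain \<theta> where th: "t \<noteq> 0" "\<bar>\<theta> - ?d\<bar> < \<epsilon> / real N / 2" "t = of_real (norm t) * cis \<theta>"
      using t unfolding disc_sector_def sector_def by auto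
    have "cis (real N * \<theta> - 2 * real l * pi) = cis (real N * \<theta>) * cis (2 * pi * - real l)" by (simp add: cis_mult algebra_simps)
    also have "cis (2 * pi * - real l) = 1" by (rule cis_multiple_2pi) simp
    finally have c: "cis (real N * \<theta> - 2 * real l * pi) = cis \<theta> ^ N" by (simp add: Complex.DeMoivre)
    have "t ^ N = of_real (norm t ^ N) * cis \<theta> ^ N"
      using arg_cong[OF th(3), of "\<lambda>x. x ^ N"] by (simp only: power_mult_distrib of_real_power)
    then have eq: "t ^ N = of_real (norm (t ^ N)) * cis (real N * \<theta> - 2 * real l * pi)" unfolding norm_power c .
    have "real N * \<bar>\<theta> - ?d\<bar> < real N * (\<epsilon> / real N / 2)" using th(2) N by (intro mult_strict_left_mono) auto
    moreover have "real N * \<bar>\<theta> - ?d\<bar> = \<bar>real N * (\<theta> - ?d)\<bar>" by (simp add: abs_mult)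
    moreover have "real N * (\<theta> - ?d) = real N * \<theta> - 2 * real l * pi - d" using N by (simp add: field_simps)
    ultimately have "\<bar>real N * \<theta> - 2 * real l * pi - d\<bar> < \<epsilon> / 2" using N by simp
    then have "t ^ N \<in> sector d \<epsilon>" unfolding sector_def using eq th(1) by auto
    then show ?thesis by (simp add: disc_sector_def)
  qed
  define H where "H t z = F (t ^ N) z" for t z
  have "Ok_sector (real N * k) ?d (\<epsilon> / real N) R R H"
    unfolding Ok_sector_def
  proof (intro conjI allI impI)
    show "holo_tz {(t, z). t \<in> disc_sector ?d (\<epsilon> / real N) R \<and> z \<in> ball 0 R} (\<lambda>(t, z). H t z)"
      unfolding H_def
      using holo_tz_compose_fst[OF *(4), of "\<lambda>t. t ^ N" UNIV "{(t, z). t \<in> disc_sector ?d (\<epsilon> / real N) R \<and> z \<in> ball 0 R}"] dom R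
      by (fastforce intro!: holomorphic_intros)
    fix r' r1' \<epsilon>' assume l: "r' < R" "r1' < R" "\<epsilon>' < \<epsilon> / real N"
    have "norm (H t z) \<le> A * exp (B * norm t powr (real N * k))"
      if "t \<in> disc_sector ?d \<epsilon>' r1'" "norm z \<le> r'" for t z
    proof -
      have "t \<in> disc_sector ?d (\<epsilon> / real N) R" using that l disc_sector_mono[of \<epsilon>' "\<epsilon> / real N" r1' R ?d] by auto
      from dom[OF this] *(5) that l R have "norm (H t z) \<le> A * exp (B * norm (t ^ N) powr k)"
        unfolding H_def by auto
      also have "norm (t ^ N) powr k = norm t powr (real N * k)"
        using N by (cases "t = 0") (auto simp: norm_power powr_powr powr_realpow[symmetric])
      finally show ?thesis .
    qed
    then show "\<exists>A B. \<forall>t\<in>disc_sector ?d \<epsilon>' r1'. \<forall>z. norm z \<le> r' \<longrightarrow> norm (H t z) \<le> A * exp (B * norm t powr (real N * k))"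
      by blast
  qed
  moreover have "H t z = G t z" if "norm t < min \<rho> R" "norm z < min \<rho> R" for t z
  proof -
    have "norm (t ^ N) < r" using small[of t R] that R by simp
    moreover have "norm z < r" using that R by simp
    ultimately have "(\<lambda>j. v j z * (t ^ N) ^ j) sums H t z" unfolding H_def using *(6) by blast
    moreover have "(\<lambda>j. v j z * t ^ (N * j)) sums G t z" using sm that by simp
    ultimately show ?thesis by (simp add: power_mult sums_unique2)
  qed
  moreover have "\<epsilon> / real N < 2 * pi"
  proof -
    have "\<epsilon> / real N \<le> \<epsilon> / 1" using *(1) N by (intro divide_left_mono) auto
    then show ?thesis using *(2) by simp
  qed
  ultimately have "Ok_sector (real N * k) ?d (\<epsilon> / real N) R R H" "\<epsilon> / real N < 2 * pi"
    "\<exists>\<rho>>0. \<forall>t z. norm t < \<rho> \<longrightarrow> norm z < \<rho> \<longrightarrow> H t z = G t z"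
    using R \<rho> by (auto intro!: exI[of _ "min \<rho> R"])
  moreover have "0 < \<epsilon> / real N" using *(1) N by simp
  ultimately show ?thesis unfolding in_Ok_sector_def using R(1) by blast
qed

section \<open>Convergence and entire growth\<close>

lemma suminf_exp_multiples_le:
  assumes "1 \<le> L" "0 \<le> (y :: real)"
  shows "summable (\<lambda>j. y ^ (L * j) / fact (L * j))" and "(\<Sum>j. y ^ (L * j) / fact (L * j)) \<le> exp y"
proof -
  have s: "(\<lambda>n. y ^ n / fact n) sums exp y"
    using exp_converges[of y] by (simp add: divide_inverse mult.commute)
  have inj: "inj (\<lambda>j. L * j)" using assms by (auto simp: inj_on_def)
  show "summable (\<lambda>j. y ^ (L * j) / fact (L * j))"
    using summable_reindex[OF sums_summable[OF s] inj] assms by (simp add: o_def)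
  show "(\<Sum>j. y ^ (L * j) / fact (L * j)) \<le> exp y"
    using suminf_reindex_mono[OF sums_summable[OF s] inj] assms sums_unique[OF s] by (simp add: o_def)
qed

lemma holo_tz_fun_mult_const: "holo_tz S (\<lambda>(t, z). f t z) \<Longrightarrow> holo_tz S (\<lambda>(t, z). c * f t z)"
  using holo_tz_mult[OF holo_tz_const, of S "\<lambda>(t, z). f t z" c] by (simp add: case_prod_unfold)

lemma converges_holo_imp_in_Ok_entire:
  fixes a :: "nat \<Rightarrow> complex^'n \<Rightarrow> complex" and b :: "nat \<Rightarrow> real"
  assumes N: "2 \<le> N" and c: "0 < c" and b: "\<And>j. c ^ j * fact (N * j) \<le> b j"
    and \<rho>: "0 < \<rho>" and sm: "\<And>t z. norm t < \<rho> \<Longrightarrow> norm z < \<rho> \<Longrightarrow> (\<lambda>j. a j z / of_real (b j) * t ^ (N * j)) sums G t z"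
    and conv: "converges_holo (\<lambda>j z. a j z / of_nat (fact j))"
  shows "in_Ok_entire (real N / (real N - 1)) G"
proof -
  obtain r U where r: "0 < r" and U: "holo_tz (ball 0 r) U"
    and Us: "\<And>t z. norm (t, z) < r \<Longrightarrow> (\<lambda>j. a j z / of_nat (fact j) * t ^ j) sums U (t, z)"
    using conv unfolding converges_holo_def by blast
  \<comment> \<open>If both components have norm at most r/3, their pair has norm at most 2 r/3 and
    stays in the ball of convergence.\<close>
  define R where "R = r / 3"
  have R: "0 < R" using r by (simp add: R_def)
  have pair: "norm (t, z) < r" if "norm t \<le> R" "norm z \<le> R" for t :: complex and z :: "complex^'n"
    using norm_Pair_le[of t z] that r unfolding R_def by linarith
  have "compact (U ` (cball 0 R \<times> cball 0 R))"
    by (intro compact_continuous_image compact_Times compact_cball continuous_on_subset[OF holo_tz_continuous_on[OF U]])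
      (use pair in auto)
  then obtain M where M: "\<And>t z. norm t \<le> R \<Longrightarrow> norm z \<le> R \<Longrightarrow> norm (U (t, z)) \<le> M"
    by (force dest!: compact_imp_bounded simp: bounded_iff)
  have M0: "0 \<le> M" using order_trans[OF norm_ge_zero M[of 0 0]] R by simp
  have Uh: "holo_tz {(t, z). t \<in> ball 0 R \<and> z \<in> ball 0 R} (\<lambda>(t, z). U (t, z))"
  proof -
    have "{(t, z). t \<in> ball 0 R \<and> z \<in> ball 0 R} \<subseteq> ball (0 :: complex \<times> (complex^'n)) r" using pair by (auto simp: dist_0_norm less_imp_le)
    from holo_tz_subset[OF U this] show ?thesis by (simp only: case_prod_conv case_prod_eta split_def prod.collapse)
  qed
  have half: "0 < R / 2" "R / 2 < R" using R by auto
  have Us': "(\<lambda>j. a j z / of_nat (fact j) * t ^ j) sums U (t, z)" if "norm t < R" "norm z < R" for t z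
    using Us[OF pair] that by simp
  have M': "norm (U (t, z)) \<le> M" if "norm t < R" "norm z < R" for t z using M that by simp
  have uh: "holo_tz {(t, z). z \<in> ball 0 R} (\<lambda>(t, z). a j z / of_nat (fact j))" for j
    by (rule holo_tz_coefficient(1)[OF Uh Us' half M'])
  have ub: "norm (a j z / of_nat (fact j)) \<le> M / (R / 2) ^ j" if "norm z < R" for j z
    by (rule holo_tz_coefficient(2)[OF Uh Us' half M' that])
  define v where "v j z = a j z / of_real (b j)" for j z
  have bpos: "0 < b j" for j using less_le_trans[OF _ b[of j]] c by simp
  have v_eq: "v j z = of_real (fact j / b j) * (a j z / of_nat (fact j))" for j z by (simp add: v_def)
  define L where "L = N - 1"
  have L: "1 \<le> L" "N = L + 1" using N by (auto simp: L_def)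
  define q where "q = 2 / (R * c)"
  have q: "0 < q" using R c by (simp add: q_def)
  have vh: "holo_tz {(t, z). z \<in> ball 0 R} (\<lambda>(t, z). v j z)" for j
    unfolding v_eq by (rule holo_tz_fun_mult_const[OF uh])
  have vb: "norm (v j z) \<le> M * (q ^ j / fact (L * j))" if z: "norm z < R" for j z
  proof -
    have f: "fact j * fact (L * j) \<le> (fact (N * j) :: real)"
    proof -
      have "fact j * fact (L * j) \<le> (fact (N * j) :: nat)"
        using fact_fact_dvd_fact[of j "L * j"] L(2) by (intro dvd_imp_le) (simp_all add: add.commute)
      then show ?thesis by (metis of_nat_fact of_nat_le_iff of_nat_mult)
    qed
    have "fact j / b j \<le> fact j / (c ^ j * fact (N * j))" using b[of j] c by (intro divide_left_mono) (auto simp: bpos)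
    also have "\<dots> \<le> fact j / (c ^ j * (fact j * fact (L * j)))" using f c by (intro divide_left_mono mult_left_mono) auto
    also have "\<dots> = 1 / (c ^ j * fact (L * j))" by simp
    finally have 1: "fact j / b j \<le> 1 / (c ^ j * fact (L * j))" .
    have "norm (v j z) = fact j / b j * norm (a j z / of_nat (fact j))"
      unfolding v_eq norm_mult norm_of_real using bpos[of j] by simp
    also have "\<dots> \<le> 1 / (c ^ j * fact (L * j)) * (M / (R / 2) ^ j)"
      using 1 ub[OF z, of j] c by (intro mult_mono) auto
    also have "\<dots> = M * (q ^ j / fact (L * j))" by (simp add: q_def power_divide power_mult_distrib)
    finally show ?thesis .
  qed
  \<comment> \<open>Chosen so that Y^L = q x^N with L = N - 1: the majorant of the j-th term becomes
    Y^(L j) / (L j)!, a term of exp Y. The order N / (N - 1) is the exponent of x in Y.\<close>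
  define Y where "Y x = q powr (1 / L) * x powr (real N / (real N - 1))" for x
  have Y0: "0 \<le> Y x" for x by (simp add: Y_def)
  have Y: "Y x ^ (L * j) = q ^ j * x ^ (N * j)" if "0 \<le> x" for x j
  proof -
    have "Y x ^ L = q * x ^ N"
    proof (cases "x = 0")
      case False
      then have x: "0 < x" using that by simp
      have "Y x ^ L = (q powr (1 / L)) powr L * (x powr (real N / L)) powr L"
        using q x L by (simp add: Y_def power_mult_distrib powr_realpow)
      also have "\<dots> = q powr 1 * x powr real N" using L by (simp add: powr_powr)
      finally show ?thesis using q x by (simp add: powr_realpow)
    qed (use L in \<open>simp add: Y_def\<close>)
    then show ?thesis by (simp add: power_mult power_mult_distrib)
  qed
  have tb: "norm (v j z * t ^ (N * j)) \<le> M * (Y T ^ (L * j) / fact (L * j))" if "norm z < R" "norm t \<le> T" for j z t T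
  proof -
    have T: "0 \<le> T" using that(2) norm_ge_zero[of t] by linarith
    have "norm (v j z * t ^ (N * j)) \<le> M * (q ^ j / fact (L * j)) * T ^ (N * j)"
      unfolding norm_mult norm_power using vb[OF that(1), of j] that(2) M0 q
      by (intro mult_mono power_mono) auto
    then show ?thesis using Y[OF T, of j] by simp
  qed
  note ex = suminf_exp_multiples_le[OF L(1) Y0]
  define F where "F t z = (\<Sum>j. v j z * t ^ (N * j))" for t z
  have ab: "summable (\<lambda>j. norm (v j z * t ^ (N * j)))" if "norm z < R" for t z
    using summable_mult[OF ex(1), of M "norm t"] by (rule summable_comparison_test'[where N = 0]) (use tb[OF that order_refl] in simp)
  have "Ok_entire (real N / (real N - 1)) R F"
    unfolding Ok_entire_def
  proof (intro conjI allI impI)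
    let ?S = "{(t :: complex, z :: complex^'n). z \<in> ball 0 R}"
    have op: "open ?S" using open_cylinder[OF open_UNIV open_ball[of "0 :: complex^'n" R]] by simp
    have "holo_tz ?S (\<lambda>y. \<Sum>j. (case y of (t, z) \<Rightarrow> v j z) * fst y ^ (N * j))"
    proof (rule holo_tz_suminf[OF op])
      show "holo_tz ?S (\<lambda>y. (case y of (t, z) \<Rightarrow> v j z) * fst y ^ (N * j))" for j
        by (rule holo_tz_mult[OF vh holo_tz_fst[where T = UNIV]]) (auto intro!: holomorphic_intros)
      fix y :: "complex \<times> (complex^'n)" assume y: "y \<in> ?S"
      define T where "T = norm (fst y) + 1"
      show "\<exists>U g. open U \<and> y \<in> U \<and> summable g \<and> (\<forall>j. \<forall>y\<in>U \<inter> ?S. norm ((case y of (t, z) \<Rightarrow> v j z) * fst y ^ (N * j)) \<le> g j)"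
      proof (rule exI[of _ "{(t, z). t \<in> ball 0 T \<and> z \<in> ball 0 R}"], rule exI[of _ "\<lambda>j. M * (Y T ^ (L * j) / fact (L * j))"], intro conjI)
        show "open {(t :: complex, z :: complex^'n). t \<in> ball 0 T \<and> z \<in> ball 0 R}" by (intro open_cylinder open_ball)
        show "y \<in> {(t, z). t \<in> ball 0 T \<and> z \<in> ball 0 R}" using y by (auto simp: T_def)
        show "summable (\<lambda>j. M * (Y T ^ (L * j) / fact (L * j)))" by (rule summable_mult[OF ex(1)])
      qed (use tb in \<open>auto simp: less_imp_le\<close>)
    qed
    then show "holo_tz ?S (\<lambda>(t, z). F t z)" by (simp add: F_def case_prod_unfold)
    fix r' assume r': "r' < R"
    have "norm (F t z) \<le> M * exp (q powr (1 / L) * norm t powr (real N / (real N - 1)))" if "norm z \<le> r'" for t z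
    proof -
      have z: "norm z < R" using that r' by simp
      have "norm (F t z) \<le> (\<Sum>j. norm (v j z * t ^ (N * j)))" unfolding F_def by (rule summable_norm[OF ab[OF z]])
      also have "\<dots> \<le> (\<Sum>j. M * (Y (norm t) ^ (L * j) / fact (L * j)))"
        by (rule suminf_le[OF tb[OF z order_refl] ab[OF z] summable_mult[OF ex(1)]])
      also have "\<dots> = M * (\<Sum>j. Y (norm t) ^ (L * j) / fact (L * j))" by (rule suminf_mult[OF ex(1)])
      also have "\<dots> \<le> M * exp (Y (norm t))" using ex(2) M0 by (rule mult_left_mono)
      finally show ?thesis by (simp add: Y_def)
    qed
    then show "\<exists>A B. \<forall>t z. norm z \<le> r' \<longrightarrow> norm (F t z) \<le> A * exp (B * norm t powr (real N / (real N - 1)))" by blast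
  qed
  moreover have "F t z = G t z" if "norm t < \<rho>" "norm z < \<rho>" for t z
    using sums_unique[OF sm[OF that]] by (simp add: F_def v_def)
  ultimately show ?thesis unfolding in_Ok_entire_def using R \<rho> by blast
qed

lemma in_Ok_entire_imp_converges_holo:
  fixes a :: "nat \<Rightarrow> complex^'n \<Rightarrow> complex" and b :: "nat \<Rightarrow> real"
  assumes N: "2 \<le> N" and b: "\<And>j. 0 < b j" "\<And>j. b j \<le> C ^ j * fact (N * j)" and C: "0 < C"
    and \<rho>: "0 < \<rho>" and sm: "\<And>t z. norm t < \<rho> \<Longrightarrow> norm z < \<rho> \<Longrightarrow> (\<lambda>j. a j z / of_real (b j) * t ^ (N * j)) sums G t z"
    and G: "in_Ok_entire (real N / (real N - 1)) G"
  shows "converges_holo (\<lambda>j z. a j z / of_nat (fact j))"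
proof -
  define \<kappa> where "\<kappa> = real N / (real N - 1)"
  have \<kappa>: "0 < \<kappa>" using N by (simp add: \<kappa>_def)
  obtain r F \<rho>' where r: "0 < r" and F: "Ok_entire \<kappa> r F" and \<rho>': "0 < \<rho>'"
    "\<And>t z. norm t < \<rho>' \<Longrightarrow> norm z < \<rho>' \<Longrightarrow> F t z = G t z"
    using G unfolding in_Ok_entire_def \<kappa>_def by blast
  have Fh: "holo_tz {(t, z). z \<in> ball 0 r} (\<lambda>(t, z). F t z)" using F unfolding Ok_entire_def by blast
  have "\<exists>A B. \<forall>t. \<forall>z. norm z \<le> r / 2 \<longrightarrow> norm (F t z) \<le> A * exp (B * norm t powr \<kappa>)"
    using conjunct2[OF F[unfolded Ok_entire_def], rule_format, of "r / 2"] r by simp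
  then obtain A0 B0 where AB0: "\<And>t z. norm z \<le> r / 2 \<Longrightarrow> norm (F t z) \<le> A0 * exp (B0 * norm t powr \<kappa>)" by blast
  define A B where "A = \<bar>A0\<bar>" and "B = \<bar>B0\<bar>"
  have AB: "norm (F t z) \<le> A * exp (B * norm t powr \<kappa>)" if "norm z \<le> r / 2" for t z
  proof -
    have "A0 * exp (B0 * norm t powr \<kappa>) \<le> A * exp (B * norm t powr \<kappa>)"
      unfolding A_def B_def by (intro mult_mono) (auto intro: mult_right_mono)
    then show ?thesis using AB0[OF that, of t] by simp
  qed
  have AB_nonneg: "0 \<le> A" "0 \<le> B" by (auto simp: A_def B_def)
  define R where "R = min (r / 2) (min \<rho> \<rho>')"
  have R: "0 < R" "R \<le> r / 2" "R \<le> \<rho>" "R \<le> \<rho>'" using r \<rho> \<rho>' by (auto simp: R_def)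
  define v where "v j z = a j z / of_real (b j)" for j z
  \<comment> \<open>Inserting zeros turns the series in t^N into a power series in t, to which the
    coefficient results apply.\<close>
  define w where "w i z = (if N dvd i then v (i div N) z else 0)" for i z
  have N0: "1 \<le> N" using N by simp
  have ws: "(\<lambda>i. w i z * t ^ i) sums F t z" if "norm t < R" "norm z < R" for t z
    using sm[of t z] \<rho>'(2)[of t z] that R sums_multiples[OF N0, of "\<lambda>j. v j z" t "F t z"] by (simp add: w_def v_def)
  have Fh': "holo_tz {(t, z). t \<in> ball 0 R \<and> z \<in> ball 0 R} (\<lambda>(t, z). F t z)"
    by (rule holo_tz_subset[OF Fh]) (use R in auto)
  have half: "0 < R / 2" "R / 2 < R" using R by auto
  have FM: "norm (F t z) \<le> A * exp (B * R powr \<kappa>)" if "norm t < R" "norm z < R" for t z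
  proof -
    have "norm (F t z) \<le> A * exp (B * norm t powr \<kappa>)" using AB that R by simp
    also have "\<dots> \<le> A * exp (B * R powr \<kappa>)"
      using that AB_nonneg \<kappa> by (intro mult_left_mono iffD2[OF exp_le_cancel_iff] powr_mono2) auto
    finally show ?thesis .
  qed
  have wh: "holo_tz {(t, z). z \<in> ball 0 R} (\<lambda>(t, z). w i z)" for i
    by (rule holo_tz_coefficient(1)[OF Fh' ws half FM])
  have vh: "holo_tz {(t, z). z \<in> ball 0 R} (\<lambda>(t, z). v j z)" for j using wh[of "N * j"] N by (simp add: w_def)
  have wb: "norm (w n z) \<le> A * exp (B * T powr \<kappa>) / T ^ n" if z: "norm z < R" and T: "0 < T" for n z T
  proof -
    have hol: "(\<lambda>t. F t z) holomorphic_on UNIV"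
      using holo_tz_section[OF Fh, of UNIV z] z R by simp
    let ?f = "\<lambda>t. F t z"
    \<comment> \<open>The Taylor coefficients of F and the \<open>w n\<close> equal the same circle
      integral. F is entire in t, so Cauchy's inequality then bounds \<open>w n\<close> on circles
      of every radius T.\<close>
    have "(\<lambda>n. (deriv ^^ n) ?f 0 / fact n * t ^ n) sums F t z" if "norm t < R" for t
      using holomorphic_power_series[of ?f 0 R t] holomorphic_on_subset[OF hol] that by simp
    from power_series_coefficient_integral(1)[OF this half, of n]
      power_series_coefficient_integral(1)[OF ws[OF _ z] half, of n]
    have eq: "w n z = (deriv ^^ n) ?f 0 / fact n" by simp
    have "norm ((deriv ^^ n) ?f 0) \<le> fact n * (A * exp (B * T powr \<kappa>)) / T ^ n"
    proof (rule Cauchy_inequality)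
      show "?f holomorphic_on ball 0 T" "continuous_on (cball 0 T) ?f"
        using holomorphic_on_subset[OF hol] holomorphic_on_imp_continuous_on[OF holomorphic_on_subset[OF hol]] by auto
      show "norm (F x z) \<le> A * exp (B * T powr \<kappa>)" if "norm (0 - x) = T" for x
        using AB[of z x] z R that by simp
    qed (use T in simp)
    from divide_right_mono[OF this, of "fact n"] show ?thesis unfolding eq norm_divide by simp
  qed
  \<comment> \<open>The factors that survive when b j / j! \<le> C^j (N j)^((N-1) j) meets the
    Cauchy bound exp (B j) / j^((N-1) j).\<close>
  define D where "D = C * exp B * real N ^ (N - 1)"
  have D: "0 < D" using C N by (simp add: D_def)
  define u where "u j z = a j z / of_nat (fact j)" for j z
  have u_eq: "u j z = of_real (b j / fact j) * v j z" for j z using b(1)[of j] by (simp add: u_def v_def)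
  have uh: "holo_tz {(t, z). z \<in> ball 0 R} (\<lambda>(t, z). u j z)" for j
    unfolding u_eq by (rule holo_tz_fun_mult_const[OF vh])
  have ub: "norm (u j z) \<le> A * exp B * D ^ j" if z: "norm z < R" for j z
  \<comment> \<open>The radius used for general j would be 0 here, so T = 1 is taken
    instead.\<close>
  proof (cases "j = 0")
    case True
    have "norm (v 0 z) \<le> A * exp B" using wb[OF z, of 1 0] by (simp add: w_def)
    moreover have "b 0 * norm (v 0 z) \<le> 1 * norm (v 0 z)" using b(2)[of 0] by (intro mult_right_mono) auto
    ultimately show ?thesis unfolding u_eq norm_mult norm_of_real using True b(1)[of 0] by simp
  next
    case False
    then have j: "0 < real j" by simp
    define L where "L = N - 1"
    have L: "1 \<le> L" "N = L + 1" using N by (auto simp: L_def)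
    have kL: "\<kappa> = real N / real L" using L by (simp add: \<kappa>_def)
    \<comment> \<open>With T^\<kappa> = j the exponential in the Cauchy bound becomes exp (B j),
      which is geometric, while T^(N j) = j^((N-1) j) cancels the superexponential growth of b j /
      j!.\<close>
    define T where "T = real j powr (1 / \<kappa>)"
    have T: "0 < T" using j by (simp add: T_def)
    have T1: "T powr \<kappa> = real j" using j \<kappa> by (simp add: T_def powr_powr)
    have T2: "T ^ (N * j) = real j ^ (L * j)"
    proof -
      have "T ^ (N * j) = real j powr (1 / \<kappa> * real (N * j))" using T by (simp add: T_def powr_powr flip: powr_realpow)
      also have "1 / \<kappa> * real (N * j) = real (L * j)" using N by (simp add: kL)
      finally show ?thesis using j by (simp only: powr_realpow)
    qed
    have "norm (v j z) \<le> A * exp (B * real j) / real j ^ (L * j)"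
      using wb[OF z T, of "N * j"] N unfolding T1 T2 by (simp add: w_def)
    moreover have "b j / fact j \<le> C ^ j * real (N * j) ^ (L * j)"
    proof -
      have "fact (N * j) div fact (N * j - L * j) \<le> (N * j) ^ (L * j)"
        by (rule fact_div_fact_le_pow) (use L in simp)
      moreover have "N * j - L * j = j" using L by simp
      ultimately have "fact (N * j) div fact j \<le> (N * j) ^ (L * j)" by simp
      moreover have "fact (N * j) = fact (N * j) div fact j * (fact j :: nat)" using N by (simp add: fact_dvd)
      ultimately have "fact (N * j) \<le> (N * j) ^ (L * j) * (fact j :: nat)" by (metis mult_le_mono1)
      then have "real (fact (N * j)) \<le> real ((N * j) ^ (L * j) * fact j)" by (simp only: of_nat_le_iff)
      then have "(fact (N * j) :: real) \<le> real (N * j) ^ (L * j) * fact j"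
        by (simp only: of_nat_mult of_nat_power of_nat_fact)
      then have "C ^ j * fact (N * j) \<le> C ^ j * (real (N * j) ^ (L * j) * fact j)" using C by (intro mult_left_mono) auto
      with b(2)[of j] have "b j \<le> C ^ j * real (N * j) ^ (L * j) * fact j" by simp
      then show ?thesis by (simp add: divide_le_eq)
    qed
    moreover have "norm (u j z) = b j / fact j * norm (v j z)" unfolding u_eq norm_mult norm_of_real using b(1)[of j] by simp
    ultimately have "norm (u j z) \<le> C ^ j * real (N * j) ^ (L * j) * (A * exp (B * real j) / real j ^ (L * j))"
      using b(1)[of j] C by (simp only:) (rule mult_mono, simp_all add: less_imp_le)
    also have "\<dots> = A * D ^ j"
    proof -
      have e: "exp (B * real j) = exp B ^ j" "real (N * j) ^ (L * j) = real N ^ (L * j) * real j ^ (L * j)"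
        "D ^ j = C ^ j * exp B ^ j * real N ^ (L * j)"
        by (simp_all only: D_def L_def power_mult_distrib power_mult exp_of_nat2_mult of_nat_mult)
      have "real j ^ (L * j) \<noteq> 0" using j by simp
      then show ?thesis unfolding e by (simp only: times_divide_eq_right times_divide_eq_left mult_ac nonzero_divide_eq_eq nonzero_eq_divide_eq divide_eq_eq eq_divide_eq not_False_eq_True if_True)
    qed
    also have "\<dots> \<le> A * exp B * D ^ j" using AB_nonneg D by (intro mult_right_mono) (auto simp: mult_le_cancel_left1)
    finally show ?thesis .
  qed
  define \<delta> where "\<delta> = min R (1 / (2 * D))"
  have \<delta>: "0 < \<delta>" "\<delta> \<le> R" "D * \<delta> \<le> 1 / 2" using R D by (auto simp: \<delta>_def min_def field_simps)
  have tb: "norm (u j z * t ^ j) \<le> A * exp B * (1 / 2) ^ j" if "norm t < \<delta>" "norm z < R" for j t z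
  proof -
    have "norm (u j z * t ^ j) \<le> A * exp B * D ^ j * \<delta> ^ j"
      unfolding norm_mult norm_power using ub[OF that(2), of j] that AB_nonneg D by (intro mult_mono power_mono) auto
    also have "\<dots> = A * exp B * (D * \<delta>) ^ j" by (simp add: power_mult_distrib)
    also have "\<dots> \<le> A * exp B * (1 / 2) ^ j" using \<delta> D AB_nonneg by (intro mult_left_mono power_mono) auto
    finally show ?thesis .
  qed
  have geo: "summable (\<lambda>j. A * exp B * (1 / 2 :: real) ^ j)" by (intro summable_mult summable_geometric) simp
  define U where "U = (\<lambda>y :: complex \<times> (complex^'n). \<Sum>j. (case y of (t, z) \<Rightarrow> u j z) * fst y ^ j)"
  let ?S = "{(t :: complex, z :: complex^'n). t \<in> ball 0 \<delta> \<and> z \<in> ball 0 R}"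
  have "holo_tz ?S U"
    unfolding U_def
  proof (rule holo_tz_suminf)
    show op: "open ?S" by (intro open_cylinder open_ball)
    show "holo_tz ?S (\<lambda>y. (case y of (t, z) \<Rightarrow> u j z) * fst y ^ j)" for j
      by (rule holo_tz_mult[OF holo_tz_subset[OF uh] holo_tz_fst[where T = UNIV]]) (auto intro!: holomorphic_intros)
    show "\<exists>U g. open U \<and> y \<in> U \<and> summable g \<and> (\<forall>j. \<forall>y\<in>U \<inter> ?S. norm ((case y of (t, z) \<Rightarrow> u j z) * fst y ^ j) \<le> g j)" if "y \<in> ?S" for y
      by (rule exI[of _ ?S], rule exI[of _ "\<lambda>j. A * exp B * (1 / 2) ^ j"]) (use that op geo tb in auto)
  qed
  have le: "norm t < \<delta>" "norm z < R" if "norm (t, z) < \<delta>" for t :: complex and z :: "complex^'n"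
    using that \<delta> norm_fst_le[of t z] norm_snd_le[of z t] by linarith+
  have sub: "ball 0 \<delta> \<subseteq> ?S"
  proof
    fix y :: "complex \<times> (complex^'n)" assume "y \<in> ball 0 \<delta>"
    then show "y \<in> ?S" using le[of "fst y" "snd y"] by (simp add: case_prod_unfold)
  qed
  have "(\<lambda>j. u j z * t ^ j) sums U (t, z)" if "norm (t, z) < \<delta>" for t z
  proof -
    have "summable (\<lambda>j. norm (u j z * t ^ j))"
      using geo by (rule summable_comparison_test'[where N = 0]) (use tb[OF le[OF that]] in simp)
    then show ?thesis unfolding U_def by (simp add: summable_norm_cancel summable_sums)
  qed
  with holo_tz_subset[OF \<open>holo_tz ?S U\<close> sub] \<delta>(1) show ?thesis
    unfolding converges_holo_def u_def by blast
qed

section \<open>Generalised moment functions\<close>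

context kernel
begin

text \<open>Substituting x = y^q produces the factor q that cancels the 1/q in the definition of the
  kernel, and multiplies the index by q. Kernels of order at most 1/2 are thereby reduced to basic
  ones.\<close>

lemma kmoment_root_kernel:
  assumes e1: "\<And>x. 0 < x \<Longrightarrow> e1 (of_real x) = e (of_real (x powr (1 / real q))) / of_nat q"
    and q: "1 \<le> q" and n: "0 < n"
  shows "kmoment e1 n = kmoment e (q * n)"
proof -
  have qn: "0 < real (q * n)" using q n by simp
  note m = moment_real[OF qn]
  define I where "I = (LINT x|lborel. exp (real (q * n) * x) * Re (e (exp (of_real x))))"
  define f where "f x = x powr (real n - 1) * Re (e1 (of_real x))" for x :: real
  define g where "g x = exp (real q * x)" for x
  have sub: "\<bar>real q * g x\<bar> * f (g x) = exp (real (q * n) * x) * Re (e (exp (of_real x)))" for x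
  proof -
    have "g x * g x powr (real n - 1) = exp (real (q * n) * x)"
      by (simp add: g_def exp_powr_real exp_add[symmetric] algebra_simps)
    moreover have "e1 (of_real (g x)) = e (exp (of_real x)) / of_nat q"
      using e1[of "g x"] q by (simp add: g_def exp_powr_real exp_of_real)
    ultimately show ?thesis using q by (simp add: f_def Re_divide_of_nat g_def)
  qed
  have int: "integrable lborel (\<lambda>x. \<bar>real q * g x\<bar> * f (g x))" unfolding sub using m(1) by simp
  then have "(\<lambda>x. \<bar>real q * g x\<bar> * f (g x)) absolutely_integrable_on UNIV"
    using integrable_completion[of "\<lambda>x. \<bar>real q * g x\<bar> * f (g x)" lborel] by (simp add: set_integrable_def)
  moreover have "integral UNIV (\<lambda>x. \<bar>real q * g x\<bar> * f (g x)) = I"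
    using integral_lborel[OF int] unfolding sub I_def by simp
  moreover have "range g = {0 :: real<..}"
  proof -
    have "x \<in> range g" if "0 < x" for x using that q by (intro image_eqI[of _ _ "ln x / real q"]) (auto simp: g_def)
    then show ?thesis by (auto simp: g_def)
  qed
  moreover have "(g has_field_derivative real q * g x) (at x)" for x
    unfolding g_def by (auto intro!: derivative_eq_intros)
  moreover have "inj g" using q by (auto simp: g_def inj_on_def)
  ultimately have "integral {0<..} f = I"
    using has_absolute_integral_change_of_variables_1'[of UNIV g "\<lambda>x. real q * g x" f I] by simp
  then have "kmoment e1 n = I" by (simp add: kmoment_def f_def[abs_def])
  moreover have "of_real (kmoment e (q * n)) = (of_real I :: complex)"
    using kmoment_eq(1)[of "q * n"] m(2) q n unfolding I_def by simp
  ultimately show ?thesis by simp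
qed

end

text \<open>The relation defining generalised moment functions is used at the index s j, so p1 and
  p2 are rewritten as polynomials in j with complex coefficients.\<close>

lemma poly_complexify:
  fixes P :: "real poly"
  shows "poly (pcompose (map_poly of_real P) [:0, of_nat s:]) (of_nat j :: complex) = of_real (poly P (real (s * j)))"
proof -
  have "poly (map_poly of_real P) (of_real x) = (of_real (poly P x) :: complex)" for x
    by (induction P) (simp_all add: map_poly_pCons)
  from this[of "real (s * j)"] show ?thesis by (simp add: poly_pcompose mult.commute)
qed

lemma poly_eventually_nonzero:
  fixes P :: "real poly"
  assumes "P \<noteq> 0" "1 \<le> s"
  shows "\<exists>J. \<forall>j\<ge>J. poly P (real (s * j)) \<noteq> 0"
proof -
  have "inj (\<lambda>j. real (s * j))" using assms(2) by (auto simp: inj_on_def)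
  then have "finite ((\<lambda>j. real (s * j)) -` {x. poly P x = 0})"
    by (intro finite_vimageI poly_roots_finite assms)
  then obtain J where "\<forall>j \<in> (\<lambda>j. real (s * j)) -` {x. poly P x = 0}. j < J"
    by (meson finite_nat_set_iff_bounded)
  then show ?thesis by (intro exI[of _ J]) fastforce
qed

lemma dir_summable_gen_moment:
  fixes u :: "nat \<Rightarrow> complex^'n \<Rightarrow> complex"
  assumes k: "0 < k" and p: "1 \<le> p" and s: "1 \<le> s" and m: "gen_moment_fun (real p) m" and u: "dir_summable k d u"
  shows "dir_summable k d (\<lambda>j z. of_real (m (s * j) / fact (p * s * j)) * u j z)"
    and "dir_summable k d (\<lambda>j z. of_real (fact (p * s * j) / m (s * j)) * u j z)"
proof -
  obtain m2 p1 p2 c where m2: "moment_fun (real p) m2" and p12: "p1 \<noteq> 0" "p2 \<noteq> 0" and c: "0 < c"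
    and rel: "\<And>j. 1 \<le> j \<Longrightarrow> poly p1 (real j) * m j = poly p2 (real j) * m2 j * c ^ j"
    using m unfolding gen_moment_fun_def by blast
  obtain e where e: "kernel_fun (1 / real p) e" and m2e: "\<And>u. m2 u = kmoment e u"
    using m2 unfolding moment_fun_def by blast
  obtain q e' where q: "1 \<le> q" and bk: "basic_kernel (real q * (1 / real p)) e'"
    and ee': "\<And>x. 0 < x \<Longrightarrow> e (of_real x) = e' (of_real (x powr (1 / real q))) / of_nat q"
    using e unfolding kernel_fun_def by blast
  interpret kernel "real q * (1 / real p)" e' by unfold_locales (rule bk)
  \<comment> \<open>The basic kernel has order q / p, and its moment enters at the index q (s j) = L
    j, to be compared with (p s j)! = (N j)!. Hence L = N (q / p), the relation under which moments
    and factorials were compared.\<close>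
  define N L where "N = p * s" and "L = q * s"
  have L: "real L = real N * (real q * (1 / real p))" using p by (simp add: N_def L_def)
  have N: "1 \<le> N" using p s by (simp add: N_def)
  obtain J1 J2 where J: "\<And>j. J1 \<le> j \<Longrightarrow> poly p1 (real (s * j)) \<noteq> 0" "\<And>j. J2 \<le> j \<Longrightarrow> poly p2 (real (s * j)) \<noteq> 0"
    using poly_eventually_nonzero[OF p12(1) s] poly_eventually_nonzero[OF p12(2) s] by blast
  \<comment> \<open>From J on neither polynomial vanishes and the relation, stated for positive
    indices, applies; below J the multiplier is adjusted term by term.\<close>
  define J where "J = max 1 (max J1 J2)"
  have nz: "poly p1 (real (s * j)) \<noteq> 0" "poly p2 (real (s * j)) \<noteq> 0" "1 \<le> j" if "J \<le> j" for j
    using that J[of j] by (auto simp: J_def)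
  define P1 P2 :: "complex poly" where "P1 = pcompose (map_poly of_real p1) [:0, of_nat s:]" and "P2 = pcompose (map_poly of_real p2) [:0, of_nat s:]"
  have P: "poly P1 (of_nat j) = of_real (poly p1 (real (s * j)))" "poly P2 (of_nat j) = of_real (poly p2 (real (s * j)))" for j
    unfolding P1_def P2_def by (rule poly_complexify)+
  have P0: "P1 \<noteq> 0" "P2 \<noteq> 0" using P[of J] nz[of J] by auto
  have ms: "m (s * j) = poly p2 (real (s * j)) / poly p1 (real (s * j)) * kmoment e' (L * j) * (c ^ s) ^ j" if j: "J \<le> j" for j
  proof -
    have "1 \<le> s * j" using s nz(3)[OF j] by simp
    from rel[OF this] have "m (s * j) = poly p2 (real (s * j)) / poly p1 (real (s * j)) * m2 (s * j) * c ^ (s * j)"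
      using nz(1)[OF j] by (simp add: field_simps)
    moreover have "m2 (s * j) = kmoment e' (L * j)"
      unfolding m2e L_def mult.assoc using kmoment_root_kernel[OF ee' q, of "s * j"] \<open>1 \<le> s * j\<close> by simp
    ultimately show ?thesis by (simp add: power_mult)
  qed
  have cs: "0 < c ^ s" "0 < 1 / c ^ s" using c by auto
  show "dir_summable k d (\<lambda>j z. of_real (m (s * j) / fact (p * s * j)) * u j z)"
  proof (rule dir_summable_modify[OF k u, where J = J and c = "\<lambda>j. of_real (m (s * j) / fact (p * s * j))"])
    show "dir_summable k d (\<lambda>j z. 1 * of_real (c ^ s) ^ j * (poly P2 (of_nat j) * (1 / poly P1 (of_nat j) *
        (of_real (kmoment e' (L * j) / fact (N * j)) * u j z))))"
      by (intro dir_summable_scale dir_summable_poly dir_summable_divide_poly dir_summable_kmoment k cs P0 L N u)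
    show "(\<lambda>z. of_real (m (s * j) / fact (p * s * j)) * u j z) = (\<lambda>z. 1 * of_real (c ^ s) ^ j * (poly P2 (of_nat j) * (1 / poly P1 (of_nat j) *
        (of_real (kmoment e' (L * j) / fact (N * j)) * u j z))))" if "J \<le> j" for j
      unfolding ms[OF that] P by (simp add: N_def mult_ac)
  qed simp
  show "dir_summable k d (\<lambda>j z. of_real (fact (p * s * j) / m (s * j)) * u j z)"
  proof (rule dir_summable_modify[OF k u, where J = J and c = "\<lambda>j. of_real (fact (p * s * j) / m (s * j))"])
    show "dir_summable k d (\<lambda>j z. 1 * of_real (1 / c ^ s) ^ j * (poly P1 (of_nat j) * (1 / poly P2 (of_nat j) *
        (of_real (fact (N * j) / kmoment e' (L * j)) * u j z))))"
      by (intro dir_summable_scale dir_summable_poly dir_summable_divide_poly dir_summable_inverse_kmoment k cs P0 L N u)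
    show "(\<lambda>z. of_real (fact (p * s * j) / m (s * j)) * u j z) = (\<lambda>z. 1 * of_real (1 / c ^ s) ^ j * (poly P1 (of_nat j) * (1 / poly P2 (of_nat j) *
        (of_real (fact (N * j) / kmoment e' (L * j)) * u j z))))" if "J \<le> j" for j
      unfolding ms[OF that] P by (simp add: N_def power_divide mult_ac)
  qed simp
qed

section \<open>The averaged mean\<close>

lemma sum_root_of_unity_powers:
  assumes s: "1 \<le> s"
  shows "(\<Sum>k<s. cis (2 * real k * pi * real j / real s)) = (if s dvd j then of_nat s else 0)"
proof -
  define x where "x = cis (2 * pi * real j / real s)"
  have x: "cis (2 * real k * pi * real j / real s) = x ^ k" for k
    by (simp add: x_def Complex.DeMoivre algebra_simps)
  have x1: "x = 1 \<longleftrightarrow> s dvd j"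
  proof -
    have "x = exp (2 * of_real pi * \<i> * of_nat j / of_nat s)" by (simp add: x_def cis_conv_exp algebra_simps)
    then show ?thesis using complex_root_unity_eq_1[OF s, of j] by simp
  qed
  show ?thesis
  proof (cases "s dvd j")
    case True
    then show ?thesis using x1 by (simp add: x)
  next
    case False
    have "x ^ s = cis (2 * pi * real j)" using s by (simp add: x_def Complex.DeMoivre)
    also have "\<dots> = 1" by (rule cis_multiple_2pi) simp
    finally show ?thesis using False x1 by (simp add: x sum_gp_strict)
  qed
qed

text \<open>The rotations satisfy \<open>c k ^ (p * j)\<close> = exp (2 \<pi> i k j / s), so
  averaging over k projects onto the indices divisible by s.\<close>

lemma cmean_s_sums:
  fixes \<phi> :: "complex^'n \<Rightarrow> complex"
  assumes p: "1 \<le> p" and s: "1 \<le> s"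
    and mean: "\<And>t. norm t < \<rho> \<Longrightarrow> (\<lambda>j. b j * t ^ (p * j)) sums cmean \<nu> h \<phi> z t" and t: "norm t < \<rho>"
  shows "(\<lambda>j. b (s * j) * t ^ (p * s * j)) sums cmean_s p s \<nu> h \<phi> z t"
proof -
  define c where "c k = cis (2 * real k * pi / real (p * s))" for k
  have "norm (t * c k) < \<rho>" for k using t by (simp add: c_def norm_mult)
  then have "(\<lambda>j. 1 / of_nat s * (\<Sum>k<s. b j * (t * c k) ^ (p * j))) sums (1 / of_nat s * (\<Sum>k<s. cmean \<nu> h \<phi> z (t * c k)))"
    by (intro sums_mult sums_sum mean)
  moreover have "1 / of_nat s * (\<Sum>k<s. cmean \<nu> h \<phi> z (t * c k)) = cmean_s p s \<nu> h \<phi> z t"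
    by (simp add: cmean_s_def cint_s_def cmean_def c_def vector_smult_assoc)
  moreover have "1 / of_nat s * (\<Sum>k<s. b j * (t * c k) ^ (p * j)) = (if s dvd j then b (s * (j div s)) else 0) * (t ^ p) ^ j" for j
  proof -
    have "c k ^ (p * j) = cis (2 * real k * pi * real j / real s)" for k
      using p by (simp add: c_def Complex.DeMoivre mult_ac)
    then have "(\<Sum>k<s. b j * (t * c k) ^ (p * j)) = b j * t ^ (p * j) * (\<Sum>k<s. cis (2 * real k * pi * real j / real s))"
      by (simp add: power_mult_distrib sum_distrib_left mult.assoc)
    also have "\<dots> = b j * t ^ (p * j) * (if s dvd j then of_nat s else 0)"
      by (simp only: sum_root_of_unity_powers[OF s])
    finally show ?thesis using s by (simp add: power_mult)
  qed
  ultimately have "(\<lambda>j. (if s dvd j then b (s * (j div s)) else 0) * (t ^ p) ^ j) sums cmean_s p s \<nu> h \<phi> z t" by simp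
  then have "(\<lambda>j. b (s * j) * (t ^ p) ^ (s * j)) sums cmean_s p s \<nu> h \<phi> z t"
    using sums_multiples[OF s, of "\<lambda>j. b (s * j)" "t ^ p"] by simp
  then show ?thesis by (simp add: power_mult[symmetric] mult.assoc)
qed

theorem theorem5:
  fixes p s :: nat
    and q :: "('n::finite \<Rightarrow> nat) \<Rightarrow> complex"
    and \<phi> :: "complex^'n \<Rightarrow> complex"
    and \<nu> :: "(complex^'n) measure" and h :: "complex^'n \<Rightarrow> complex"
    and B :: "(complex^'n) set"
    and m :: "nat \<Rightarrow> real"
  assumes ps: "p * s > 1"
    and Q: "homog_op_order q p"
    and phi: "\<exists>r>0. holo_n (ball 0 r) \<phi>"
    and nu_sets: "sets \<nu> = sets borel" and nu_fin: "finite_measure \<nu>"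
    and h_int: "integrable \<nu> h"
    and B_bdd: "bounded B" and supp: "AE y in \<nu>. y \<in> B"
    and mass: "cint \<nu> h (\<lambda>y. 1) = 1"
    and m_ord: "order_fun (real p) m"
    and mean: "\<exists>\<rho>>0. \<forall>z t. norm z < \<rho> \<longrightarrow> norm t < \<rho> \<longrightarrow>
                 (\<lambda>j. (Qop q p ^^ j) \<phi> z / of_real (m j) * t ^ (p * j)) sums cmean \<nu> h \<phi> z t"
  shows "(\<exists>\<rho>>0. \<forall>z t. norm z < \<rho> \<longrightarrow> norm t < \<rho> \<longrightarrow>
            (\<lambda>j. (Qop q p ^^ (s * j)) \<phi> z / of_real (m (s * j)) * t ^ (p * s * j))
              sums cmean_s p s \<nu> h \<phi> z t)
       \<and> (converges_holo (\<lambda>j z. (Qop q p ^^ (s * j)) \<phi> z / of_nat (fact j))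
            \<longleftrightarrow> in_Ok_entire (real (p * s) / (real (p * s) - 1)) (\<lambda>t z. cmean_s p s \<nu> h \<phi> z t))
       \<and> (\<forall>d::real. gen_moment_fun (real p) m \<longrightarrow>
            (k_summable (1 / (real (p * s) - 1)) d (\<lambda>j z. (Qop q p ^^ (s * j)) \<phi> z / of_nat (fact j))
             \<longleftrightarrow> (\<forall>k < p * s. in_Ok_sector (real (p * s) / (real (p * s) - 1))
                     ((d + 2 * real k * pi) / real (p * s)) (\<lambda>t z. cmean_s p s \<nu> h \<phi> z t))))"
proof -
  define N where "N = p * s"
  define a where "a j = (Qop q p ^^ (s * j)) \<phi>" for j
  define b where "b j = m (s * j)" for j
  define G where "G t z = cmean_s p s \<nu> h \<phi> z t" for t z
  have N: "2 \<le> N" "1 \<le> N" using ps unfolding N_def by linarith+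
  have "0 < p * s" using ps by linarith
  then have p: "1 \<le> p" and s: "1 \<le> s" by (simp_all only: nat_0_less_mult_iff Suc_le_eq One_nat_def simp_thms)
  obtain \<rho> where \<rho>: "0 < \<rho>" and mean': "\<And>z t. norm z < \<rho> \<Longrightarrow> norm t < \<rho> \<Longrightarrow>
      (\<lambda>j. (Qop q p ^^ j) \<phi> z / of_real (m j) * t ^ (p * j)) sums cmean \<nu> h \<phi> z t"
    using mean by blast
  have sm: "(\<lambda>j. a j z / of_real (b j) * t ^ (N * j)) sums G t z" if "norm t < \<rho>" "norm z < \<rho>" for t z
    unfolding a_def b_def N_def G_def by (rule cmean_s_sums[OF p s mean'[OF that(2)] that(1)])
  obtain c0 C0 where c0: "0 < c0" "0 < C0" and m0: "\<And>j. c0 ^ j * Gamma (1 + real p * real j) \<le> m j"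
    "\<And>j. m j \<le> C0 ^ j * Gamma (1 + real p * real j)"
    using m_ord unfolding order_fun_def by blast
  have G_fact: "Gamma (1 + real n) = fact n" for n by (simp add: Gamma_fact add.commute)
  have Gb: "Gamma (1 + real p * real (s * j)) = fact (N * j)" for j
    using G_fact[of "N * j"] by (simp add: N_def mult.assoc)
  have b: "(c0 ^ s) ^ j * fact (N * j) \<le> b j" "b j \<le> (C0 ^ s) ^ j * fact (N * j)" for j
    using m0[of "s * j"] unfolding Gb by (simp_all add: b_def power_mult)
  have bpos: "0 < b j" for j using less_le_trans[OF _ b(1)[of j]] c0 by simp
  have conv: "converges_holo (\<lambda>j z. a j z / of_nat (fact j)) \<longleftrightarrow> in_Ok_entire (real N / (real N - 1)) G"
  proof
    assume "converges_holo (\<lambda>j z. a j z / of_nat (fact j))"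
    then show "in_Ok_entire (real N / (real N - 1)) G"
      by (rule converges_holo_imp_in_Ok_entire[OF N(1) _ b(1) \<rho> sm, rotated -1]) (use c0 in auto)
  next
    assume "in_Ok_entire (real N / (real N - 1)) G"
    then show "converges_holo (\<lambda>j z. a j z / of_nat (fact j))"
      by (rule in_Ok_entire_imp_converges_holo[OF N(1) bpos b(2) _ \<rho> sm, rotated -1]) (use c0 in auto)
  qed
  have summ: "k_summable (1 / (real N - 1)) d (\<lambda>j z. a j z / of_nat (fact j)) \<longleftrightarrow>
      (\<forall>k < N. in_Ok_sector (real N / (real N - 1)) ((d + 2 * real k * pi) / real N) G)"
    if gm: "gen_moment_fun (real p) m" for d
  proof -
    define k where "k = 1 / (real N - 1)"
    have k: "0 < k" "real N * k = real N / (real N - 1)" using N by (simp_all add: k_def)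
    \<comment> \<open>The Borel transform of the formal solution: the Gamma value is ((N - 1) j)!.
      The quotient of u by v is the product of (N j)! / (j! ((N - 1) j)!) and b j / (N j)!, and both
      factors and their inverses are multipliers.\<close>
    define u where "u j z = a j z / of_nat (fact j) / of_real (Gamma (1 + real j / k))" for j z
    define v where "v j z = a j z / of_real (b j)" for j z
    have Gk: "Gamma (1 + real j / k) = fact ((N - 1) * j)" for j
    proof -
      have "real j / k = real ((N - 1) * j)" using N by (simp add: k_def of_nat_diff mult.commute)
      then show ?thesis using G_fact[of "(N - 1) * j"] by simp
    qed
    have "dir_summable k d v" if "dir_summable k d u"
    proof -
      have "dir_summable k d (\<lambda>j z. of_real (fact (p * s * j) / m (s * j)) * (of_real (fact j * fact ((N - 1) * j) / fact (N * j)) * u j z))"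
        by (intro dir_summable_gen_moment(2) dir_summable_fact_quotient(2) k N p s gm that)
      then show ?thesis unfolding v_def u_def Gk by (simp add: b_def N_def)
    qed
    moreover have "dir_summable k d u" if "dir_summable k d v"
    proof -
      have "dir_summable k d (\<lambda>j z. of_real (fact (N * j) / (fact j * fact ((N - 1) * j))) * (of_real (m (s * j) / fact (p * s * j)) * v j z))"
        by (intro dir_summable_gen_moment(1) dir_summable_fact_quotient(1) k N p s gm that)
      moreover have "m (s * j) \<noteq> 0" for j using bpos[of j] by (simp add: b_def)
      ultimately show ?thesis unfolding v_def u_def Gk by (simp add: b_def N_def)
    qed
    ultimately have uv: "dir_summable k d u \<longleftrightarrow> dir_summable k d v" by blast
    have sm': "(\<lambda>j. v j z * t ^ (N * j)) sums G t z" if "norm t < \<rho>" "norm z < \<rho>" for t z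
      unfolding v_def by (rule sm[OF that])
    have "dir_summable k d v \<longleftrightarrow> (\<forall>l<N. in_Ok_sector (real N * k) ((d + 2 * real l * pi) / real N) G)"
    proof
      assume v: "dir_summable k d v"
      show "\<forall>l<N. in_Ok_sector (real N * k) ((d + 2 * real l * pi) / real N) G"
        by (intro allI impI, rule dir_summable_imp_in_Ok_sector[OF k(1) N(2) v \<rho>], rule sm')
    next
      assume "\<forall>l<N. in_Ok_sector (real N * k) ((d + 2 * real l * pi) / real N) G"
      \<comment> \<open>The direction with l = 0 is d / N, from which the branch of the N-th root
        leads back to d.\<close>
      from this[rule_format, of 0] have "in_Ok_sector (real N * k) (d / real N) G" using N by simp
      then show "dir_summable k d v" by (rule in_Ok_sector_imp_dir_summable[OF k(1) N(2) _ \<rho>]) (rule sm')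
    qed
    with uv show ?thesis unfolding k_summable_iff_dir_summable u_def[symmetric] k(2) k_def[symmetric] by simp
  qed
  show ?thesis
    using \<rho> sm conv summ unfolding a_def b_def N_def G_def by blast
qed

end
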